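(* Suppose that $(R,\mathfrak{m})$ is a local ring of characteristic $p>0$ which is a splinter (for instance, if it is strongly $F$-regular). Then there is no finite local extension $(R,\mathfrak{m})\subseteq(S,\mathfrak{n})$ of normal domains with corresponding fraction fields $K\subseteq L$ such that all of the following hold: (1) the residue fields $R/\mathfrak{m}=S/\mathfrak{n}=k$ are equal; (2) $p$ divides $[L:K]$; and (3) $R\subseteq S$ is étale in codimension $1$.
   Context: All rings are Noetherian, of prime characteristic $p>0$ and $F$-finite (the Frobenius map is finite). A ring $R$ is a splinter if every module-finite ring extension $R\subseteq T$ splits as a map of $R$-modules. A finite extension $R\subseteq S$ of normal domains is étale in codimension $1$ if $R_{Q\cap R}\to S_Q$ is étale for every prime $Q$ of $S$ of height at most $1$. A normal $F$-finite local ring $R$ is strongly $F$-regular if for every $0\neq c\in R$ there exist $e>0$ and $\varphi\in\operatorname{Hom}_R(F^e_*R,R)$ with $\varphi(F^e_*(cR))=R$, where $F^e_*R$ is $R$ viewed as an $R$-module via the $e$-th iterate of Frobenius. *)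

theory Defs
  imports
    "HOL-Algebra.Algebra"
    "HOL-Algebra.Finite_Extensions"
    "HOL-Algebra.Free_Abelian_Groups"
    "HOL-Algebra.Generated_Rings"
    "HOL-Algebra.Weak_Morphisms"
    "HOL-Library.Extended_Nat"
begin

text \<open>
  Rings are records in the style of HOL-Algebra.  An extension \<open>R \<subseteq> S\<close> is given by an injective
  ring homomorphism \<open>\<iota> : R \<rightarrow> S\<close>; all constructions below are functorial in such maps.
\<close>

section \<open>Modules\<close>

text \<open>An \<open>R\<close>-algebra \<open>f : R \<rightarrow> T\<close>, viewed as an \<open>R\<close>-module.\<close>

definition alg_module ::
  "('a \<Rightarrow> 'b) \<Rightarrow> ('b, 'd) ring_scheme \<Rightarrow> ('a, 'b) module" where
  "alg_module f T =
     \<lparr> carrier = carrier T, monoid.mult = monoid.mult T, one = \<one>\<^bsub>T\<^esub>, ring.zero = \<zero>\<^bsub>T\<^esub>, add = add T,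
       smult = (\<lambda>r x. f r \<otimes>\<^bsub>T\<^esub> x) \<rparr>"

definition module_hom ::
  "('a, 'k) ring_scheme \<Rightarrow> ('a, 'm, 'x) module_scheme \<Rightarrow> ('a, 'n, 'y) module_scheme
     \<Rightarrow> ('m \<Rightarrow> 'n) set" where
  "module_hom R M N =
     {\<phi> \<in> carrier M \<rightarrow> carrier N.
        (\<forall>x\<in>carrier M. \<forall>y\<in>carrier M. \<phi> (x \<oplus>\<^bsub>M\<^esub> y) = \<phi> x \<oplus>\<^bsub>N\<^esub> \<phi> y) \<and>
        (\<forall>r\<in>carrier R. \<forall>x\<in>carrier M. \<phi> (r \<odot>\<^bsub>M\<^esub> x) = r \<odot>\<^bsub>N\<^esub> \<phi> x)}"

definition fin_gen_module ::
  "('a, 'k) ring_scheme \<Rightarrow> ('a, 'm, 'x) module_scheme \<Rightarrow> bool" where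
  "fin_gen_module R M \<longleftrightarrow>
     (\<exists>B. finite B \<and> B \<subseteq> carrier M \<and>
        (\<forall>x\<in>carrier M. \<exists>c\<in>B \<rightarrow> carrier R. x = (\<Oplus>\<^bsub>M\<^esub>b\<in>B. c b \<odot>\<^bsub>M\<^esub> b)))"

text \<open>
  \<open>M \<otimes>\<^sub>R N\<close> is the free abelian group on pairs modulo the usual relations, written
  additively inside the type of finitely supported integer-valued functions.
\<close>

definition tensor_relations ::
  "('a, 'k) ring_scheme \<Rightarrow> ('a, 'm, 'x) module_scheme \<Rightarrow> ('a, 'n, 'y) module_scheme
     \<Rightarrow> ('m \<times> 'n \<Rightarrow>\<^sub>0 int) set" where
  "tensor_relations R M N =
     generate (free_Abelian_group (carrier M \<times> carrier N))
       ({frag_of (x \<oplus>\<^bsub>M\<^esub> x', y) - frag_of (x, y) - frag_of (x', y) | x x' y.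
           x \<in> carrier M \<and> x' \<in> carrier M \<and> y \<in> carrier N} \<union>
        {frag_of (x, y \<oplus>\<^bsub>N\<^esub> y') - frag_of (x, y) - frag_of (x, y') | x y y'.
           x \<in> carrier M \<and> y \<in> carrier N \<and> y' \<in> carrier N} \<union>
        {frag_of (r \<odot>\<^bsub>M\<^esub> x, y) - frag_of (x, r \<odot>\<^bsub>N\<^esub> y) | r x y.
           r \<in> carrier R \<and> x \<in> carrier M \<and> y \<in> carrier N})"

definition tensor_product ::
  "('a, 'k) ring_scheme \<Rightarrow> ('a, 'm, 'x) module_scheme \<Rightarrow> ('a, 'n, 'y) module_scheme
     \<Rightarrow> ('m \<times> 'n \<Rightarrow>\<^sub>0 int) set monoid" where
  "tensor_product R M N =
     free_Abelian_group (carrier M \<times> carrier N) Mod tensor_relations R M N"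

text \<open>The map \<open>u \<otimes> id : M \<otimes>\<^sub>R N \<rightarrow> M' \<otimes>\<^sub>R N\<close> (a union of equal cosets).\<close>

definition tensor_map ::
  "('a, 'k) ring_scheme \<Rightarrow> ('a, 'm, 'x) module_scheme \<Rightarrow> ('a, 'n, 'y) module_scheme
     \<Rightarrow> ('l \<Rightarrow> 'm) \<Rightarrow> ('l \<times> 'n \<Rightarrow>\<^sub>0 int) set \<Rightarrow> ('m \<times> 'n \<Rightarrow>\<^sub>0 int) set" where
  "tensor_map R M' N u Z =
     (\<Union>t\<in>Z. r_coset (free_Abelian_group (carrier M' \<times> carrier N)) (tensor_relations R M' N)
        (frag_extend (\<lambda>(x, y). frag_of (u x, y)) t))"

text \<open>
  The test modules \<open>N\<close>, \<open>N'\<close> have carriers in the type \<^typ>\<open>'a list set\<close>.  Every finitely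
  generated \<open>R\<close>-module is a quotient of some \<open>R\<^sup>n\<close> and hence has an isomorphic copy there, so this
  is no restriction: flatness can be tested on inclusions of finitely generated ideals into \<open>R\<close>.
\<close>

definition flat_module :: "('a, 'k) ring_scheme \<Rightarrow> ('a, 'm, 'x) module_scheme \<Rightarrow> bool" where
  "flat_module R M \<longleftrightarrow>
     (\<forall>(N :: ('a, 'a list set) module) (N' :: ('a, 'a list set) module) u.
        module R N \<and> module R N' \<and> u \<in> module_hom R N N' \<and> inj_on u (carrier N)
        \<longrightarrow> inj_on (tensor_map R N' M u) (carrier (tensor_product R N M)))"

section \<open>Local rings, localization and fraction fields\<close>

definition local_ring :: "('a, 'k) ring_scheme \<Rightarrow> 'a set \<Rightarrow> bool" where
  "local_ring R m \<longleftrightarrow>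
     cring R \<and> maximalideal m R \<and> (\<forall>J. maximalideal J R \<longrightarrow> J = m)"

text \<open>The class of the fraction \<open>a/s\<close> in \<open>W\<^sup>-\<^sup>1R\<close>.\<close>

definition fraction ::
  "('a, 'k) ring_scheme \<Rightarrow> 'a set \<Rightarrow> 'a \<Rightarrow> 'a \<Rightarrow> ('a \<times> 'a) set" where
  "fraction R W a s =
     {(b, t). b \<in> carrier R \<and> t \<in> W \<and>
        (\<exists>u\<in>W. u \<otimes>\<^bsub>R\<^esub> (a \<otimes>\<^bsub>R\<^esub> t) = u \<otimes>\<^bsub>R\<^esub> (b \<otimes>\<^bsub>R\<^esub> s))}"

definition localization :: "('a, 'k) ring_scheme \<Rightarrow> 'a set \<Rightarrow> ('a \<times> 'a) set ring" where
  "localization R W =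
     \<lparr> carrier = {fraction R W a s | a s. a \<in> carrier R \<and> s \<in> W},
       monoid.mult = (\<lambda>Y Z. \<Union>(a, s)\<in>Y. \<Union>(b, t)\<in>Z. fraction R W (a \<otimes>\<^bsub>R\<^esub> b) (s \<otimes>\<^bsub>R\<^esub> t)),
       one = fraction R W \<one>\<^bsub>R\<^esub> \<one>\<^bsub>R\<^esub>,
       ring.zero = fraction R W \<zero>\<^bsub>R\<^esub> \<one>\<^bsub>R\<^esub>,
       add = (\<lambda>Y Z. \<Union>(a, s)\<in>Y. \<Union>(b, t)\<in>Z.
                fraction R W (a \<otimes>\<^bsub>R\<^esub> t \<oplus>\<^bsub>R\<^esub> b \<otimes>\<^bsub>R\<^esub> s) (s \<otimes>\<^bsub>R\<^esub> t)) \<rparr>"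

text \<open>The map \<open>a/s \<mapsto> f a / f s\<close> from a localization of the source of \<open>f\<close> to \<open>W\<^sup>-\<^sup>1S\<close>.\<close>

definition localization_map ::
  "('b, 'k) ring_scheme \<Rightarrow> 'b set \<Rightarrow> ('a \<Rightarrow> 'b) \<Rightarrow> ('a \<times> 'a) set \<Rightarrow> ('b \<times> 'b) set" where
  "localization_map S W f Z = (\<Union>(a, s)\<in>Z. fraction S W (f a) (f s))"

abbreviation localization_at :: "('a, 'k) ring_scheme \<Rightarrow> 'a set \<Rightarrow> ('a \<times> 'a) set ring" where
  "localization_at R P \<equiv> localization R (carrier R - P)"

definition fraction_field :: "('a, 'k) ring_scheme \<Rightarrow> ('a \<times> 'a) set ring" where
  "fraction_field R = localization R (carrier R - {\<zero>\<^bsub>R\<^esub>})"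

definition to_fraction_field :: "('a, 'k) ring_scheme \<Rightarrow> 'a \<Rightarrow> ('a \<times> 'a) set" where
  "to_fraction_field R a = fraction R (carrier R - {\<zero>\<^bsub>R\<^esub>}) a \<one>\<^bsub>R\<^esub>"

definition fraction_field_map ::
  "('b, 'k) ring_scheme \<Rightarrow> ('a \<Rightarrow> 'b) \<Rightarrow> ('a \<times> 'a) set \<Rightarrow> ('b \<times> 'b) set" where
  "fraction_field_map S = localization_map S (carrier S - {\<zero>\<^bsub>S\<^esub>})"

text \<open>The map \<open>R/I \<rightarrow> S/J\<close> induced by \<open>f : R \<rightarrow> S\<close> when \<open>f I \<subseteq> J\<close>
  (again a union of equal cosets).\<close>

definition quotient_map ::
  "('b, 'k) ring_scheme \<Rightarrow> 'b set \<Rightarrow> ('a \<Rightarrow> 'b) \<Rightarrow> 'a set \<Rightarrow> 'b set" where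
  "quotient_map S J f Z = (\<Union>x\<in>Z. J +>\<^bsub>S\<^esub> f x)"

section \<open>Field extensions\<close>

text \<open>The degree \<open>[L : K]\<close> of the field extension \<open>g : K \<rightarrow> L\<close>.\<close>

definition field_degree ::
  "('a, 'k) ring_scheme \<Rightarrow> ('b, 'l) ring_scheme \<Rightarrow> ('a \<Rightarrow> 'b) \<Rightarrow> nat" where
  "field_degree K L g = ring.dim L (g ` carrier K) (carrier L)"

text \<open>Polynomials of HOL-Algebra are coefficient lists with the leading coefficient first.\<close>

definition poly_derivative :: "('a, 'k) ring_scheme \<Rightarrow> 'a list \<Rightarrow> 'a list" where
  "poly_derivative F q =
     ring.normalize F (map (\<lambda>i. add_pow F (length q - 1 - i) (q ! i)) [0..<length q - 1])"

text \<open>\<open>q \<in> K[X]\<close> is coprime to its derivative; \<open>K\<close> is a subfield of \<open>F\<close>.\<close>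

definition separable_poly :: "('a, 'k) ring_scheme \<Rightarrow> 'a set \<Rightarrow> 'a list \<Rightarrow> bool" where
  "separable_poly F K q \<longleftrightarrow>
     (\<exists>a\<in>carrier (univ_poly F K). \<exists>b\<in>carrier (univ_poly F K).
        (a \<otimes>\<^bsub>univ_poly F K\<^esub> q) \<oplus>\<^bsub>univ_poly F K\<^esub> (b \<otimes>\<^bsub>univ_poly F K\<^esub> poly_derivative F q)
          = \<one>\<^bsub>univ_poly F K\<^esub>)"

definition finite_separable_extension ::
  "('a, 'k) ring_scheme \<Rightarrow> ('b, 'l) ring_scheme \<Rightarrow> ('a \<Rightarrow> 'b) \<Rightarrow> bool" where
  "finite_separable_extension K L g \<longleftrightarrow>
     ring.finite_dimension L (g ` carrier K) (carrier L) \<and>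
     (\<forall>x\<in>carrier L. \<not> ring.transcendental L (g ` carrier K) x \<and>
        separable_poly L (g ` carrier K) (ring.Irr L (g ` carrier K) x))"

section \<open>Normal domains\<close>

definition integral_over :: "('a, 'k) ring_scheme \<Rightarrow> 'a set \<Rightarrow> 'a \<Rightarrow> bool" where
  "integral_over E A x \<longleftrightarrow>
     (\<exists>q. polynomial\<^bsub>E\<^esub> A q \<and> q \<noteq> [] \<and> hd q = \<one>\<^bsub>E\<^esub> \<and> ring.eval E q x = \<zero>\<^bsub>E\<^esub>)"

definition normal_domain :: "('a, 'k) ring_scheme \<Rightarrow> bool" where
  "normal_domain R \<longleftrightarrow>
     domain R \<and>
     (\<forall>x\<in>carrier (fraction_field R).
        integral_over (fraction_field R) (to_fraction_field R ` carrier R) x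
          \<longrightarrow> x \<in> to_fraction_field R ` carrier R)"

section \<open>Etale in codimension one\<close>

definition height :: "('a, 'k) ring_scheme \<Rightarrow> 'a set \<Rightarrow> enat" where
  "height R Q =
     (SUP n \<in> {n. \<exists>P :: nat \<Rightarrow> 'a set.
                  (\<forall>i\<le>n. primeideal (P i) R) \<and> (\<forall>i<n. P i \<subset> P (Suc i)) \<and> P n = Q}. enat n)"

text \<open>
  \<open>B\<close> is a localization of a finitely generated \<open>A\<close>-algebra: it has a finitely generated
  \<open>A\<close>-subalgebra such that every element of \<open>B\<close> is \<open>x v\<^sup>-\<^sup>1\<close> with \<open>x\<close>, \<open>v\<close> in the subalgebra.
\<close>

definition ess_finite_type ::
  "('a, 'k) ring_scheme \<Rightarrow> ('b, 'l) ring_scheme \<Rightarrow> ('a \<Rightarrow> 'b) \<Rightarrow> bool" where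
  "ess_finite_type A B f \<longleftrightarrow>
     (\<exists>Z. finite Z \<and> Z \<subseteq> carrier B \<and>
        (\<forall>y\<in>carrier B. \<exists>x\<in>generate_ring B (f ` carrier A \<union> Z).
           \<exists>v\<in>generate_ring B (f ` carrier A \<union> Z) \<inter> Units B. y = x \<otimes>\<^bsub>B\<^esub> inv\<^bsub>B\<^esub> v))"

text \<open>
  Etale homomorphisms of local rings: local, essentially of finite type, flat, and unramified,
  i.e.\ the maximal ideal of \<open>A\<close> generates that of \<open>B\<close> and the residue field extension is finite
  separable.
\<close>

definition etale_local_hom ::
  "('a, 'k) ring_scheme \<Rightarrow> ('b, 'l) ring_scheme \<Rightarrow> ('a \<Rightarrow> 'b) \<Rightarrow> bool" where
  "etale_local_hom A B f \<longleftrightarrow>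
     (\<exists>m n. local_ring A m \<and> local_ring B n \<and> f \<in> ring_hom A B \<and> f ` m \<subseteq> n \<and>
        ess_finite_type A B f \<and>
        flat_module A (alg_module f B) \<and>
        genideal B (f ` m) = n \<and>
        finite_separable_extension (A Quot m) (B Quot n) (quotient_map B n f))"

definition etale_in_codim_1 ::
  "('a, 'k) ring_scheme \<Rightarrow> ('b, 'l) ring_scheme \<Rightarrow> ('a \<Rightarrow> 'b) \<Rightarrow> bool" where
  "etale_in_codim_1 R S \<iota> \<longleftrightarrow>
     (\<forall>Q. primeideal Q S \<and> height S Q \<le> 1 \<longrightarrow>
        etale_local_hom (localization_at R {r \<in> carrier R. \<iota> r \<in> Q}) (localization_at S Q)
          (localization_map S (carrier S - Q) \<iota>))"

section \<open>Splinters and strong F-regularity\<close>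

definition module_finite_extension ::
  "('a, 'k) ring_scheme \<Rightarrow> ('b, 'l) ring_scheme \<Rightarrow> ('a \<Rightarrow> 'b) \<Rightarrow> bool" where
  "module_finite_extension R T \<iota> \<longleftrightarrow>
     cring T \<and> \<iota> \<in> ring_hom R T \<and> inj_on \<iota> (carrier R) \<and>
     fin_gen_module R (alg_module \<iota> T)"

definition extension_splits ::
  "('a, 'k) ring_scheme \<Rightarrow> ('b, 'l) ring_scheme \<Rightarrow> ('a \<Rightarrow> 'b) \<Rightarrow> bool" where
  "extension_splits R T \<iota> \<longleftrightarrow>
     (\<exists>\<phi>\<in>module_hom R (alg_module \<iota> T) (alg_module id R). \<forall>r\<in>carrier R. \<phi> (\<iota> r) = r)"

text \<open>
  Quantification over all module-finite extensions: each of them is a quotient of some \<open>R\<^sup>n\<close> as a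
  module, hence isomorphic to one with carrier in \<^typ>\<open>'a list set\<close>.  Lemma \<open>splinter_splits\<close>
  below removes the restriction on the carrier type.
\<close>

definition splinter :: "('a, 'k) ring_scheme \<Rightarrow> bool" where
  "splinter R \<longleftrightarrow>
     cring R \<and>
     (\<forall>(T :: 'a list set ring) \<iota>. module_finite_extension R T \<iota> \<longrightarrow> extension_splits R T \<iota>)"

text \<open>
  \<open>F\<^sup>e\<^sub>*R\<close> is the module \<^term>\<open>alg_module (frobenius p R ^^ e) R\<close>.  A normal local ring is a
  domain, so normality is expressed by \<^term>\<open>normal_domain R\<close>.
\<close>

definition frobenius :: "nat \<Rightarrow> ('a, 'k) ring_scheme \<Rightarrow> 'a \<Rightarrow> 'a" where
  "frobenius p R x = x [^]\<^bsub>R\<^esub> p"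

definition F_finite :: "nat \<Rightarrow> ('a, 'k) ring_scheme \<Rightarrow> bool" where
  "F_finite p R \<longleftrightarrow> fin_gen_module R (alg_module (frobenius p R) R)"

definition strongly_F_regular :: "nat \<Rightarrow> ('a, 'k) ring_scheme \<Rightarrow> bool" where
  "strongly_F_regular p R \<longleftrightarrow>
     normal_domain R \<and> F_finite p R \<and> (\<exists>m. local_ring R m) \<and>
     (\<forall>c\<in>carrier R. c \<noteq> \<zero>\<^bsub>R\<^esub> \<longrightarrow>
        (\<exists>e>0. \<exists>\<phi>\<in>module_hom R (alg_module (frobenius p R ^^ e) R) (alg_module id R).
           \<phi> ` (PIdl\<^bsub>R\<^esub> c) = carrier R))"

definition ring_characteristic :: "('a, 'k) ring_scheme \<Rightarrow> nat" where
  "ring_characteristic R = group.ord (add_monoid R) \<one>\<^bsub>R\<^esub>"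

section \<open>Independence of the carrier type\<close>

lemma finsum_alg_module: "finsum (alg_module f T) h A = finsum T h A"
  by (simp add: alg_module_def finsum_def finprod_def foldSetD_def foldD_def cong: if_cong)

lemma module_finite_extension_inj_list_set:
  fixes R :: "('a, 'k) ring_scheme" and T :: "('b, 'l) ring_scheme"
  assumes "module_finite_extension R T \<iota>"
  obtains g :: "'b \<Rightarrow> 'a list set" where "inj_on g (carrier T)"
proof -
  let ?M = "alg_module \<iota> T"
  obtain B where B: "finite B" "B \<subseteq> carrier ?M"
    and gen: "\<And>x. x \<in> carrier ?M \<Longrightarrow> \<exists>c\<in>B \<rightarrow> carrier R. x = (\<Oplus>\<^bsub>?M\<^esub>b\<in>B. c b \<odot>\<^bsub>?M\<^esub> b)"
    using assms unfolding module_finite_extension_def fin_gen_module_def by blast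
  interpret T: cring T
    using assms by (simp add: module_finite_extension_def)
  have \<iota>: "\<iota> \<in> ring_hom R T"
    using assms by (simp add: module_finite_extension_def)
  have carr: "carrier ?M = carrier T"
    by (simp add: alg_module_def)
  obtain bs where bs: "set bs = B"
    using finite_list[OF B(1)] by blast
  define g where
    "g t = {map c bs | c. c \<in> B \<rightarrow> carrier R \<and> t = (\<Oplus>\<^bsub>?M\<^esub>b\<in>B. c b \<odot>\<^bsub>?M\<^esub> b)}" for t
  have "inj_on g (carrier T)"
  proof (rule inj_onI)
    fix s t assume st: "s \<in> carrier T" "t \<in> carrier T" "g s = g t"
    obtain c where c: "c \<in> B \<rightarrow> carrier R" "s = (\<Oplus>\<^bsub>?M\<^esub>b\<in>B. c b \<odot>\<^bsub>?M\<^esub> b)"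
      using gen[of s] st carr by auto
    then have "map c bs \<in> g s"
      unfolding g_def by blast
    then have "map c bs \<in> g t"
      using st by simp
    then obtain d where d: "map c bs = map d bs" "d \<in> B \<rightarrow> carrier R"
        "t = (\<Oplus>\<^bsub>?M\<^esub>b\<in>B. d b \<odot>\<^bsub>?M\<^esub> b)"
      unfolding g_def by blast
    have eq: "\<And>b. b \<in> B \<Longrightarrow> c b = d b"
      using d(1) bs by auto
    have "(\<Oplus>\<^bsub>T\<^esub>b\<in>B. c b \<odot>\<^bsub>?M\<^esub> b) = (\<Oplus>\<^bsub>T\<^esub>b\<in>B. d b \<odot>\<^bsub>?M\<^esub> b)"
      using d(2) eq B(2) carr ring_hom_closed[OF \<iota>]
      by (intro T.finsum_cong') (auto simp: alg_module_def Pi_iff subset_iff)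
    then show "s = t"
      using c(2) d(3) by (simp add: finsum_alg_module)
  qed
  then show thesis
    using that by blast
qed

lemma splinter_splits:
  fixes R :: "('a, 'k) ring_scheme" and T :: "('b, 'l) ring_scheme"
  assumes spl: "splinter R" and ext: "module_finite_extension R T \<iota>"
  shows "extension_splits R T \<iota>"
proof -
  obtain g :: "'b \<Rightarrow> 'a list set" where g: "inj_on g (carrier T)"
    using module_finite_extension_inj_list_set[OF ext] .
  define T' where "T' = image_ring g T"
  have T: "cring T" and \<iota>: "\<iota> \<in> ring_hom R T" and inj: "inj_on \<iota> (carrier R)"
    and fg: "fin_gen_module R (alg_module \<iota> T)"
    using ext by (auto simp: module_finite_extension_def)
  interpret T: cring T by (rule T)
  have iso: "g \<in> ring_iso T T'"
    unfolding T'_def using inj_imp_image_ring_iso[OF g] .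
  have hom: "g \<in> ring_hom T T'"
    using iso by (simp add: ring_iso_def)
  have carr': "carrier T' = g ` carrier T"
    by (simp add: T'_def image_ring_carrier)
  interpret T': ring T'
    unfolding T'_def using T.inj_imp_image_ring_is_ring[OF g] .
  have T': "cring T'"
  proof (intro_locales, unfold_locales)
    fix x y assume "x \<in> carrier T'" "y \<in> carrier T'"
    then obtain a b where "a \<in> carrier T" "b \<in> carrier T" "x = g a" "y = g b"
      using carr' by auto
    then show "x \<otimes>\<^bsub>T'\<^esub> y = y \<otimes>\<^bsub>T'\<^esub> x"
      using ring_hom_mult[OF hom] T.m_comm by metis
  qed
  interpret T'c: cring T' by (rule T')
  interpret h: ring_hom_cring T T' g
    by unfold_locales (rule hom)
  have \<iota>c: "\<And>r. r \<in> carrier R \<Longrightarrow> \<iota> r \<in> carrier T"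
    using ring_hom_closed[OF \<iota>] .
  have "fin_gen_module R (alg_module (g \<circ> \<iota>) T')"
  proof -
    obtain B where B: "finite B" "B \<subseteq> carrier T"
      and gen: "\<And>x. x \<in> carrier T \<Longrightarrow> \<exists>c\<in>B \<rightarrow> carrier R. x = (\<Oplus>\<^bsub>T\<^esub>b\<in>B. \<iota> (c b) \<otimes>\<^bsub>T\<^esub> b)"
      using fg unfolding fin_gen_module_def finsum_alg_module by (auto simp: alg_module_def)
    have "\<exists>c\<in>g ` B \<rightarrow> carrier R. y = (\<Oplus>\<^bsub>T'\<^esub>b\<in>g ` B. g (\<iota> (c b)) \<otimes>\<^bsub>T'\<^esub> b)"
      if "y \<in> carrier T'" for y
    proof -
      obtain x where x: "x \<in> carrier T" "y = g x"
        using \<open>y \<in> carrier T'\<close> carr' by auto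
      obtain c where c: "c \<in> B \<rightarrow> carrier R" "x = (\<Oplus>\<^bsub>T\<^esub>b\<in>B. \<iota> (c b) \<otimes>\<^bsub>T\<^esub> b)"
        using gen[OF x(1)] by blast
      define c' where "c' = c \<circ> inv_into B g"
      have gB: "inj_on g B"
        using g B(2) inj_on_subset by blast
      have c'g: "\<And>b. b \<in> B \<Longrightarrow> c' (g b) = c b"
        by (simp add: c'_def gB)
      have "y = (\<Oplus>\<^bsub>T'\<^esub>b\<in>B. g (\<iota> (c b) \<otimes>\<^bsub>T\<^esub> b))"
        unfolding x(2) c(2) using c(1) B(2) \<iota>c
        by (subst h.hom_finsum) (auto simp: Pi_iff subset_iff comp_def)
      also have "\<dots> = (\<Oplus>\<^bsub>T'\<^esub>b\<in>B. g (\<iota> (c' (g b))) \<otimes>\<^bsub>T'\<^esub> g b)"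
        using c(1) B(2) \<iota>c c'g
        by (intro T'.finsum_cong') (auto simp: Pi_iff subset_iff)
      also have "\<dots> = (\<Oplus>\<^bsub>T'\<^esub>b\<in>g ` B. g (\<iota> (c' b)) \<otimes>\<^bsub>T'\<^esub> b)"
        using gB c(1) B(2) \<iota>c c'g
        by (intro T'.finsum_reindex[symmetric]) (auto simp: Pi_iff subset_iff)
      finally have "y = (\<Oplus>\<^bsub>T'\<^esub>b\<in>g ` B. g (\<iota> (c' b)) \<otimes>\<^bsub>T'\<^esub> b)" .
      moreover have "c' \<in> g ` B \<rightarrow> carrier R"
        using c(1) c'g by auto
      ultimately show ?thesis by blast
    qed
    then show ?thesis
      unfolding fin_gen_module_def finsum_alg_module
      using B carr' by (intro exI[of _ "g ` B"]) (auto simp: alg_module_def)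
  qed
  moreover have "g \<circ> \<iota> \<in> ring_hom R T'"
    using ring_hom_trans[OF \<iota> hom] .
  moreover have "inj_on (g \<circ> \<iota>) (carrier R)"
    using inj g \<iota>c by (intro comp_inj_on) (auto intro: inj_on_subset)
  ultimately have "module_finite_extension R T' (g \<circ> \<iota>)"
    using T' by (simp add: module_finite_extension_def)
  then have "extension_splits R T' (g \<circ> \<iota>)"
    using spl by (simp add: splinter_def)
  then obtain \<phi> where \<phi>: "\<phi> \<in> module_hom R (alg_module (g \<circ> \<iota>) T') (alg_module id R)"
      "\<forall>r\<in>carrier R. \<phi> (g (\<iota> r)) = r"
    unfolding extension_splits_def by auto
  have "\<phi> \<circ> g \<in> module_hom R (alg_module \<iota> T) (alg_module id R)"
    using \<phi>(1) \<iota>c unfolding module_hom_def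
    by (auto simp: alg_module_def Pi_iff)
  then show ?thesis
    unfolding extension_splits_def using \<phi>(2) by (intro bexI[of _ "\<phi> \<circ> g"]) auto
qed

end

theory Submission
  imports Defs
begin

text \<open>
  A strongly \<open>F\<close>-regular domain is a splinter because a finite extension \<open>T\<close> always has a nonzero
  \<open>R\<close>-linear functional \<open>\<theta> : T \<rightarrow> R\<close> with \<open>c = \<theta> 1 \<noteq> 0\<close> (\<open>finite_extension_functional\<close>), and the
  hypothesis provides \<open>e\<close>, \<open>d\<close> and a map \<open>\<psi> : F\<^sup>e\<^sub>*R \<rightarrow> R\<close> with \<open>\<psi> (d c) = 1\<close>.  As Frobenius is
  additive, \<open>t \<mapsto> \<psi> (d \<theta> (t\<^sup>q))\<close> with \<open>q = p\<^sup>e\<close> is \<open>R\<close>-linear, and it sends \<open>1\<close> to \<open>1\<close>.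

  For the second half let \<open>\<phi> : S \<rightarrow> R\<close> be a splitting.  Being etale at the zero ideal means that the
  extension of fraction fields \<open>L/K\<close> is separable, so \<open>S\<close> has \<open>[L:K]\<close> embeddings \<open>\<sigma>\<close> over \<open>R\<close> into an
  algebraically closed field (\<open>embeddings_of_separable_extension\<close>).  By Dedekind's independence
  theorem \<open>\<phi>\<close> is a combination of them, and \<open>\<phi> y = \<Sum>\<^sub>\<sigma> \<sigma> (l y)\<close> for one element \<open>l = a/b\<close> of \<open>L\<close>
  (\<open>splitting_numerator\<close>): the splitting is \<open>Tr (l \<cdot>)\<close>.

  The main point is that \<open>l\<close> lies in \<open>S\<close> (\<open>functional_numerator_divisible\<close>).  Otherwise a maximal
  proper conductor \<open>Q = (b : s a)\<close> is prime, and since \<open>S\<close> is normal \<open>Q\<close> is locally principal, so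
  its height is at most one and \<open>R \<subseteq> S\<close> is unramified there.  Hence some \<open>\<pi>\<close> in \<open>R \<inter> Q\<close> generates
  \<open>Q\<close> locally, and \<open>w = \<pi> s l\<close> is an element of \<open>S\<close> outside \<open>Q\<close>.  But
  \<open>\<Sum>\<^sub>\<sigma> \<sigma> w \<sigma> y = \<pi> \<phi> (s y)\<close> vanishes modulo a prime over \<open>Q\<close> in the ring generated by all conjugates.
  Distinct embeddings stay distinct modulo such a prime (\<open>unramified_separates\<close>), so Dedekind's
  argument applies modulo the prime (\<open>independence_mod_prime\<close>) and puts \<open>w\<close> into \<open>Q\<close>.

  Now \<open>Tr l = \<phi> 1 = 1\<close>.  As the residue fields agree, \<open>l = r + x\<close> with \<open>r\<close> in \<open>R\<close> and \<open>x\<close> in the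
  maximal ideal \<open>n\<close> of \<open>S\<close>, and \<open>Tr r = [L:K] r = 0\<close> in characteristic \<open>p\<close>.  So \<open>Tr x = 1\<close>.  Since
  \<open>n\<close> is the only prime of \<open>S\<close> over \<open>m\<close>, all conjugates of \<open>x\<close> lie in one proper prime ideal of the
  ring that they generate over \<open>R\<close>, and hence so does their sum \<open>1\<close>, which is absurd
  (\<open>residue_contradiction\<close>).

  Local statements are phrased without localizing: \<open>M\<^sub>Q = 0\<close> becomes the existence of multipliers
  outside \<open>Q\<close>, so that Nakayama's lemma at \<open>Q\<close> is an elimination of generators
  (\<open>nakayama_at_prime\<close>).  Localizations enter only where the definition of etale maps requires them
  and through fraction fields.
\<close>

section \<open>Linear spans and Nakayama's lemma\<close>

text \<open>
  Finite \<open>A\<close>-combinations of elements of \<open>G\<close>.  The coefficients range over an arbitrary set: for a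
  prime \<open>Q\<close> of a subring, \<open>lin_span E Q G\<close> is \<open>Q\<close> times the module generated by \<open>G\<close>.  With the empty
  combination as base case, closure properties follow by rule induction.
\<close>

inductive_set lin_span :: "('e, 'k) ring_scheme \<Rightarrow> 'e set \<Rightarrow> 'e set \<Rightarrow> 'e set"
  for E :: "('e, 'k) ring_scheme" and A :: "'e set" and G :: "'e set" where
  lin_span_zero: "\<zero>\<^bsub>E\<^esub> \<in> lin_span E A G"
| lin_span_step: "a \<in> A \<Longrightarrow> g \<in> G \<Longrightarrow> x \<in> lin_span E A G \<Longrightarrow> a \<otimes>\<^bsub>E\<^esub> g \<oplus>\<^bsub>E\<^esub> x \<in> lin_span E A G"

context cring
begin

lemma lin_span_closed:
  assumes "A \<subseteq> carrier R" "G \<subseteq> carrier R" "x \<in> lin_span R A G"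
  shows "x \<in> carrier R"
  using assms(3,1,2) by (induction) auto

lemma lin_span_mono:
  assumes "A \<subseteq> A'" "G \<subseteq> G'" "x \<in> lin_span R A G"
  shows "x \<in> lin_span R A' G'"
  using assms(3,1,2) by (induction) (auto intro: lin_span.intros)

lemma lin_span_add:
  assumes "A \<subseteq> carrier R" "G \<subseteq> carrier R" "x \<in> lin_span R A G" "y \<in> lin_span R A G"
  shows "x \<oplus> y \<in> lin_span R A G"
  using assms(3,1,2,4)
proof (induction)
  case lin_span_zero
  then show ?case using lin_span_closed by auto
next
  case (lin_span_step a g x)
  have "x \<in> carrier R" "y \<in> carrier R" "a \<in> carrier R" "g \<in> carrier R"
    using lin_span_step lin_span_closed by blast+
  then have "a \<otimes> g \<oplus> x \<oplus> y = a \<otimes> g \<oplus> (x \<oplus> y)" by (simp add: a_assoc)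
  then show ?case using lin_span_step by (auto intro: lin_span.lin_span_step)
qed

lemma lin_span_smult:
  assumes "A \<subseteq> carrier R" "G \<subseteq> carrier R" "b \<in> carrier R" "\<And>a. a \<in> A \<Longrightarrow> b \<otimes> a \<in> A'"
    and "x \<in> lin_span R A G"
  shows "b \<otimes> x \<in> lin_span R A' G"
  using assms(5)
proof (induction)
  case lin_span_zero
  then show ?case using assms by (auto intro: lin_span.intros)
next
  case (lin_span_step a g x)
  have "x \<in> carrier R" "a \<in> carrier R" "g \<in> carrier R"
    using lin_span_step assms lin_span_closed by blast+
  then have "b \<otimes> (a \<otimes> g \<oplus> x) = (b \<otimes> a) \<otimes> g \<oplus> b \<otimes> x"
    using assms(3) by (simp add: r_distr m_assoc)
  then show ?case using lin_span_step assms(4) by (auto intro: lin_span.lin_span_step)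
qed

lemma lin_span_single:
  assumes "A \<subseteq> carrier R" "G \<subseteq> carrier R" "a \<in> A" "g \<in> G"
  shows "a \<otimes> g \<in> lin_span R A G"
proof -
  have "a \<otimes> g \<oplus> \<zero> \<in> lin_span R A G"
    using assms by (intro lin_span.intros)
  then show ?thesis using assms by (auto simp: subset_iff)
qed

lemma lin_span_base:
  assumes "A \<subseteq> carrier R" "G \<subseteq> carrier R" "\<one> \<in> A" "g \<in> G"
  shows "g \<in> lin_span R A G"
  using lin_span_single[OF assms] assms by (auto simp: subset_iff)

lemma lin_span_least:
  assumes "\<zero> \<in> M" "\<And>x y. x \<in> M \<Longrightarrow> y \<in> M \<Longrightarrow> x \<oplus> y \<in> M"
    "\<And>a g. a \<in> A \<Longrightarrow> g \<in> G \<Longrightarrow> a \<otimes> g \<in> M" and "x \<in> lin_span R A G"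
  shows "x \<in> M"
  using assms(4,1-3) by (induction) auto

lemma lin_span_insertE:
  assumes "A \<subseteq> carrier R" "insert h G \<subseteq> carrier R" "\<zero> \<in> A"
    "\<And>x y. x \<in> A \<Longrightarrow> y \<in> A \<Longrightarrow> x \<oplus> y \<in> A"
    and "x \<in> lin_span R A (insert h G)"
  obtains a z where "a \<in> A" "z \<in> lin_span R A G" "x = a \<otimes> h \<oplus> z"
proof -
  have "\<exists>a\<in>A. \<exists>z\<in>lin_span R A G. x = a \<otimes> h \<oplus> z"
    using assms(5)
  proof (induction)
    case lin_span_zero
    have "\<zero> = \<zero> \<otimes> h \<oplus> \<zero>" using assms(2) by simp
    then show ?case using assms(3) lin_span.lin_span_zero by metis
  next
    case (lin_span_step b g x)
    then obtain a z where az: "a \<in> A" "z \<in> lin_span R A G" "x = a \<otimes> h \<oplus> z" by blast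
    have z: "z \<in> carrier R" using az(2) assms lin_span_closed by blast
    have c: "a \<in> carrier R" "b \<in> carrier R" "h \<in> carrier R" "g \<in> carrier R"
      using az lin_span_step assms by auto
    show ?case
    proof (cases "g = h")
      case True
      have "b \<otimes> g \<oplus> x = (b \<oplus> a) \<otimes> h \<oplus> z"
        unfolding az(3) True using c z by algebra
      then show ?thesis using az lin_span_step assms(4) by blast
    next
      case False
      have "b \<otimes> g \<oplus> x = a \<otimes> h \<oplus> (b \<otimes> g \<oplus> z)"
        unfolding az(3) using c z by algebra
      moreover have "b \<otimes> g \<oplus> z \<in> lin_span R A G"
        using False lin_span_step(1,2) az(2) by (auto intro: lin_span.lin_span_step)
      ultimately show ?thesis using az by blast
    qed
  qed
  then show ?thesis using that by blast
qed

lemma lin_span_finsum_mem: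
  assumes "A \<subseteq> carrier R" "finite G" "G \<subseteq> carrier R" "c \<in> G \<rightarrow> A"
  shows "(\<Oplus>g\<in>G. c g \<otimes> g) \<in> lin_span R A G"
  using assms(2-4)
proof (induction G rule: finite_induct)
  case empty
  then show ?case by (simp add: lin_span_zero)
next
  case (insert h G)
  have IH: "(\<Oplus>g\<in>G. c g \<otimes> g) \<in> lin_span R A (insert h G)"
    by (rule lin_span_mono[OF _ _ insert.IH]) (use insert.prems in auto)
  have "(\<Oplus>g\<in>insert h G. c g \<otimes> g) = c h \<otimes> h \<oplus> (\<Oplus>g\<in>G. c g \<otimes> g)"
    using insert assms(1) by (intro finsum_insert) (auto simp: Pi_iff subset_iff)
  then show ?case using IH insert.prems by (auto intro: lin_span_step)
qed

lemma lin_span_finsumE: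
  assumes "A \<subseteq> carrier R" "finite G" "G \<subseteq> carrier R" "\<zero> \<in> A"
    "\<And>x y. x \<in> A \<Longrightarrow> y \<in> A \<Longrightarrow> x \<oplus> y \<in> A" "x \<in> lin_span R A G"
  obtains c where "c \<in> G \<rightarrow> A" "x = (\<Oplus>g\<in>G. c g \<otimes> g)"
proof -
  have "\<exists>c\<in>G \<rightarrow> A. x = (\<Oplus>g\<in>G. c g \<otimes> g)"
    using assms(2,3,6)
  proof (induction G arbitrary: x rule: finite_induct)
    case empty
    have "x = \<zero>" using empty(2) by (cases) auto
    then show ?case by auto
  next
    case (insert h G)
    obtain a z where az: "a \<in> A" "z \<in> lin_span R A G" "x = a \<otimes> h \<oplus> z"
      using lin_span_insertE[OF assms(1) insert.prems(1) assms(4,5) insert.prems(2)] by blast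
    obtain c where c: "c \<in> G \<rightarrow> A" "z = (\<Oplus>g\<in>G. c g \<otimes> g)"
      using insert.IH[OF _ az(2)] insert.prems by auto
    let ?c = "c(h := a)"
    have "(\<Oplus>g\<in>insert h G. ?c g \<otimes> g) = ?c h \<otimes> h \<oplus> (\<Oplus>g\<in>G. ?c g \<otimes> g)"
      using insert assms(1) az c by (intro finsum_insert) (auto simp: Pi_iff subset_iff)
    also have "(\<Oplus>g\<in>G. ?c g \<otimes> g) = (\<Oplus>g\<in>G. c g \<otimes> g)"
      using insert assms(1) c by (intro finsum_cong') (auto simp: Pi_iff subset_iff)
    finally have "x = (\<Oplus>g\<in>insert h G. ?c g \<otimes> g)" using az c by simp
    moreover have "?c \<in> insert h G \<rightarrow> A" using az c by auto
    ultimately show ?case by blast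
  qed
  then show ?thesis using that by blast
qed

end

text \<open>
  Nakayama's lemma as an elimination.  The set \<open>U\<close> plays the role of units and \<open>I\<close> that of an ideal in
  the Jacobson radical, so \<open>U - I \<subseteq> U\<close>.  An equation \<open>u h = i h + z\<close> gives \<open>(u - i) h = z\<close> with \<open>z\<close> free of
  \<open>h\<close>; multiplying the other equations by \<open>u - i\<close> removes \<open>h\<close> from them as well.
\<close>

lemma (in domain) nakayama:
  assumes "finite G" "G \<subseteq> carrier R" "I \<subseteq> carrier R" "U \<subseteq> carrier R" "\<zero> \<notin> U" "\<zero> \<in> I"
    and add: "\<And>x y. x \<in> I \<Longrightarrow> y \<in> I \<Longrightarrow> x \<oplus> y \<in> I"
    and mult: "\<And>x y. x \<in> I \<Longrightarrow> y \<in> I \<Longrightarrow> x \<otimes> y \<in> I"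
    and UU: "\<And>x y. x \<in> U \<Longrightarrow> y \<in> U \<Longrightarrow> x \<otimes> y \<in> U"
    and UI: "\<And>x y. x \<in> U \<Longrightarrow> y \<in> I \<Longrightarrow> x \<otimes> y \<in> I"
    and UmI: "\<And>x y. x \<in> U \<Longrightarrow> y \<in> I \<Longrightarrow> x \<ominus> y \<in> U"
    and eqs: "\<And>g. g \<in> G \<Longrightarrow> \<exists>u\<in>U. u \<otimes> g \<in> lin_span R I G"
  shows "\<forall>g\<in>G. g = \<zero>"
  using assms(1,2) eqs
proof (induction G rule: finite_induct)
  case empty
  then show ?case by simp
next
  case (insert h G)
  have sp: "\<exists>a\<in>I. \<exists>z\<in>lin_span R I G. x = a \<otimes> h \<oplus> z" if "x \<in> lin_span R I (insert h G)" for x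
    by (rule lin_span_insertE[OF assms(3) insert.prems(1) assms(6) _ that]) (use add in blast)+
  have Gc: "G \<subseteq> carrier R" and hc: "h \<in> carrier R" using insert.prems by auto
  obtain u where u: "u \<in> U" "u \<otimes> h \<in> lin_span R I (insert h G)"
    using insert.prems(2) by blast
  obtain i z where iz: "i \<in> I" "z \<in> lin_span R I G" "u \<otimes> h = i \<otimes> h \<oplus> z"
    using sp[OF u(2)] by blast
  define v where "v = u \<ominus> i"
  have v: "v \<in> U" using UmI u iz v_def by auto
  have c: "u \<in> carrier R" "i \<in> carrier R" "v \<in> carrier R" "z \<in> carrier R"
    using u iz v assms lin_span_closed[OF assms(3) Gc] by auto
  have "v \<otimes> h = u \<otimes> h \<ominus> i \<otimes> h" unfolding v_def using c hc by algebra
  also have "\<dots> = z" unfolding iz(3) using c hc by algebra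
  finally have vh: "v \<otimes> h = z" .
  have "\<exists>u\<in>U. u \<otimes> g \<in> lin_span R I G" if g: "g \<in> G" for g
  proof -
    obtain u' where u': "u' \<in> U" "u' \<otimes> g \<in> lin_span R I (insert h G)"
      using insert.prems(2) g by blast
    obtain i' z' where iz': "i' \<in> I" "z' \<in> lin_span R I G" "u' \<otimes> g = i' \<otimes> h \<oplus> z'"
      using sp[OF u'(2)] by blast
    have c': "u' \<in> carrier R" "i' \<in> carrier R" "z' \<in> carrier R" "g \<in> carrier R"
      using u' iz' g Gc assms lin_span_closed[OF assms(3) Gc] by auto
    have "(v \<otimes> u') \<otimes> g = v \<otimes> (u' \<otimes> g)" using c c' by algebra
    also have "\<dots> = i' \<otimes> (v \<otimes> h) \<oplus> v \<otimes> z'" unfolding iz'(3) using c c' hc by algebra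
    also have "\<dots> = i' \<otimes> z \<oplus> v \<otimes> z'" using vh by simp
    finally have eq: "(v \<otimes> u') \<otimes> g = i' \<otimes> z \<oplus> v \<otimes> z'" .
    have "i' \<otimes> z \<in> lin_span R I G"
      by (rule lin_span_smult[OF assms(3) Gc c'(2) _ iz(2)]) (use mult iz' in auto)
    moreover have "v \<otimes> z' \<in> lin_span R I G"
      by (rule lin_span_smult[OF assms(3) Gc c(3) _ iz'(2)]) (use UI v in auto)
    ultimately show ?thesis
      using eq lin_span_add[OF assms(3) Gc] UU[OF v u'(1)] by metis
  qed
  then have G0: "\<forall>g\<in>G. g = \<zero>" using insert.IH Gc by blast
  have "z = \<zero>"
  proof -
    have "z \<in> {\<zero>}"
      by (rule lin_span_least[OF _ _ _ iz(2)]) (use G0 assms(3) in \<open>auto simp: subset_iff\<close>)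
    then show ?thesis by simp
  qed
  then have "v \<otimes> h = \<zero>" using vh by simp
  then have "h = \<zero>" using integral[of v h] c hc v assms(5) by auto
  then show ?case using G0 by simp
qed

section \<open>Linear dependence\<close>

text \<open>
  More vectors than coordinates are dependent, over a domain without dividing: pivot on a nonzero
  entry and cross-multiply.
\<close>

lemma (in domain) linear_dependence:
  assumes "subring A R" "finite I" "finite J" "card I < card J"
    "\<And>j i. j \<in> J \<Longrightarrow> i \<in> I \<Longrightarrow> v j i \<in> A"
  obtains c where "c \<in> J \<rightarrow> A" "\<exists>j\<in>J. c j \<noteq> \<zero>" "\<And>i. i \<in> I \<Longrightarrow> (\<Oplus>j\<in>J. c j \<otimes> v j i) = \<zero>"
proof -
  have Ac: "A \<subseteq> carrier R" using assms(1) by (rule subringE)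
  have "\<exists>c\<in>J \<rightarrow> A. (\<exists>j\<in>J. c j \<noteq> \<zero>) \<and> (\<forall>i\<in>I. (\<Oplus>j\<in>J. c j \<otimes> v j i) = \<zero>)"
    using assms(2-5)
  proof (induction I arbitrary: J v rule: finite_induct)
    case empty
    then obtain j where "j \<in> J" by fastforce
    then show ?case
      using subringE(3)[OF assms(1)] by (intro bexI[of _ "\<lambda>_. \<one>"]) auto
  next
    case (insert i0 I)
    note vA = insert.prems(3)
    have vc: "\<And>j i. j \<in> J \<Longrightarrow> i \<in> insert i0 I \<Longrightarrow> v j i \<in> carrier R" using vA Ac by blast
    show ?case
    proof (cases "\<forall>j\<in>J. v j i0 = \<zero>")
      case True
      obtain c where c: "c \<in> J \<rightarrow> A" "\<exists>j\<in>J. c j \<noteq> \<zero>" "\<forall>i\<in>I. (\<Oplus>j\<in>J. c j \<otimes> v j i) = \<zero>"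
        using insert.IH[of J v] insert.prems insert.hyps by auto
      have "(\<Oplus>j\<in>J. c j \<otimes> v j i0) = (\<Oplus>j\<in>J. \<zero>)"
        using True c Ac by (intro finsum_cong') (auto simp: Pi_iff subset_iff)
      then show ?thesis using c by auto
    next
      case False
      then obtain j0 where j0: "j0 \<in> J" "v j0 i0 \<noteq> \<zero>" by blast
      define J' where "J' = J - {j0}"
      define v' where "v' = (\<lambda>j i. v j0 i0 \<otimes> v j i \<ominus> v j i0 \<otimes> v j0 i)"
      have J': "finite J'" "card I < card J'" "J = insert j0 J'" "j0 \<notin> J'"
        using insert.prems(1,2) insert.hyps j0 J'_def by auto
      have "\<exists>c\<in>J' \<rightarrow> A. (\<exists>j\<in>J'. c j \<noteq> \<zero>) \<and> (\<forall>i\<in>I. (\<Oplus>j\<in>J'. c j \<otimes> v' j i) = \<zero>)"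
      proof (rule insert.IH[OF J'(1,2)])
        fix j i assume "j \<in> J'" "i \<in> I"
        then show "v' j i \<in> A" unfolding v'_def a_minus_def
          using vA J'(3) j0(1) subringE(5-7)[OF assms(1)] by auto
      qed
      then obtain c where c: "c \<in> J' \<rightarrow> A" "\<exists>j\<in>J'. c j \<noteq> \<zero>"
          "\<And>i. i \<in> I \<Longrightarrow> (\<Oplus>j\<in>J'. c j \<otimes> v' j i) = \<zero>" by blast
      have cc: "c \<in> J' \<rightarrow> carrier R" using c Ac by blast
      define s where "s = (\<Oplus>j\<in>J'. c j \<otimes> v j i0)"
      have sA: "s \<in> A" unfolding s_def
      proof -
        have "finite T \<Longrightarrow> T \<subseteq> J' \<Longrightarrow> (\<Oplus>j\<in>T. c j \<otimes> v j i0) \<in> A" for T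
        proof (induction T rule: finite_induct)
          case empty then show ?case using subringE(2)[OF assms(1)] by simp
        next
          case (insert x T)
          have "(\<Oplus>j\<in>insert x T. c j \<otimes> v j i0) = c x \<otimes> v x i0 \<oplus> (\<Oplus>j\<in>T. c j \<otimes> v j i0)"
            using insert cc vc J'(3) by (intro finsum_insert) (auto simp: Pi_iff subset_iff)
          then show ?case using insert c(1) vA J'(3) subringE(6,7)[OF assms(1)]
            by (auto simp: Pi_iff subset_iff)
        qed
        then show "(\<Oplus>j\<in>J'. c j \<otimes> v j i0) \<in> A" using J' by blast
      qed
      have sc: "s \<in> carrier R" using sA Ac by blast
      \<comment> \<open>The coefficient of the pivot vector \<open>j0\<close> is chosen so that coordinate \<open>i0\<close> of the sum vanishes.\<close>
      define d where "d = (\<lambda>j. if j = j0 then \<ominus> s else c j \<otimes> v j0 i0)"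
      have dA: "d \<in> J \<rightarrow> A"
        unfolding d_def using c(1) vA j0(1) J'(3) sA subringE(5,6)[OF assms(1)] by (auto simp: Pi_iff)
      have sum: "(\<Oplus>j\<in>J. d j \<otimes> v j i) = (\<Oplus>j\<in>J'. c j \<otimes> v' j i)" if i: "i \<in> insert i0 I" for i
      proof -
        have "(\<Oplus>j\<in>J. d j \<otimes> v j i) = d j0 \<otimes> v j0 i \<oplus> (\<Oplus>j\<in>J'. d j \<otimes> v j i)"
          unfolding J'(3) using J' dA Ac vc i by (intro finsum_insert) (auto simp: Pi_iff subset_iff)
        also have "d j0 \<otimes> v j0 i = \<ominus> (s \<otimes> v j0 i)"
          using sc vc[OF j0(1) i] by (simp add: d_def l_minus)
        also have "s \<otimes> v j0 i = (\<Oplus>j\<in>J'. (c j \<otimes> v j i0) \<otimes> v j0 i)"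
          unfolding s_def using cc vc[OF j0(1) i] vc J' by (intro finsum_ldistr) (auto simp: Pi_iff)
        also have "(\<Oplus>j\<in>J'. d j \<otimes> v j i) = (\<Oplus>j\<in>J'. c j \<otimes> v' j i \<oplus> (c j \<otimes> v j i0) \<otimes> v j0 i)"
        proof (rule finsum_cong'[OF refl])
          show "(\<lambda>j. c j \<otimes> v' j i \<oplus> (c j \<otimes> v j i0) \<otimes> v j0 i) \<in> J' \<rightarrow> carrier R"
            using cc vc j0 J' i by (auto simp: Pi_iff v'_def)
          fix j assume j: "j \<in> J'"
          have cl: "c j \<in> carrier R" "v j i \<in> carrier R" "v j i0 \<in> carrier R" "v j0 i \<in> carrier R" "v j0 i0 \<in> carrier R"
            using cc vc j0 J' i j by (auto simp: Pi_iff)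
          have "d j = c j \<otimes> v j0 i0" using j J' by (auto simp: d_def)
          then show "d j \<otimes> v j i = c j \<otimes> v' j i \<oplus> (c j \<otimes> v j i0) \<otimes> v j0 i"
            unfolding v'_def using cl by (simp only:) algebra
        qed
        also have "\<dots> = (\<Oplus>j\<in>J'. c j \<otimes> v' j i) \<oplus> (\<Oplus>j\<in>J'. (c j \<otimes> v j i0) \<otimes> v j0 i)"
          using cc vc j0 J' i by (intro finsum_addf) (auto simp: Pi_iff v'_def)
        finally have *: "(\<Oplus>j\<in>J. d j \<otimes> v j i) = \<ominus> (\<Oplus>j\<in>J'. (c j \<otimes> v j i0) \<otimes> v j0 i)
            \<oplus> ((\<Oplus>j\<in>J'. c j \<otimes> v' j i) \<oplus> (\<Oplus>j\<in>J'. (c j \<otimes> v j i0) \<otimes> v j0 i))" .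
        have "(\<Oplus>j\<in>J'. (c j \<otimes> v j i0) \<otimes> v j0 i) \<in> carrier R" "(\<Oplus>j\<in>J'. c j \<otimes> v' j i) \<in> carrier R"
          using cc vc j0 J' i by (auto simp: Pi_iff v'_def intro!: finsum_closed)
        moreover have "\<ominus> x \<oplus> (y \<oplus> x) = y" if "x \<in> carrier R" "y \<in> carrier R" for x y
          using that by algebra
        ultimately show ?thesis unfolding * by blast
      qed
      have "(\<Oplus>j\<in>J'. c j \<otimes> v' j i0) = (\<Oplus>j\<in>J'. \<zero>)"
      proof (rule finsum_cong'[OF refl])
        fix j assume j: "j \<in> J'"
        have "v j i0 \<in> carrier R" "v j0 i0 \<in> carrier R" using vc j j0 J' by auto
        then have "v' j i0 = \<zero>" unfolding v'_def by (simp add: a_minus_def m_comm r_neg)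
        then show "c j \<otimes> v' j i0 = \<zero>" using cc j by (auto simp: Pi_iff)
      qed auto
      then have "\<forall>i\<in>insert i0 I. (\<Oplus>j\<in>J. d j \<otimes> v j i) = \<zero>" using sum c(3) by auto
      moreover have "\<exists>j\<in>J. d j \<noteq> \<zero>"
      proof -
        obtain j where "j \<in> J'" "c j \<noteq> \<zero>" using c(2) by blast
        then have "d j \<noteq> \<zero>" using integral[of "c j" "v j0 i0"] j0 vc[of j0 i0] cc J'(4)
          by (auto simp: d_def Pi_iff)
        then show ?thesis using \<open>j \<in> J'\<close> J'(3) by blast
      qed
      ultimately show ?thesis using dA by blast
    qed
  qed
  then show ?thesis using that by blast
qed

section \<open>Primes of subrings\<close>

text \<open>
  A prime ideal of a subring \<open>A\<close> of a fixed ring \<open>E\<close>; keeping \<open>E\<close> fixed makes it possible to pass to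
  larger and larger subrings.
\<close>

definition prime_in :: "('e, 'k) ring_scheme \<Rightarrow> 'e set \<Rightarrow> 'e set \<Rightarrow> bool" where
  "prime_in E A P \<longleftrightarrow> subring A E \<and> P \<subseteq> A \<and> \<zero>\<^bsub>E\<^esub> \<in> P \<and> \<one>\<^bsub>E\<^esub> \<notin> P \<and>
     (\<forall>x\<in>P. \<forall>y\<in>P. x \<oplus>\<^bsub>E\<^esub> y \<in> P) \<and> (\<forall>a\<in>A. \<forall>x\<in>P. a \<otimes>\<^bsub>E\<^esub> x \<in> P) \<and>
     (\<forall>x\<in>A. \<forall>y\<in>A. x \<otimes>\<^bsub>E\<^esub> y \<in> P \<longrightarrow> x \<in> P \<or> y \<in> P)"

lemma prime_inD:
  assumes "prime_in E A P"
  shows "subring A E" "P \<subseteq> A" "\<zero>\<^bsub>E\<^esub> \<in> P" "\<one>\<^bsub>E\<^esub> \<notin> P"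
    "\<And>x y. x \<in> P \<Longrightarrow> y \<in> P \<Longrightarrow> x \<oplus>\<^bsub>E\<^esub> y \<in> P" "\<And>a x. a \<in> A \<Longrightarrow> x \<in> P \<Longrightarrow> a \<otimes>\<^bsub>E\<^esub> x \<in> P"
    "\<And>x y. x \<in> A \<Longrightarrow> y \<in> A \<Longrightarrow> x \<otimes>\<^bsub>E\<^esub> y \<in> P \<Longrightarrow> x \<in> P \<or> y \<in> P"
    "A \<subseteq> carrier E" "P \<subseteq> carrier E"
  using assms subringE(1)[of A E] by (auto simp: prime_in_def)

context cring
begin

lemma prime_in_minus:
  assumes "prime_in R A P" "x \<in> P" "y \<in> P"
  shows "x \<ominus> y \<in> P"
proof -
  note p = prime_inD[OF assms(1)]
  have "\<ominus> \<one> \<in> A" using subringE(3,5)[OF p(1)] by auto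
  then have "x \<oplus> (\<ominus> \<one>) \<otimes> y \<in> P" using p(5)[OF assms(2) p(6)[OF _ assms(3)]] by auto
  moreover have "x \<oplus> (\<ominus> \<one>) \<otimes> y = x \<ominus> y" using assms p(9) by (auto simp: a_minus_def l_minus)
  ultimately show ?thesis by simp
qed

lemma prime_in_finsum:
  assumes "prime_in R A P" "finite F" "\<And>i. i \<in> F \<Longrightarrow> f i \<in> P"
  shows "(\<Oplus>i\<in>F. f i) \<in> P"
  using assms(2,3)
proof (induction F rule: finite_induct)
  case empty then show ?case using prime_inD(3)[OF assms(1)] by simp
next
  case (insert x F)
  have "(\<Oplus>i\<in>insert x F. f i) = f x \<oplus> (\<Oplus>i\<in>F. f i)"
    using insert prime_inD(9)[OF assms(1)] by (intro finsum_insert) auto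
  then show ?case using insert prime_inD(5)[OF assms(1)] by auto
qed

text \<open>
  Dedekind's independence argument modulo a prime.  If \<open>\<Sum> c\<^sub>i \<tau>\<^sub>i\<close> vanishes modulo \<open>P\<close>, subtract \<open>\<tau>\<^sub>j y0\<close>
  times the relation from the relation with \<open>y0 y\<close> in place of \<open>y\<close>: this removes \<open>\<tau>\<^sub>j\<close> and multiplies \<open>c\<^sub>k\<close> by
  \<open>\<tau>\<^sub>k y0 - \<tau>\<^sub>j y0\<close>, which is not in \<open>P\<close>.
\<close>

lemma independence_mod_prime:
  assumes P: "prime_in R A P" and "finite F" "k \<notin> F"
    and cA: "\<And>i. i \<in> insert k F \<Longrightarrow> c i \<in> A"
    and \<tau>A: "\<And>i y. i \<in> insert k F \<Longrightarrow> y \<in> Y \<Longrightarrow> \<tau> i y \<in> A"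
    and mult: "\<And>i x y. i \<in> insert k F \<Longrightarrow> x \<in> Y \<Longrightarrow> y \<in> Y \<Longrightarrow> mul x y \<in> Y \<and> \<tau> i (mul x y) = \<tau> i x \<otimes> \<tau> i y"
    and diff: "\<And>i. i \<in> F \<Longrightarrow> \<exists>y\<in>Y. \<tau> i y \<ominus> \<tau> k y \<notin> P"
    and rel: "\<And>y. y \<in> Y \<Longrightarrow> (\<Oplus>i\<in>insert k F. c i \<otimes> \<tau> i y) \<in> P"
    and "y \<in> Y"
  shows "c k \<otimes> \<tau> k y \<in> P"
  using assms(2-)
proof (induction F arbitrary: c y rule: finite_induct)
  case empty
  have "c k \<in> A" "\<tau> k y \<in> A" using empty.prems by blast+
  then have "c k \<otimes> \<tau> k y \<in> carrier R" using prime_inD(8)[OF P] by blast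
  moreover have "(\<Oplus>i\<in>{k}. c i \<otimes> \<tau> i y) = c k \<otimes> \<tau> k y"
    using calculation by (subst finsum_insert) auto
  ultimately show ?case using empty.prems(6)[OF empty.prems(7)] by simp
next
  case (insert j F)
  note p = prime_inD[OF P]
  note Ac = p(8)
  have ce: "\<And>i. i \<in> insert k (insert j F) \<Longrightarrow> c i \<in> carrier R" using insert.prems(2) Ac by blast
  have te: "\<And>i y. i \<in> insert k (insert j F) \<Longrightarrow> y \<in> Y \<Longrightarrow> \<tau> i y \<in> carrier R" using insert.prems(3) Ac by blast
  obtain y0 where y0: "y0 \<in> Y" "\<tau> j y0 \<ominus> \<tau> k y0 \<notin> P" using insert.prems(5) by blast
  define c' where "c' = (\<lambda>i. c i \<otimes> (\<tau> i y0 \<ominus> \<tau> j y0))"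
  have c'A: "c' i \<in> A" if "i \<in> insert k (insert j F)" for i
    using that insert.prems(2,3) y0 subringE(5-7)[OF p(1)] by (auto simp: c'_def a_minus_def)
  have c'c: "\<And>i. i \<in> insert k (insert j F) \<Longrightarrow> c' i \<in> carrier R" using c'A Ac by blast
  have sums: "(\<Oplus>i\<in>insert k F. c' i \<otimes> \<tau> i z) \<in> P" if z: "z \<in> Y" for z
  proof -
    let ?K = "insert k (insert j F)"
    have fin: "finite (insert k F)" "j \<notin> insert k F" "?K = insert j (insert k F)"
      using insert by auto
    have cl: "(\<Oplus>i\<in>insert k F. c' i \<otimes> \<tau> i z) \<in> carrier R"
      using c'c te z by (intro finsum_closed) (auto simp: Pi_iff)
    have m: "mul y0 z \<in> Y" using insert.prems(4) y0 z by blast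
    have "(\<Oplus>i\<in>?K. c' i \<otimes> \<tau> i z) = c' j \<otimes> \<tau> j z \<oplus> (\<Oplus>i\<in>insert k F. c' i \<otimes> \<tau> i z)"
      unfolding fin(3) using fin c'c te z by (intro finsum_insert) (auto simp: Pi_iff)
    also have "c' j \<otimes> \<tau> j z = \<zero>"
      unfolding c'_def using ce[of j] te[of j y0] te[of j z] y0 z by (simp add: a_minus_def r_neg)
    finally have 1: "(\<Oplus>i\<in>insert k F. c' i \<otimes> \<tau> i z) = (\<Oplus>i\<in>?K. c' i \<otimes> \<tau> i z)"
      using cl by simp
    have "(\<Oplus>i\<in>?K. c i \<otimes> \<tau> i (mul y0 z)) = (\<Oplus>i\<in>?K. c' i \<otimes> \<tau> i z \<oplus> \<tau> j y0 \<otimes> (c i \<otimes> \<tau> i z))"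
    proof (rule finsum_cong'[OF refl])
      show "(\<lambda>i. c' i \<otimes> \<tau> i z \<oplus> \<tau> j y0 \<otimes> (c i \<otimes> \<tau> i z)) \<in> ?K \<rightarrow> carrier R"
        using c'c ce te y0 z by (auto simp: Pi_iff)
      fix i assume i: "i \<in> ?K"
      have "\<tau> i (mul y0 z) = \<tau> i y0 \<otimes> \<tau> i z" using insert.prems(4) i y0 z by blast
      then show "c i \<otimes> \<tau> i (mul y0 z) = c' i \<otimes> \<tau> i z \<oplus> \<tau> j y0 \<otimes> (c i \<otimes> \<tau> i z)"
        unfolding c'_def using ce[OF i] te[OF i y0(1)] te[OF i z] te[of j y0] y0
        by (simp only: insert_iff) algebra
    qed
    also have "\<dots> = (\<Oplus>i\<in>?K. c' i \<otimes> \<tau> i z) \<oplus> (\<Oplus>i\<in>?K. \<tau> j y0 \<otimes> (c i \<otimes> \<tau> i z))"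
      using c'c ce te y0 z by (intro finsum_addf) (auto simp: Pi_iff)
    also have "(\<Oplus>i\<in>?K. \<tau> j y0 \<otimes> (c i \<otimes> \<tau> i z)) = \<tau> j y0 \<otimes> (\<Oplus>i\<in>?K. c i \<otimes> \<tau> i z)"
      using ce te y0 z insert.hyps by (intro finsum_rdistr[symmetric]) (auto simp: Pi_iff)
    finally have 2: "(\<Oplus>i\<in>?K. c i \<otimes> \<tau> i (mul y0 z)) = (\<Oplus>i\<in>?K. c' i \<otimes> \<tau> i z) \<oplus> \<tau> j y0 \<otimes> (\<Oplus>i\<in>?K. c i \<otimes> \<tau> i z)" .
    have 3: "(\<Oplus>i\<in>?K. c i \<otimes> \<tau> i (mul y0 z)) \<in> P" "(\<Oplus>i\<in>?K. c i \<otimes> \<tau> i z) \<in> P"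
      using insert.prems(6) m z by auto
    have 4: "\<tau> j y0 \<otimes> (\<Oplus>i\<in>?K. c i \<otimes> \<tau> i z) \<in> P" using 3(2) p(6) insert.prems(3) y0 by auto
    have "(\<Oplus>i\<in>?K. c' i \<otimes> \<tau> i z) = (\<Oplus>i\<in>?K. c i \<otimes> \<tau> i (mul y0 z)) \<ominus> \<tau> j y0 \<otimes> (\<Oplus>i\<in>?K. c i \<otimes> \<tau> i z)"
      unfolding 2 using cl[unfolded 1] 4 p(9) by (simp add: subset_iff a_minus_def a_assoc r_neg)
    then show ?thesis unfolding 1 using prime_in_minus[OF P 3(1) 4] by simp
  qed
  have "c' k \<otimes> \<tau> k y \<in> P"
  proof (rule insert.IH[of c'])
    show "k \<notin> F" using insert.prems by blast
    fix i x y assume "i \<in> insert k F" "x \<in> Y" "y \<in> Y"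
    then show "mul x y \<in> Y \<and> \<tau> i (mul x y) = \<tau> i x \<otimes> \<tau> i y" using insert.prems(4) by blast
  qed (use insert.prems c'A sums in auto)
  moreover have "c' k \<otimes> \<tau> k y = (\<tau> k y0 \<ominus> \<tau> j y0) \<otimes> (c k \<otimes> \<tau> k y)"
    unfolding c'_def using ce[of k] te[of k y0] te[of j y0] te[of k y] y0 insert.prems(7)
    by (simp only: insert_iff) algebra
  moreover have "\<tau> k y0 \<ominus> \<tau> j y0 \<notin> P"
  proof
    assume "\<tau> k y0 \<ominus> \<tau> j y0 \<in> P"
    then have "\<zero> \<ominus> (\<tau> k y0 \<ominus> \<tau> j y0) \<in> P" using prime_in_minus[OF P p(3)] by blast
    moreover have "\<zero> \<ominus> (\<tau> k y0 \<ominus> \<tau> j y0) = \<tau> j y0 \<ominus> \<tau> k y0"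
      using te[of k y0] te[of j y0] y0 by (simp only: insert_iff) algebra
    ultimately show False using y0 by simp
  qed
  moreover have "\<tau> k y0 \<ominus> \<tau> j y0 \<in> A" "c k \<otimes> \<tau> k y \<in> A"
    using insert.prems y0 subringE(5-7)[OF p(1)] by (auto simp: a_minus_def)
  ultimately show ?case using p(7) by metis
qed

end

section \<open>Module-finite extensions\<close>

lemma module_finite_extensionD:
  assumes "module_finite_extension R T \<iota>"
  shows "cring T" "\<iota> \<in> ring_hom R T" "inj_on \<iota> (carrier R)"
  using assms by (auto simp: module_finite_extension_def)

lemma module_finite_lin_span:
  assumes "module_finite_extension R T \<iota>"
  obtains B where "finite B" "B \<subseteq> carrier T"
    "\<And>t. t \<in> carrier T \<Longrightarrow> t \<in> lin_span T (\<iota> ` carrier R) B"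
proof -
  interpret T: cring T using module_finite_extensionD(1)[OF assms] .
  have \<iota>: "\<And>r. r \<in> carrier R \<Longrightarrow> \<iota> r \<in> carrier T"
    using module_finite_extensionD(2)[OF assms] by (rule ring_hom_closed)
  have "\<exists>B. finite B \<and> B \<subseteq> carrier T \<and>
      (\<forall>x\<in>carrier T. \<exists>c\<in>B \<rightarrow> carrier R. x = (\<Oplus>\<^bsub>T\<^esub>b\<in>B. \<iota> (c b) \<otimes>\<^bsub>T\<^esub> b))"
    using assms unfolding module_finite_extension_def fin_gen_module_def finsum_alg_module
    by (auto simp: alg_module_def)
  then obtain B where B: "finite B" "B \<subseteq> carrier T"
    and gen: "\<And>x. x \<in> carrier T \<Longrightarrow> \<exists>c\<in>B \<rightarrow> carrier R. x = (\<Oplus>\<^bsub>T\<^esub>b\<in>B. \<iota> (c b) \<otimes>\<^bsub>T\<^esub> b)"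
    by blast
  have "t \<in> lin_span T (\<iota> ` carrier R) B" if "t \<in> carrier T" for t
  proof -
    obtain c where c: "c \<in> B \<rightarrow> carrier R" "t = (\<Oplus>\<^bsub>T\<^esub>b\<in>B. (\<iota> \<circ> c) b \<otimes>\<^bsub>T\<^esub> b)"
      using gen[OF \<open>t \<in> carrier T\<close>] by auto
    show ?thesis unfolding c(2)
      by (rule T.lin_span_finsum_mem) (use B c(1) \<iota> in auto)
  qed
  then show ?thesis using that B by blast
qed

section \<open>Linear independence and coordinates\<close>

definition lin_indep :: "('e, 'k) ring_scheme \<Rightarrow> 'e set \<Rightarrow> 'e set \<Rightarrow> bool" where
  "lin_indep E A G \<longleftrightarrow> finite G \<and> G \<subseteq> carrier E \<and>
     (\<forall>c\<in>G \<rightarrow> A. (\<Oplus>\<^bsub>E\<^esub>g\<in>G. c g \<otimes>\<^bsub>E\<^esub> g) = \<zero>\<^bsub>E\<^esub> \<longrightarrow> (\<forall>g\<in>G. c g = \<zero>\<^bsub>E\<^esub>))"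

lemma lin_indepD:
  assumes "lin_indep E A G" "c \<in> G \<rightarrow> A" "(\<Oplus>\<^bsub>E\<^esub>g\<in>G. c g \<otimes>\<^bsub>E\<^esub> g) = \<zero>\<^bsub>E\<^esub>" "g \<in> G"
  shows "c g = \<zero>\<^bsub>E\<^esub>"
  using assms unfolding lin_indep_def by blast

context cring
begin

lemma finsum_coefficients_minus:
  assumes "finite G" "G \<subseteq> carrier R" "c \<in> G \<rightarrow> carrier R" "d \<in> G \<rightarrow> carrier R"
  shows "(\<Oplus>g\<in>G. (c g \<ominus> d g) \<otimes> g) = (\<Oplus>g\<in>G. c g \<otimes> g) \<ominus> (\<Oplus>g\<in>G. d g \<otimes> g)"
  using assms
proof (induction G rule: finite_induct)
  case empty then show ?case by (simp add: a_minus_def)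
next
  case (insert h G)
  have cl: "c h \<in> carrier R" "d h \<in> carrier R" "h \<in> carrier R"
    "(\<Oplus>g\<in>G. c g \<otimes> g) \<in> carrier R" "(\<Oplus>g\<in>G. d g \<otimes> g) \<in> carrier R"
    using insert.prems by (auto simp: Pi_iff subset_iff intro!: finsum_closed)
  have id: "(a \<ominus> b) \<otimes> x \<oplus> (y \<ominus> z) = a \<otimes> x \<oplus> y \<ominus> (b \<otimes> x \<oplus> z)"
    if "a \<in> carrier R" "b \<in> carrier R" "x \<in> carrier R" "y \<in> carrier R" "z \<in> carrier R" for a b x y z
    using that by algebra
  have "(\<Oplus>g\<in>insert h G. (c g \<ominus> d g) \<otimes> g) = (c h \<ominus> d h) \<otimes> h \<oplus> (\<Oplus>g\<in>G. (c g \<ominus> d g) \<otimes> g)"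
    using insert by (intro finsum_insert) (auto simp: Pi_iff subset_iff)
  moreover have "(\<Oplus>g\<in>insert h G. c g \<otimes> g) = c h \<otimes> h \<oplus> (\<Oplus>g\<in>G. c g \<otimes> g)"
    using insert by (intro finsum_insert) (auto simp: Pi_iff subset_iff)
  moreover have "(\<Oplus>g\<in>insert h G. d g \<otimes> g) = d h \<otimes> h \<oplus> (\<Oplus>g\<in>G. d g \<otimes> g)"
    using insert by (intro finsum_insert) (auto simp: Pi_iff subset_iff)
  moreover have "(\<Oplus>g\<in>G. (c g \<ominus> d g) \<otimes> g) = (\<Oplus>g\<in>G. c g \<otimes> g) \<ominus> (\<Oplus>g\<in>G. d g \<otimes> g)"
    using insert by auto
  ultimately show ?case using id[OF cl] by simp
qed

lemma lin_indep_unique: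
  assumes "subring A R" "lin_indep R A G" "c \<in> G \<rightarrow> A" "d \<in> G \<rightarrow> A"
    "(\<Oplus>g\<in>G. c g \<otimes> g) = (\<Oplus>g\<in>G. d g \<otimes> g)" "g \<in> G"
  shows "c g = d g"
proof -
  note A = subringE[OF assms(1)]
  have G: "finite G" "G \<subseteq> carrier R" using assms(2) by (auto simp: lin_indep_def)
  have cd: "c \<in> G \<rightarrow> carrier R" "d \<in> G \<rightarrow> carrier R" using assms A(1) by blast+
  have cl: "(\<Oplus>g\<in>G. d g \<otimes> g) \<in> carrier R"
    using G cd by (auto simp: Pi_iff subset_iff intro!: finsum_closed)
  have "(\<Oplus>g\<in>G. (c g \<ominus> d g) \<otimes> g) = \<zero>"
    using finsum_coefficients_minus[OF G cd] assms(5) cl by (simp add: a_minus_def r_neg)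
  moreover have "(\<lambda>g. c g \<ominus> d g) \<in> G \<rightarrow> A"
    using assms(3,4) A(5,7) by (auto simp: a_minus_def Pi_iff)
  moreover have "\<forall>c\<in>G \<rightarrow> A. (\<Oplus>g\<in>G. c g \<otimes> g) = \<zero> \<longrightarrow> (\<forall>g\<in>G. c g = \<zero>)"
    using assms(2) unfolding lin_indep_def by blast
  ultimately have "c g \<ominus> d g = \<zero>"
    using assms(6) by (auto dest!: bspec[where x = "\<lambda>g. c g \<ominus> d g"])
  then show ?thesis using cd assms(6) by (auto simp: Pi_iff)
qed

text \<open>
  A maximal independent subset of a generating set is a basis after inverting one nonzero \<open>d\<close>: this
  replaces a vector space basis over the fraction field of \<open>A\<close>.
\<close>

lemma extend_to_maximal_lin_indep:
  assumes A: "subring A R" and dom: "\<And>x y. x \<in> A \<Longrightarrow> y \<in> A \<Longrightarrow> x \<otimes> y = \<zero> \<Longrightarrow> x = \<zero> \<or> y = \<zero>"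
    and "\<one> \<noteq> \<zero>"
    and E0: "lin_indep R A E0" and "finite B" "B \<subseteq> carrier R"
  obtains E d where "E0 \<subseteq> E" "lin_indep R A E" "d \<in> A" "d \<noteq> \<zero>"
    "\<And>t. t \<in> lin_span R A B \<Longrightarrow> d \<otimes> t \<in> lin_span R A E"
proof -
  note a = subringE[OF A]
  have "\<exists>E d. E0 \<subseteq> E \<and> lin_indep R A E \<and> d \<in> A \<and> d \<noteq> \<zero> \<and> (\<forall>b\<in>B. d \<otimes> b \<in> lin_span R A E)"
    using assms(5,6)
  proof (induction B rule: finite_induct)
    case empty
    show ?case using E0 a(3) assms(3) by blast
  next
    case (insert b B)
    then obtain E d where E: "E0 \<subseteq> E" "lin_indep R A E" "d \<in> A" "d \<noteq> \<zero>"
      "\<And>b. b \<in> B \<Longrightarrow> d \<otimes> b \<in> lin_span R A E" by blast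
    have Ef: "finite E" "E \<subseteq> carrier R" using E(2) by (auto simp: lin_indep_def)
    have b: "b \<in> carrier R" using insert.prems by simp
    show ?case
    proof (cases "lin_indep R A (insert b E)")
      case True
      have i: "insert b E \<subseteq> carrier R" using Ef b by simp
      have "d \<otimes> x \<in> lin_span R A (insert b E)" if "x \<in> insert b B" for x
      proof (cases "x = b")
        case True then show ?thesis using lin_span_single[OF a(1) i E(3)] by simp
      next
        case False
        then have "d \<otimes> x \<in> lin_span R A E" using that E(5) by blast
        then show ?thesis using lin_span_mono[of A A E] by blast
      qed
      then show ?thesis using True E by blast
    next
      case False
      then have bE: "b \<notin> E" using E(2) by (metis insert_absorb)
      obtain c where c: "c \<in> insert b E \<rightarrow> A" "(\<Oplus>g\<in>insert b E. c g \<otimes> g) = \<zero>" "\<exists>g\<in>insert b E. c g \<noteq> \<zero>"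
        using False Ef b unfolding lin_indep_def by auto
      have cc: "\<And>g. g \<in> insert b E \<Longrightarrow> c g \<in> carrier R" using c(1) a(1) by blast
      have sum: "(\<Oplus>g\<in>insert b E. c g \<otimes> g) = c b \<otimes> b \<oplus> (\<Oplus>g\<in>E. c g \<otimes> g)"
        using Ef bE cc b by (intro finsum_insert) (auto simp: Pi_iff subset_iff)
      have sE: "(\<Oplus>g\<in>E. c g \<otimes> g) \<in> carrier R"
        using Ef cc by (auto simp: Pi_iff subset_iff intro!: finsum_closed)
      have cb0: "c b \<noteq> \<zero>"
      proof
        assume "c b = \<zero>"
        then have "(\<Oplus>g\<in>E. c g \<otimes> g) = \<zero>" using c(2) sum sE b by simp
        then have "\<forall>g\<in>E. c g = \<zero>" using E(2) c(1) unfolding lin_indep_def by blast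
        then show False using c(3) \<open>c b = \<zero>\<close> by blast
      qed
      have cb: "c b \<otimes> b \<in> lin_span R A E"
      proof -
        have "(\<lambda>g. \<ominus> c g) \<in> E \<rightarrow> A" using c(1) a(5) by (auto simp: Pi_iff)
        then have "(\<Oplus>g\<in>E. (\<lambda>g. \<ominus> c g) g \<otimes> g) \<in> lin_span R A E"
          by (rule lin_span_finsum_mem[OF a(1) Ef])
        moreover have "(\<Oplus>g\<in>E. (\<lambda>g. \<ominus> c g) g \<otimes> g) = (\<Oplus>g\<in>E. (\<zero> \<ominus> c g) \<otimes> g)"
          using Ef cc by (intro finsum_cong') (auto simp: a_minus_def Pi_iff subset_iff)
        moreover have "\<dots> = (\<Oplus>g\<in>E. \<zero> \<otimes> g) \<ominus> (\<Oplus>g\<in>E. c g \<otimes> g)"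
          using Ef cc by (intro finsum_coefficients_minus) (auto simp: Pi_iff)
        moreover have "(\<Oplus>g\<in>E. \<zero> \<otimes> g) = (\<Oplus>g\<in>E. \<zero>)"
          using Ef by (intro finsum_cong') (auto simp: subset_iff)
        moreover have "\<zero> \<ominus> y = x" if "x \<oplus> y = \<zero>" "x \<in> carrier R" "y \<in> carrier R" for x y
          using that by (metis a_minus_def a_inv_closed add.inv_equality l_zero minus_minus)
        ultimately show ?thesis using c(2) sum sE cc[of b] b by simp
      qed
      define d' where "d' = c b \<otimes> d"
      have d': "d' \<in> A" "d' \<noteq> \<zero>" "c b \<in> A" using c(1) E(3,4) cb0 dom a(6) unfolding d'_def by blast+
      have "d' \<otimes> x \<in> lin_span R A E" if "x \<in> insert b B" for x
      proof (cases "x = b")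
        case True
        have "d \<otimes> (c b \<otimes> b) \<in> lin_span R A E"
          by (rule lin_span_smult[OF a(1) Ef(2) _ _ cb]) (use E(3) a(1,6) in auto)
        moreover have "d \<otimes> (c b \<otimes> b) = d' \<otimes> b"
          unfolding d'_def using E(3) a(1) cc[of b] b by (simp add: m_ac subset_iff)
        ultimately show ?thesis using True by simp
      next
        case False
        then have x: "x \<in> B" "x \<in> carrier R" using that insert.prems by auto
        have "c b \<otimes> (d \<otimes> x) \<in> lin_span R A E"
          by (rule lin_span_smult[OF a(1) Ef(2) _ _ E(5)[OF x(1)]]) (use d' a(1,6) in auto)
        then show ?thesis unfolding d'_def using E(3) a(1) cc[of b] x by (simp add: m_assoc subset_iff)
      qed
      then show ?thesis using E(1,2) d' by blast
    qed
  qed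
  then obtain E d where E: "E0 \<subseteq> E" "lin_indep R A E" "d \<in> A" "d \<noteq> \<zero>"
      "\<And>b. b \<in> B \<Longrightarrow> d \<otimes> b \<in> lin_span R A E" by blast
  have Ef: "finite E" "E \<subseteq> carrier R" using E(2) by (auto simp: lin_indep_def)
  have "d \<otimes> t \<in> lin_span R A E" if "t \<in> lin_span R A B" for t
    using that
  proof (induction)
    case lin_span_zero then show ?case using E(3) a(1) lin_span.lin_span_zero[of R A E] by (auto simp: subset_iff)
  next
    case (lin_span_step x g t)
    have cl: "d \<in> carrier R" "x \<in> carrier R" "g \<in> carrier R" "t \<in> carrier R"
      using lin_span_step a(1) E(3) assms(6) lin_span_closed[OF a(1) assms(6)] by auto
    have "d \<otimes> (x \<otimes> g \<oplus> t) = x \<otimes> (d \<otimes> g) \<oplus> d \<otimes> t" using cl by algebra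
    moreover have "x \<otimes> (d \<otimes> g) \<in> lin_span R A E"
      by (rule lin_span_smult[OF a(1) Ef(2) _ _ E(5)]) (use lin_span_step a(1,6) in auto)
    ultimately show ?case using lin_span_add[OF a(1) Ef(2)] lin_span_step by metis
  qed
  then show ?thesis using that E by blast
qed

end

text \<open>
  Extend \<open>1\<close> to an independent set \<open>E\<close> such that \<open>d T\<close> lies in its span; the functional is the
  coefficient of \<open>1\<close> in \<open>d t\<close>.
\<close>

lemma finite_extension_functional:
  assumes "domain R" and ext: "module_finite_extension R T \<iota>"
  obtains \<theta> where "\<theta> \<in> module_hom R (alg_module \<iota> T) (alg_module id R)" "\<theta> \<one>\<^bsub>T\<^esub> \<noteq> \<zero>\<^bsub>R\<^esub>"
proof -
  interpret R: domain R by fact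
  interpret T: cring T using module_finite_extensionD(1)[OF ext] .
  note hom = module_finite_extensionD(2)[OF ext]
  note inj = module_finite_extensionD(3)[OF ext]
  interpret h: ring_hom_cring R T \<iota> using hom by unfold_locales
  define A where "A = \<iota> ` carrier R"
  have A: "subring A T" unfolding A_def  by (rule h.ring.img_is_subring[OF R.carrier_is_subring])
  note a = subringE[OF A]
  have \<iota>0: "\<iota> r = \<zero>\<^bsub>T\<^esub> \<Longrightarrow> r = \<zero>\<^bsub>R\<^esub>" if "r \<in> carrier R" for r
    using inj that h.hom_zero by (metis R.zero_closed inj_onD)
  have dom: "x = \<zero>\<^bsub>T\<^esub> \<or> y = \<zero>\<^bsub>T\<^esub>" if xy: "x \<in> A" "y \<in> A" "x \<otimes>\<^bsub>T\<^esub> y = \<zero>\<^bsub>T\<^esub>" for x y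
  proof -
    obtain r s where rs: "r \<in> carrier R" "s \<in> carrier R" "x = \<iota> r" "y = \<iota> s"
      using xy A_def by auto
    then have "\<iota> (r \<otimes>\<^bsub>R\<^esub> s) = \<zero>\<^bsub>T\<^esub>" using xy by simp
    then show ?thesis using \<iota>0[of "r \<otimes>\<^bsub>R\<^esub> s"] rs R.integral[of r s] by auto
  qed
  have T1: "\<one>\<^bsub>T\<^esub> \<noteq> \<zero>\<^bsub>T\<^esub>" using \<iota>0[of "\<one>\<^bsub>R\<^esub>"] by auto
  obtain B where B: "finite B" "B \<subseteq> carrier T" "\<And>t. t \<in> carrier T \<Longrightarrow> t \<in> lin_span T A B"
    using module_finite_lin_span[OF ext] unfolding A_def by blast
  have one: "lin_indep T A {\<one>\<^bsub>T\<^esub>}"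
    unfolding lin_indep_def
  proof (intro conjI ballI impI)
    fix c g assume c: "c \<in> {\<one>\<^bsub>T\<^esub>} \<rightarrow> A" "(\<Oplus>\<^bsub>T\<^esub>g\<in>{\<one>\<^bsub>T\<^esub>}. c g \<otimes>\<^bsub>T\<^esub> g) = \<zero>\<^bsub>T\<^esub>" "g \<in> {\<one>\<^bsub>T\<^esub>}"
    have "c \<one>\<^bsub>T\<^esub> \<in> carrier T" using c a(1) by auto
    moreover have "(\<Oplus>\<^bsub>T\<^esub>g\<in>{\<one>\<^bsub>T\<^esub>}. c g \<otimes>\<^bsub>T\<^esub> g) = c \<one>\<^bsub>T\<^esub>"
      using calculation by (subst T.finsum_insert) auto
    ultimately show "c g = \<zero>\<^bsub>T\<^esub>" using c by simp
  qed auto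
  obtain E d where E: "{\<one>\<^bsub>T\<^esub>} \<subseteq> E" "lin_indep T A E" "d \<in> A" "d \<noteq> \<zero>\<^bsub>T\<^esub>"
    "\<And>t. t \<in> lin_span T A B \<Longrightarrow> d \<otimes>\<^bsub>T\<^esub> t \<in> lin_span T A E"
    by (rule T.extend_to_maximal_lin_indep[OF A _ T1 one B(1,2)]) (use dom in blast)+
  have Ef: "finite E" "E \<subseteq> carrier T" using E(2) by (auto simp: lin_indep_def)
  define crd where "crd t = (SOME c. c \<in> E \<rightarrow> A \<and> d \<otimes>\<^bsub>T\<^esub> t = (\<Oplus>\<^bsub>T\<^esub>g\<in>E. c g \<otimes>\<^bsub>T\<^esub> g))" for t
  have crd: "crd t \<in> E \<rightarrow> A" "d \<otimes>\<^bsub>T\<^esub> t = (\<Oplus>\<^bsub>T\<^esub>g\<in>E. crd t g \<otimes>\<^bsub>T\<^esub> g)" if t: "t \<in> carrier T" for t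
  proof -
    obtain c where "c \<in> E \<rightarrow> A" "d \<otimes>\<^bsub>T\<^esub> t = (\<Oplus>\<^bsub>T\<^esub>g\<in>E. c g \<otimes>\<^bsub>T\<^esub> g)"
      by (rule T.lin_span_finsumE[OF a(1) Ef a(2) _ E(5)[OF B(3)[OF t]]]) (use a(7) in auto)
    then have "\<exists>c. c \<in> E \<rightarrow> A \<and> d \<otimes>\<^bsub>T\<^esub> t = (\<Oplus>\<^bsub>T\<^esub>g\<in>E. c g \<otimes>\<^bsub>T\<^esub> g)" by blast
    then have "crd t \<in> E \<rightarrow> A \<and> d \<otimes>\<^bsub>T\<^esub> t = (\<Oplus>\<^bsub>T\<^esub>g\<in>E. crd t g \<otimes>\<^bsub>T\<^esub> g)"
      unfolding crd_def by (rule someI_ex)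
    then show "crd t \<in> E \<rightarrow> A" "d \<otimes>\<^bsub>T\<^esub> t = (\<Oplus>\<^bsub>T\<^esub>g\<in>E. crd t g \<otimes>\<^bsub>T\<^esub> g)" by auto
  qed
  have uniq: "crd t \<one>\<^bsub>T\<^esub> = c \<one>\<^bsub>T\<^esub>"
    if "t \<in> carrier T" "c \<in> E \<rightarrow> A" "d \<otimes>\<^bsub>T\<^esub> t = (\<Oplus>\<^bsub>T\<^esub>g\<in>E. c g \<otimes>\<^bsub>T\<^esub> g)" for t c
    by (rule T.lin_indep_unique[OF A E(2) crd(1)[OF that(1)] that(2)
          trans[OF crd(2)[OF that(1), symmetric] that(3)]]) (use E(1) in blast)
  have dc: "d \<in> carrier T" using E(3) a(1) by blast
  have cA: "\<And>t g. t \<in> carrier T \<Longrightarrow> g \<in> E \<Longrightarrow> crd t g \<in> carrier T" using crd(1) a(1) by blast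
  define \<theta> where "\<theta> t = inv_into (carrier R) \<iota> (crd t \<one>\<^bsub>T\<^esub>)" for t
  have \<iota>\<theta>: "\<iota> (\<theta> t) = crd t \<one>\<^bsub>T\<^esub>" "\<theta> t \<in> carrier R" if "t \<in> carrier T" for t
  proof -
    have "crd t \<one>\<^bsub>T\<^esub> \<in> \<iota> ` carrier R" using crd(1)[OF that] E(1) A_def by auto
    then show "\<iota> (\<theta> t) = crd t \<one>\<^bsub>T\<^esub>" "\<theta> t \<in> carrier R"
      unfolding \<theta>_def by (auto simp: f_inv_into_f inv_into_into)
  qed
  have "\<theta> (x \<oplus>\<^bsub>T\<^esub> y) = \<theta> x \<oplus>\<^bsub>R\<^esub> \<theta> y" if xy: "x \<in> carrier T" "y \<in> carrier T" for x y
  proof -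
    have "d \<otimes>\<^bsub>T\<^esub> (x \<oplus>\<^bsub>T\<^esub> y) = (\<Oplus>\<^bsub>T\<^esub>g\<in>E. crd x g \<otimes>\<^bsub>T\<^esub> g) \<oplus>\<^bsub>T\<^esub> (\<Oplus>\<^bsub>T\<^esub>g\<in>E. crd y g \<otimes>\<^bsub>T\<^esub> g)"
      using xy crd(2) dc by (simp add: T.r_distr)
    also have "\<dots> = (\<Oplus>\<^bsub>T\<^esub>g\<in>E. crd x g \<otimes>\<^bsub>T\<^esub> g \<oplus>\<^bsub>T\<^esub> crd y g \<otimes>\<^bsub>T\<^esub> g)"
      using cA xy Ef by (intro T.finsum_addf[symmetric]) (auto simp: Pi_iff subset_iff)
    also have "\<dots> = (\<Oplus>\<^bsub>T\<^esub>g\<in>E. (crd x g \<oplus>\<^bsub>T\<^esub> crd y g) \<otimes>\<^bsub>T\<^esub> g)"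
      using cA xy Ef by (intro T.finsum_cong') (auto simp: Pi_iff subset_iff T.l_distr)
    finally have "crd (x \<oplus>\<^bsub>T\<^esub> y) \<one>\<^bsub>T\<^esub> = crd x \<one>\<^bsub>T\<^esub> \<oplus>\<^bsub>T\<^esub> crd y \<one>\<^bsub>T\<^esub>"
      using xy crd(1)[of x] crd(1)[of y] a(7)
      by (intro uniq[of "x \<oplus>\<^bsub>T\<^esub> y" "\<lambda>g. crd x g \<oplus>\<^bsub>T\<^esub> crd y g"]) (auto simp: Pi_iff)
    then have "\<iota> (\<theta> (x \<oplus>\<^bsub>T\<^esub> y)) = \<iota> (\<theta> x \<oplus>\<^bsub>R\<^esub> \<theta> y)" using \<iota>\<theta> xy by simp
    then show ?thesis by (rule inj_onD[OF inj]) (use \<iota>\<theta>(2) xy in simp_all)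
  qed
  moreover have "\<theta> (\<iota> r \<otimes>\<^bsub>T\<^esub> x) = r \<otimes>\<^bsub>R\<^esub> \<theta> x" if rx: "r \<in> carrier R" "x \<in> carrier T" for r x
  proof -
    have r: "\<iota> r \<in> carrier T" "\<iota> r \<in> A" using rx A_def by auto
    have "d \<otimes>\<^bsub>T\<^esub> (\<iota> r \<otimes>\<^bsub>T\<^esub> x) = \<iota> r \<otimes>\<^bsub>T\<^esub> (d \<otimes>\<^bsub>T\<^esub> x)" using r rx dc by (simp add: T.m_ac)
    also have "\<dots> = (\<Oplus>\<^bsub>T\<^esub>g\<in>E. \<iota> r \<otimes>\<^bsub>T\<^esub> (crd x g \<otimes>\<^bsub>T\<^esub> g))"
      unfolding crd(2)[OF rx(2)] using cA rx r Ef by (intro T.finsum_rdistr) (auto simp: Pi_iff subset_iff)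
    also have "\<dots> = (\<Oplus>\<^bsub>T\<^esub>g\<in>E. (\<iota> r \<otimes>\<^bsub>T\<^esub> crd x g) \<otimes>\<^bsub>T\<^esub> g)"
      using cA rx r Ef by (intro T.finsum_cong') (auto simp: Pi_iff subset_iff T.m_assoc)
    finally have "crd (\<iota> r \<otimes>\<^bsub>T\<^esub> x) \<one>\<^bsub>T\<^esub> = \<iota> r \<otimes>\<^bsub>T\<^esub> crd x \<one>\<^bsub>T\<^esub>"
      using r rx crd(1)[of x] a(6)
      by (intro uniq[of "\<iota> r \<otimes>\<^bsub>T\<^esub> x" "\<lambda>g. \<iota> r \<otimes>\<^bsub>T\<^esub> crd x g"]) (auto simp: Pi_iff)
    then have "\<iota> (\<theta> (\<iota> r \<otimes>\<^bsub>T\<^esub> x)) = \<iota> (r \<otimes>\<^bsub>R\<^esub> \<theta> x)" using \<iota>\<theta> rx r by simp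
    then show ?thesis by (rule inj_onD[OF inj]) (use \<iota>\<theta>(2) rx r in simp_all)
  qed
  ultimately have "\<theta> \<in> module_hom R (alg_module \<iota> T) (alg_module id R)"
    unfolding module_hom_def using \<iota>\<theta>(2) by (auto simp: alg_module_def)
  moreover have "\<theta> \<one>\<^bsub>T\<^esub> \<noteq> \<zero>\<^bsub>R\<^esub>"
  proof -
    \<comment> \<open>\<open>d 1\<close> has coefficient \<open>d\<close> at \<open>1\<close>.\<close>
    let ?c = "\<lambda>g. if g = \<one>\<^bsub>T\<^esub> then d else \<zero>\<^bsub>T\<^esub>"
    have "(\<Oplus>\<^bsub>T\<^esub>g\<in>E. ?c g \<otimes>\<^bsub>T\<^esub> g) = (\<Oplus>\<^bsub>T\<^esub>g\<in>E. if \<one>\<^bsub>T\<^esub> = g then d else \<zero>\<^bsub>T\<^esub>)"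
      using Ef dc by (intro T.finsum_cong') (auto simp: Pi_iff subset_iff)
    also have "\<dots> = d" using T.finsum_singleton[of "\<one>\<^bsub>T\<^esub>" E "\<lambda>_. d"] E(1) Ef dc by auto
    finally have "crd \<one>\<^bsub>T\<^esub> \<one>\<^bsub>T\<^esub> = ?c \<one>\<^bsub>T\<^esub>"
      using E(3) a(2) dc by (intro uniq[of "\<one>\<^bsub>T\<^esub>" ?c]) auto
    then have "\<iota> (\<theta> \<one>\<^bsub>T\<^esub>) = d" using \<iota>\<theta> by simp
    then show ?thesis using E(4) by auto
  qed
  ultimately show ?thesis using that by blast
qed

section \<open>Frobenius\<close>

context cring
begin

lemma binomial:
  assumes "x \<in> carrier R" "y \<in> carrier R"
  shows "(x \<oplus> y) [^] (n::nat) = (\<Oplus>k\<in>{..n}. add_pow R (n choose k) (x [^] k \<otimes> y [^] (n - k)))"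
proof (induction n)
  case 0
  then show ?case using assms by simp
next
  case (Suc n)
  let ?f = "\<lambda>n k. add_pow R (n choose k) (x [^] k \<otimes> y [^] (n - k))"
  have fc: "\<And>n k. ?f n k \<in> carrier R" using assms by auto
  have "(x \<oplus> y) [^] Suc n = (\<Oplus>k\<in>{..n}. ?f n k) \<otimes> (x \<oplus> y)"
    using Suc by simp
  also have "\<dots> = (\<Oplus>k\<in>{..n}. ?f n k) \<otimes> x \<oplus> (\<Oplus>k\<in>{..n}. ?f n k) \<otimes> y"
    using assms fc by (intro r_distr finsum_closed) auto
  also have "(\<Oplus>k\<in>{..n}. ?f n k) \<otimes> x = (\<Oplus>k\<in>{..n}. ?f n k \<otimes> x)"
    using assms fc by (intro finsum_ldistr) auto
  also have "(\<Oplus>k\<in>{..n}. ?f n k) \<otimes> y = (\<Oplus>k\<in>{..n}. ?f n k \<otimes> y)"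
    using assms fc by (intro finsum_ldistr) auto
  also have "(\<Oplus>k\<in>{..n}. ?f n k \<otimes> y) = (\<Oplus>k\<in>{..n}. add_pow R (n choose k) (x [^] k \<otimes> y [^] (Suc n - k)))"
    using assms by (intro finsum_cong') (auto simp: add_pow_ldistr m_assoc Suc_diff_le)
  also have "\<dots> = (\<Oplus>k\<in>{..Suc n}. add_pow R (n choose k) (x [^] k \<otimes> y [^] (Suc n - k)))"
    using assms by (subst finsum_Suc) (auto simp: binomial_eq_0)
  also have "\<dots> = (\<Oplus>k\<in>{..n}. add_pow R (n choose Suc k) (x [^] Suc k \<otimes> y [^] (n - k))) \<oplus> y [^] Suc n"
    using assms by (subst finsum_Suc2) auto
  finally have 1: "(x \<oplus> y) [^] Suc n = (\<Oplus>k\<in>{..n}. ?f n k \<otimes> x) \<oplus>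
     ((\<Oplus>k\<in>{..n}. add_pow R (n choose Suc k) (x [^] Suc k \<otimes> y [^] (n - k))) \<oplus> y [^] Suc n)" .
  have "(\<Oplus>k\<in>{..Suc n}. ?f (Suc n) k) = (\<Oplus>k\<in>{..n}. ?f (Suc n) (Suc k)) \<oplus> y [^] Suc n"
    using assms by (subst finsum_Suc2) auto
  also have "(\<Oplus>k\<in>{..n}. ?f (Suc n) (Suc k)) =
      (\<Oplus>k\<in>{..n}. ?f n k \<otimes> x \<oplus> add_pow R (n choose Suc k) (x [^] Suc k \<otimes> y [^] (n - k)))"
  proof (rule finsum_cong'[OF refl])
    fix k
    have "add_pow R (n choose k) (x [^] k \<otimes> y [^] (n - k)) \<otimes> x = add_pow R (n choose k) (x [^] Suc k \<otimes> y [^] (n - k))"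
      using assms by (simp add: add_pow_ldistr m_assoc) (simp add: m_ac)
    then show "?f (Suc n) (Suc k) = ?f n k \<otimes> x \<oplus> add_pow R (n choose Suc k) (x [^] Suc k \<otimes> y [^] (n - k))"
      using assms by (simp add: add.nat_pow_mult)
  qed (use assms in auto)
  also have "\<dots> = (\<Oplus>k\<in>{..n}. ?f n k \<otimes> x) \<oplus> (\<Oplus>k\<in>{..n}. add_pow R (n choose Suc k) (x [^] Suc k \<otimes> y [^] (n - k)))"
    using assms by (intro finsum_addf) auto
  finally show ?case unfolding 1
    using assms by (simp add: a_assoc)
qed

lemma frobenius_add:
  assumes "Factorial_Ring.prime p" "add_pow R (p) \<one> = \<zero>" "x \<in> carrier R" "y \<in> carrier R"
  shows "(x \<oplus> y) [^] p = x [^] p \<oplus> y [^] (p::nat)"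
proof -
  have multiples: "add_pow R (n) z = \<zero>" if n: "p dvd n" and "z \<in> carrier R" for n z
  proof -
    have "add_pow R (p) z = add_pow R (p) \<one> \<otimes> z" using that by (simp add: add_pow_ldistr)
    then have "add_pow R (p) z = \<zero>" using assms(2) that by simp
    moreover obtain k where "n = p * k" using n by (elim dvdE)
    ultimately show ?thesis using that by (simp flip: add.nat_pow_pow)
  qed
  obtain q where q: "p = Suc (Suc q)"
    using prime_ge_2_nat[OF assms(1)] by (metis Suc_diff_Suc Suc_1 Suc_le_lessD numeral_2_eq_2 add_2_eq_Suc le_Suc_ex)
  let ?f = "\<lambda>k. add_pow R (p choose k) (x [^] k \<otimes> y [^] (p - k))"
  have fc: "\<And>k. ?f k \<in> carrier R" using assms by auto
  have mid: "?f (Suc k) = \<zero>" if "k \<le> q" for k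
  proof (rule multiples)
    show "p dvd (p choose Suc k)" using assms(1) that q by (intro dvd_choose_prime) auto
  qed (use assms in auto)
  have "(x \<oplus> y) [^] p = (\<Oplus>k\<in>{..Suc (Suc q)}. ?f k)"
    using binomial[OF assms(3,4), of p] q by simp
  also have "\<dots> = (\<Oplus>k\<in>{..Suc q}. ?f (Suc k)) \<oplus> ?f 0"
    using assms(3,4) by (intro finsum_Suc2) auto
  also have "(\<Oplus>k\<in>{..Suc q}. ?f (Suc k)) = ?f (Suc (Suc q)) \<oplus> (\<Oplus>k\<in>{..q}. ?f (Suc k))"
    using assms(3,4) by (intro finsum_Suc) auto
  also have "(\<Oplus>k\<in>{..q}. ?f (Suc k)) = (\<Oplus>k\<in>{..q}. \<zero>)"
    using mid by (intro finsum_cong') auto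
  finally show ?thesis using assms(3,4) by (simp flip: q)
qed

lemma frobenius_iterate_add:
  assumes "Factorial_Ring.prime p" "add_pow R (p) \<one> = \<zero>" "x \<in> carrier R" "y \<in> carrier R"
  shows "(x \<oplus> y) [^] (p ^ e) = x [^] (p ^ e) \<oplus> y [^] ((p::nat) ^ e)"
proof (induction e)
  case (Suc e)
  have "\<And>z. z \<in> carrier R \<Longrightarrow> z [^] (p ^ Suc e) = (z [^] (p ^ e)) [^] p"
    by (simp add: nat_pow_pow mult.commute)
  then show ?case using Suc assms by (simp add: frobenius_add)
qed (use assms in auto)

lemma frobenius_iterate:
  "x \<in> carrier R \<Longrightarrow> (frobenius p R ^^ e) x = x [^] (p ^ e)"
  by (induction e) (auto simp: frobenius_def nat_pow_pow mult.commute)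

end

text \<open>
  Compose a functional on \<open>T\<close> with Frobenius of \<open>T\<close> on one side and a map \<open>F\<^sup>e\<^sub>*R \<rightarrow> R\<close> that sends a
  multiple of its value at \<open>1\<close> to \<open>1\<close> on the other side.
\<close>

theorem strongly_F_regular_imp_splinter:
  fixes R :: "('a, 'k) ring_scheme"
  assumes p: "Factorial_Ring.prime p" and char: "ring_characteristic R = p" and F: "strongly_F_regular p R"
  shows "splinter R"
proof -
  have "domain R" using F by (simp add: strongly_F_regular_def normal_domain_def)
  then interpret R: domain R .
  have p1: "add_pow R p \<one>\<^bsub>R\<^esub> = \<zero>\<^bsub>R\<^esub>"
    using R.add.pow_ord_eq_1[of "\<one>\<^bsub>R\<^esub>"] char unfolding ring_characteristic_def add_pow_def by simp
  have "extension_splits R T \<iota>" if ext: "module_finite_extension R T \<iota>" for T :: "'a list set ring" and \<iota>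
  proof -
    interpret T: cring T using module_finite_extensionD(1)[OF ext] .
    interpret h: ring_hom_cring R T \<iota> using module_finite_extensionD(2)[OF ext] by unfold_locales
    have "add_pow T n (\<iota> \<one>\<^bsub>R\<^esub>) = \<iota> (add_pow R n \<one>\<^bsub>R\<^esub>)" for n :: nat
      by (induction n) (auto simp: R.add.nat_pow_Suc T.add.nat_pow_Suc)
    from this[of p] have p1T: "add_pow T p \<one>\<^bsub>T\<^esub> = \<zero>\<^bsub>T\<^esub>" using p1 by simp
    obtain \<theta> where \<theta>: "\<theta> \<in> module_hom R (alg_module \<iota> T) (alg_module id R)" "\<theta> \<one>\<^bsub>T\<^esub> \<noteq> \<zero>\<^bsub>R\<^esub>"
      using finite_extension_functional[OF \<open>domain R\<close> ext] .
    have \<theta>c: "\<And>t. t \<in> carrier T \<Longrightarrow> \<theta> t \<in> carrier R"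
      and \<theta>a: "\<And>s t. s \<in> carrier T \<Longrightarrow> t \<in> carrier T \<Longrightarrow> \<theta> (s \<oplus>\<^bsub>T\<^esub> t) = \<theta> s \<oplus>\<^bsub>R\<^esub> \<theta> t"
      and \<theta>m: "\<And>r t. r \<in> carrier R \<Longrightarrow> t \<in> carrier T \<Longrightarrow> \<theta> (\<iota> r \<otimes>\<^bsub>T\<^esub> t) = r \<otimes>\<^bsub>R\<^esub> \<theta> t"
      using \<theta>(1) by (auto simp: module_hom_def alg_module_def)
    define c where "c = \<theta> \<one>\<^bsub>T\<^esub>"
    have c: "c \<in> carrier R" "c \<noteq> \<zero>\<^bsub>R\<^esub>" using \<theta>c \<theta>(2) c_def by auto
    obtain e \<psi> where \<psi>: "\<psi> \<in> module_hom R (alg_module (frobenius p R ^^ e) R) (alg_module id R)"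
      "\<psi> ` (PIdl\<^bsub>R\<^esub> c) = carrier R"
      using F c unfolding strongly_F_regular_def by blast
    have \<psi>c: "\<And>t. t \<in> carrier R \<Longrightarrow> \<psi> t \<in> carrier R"
      and \<psi>a: "\<And>s t. s \<in> carrier R \<Longrightarrow> t \<in> carrier R \<Longrightarrow> \<psi> (s \<oplus>\<^bsub>R\<^esub> t) = \<psi> s \<oplus>\<^bsub>R\<^esub> \<psi> t"
      and \<psi>m: "\<And>r t. r \<in> carrier R \<Longrightarrow> t \<in> carrier R \<Longrightarrow> \<psi> (r [^]\<^bsub>R\<^esub> (p ^ e) \<otimes>\<^bsub>R\<^esub> t) = r \<otimes>\<^bsub>R\<^esub> \<psi> t"
      using \<psi>(1) by (auto simp: module_hom_def alg_module_def R.frobenius_iterate)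
    have "\<one>\<^bsub>R\<^esub> \<in> \<psi> ` (PIdl\<^bsub>R\<^esub> c)" using \<psi>(2) by simp
    then obtain d where d: "d \<in> carrier R" "\<psi> (d \<otimes>\<^bsub>R\<^esub> c) = \<one>\<^bsub>R\<^esub>"
      unfolding cgenideal_def by auto
    define \<Phi> where "\<Phi> t = \<psi> (d \<otimes>\<^bsub>R\<^esub> \<theta> (t [^]\<^bsub>T\<^esub> (p ^ e)))" for t
    have "\<Phi> t \<in> carrier R" if "t \<in> carrier T" for t
      unfolding \<Phi>_def using \<psi>c \<theta>c d that by auto
    moreover have "\<Phi> (s \<oplus>\<^bsub>T\<^esub> t) = \<Phi> s \<oplus>\<^bsub>R\<^esub> \<Phi> t" if "s \<in> carrier T" "t \<in> carrier T" for s t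
      unfolding \<Phi>_def using that T.frobenius_iterate_add[OF p p1T that] \<theta>a \<theta>c \<psi>a d
      by (simp add: R.r_distr)
    moreover have "\<Phi> (\<iota> r \<otimes>\<^bsub>T\<^esub> t) = r \<otimes>\<^bsub>R\<^esub> \<Phi> t" if rt: "r \<in> carrier R" "t \<in> carrier T" for r t
    proof -
      have "(\<iota> r \<otimes>\<^bsub>T\<^esub> t) [^]\<^bsub>T\<^esub> (p ^ e) = \<iota> (r [^]\<^bsub>R\<^esub> (p ^ e)) \<otimes>\<^bsub>T\<^esub> t [^]\<^bsub>T\<^esub> (p ^ e)"
        using rt by (simp add: T.nat_pow_distrib h.ring.hom_nat_pow)
      then have "\<theta> ((\<iota> r \<otimes>\<^bsub>T\<^esub> t) [^]\<^bsub>T\<^esub> (p ^ e)) = r [^]\<^bsub>R\<^esub> (p ^ e) \<otimes>\<^bsub>R\<^esub> \<theta> (t [^]\<^bsub>T\<^esub> (p ^ e))"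
        using \<theta>m[of "r [^]\<^bsub>R\<^esub> (p ^ e)" "t [^]\<^bsub>T\<^esub> (p ^ e)"] rt by simp
      then have "d \<otimes>\<^bsub>R\<^esub> \<theta> ((\<iota> r \<otimes>\<^bsub>T\<^esub> t) [^]\<^bsub>T\<^esub> (p ^ e)) = r [^]\<^bsub>R\<^esub> (p ^ e) \<otimes>\<^bsub>R\<^esub> (d \<otimes>\<^bsub>R\<^esub> \<theta> (t [^]\<^bsub>T\<^esub> (p ^ e)))"
        using \<theta>c d rt by (simp add: R.m_lcomm)
      then show ?thesis unfolding \<Phi>_def using \<psi>m \<theta>c d rt by simp
    qed
    ultimately have "\<Phi> \<in> module_hom R (alg_module \<iota> T) (alg_module id R)"
      unfolding module_hom_def by (auto simp: alg_module_def)
    moreover have "\<Phi> (\<iota> r) = r" if r: "r \<in> carrier R" for r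
    proof -
      have "\<Phi> \<one>\<^bsub>T\<^esub> = \<one>\<^bsub>R\<^esub>" unfolding \<Phi>_def using d c_def by simp
      then show ?thesis
        using \<open>\<And>r t. r \<in> carrier R \<Longrightarrow> t \<in> carrier T \<Longrightarrow> \<Phi> (\<iota> r \<otimes>\<^bsub>T\<^esub> t) = r \<otimes>\<^bsub>R\<^esub> \<Phi> t\<close>[OF r, of "\<one>\<^bsub>T\<^esub>"] r by simp
    qed
    ultimately show ?thesis unfolding extension_splits_def by blast
  qed
  then show ?thesis unfolding splinter_def using R.cring_axioms by blast
qed

section \<open>Lying over\<close>

text \<open>
  \<open>Q M\<^sub>Q = M\<^sub>Q\<close> implies \<open>M\<^sub>Q = 0\<close>, and hence \<open>M = 0\<close> as \<open>M\<close> is torsion-free.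
\<close>

lemma (in domain) nakayama_at_prime:
  assumes Q: "prime_in R A Q" and G: "finite G" "G \<subseteq> carrier R"
    and eqs: "\<And>g. g \<in> G \<Longrightarrow> \<exists>u\<in>A - Q. u \<otimes> g \<in> lin_span R Q G"
  shows "\<forall>g\<in>G. g = \<zero>"
proof -
  note q = prime_inD[OF Q]
  show ?thesis
  proof (rule nakayama[OF G q(9), of "A - Q"])
      fix x y assume x: "x \<in> A - Q" and y: "y \<in> Q"
      have "x \<ominus> y \<in> A" using x y q(2) subringE(5,7)[OF q(1)] by (auto simp: a_minus_def)
      moreover have "x \<ominus> y \<notin> Q"
      proof
        assume "x \<ominus> y \<in> Q"
        then have "(x \<ominus> y) \<oplus> y \<in> Q" using q(5) y by blast
        moreover have "(x \<ominus> y) \<oplus> y = x" using x y q(8,9) by (auto simp: a_minus_def a_assoc l_neg subset_iff)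
        ultimately show False using x by simp
      qed
      ultimately show "x \<ominus> y \<in> A - Q" by blast
    next
      fix x y assume "x \<in> Q" "y \<in> Q"
      then show "x \<otimes> y \<in> Q" using q(2) q(6)[of x y] by blast
    next
      fix x y assume "x \<in> A - Q" "y \<in> A - Q"
      then show "x \<otimes> y \<in> A - Q" using q(7)[of x y] subringE(6)[OF q(1), of x y] by blast
    next
      fix x y assume "x \<in> A - Q" "y \<in> Q"
      then show "x \<otimes> y \<in> Q" using q(6)[of x y] by blast
  qed (use q(3,5,8) eqs in auto)
qed

text \<open>
  The ideal \<open>Q A'\<close> contracts to \<open>Q\<close>: an element \<open>w\<close> of \<open>A - Q\<close> in it would satisfy \<open>w A' \<subseteq> Q A'\<close>, against
  Nakayama's lemma at \<open>Q\<close>.  Among the ideals of \<open>A'\<close> contracting to \<open>Q\<close> a maximal one is prime.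
\<close>

lemma (in domain) lying_over:
  assumes Q: "prime_in R A Q" and A': "subring A' R" and AA': "A \<subseteq> A'"
    and G: "finite G" "G \<subseteq> A'" and span: "\<And>x. x \<in> A' \<Longrightarrow> x \<in> lin_span R A G"
  obtains Q' where "prime_in R A' Q'" "Q' \<inter> A = Q"
proof -
  note q = prime_inD[OF Q]
  note a = subringE[OF A']
  have Gc: "G \<subseteq> carrier R" using G(2) a(1) by blast
  define F where "F = {J. J \<subseteq> A' \<and> Q \<subseteq> J \<and> (\<forall>x\<in>J. \<forall>y\<in>J. x \<oplus> y \<in> J) \<and> (\<forall>c\<in>A'. \<forall>x\<in>J. c \<otimes> x \<in> J) \<and> J \<inter> A \<subseteq> Q}"
  let ?J = "lin_span R Q A'"
  have sm: "c \<otimes> x \<in> ?J" if c: "c \<in> A'" and "x \<in> ?J" for c x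
    using that(2)
  proof (induction)
    case lin_span_zero
    then show ?case using c a(1) lin_span.lin_span_zero[of R Q A'] by (auto simp: subset_iff)
  next
    case (lin_span_step b g x)
    have cl: "c \<in> carrier R" "b \<in> carrier R" "g \<in> carrier R" "x \<in> carrier R"
      using lin_span_step c a(1) q(9) lin_span_closed[OF q(9) a(1)] by auto
    have "c \<otimes> (b \<otimes> g \<oplus> x) = b \<otimes> (c \<otimes> g) \<oplus> c \<otimes> x" using cl by algebra
    then show ?case using lin_span_step c a(6) lin_span.lin_span_step by metis
  qed
  have "?J \<in> F"
    unfolding F_def
  proof (intro CollectI conjI ballI subsetI)
    fix x assume "x \<in> ?J"
    show "x \<in> A'"
    proof (rule lin_span_least[OF a(2) _ _ \<open>x \<in> ?J\<close>])
      show "c \<otimes> g \<in> A'" if "c \<in> Q" "g \<in> A'" for c g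
        using that q(2) AA' a(6)[of c g] by blast
    qed (rule a(7))
  next
    fix x assume "x \<in> Q"
    then have "x \<otimes> \<one> \<in> ?J" by (intro lin_span_single[OF q(9) a(1)] a(3))
    then show "x \<in> ?J" using \<open>x \<in> Q\<close> q(9) by (simp add: subset_iff)
  next
    fix x y assume "x \<in> ?J" "y \<in> ?J"
    then show "x \<oplus> y \<in> ?J" by (rule lin_span_add[OF q(9) a(1)])
  next
    fix c x assume "c \<in> A'" "x \<in> ?J"
    then show "c \<otimes> x \<in> ?J" by (rule sm)
  next
    fix w assume w: "w \<in> ?J \<inter> A"
    show "w \<in> Q"
    proof (rule ccontr)
      assume "w \<notin> Q"
      have G0: "\<forall>g\<in>G. g = \<zero>"
      proof (rule nakayama_at_prime[OF Q G(1) Gc])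
        fix g assume g: "g \<in> G"
        have "w \<otimes> g \<in> lin_span R Q G" if "w \<in> ?J" for w using that
        proof (induction)
          case lin_span_zero
          then show ?case using g Gc lin_span.lin_span_zero[of R Q G] by (auto simp: subset_iff)
        next
          case (lin_span_step b x y)
          have cl: "g \<in> carrier R" "b \<in> carrier R" "x \<in> carrier R" "y \<in> carrier R"
            using lin_span_step g Gc a(1) q(9) lin_span_closed[OF q(9) a(1)] by auto
          have "(b \<otimes> x \<oplus> y) \<otimes> g = b \<otimes> (x \<otimes> g) \<oplus> y \<otimes> g" using cl by algebra
          moreover have "b \<otimes> (x \<otimes> g) \<in> lin_span R Q G"
          proof (rule lin_span_smult[OF q(8) Gc cl(2)])
            show "x \<otimes> g \<in> lin_span R A G" using span a(6) lin_span_step g G(2) by blast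
            show "\<And>a. a \<in> A \<Longrightarrow> b \<otimes> a \<in> Q"
              using q(6)[OF _ lin_span_step(1)] cl q(8) by (metis m_comm subsetD)
          qed
          ultimately show ?case using lin_span_step lin_span_add[OF q(9) Gc] by metis
        qed
        then show "\<exists>u\<in>A - Q. u \<otimes> g \<in> lin_span R Q G" using w \<open>w \<notin> Q\<close> by blast
      qed
      have "x = \<zero>" if "x \<in> lin_span R A G" for x
        using that
      proof induction
        case (lin_span_step b g x)
        then have "b \<in> carrier R" "g = \<zero>" using q(8) G0 by auto
        then show ?case using lin_span_step by simp
      qed simp
      then have "\<one> = \<zero>" using span[OF a(3)] by blast
      then show False by simp
    qed
  qed
  then have "F \<noteq> {}" by blast
  moreover have "\<Union>\<C> \<in> F" if "\<C> \<noteq> {}" "subset.chain F \<C>" for \<C>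
  proof -
    have CF: "\<C> \<subseteq> F" and lin: "\<And>U V. U \<in> \<C> \<Longrightarrow> V \<in> \<C> \<Longrightarrow> U \<subseteq> V \<or> V \<subseteq> U"
      using that(2) by (auto simp: subset_chain_def)
    have "x \<oplus> y \<in> \<Union>\<C>" if "x \<in> \<Union>\<C>" "y \<in> \<Union>\<C>" for x y
    proof -
      obtain U V where "U \<in> \<C>" "V \<in> \<C>" "x \<in> U" "y \<in> V" using \<open>x \<in> \<Union>\<C>\<close> \<open>y \<in> \<Union>\<C>\<close> by blast
      then obtain W where "W \<in> \<C>" "x \<in> W" "y \<in> W" using lin by blast
      moreover from this have "x \<oplus> y \<in> W" using CF by (auto simp: F_def)
      ultimately show ?thesis by blast
    qed
    note add_closed = this
    have JF: "J \<subseteq> A'" "Q \<subseteq> J" "J \<inter> A \<subseteq> Q" "\<And>c x. c \<in> A' \<Longrightarrow> x \<in> J \<Longrightarrow> c \<otimes> x \<in> J"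
      if "J \<in> \<C>" for J
      using CF that by (auto simp: F_def)
    obtain J where "J \<in> \<C>" using \<open>\<C> \<noteq> {}\<close> by blast
    show ?thesis unfolding F_def
    proof (intro CollectI conjI ballI)
      show "\<Union>\<C> \<subseteq> A'" using JF(1) by (rule Union_least)
      show "Q \<subseteq> \<Union>\<C>" by (rule subset_trans[OF JF(2)[OF \<open>J \<in> \<C>\<close>] Union_upper[OF \<open>J \<in> \<C>\<close>]])
      show "\<Union>\<C> \<inter> A \<subseteq> Q" unfolding Int_Union2 by (rule UN_least) (rule JF(3))
    next
      fix c x assume c: "c \<in> A'" and "x \<in> \<Union>\<C>"
      then obtain U where U: "U \<in> \<C>" "x \<in> U" by (elim UnionE)
      show "c \<otimes> x \<in> \<Union>\<C>" by (rule UnionI[OF U(1) JF(4)[OF U(1) c U(2)]])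
    qed (rule add_closed)
  qed
  ultimately obtain M where M: "M \<in> F" "\<And>N. N \<in> F \<Longrightarrow> M \<subseteq> N \<Longrightarrow> N = M"
    using subset_Zorn_nonempty[of F] by blast
  have m: "M \<subseteq> A'" "Q \<subseteq> M" "\<And>x y. x \<in> M \<Longrightarrow> y \<in> M \<Longrightarrow> x \<oplus> y \<in> M"
    "\<And>c x. c \<in> A' \<Longrightarrow> x \<in> M \<Longrightarrow> c \<otimes> x \<in> M" "M \<inter> A \<subseteq> Q"
    using M(1) by (auto simp: F_def)
  have Mc: "M \<subseteq> carrier R" using m(1) a(1) by blast
  \<comment> \<open>By maximality, \<open>M + x A'\<close> meets \<open>A - Q\<close> for every \<open>x\<close> outside \<open>M\<close>.\<close>
  have ext: "\<exists>j\<in>M. \<exists>c\<in>A'. j \<oplus> x \<otimes> c \<in> A - Q" if x: "x \<in> A'" "x \<notin> M" for x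
  proof (rule ccontr)
    assume neg: "\<not> ?thesis"
    have xc: "x \<in> carrier R" using x a(1) by blast
    let ?N = "{j \<oplus> x \<otimes> c | j c. j \<in> M \<and> c \<in> A'}"
    have "?N \<in> F"
      unfolding F_def
    proof (rule CollectI, intro conjI ballI subsetI)
      fix y assume "y \<in> ?N"
      then show "y \<in> A'" using m(1) x a(6,7) by blast
    next
      fix y assume y: "y \<in> Q"
      have "y = y \<oplus> x \<otimes> \<zero>" using xc y q(9) by (auto simp: subset_iff)
      then show "y \<in> ?N" using y m(2) a(2) by blast
    next
      fix y z assume "y \<in> ?N" "z \<in> ?N"
      then obtain j c j' c' where jc: "j \<in> M" "c \<in> A'" "j' \<in> M" "c' \<in> A'"
        "y = j \<oplus> x \<otimes> c" "z = j' \<oplus> x \<otimes> c'" by blast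
      have "j \<in> carrier R" "c \<in> carrier R" "j' \<in> carrier R" "c' \<in> carrier R"
        using jc Mc a(1) by auto
      then have "y \<oplus> z = (j \<oplus> j') \<oplus> x \<otimes> (c \<oplus> c')" unfolding jc(5,6) using xc by algebra
      then show "y \<oplus> z \<in> ?N" using jc m(3) a(7) by blast
    next
      fix b y assume b: "b \<in> A'" and "y \<in> ?N"
      then obtain j c where jc: "j \<in> M" "c \<in> A'" "y = j \<oplus> x \<otimes> c" by blast
      have "j \<in> carrier R" "c \<in> carrier R" "b \<in> carrier R" using jc Mc a(1) b by auto
      then have "b \<otimes> y = b \<otimes> j \<oplus> x \<otimes> (b \<otimes> c)" unfolding jc(3) using xc by algebra
      then show "b \<otimes> y \<in> ?N" using jc m(4) a(6) b by blast
    next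
      fix y assume "y \<in> ?N \<inter> A"
      then show "y \<in> Q" using neg by blast
    qed
    moreover have "M \<subseteq> ?N"
    proof
      fix y assume y: "y \<in> M"
      have "y = y \<oplus> x \<otimes> \<zero>" using xc y Mc by (auto simp: subset_iff)
      then show "y \<in> ?N" using y a(2) by blast
    qed
    ultimately have "?N = M" using M(2) by blast
    moreover have "x = \<zero> \<oplus> x \<otimes> \<one>" using xc by simp
    moreover have "\<zero> \<in> M" using q(3) m(2) by blast
    ultimately have "x \<in> M" using a(3) by blast
    then show False using x by simp
  qed
  have "prime_in R A' M"
    unfolding prime_in_def
  proof (intro conjI ballI impI)
    show "\<one> \<notin> M" using m(5) q(4) subringE(3)[OF q(1)] by blast
  next
    fix x y assume xy: "x \<in> A'" "y \<in> A'" "x \<otimes> y \<in> M"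
    show "x \<in> M \<or> y \<in> M"
    proof (rule ccontr)
      assume "\<not> ?thesis"
      then obtain j c j' c' where jc: "j \<in> M" "c \<in> A'" "j' \<in> M" "c' \<in> A'"
        "j \<oplus> x \<otimes> c \<in> A - Q" "j' \<oplus> y \<otimes> c' \<in> A - Q" using ext xy by meson
      have cl: "j \<in> carrier R" "c \<in> carrier R" "j' \<in> carrier R" "c' \<in> carrier R" "x \<in> carrier R" "y \<in> carrier R"
        using jc Mc a(1) xy by auto
      have "(j \<oplus> x \<otimes> c) \<otimes> (j' \<oplus> y \<otimes> c') = ((j' \<oplus> y \<otimes> c') \<otimes> j \<oplus> (x \<otimes> c) \<otimes> j') \<oplus> (c \<otimes> c') \<otimes> (x \<otimes> y)"
        using cl by algebra
      also have "\<dots> \<in> M"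
      proof (rule m(3)[OF m(3)])
        show "(j' \<oplus> y \<otimes> c') \<otimes> j \<in> M" by (rule m(4)) (use jc xy m(1) a(6,7) in auto)
        show "(x \<otimes> c) \<otimes> j' \<in> M" by (rule m(4)) (use jc xy a(6) in auto)
        show "(c \<otimes> c') \<otimes> (x \<otimes> y) \<in> M" by (rule m(4)) (use jc xy a(6) in auto)
      qed
      finally have "(j \<oplus> x \<otimes> c) \<otimes> (j' \<oplus> y \<otimes> c') \<in> Q"
        using m(5) jc subringE(6)[OF q(1)] by blast
      then show False using q(7) jc by blast
    qed
  next
    show "\<zero> \<in> M" using q(3) m(2) by blast
  qed (use A' m(1,3,4) in auto)
  moreover have "M \<inter> A = Q" using m(2,5) q(2) by blast
  ultimately show ?thesis using that by blast
qed

section \<open>Finite extensions of domains and their homomorphisms into a domain\<close>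

locale finite_domain_extension =
  R: domain R + S: domain S
  for R :: "('a, 'k) ring_scheme" and S :: "('b, 'l) ring_scheme" +
  fixes \<iota> :: "'a \<Rightarrow> 'b" and B :: "'b set"
  assumes \<iota>: "\<iota> \<in> ring_hom R S" and \<iota>_inj: "inj_on \<iota> (carrier R)"
    and B: "finite B" "B \<subseteq> carrier S"
    and span: "\<And>s. s \<in> carrier S \<Longrightarrow> s \<in> lin_span S (\<iota> ` carrier R) B"

sublocale finite_domain_extension \<subseteq> \<iota>: ring_hom_cring R S \<iota>
  using \<iota> by unfold_locales

lemma (in finite_domain_extension) \<iota>_zero_iff: "r \<in> carrier R \<Longrightarrow> \<iota> r = \<zero>\<^bsub>S\<^esub> \<longleftrightarrow> r = \<zero>\<^bsub>R\<^esub>"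
  using \<iota>_inj \<iota>.hom_zero by (metis R.zero_closed inj_onD)

text \<open>
  \<open>\<eta>\<close> is the common restriction to \<open>R\<close> of the homomorphisms considered; it becomes a homomorphism as
  soon as one of them is given.
\<close>

locale extension_homs = finite_domain_extension R S \<iota> B + E: domain E
  for R :: "('a, 'k) ring_scheme" and S :: "('b, 'l) ring_scheme" and \<iota> B
    and E :: "('e, 'n) ring_scheme" +
  fixes \<eta> :: "'a \<Rightarrow> 'e"
begin

definition is_ext :: "('b \<Rightarrow> 'e) \<Rightarrow> bool" where
  "is_ext \<sigma> \<longleftrightarrow> \<sigma> \<in> ring_hom S E \<and> inj_on \<sigma> (carrier S) \<and> (\<forall>r\<in>carrier R. \<sigma> (\<iota> r) = \<eta> r)"

lemma is_extD:
  assumes "is_ext \<sigma>"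
  shows "ring_hom_cring S E \<sigma>" "inj_on \<sigma> (carrier S)" "\<And>r. r \<in> carrier R \<Longrightarrow> \<sigma> (\<iota> r) = \<eta> r"
  using assms by (auto simp: is_ext_def ring_hom_cring_def ring_hom_cring_axioms_def S.is_cring E.is_cring)

lemma ext_span:
  assumes "is_ext \<sigma>" "\<eta> ` carrier R \<subseteq> A" "A \<subseteq> carrier E" "s \<in> carrier S"
  shows "\<sigma> s \<in> lin_span E A (\<sigma> ` B)"
proof -
  interpret \<sigma>: ring_hom_cring S E \<sigma> using is_extD(1)[OF assms(1)] .
  have sB: "\<iota> ` carrier R \<subseteq> carrier S" by auto
  show ?thesis
    using span[OF assms(4)]
  proof (induction)
    case lin_span_zero then show ?case by (simp add: lin_span.lin_span_zero)
  next
    case (lin_span_step c g x)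
    have "x \<in> carrier S" using S.lin_span_closed[OF sB B(2)] lin_span_step by blast
    moreover obtain r where "r \<in> carrier R" "c = \<iota> r" using lin_span_step by blast
    moreover have "g \<in> carrier S" using lin_span_step B by blast
    ultimately have "\<sigma> (c \<otimes>\<^bsub>S\<^esub> g \<oplus>\<^bsub>S\<^esub> x) = \<eta> r \<otimes>\<^bsub>E\<^esub> \<sigma> g \<oplus>\<^bsub>E\<^esub> \<sigma> x" "\<eta> r \<in> A"
      using is_extD(3)[OF assms(1)] assms(2) by auto
    then show ?case using lin_span_step by (auto intro: lin_span.lin_span_step)
  qed
qed

text \<open>
  The ring generated by \<open>A\<close> and \<open>\<sigma> S\<close> is a finitely generated \<open>A\<close>-module, because \<open>\<sigma> B\<close> spans it.
\<close>

lemma adjoin_image: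
  assumes \<sigma>: "is_ext \<sigma>" and A: "subring A E" and \<eta>A: "\<eta> ` carrier R \<subseteq> A"
  shows "subring (lin_span E A (\<sigma> ` B)) E" "A \<subseteq> lin_span E A (\<sigma> ` B)"
    "\<sigma> ` carrier S \<subseteq> lin_span E A (\<sigma> ` B)"
proof -
  interpret \<sigma>: ring_hom_cring S E \<sigma> using is_extD(1)[OF \<sigma>] .
  note a = subringE[OF A]
  have Gc: "\<sigma> ` B \<subseteq> carrier E" using B by auto
  let ?A = "lin_span E A (\<sigma> ` B)"
  have cl: "\<And>x. x \<in> ?A \<Longrightarrow> x \<in> carrier E" using E.lin_span_closed[OF a(1) Gc] .
  have img: "\<And>s. s \<in> carrier S \<Longrightarrow> \<sigma> s \<in> ?A" using ext_span[OF \<sigma> \<eta>A a(1)] .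
  then show "\<sigma> ` carrier S \<subseteq> ?A" by blast
  have one: "\<one>\<^bsub>E\<^esub> \<in> ?A" using img[of "\<one>\<^bsub>S\<^esub>"] by simp
  have sm: "c \<otimes>\<^bsub>E\<^esub> x \<in> ?A" if "c \<in> A" "x \<in> ?A" for c x
    by (rule E.lin_span_smult[OF a(1) Gc _ _ that(2)]) (use that a in auto)
  show "A \<subseteq> ?A"
  proof
    fix c assume "c \<in> A"
    then show "c \<in> ?A" using sm[of c "\<one>\<^bsub>E\<^esub>"] one a(1) by (auto simp: subset_iff)
  qed
  have bx: "\<sigma> b \<otimes>\<^bsub>E\<^esub> x \<in> ?A" if b: "b \<in> B" and "x \<in> ?A" for b x
    using that(2)
  proof (induction)
    case lin_span_zero
    then show ?case using b B by (auto simp: subset_iff intro: lin_span.lin_span_zero)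
  next
    case (lin_span_step c g x)
    then obtain b' where b': "b' \<in> B" "g = \<sigma> b'" by blast
    have c: "c \<in> carrier E" "x \<in> carrier E" "\<sigma> b \<in> carrier E" "g \<in> carrier E" "b \<in> carrier S" "b' \<in> carrier S"
      using lin_span_step a(1) cl b b' B by auto
    have "\<sigma> b \<otimes>\<^bsub>E\<^esub> (c \<otimes>\<^bsub>E\<^esub> g \<oplus>\<^bsub>E\<^esub> x) = c \<otimes>\<^bsub>E\<^esub> (\<sigma> b \<otimes>\<^bsub>E\<^esub> g) \<oplus>\<^bsub>E\<^esub> \<sigma> b \<otimes>\<^bsub>E\<^esub> x"
      using c(1-4) by algebra
    moreover have "\<sigma> b \<otimes>\<^bsub>E\<^esub> g = \<sigma> (b \<otimes>\<^bsub>S\<^esub> b')" using c b' by simp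
    ultimately show ?case
      using sm[OF lin_span_step(1) img[of "b \<otimes>\<^bsub>S\<^esub> b'"]] c lin_span_step E.lin_span_add[OF a(1) Gc] by simp
  qed
  have mult: "x \<otimes>\<^bsub>E\<^esub> y \<in> ?A" if "x \<in> ?A" "y \<in> ?A" for x y
    using that(1)
  proof (induction)
    case lin_span_zero
    then show ?case using cl[OF that(2)] by (auto intro: lin_span.lin_span_zero)
  next
    case (lin_span_step c g x)
    have c: "c \<in> carrier E" "x \<in> carrier E" "g \<in> carrier E" "y \<in> carrier E"
      using lin_span_step a(1) cl that Gc by auto
    have "(c \<otimes>\<^bsub>E\<^esub> g \<oplus>\<^bsub>E\<^esub> x) \<otimes>\<^bsub>E\<^esub> y = c \<otimes>\<^bsub>E\<^esub> (g \<otimes>\<^bsub>E\<^esub> y) \<oplus>\<^bsub>E\<^esub> x \<otimes>\<^bsub>E\<^esub> y"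
      using c by algebra
    moreover have "c \<otimes>\<^bsub>E\<^esub> (g \<otimes>\<^bsub>E\<^esub> y) \<in> ?A" using sm bx lin_span_step that(2) by blast
    ultimately show ?case using lin_span_step E.lin_span_add[OF a(1) Gc] by simp
  qed
  show "subring ?A E"
  proof (rule E.subringI)
    fix x assume x: "x \<in> ?A"
    have "\<ominus>\<^bsub>E\<^esub> \<one>\<^bsub>E\<^esub> \<in> A" using a(3,5) by blast
    from sm[OF this x] show "\<ominus>\<^bsub>E\<^esub> x \<in> ?A" using cl[OF x] by (simp add: E.l_minus)
  next
    show "?A \<subseteq> carrier E" using cl by blast
  qed (use one mult E.lin_span_add[OF a(1) Gc] in simp_all)
qed

text \<open>
  A prime \<open>Q\<close> of \<open>S\<close>, transported by \<open>\<sigma>1\<close>, extends to a prime of a ring that contains all the conjugates: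
  adjoin the images of \<open>S\<close> one after the other, each step being a finite extension.
\<close>

lemma lying_over_images:
  assumes "finite F" and F: "\<And>\<sigma>. \<sigma> \<in> insert \<sigma>1 F \<Longrightarrow> is_ext \<sigma>" and Q: "primeideal Q S"
  obtains A QQ where "prime_in E A QQ" "\<And>\<sigma>. \<sigma> \<in> insert \<sigma>1 F \<Longrightarrow> \<sigma> ` carrier S \<subseteq> A"
    "\<And>s. s \<in> carrier S \<Longrightarrow> \<sigma>1 s \<in> QQ \<longleftrightarrow> s \<in> Q"
proof -
  have "\<exists>A QQ. prime_in E A QQ \<and> (\<forall>\<sigma>\<in>insert \<sigma>1 F. \<sigma> ` carrier S \<subseteq> A) \<and>
      (\<forall>s\<in>carrier S. \<sigma>1 s \<in> QQ \<longleftrightarrow> s \<in> Q)"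
    using assms(1,2)
  proof (induction F rule: finite_induct)
    case empty
    have \<sigma>1: "is_ext \<sigma>1" using empty by simp
    interpret \<sigma>: ring_hom_cring S E \<sigma>1 using is_extD(1)[OF \<sigma>1] .
    interpret Q: primeideal Q S by (rule Q)
    note inj = is_extD(2)[OF \<sigma>1]
    have mem: "\<sigma>1 s \<in> \<sigma>1 ` Q \<longleftrightarrow> s \<in> Q" if "s \<in> carrier S" for s
      using inj that Q.a_subset by (auto dest: inj_onD)
    have "prime_in E (\<sigma>1 ` carrier S) (\<sigma>1 ` Q)"
      unfolding prime_in_def
    proof (intro conjI ballI impI)
      show "subring (\<sigma>1 ` carrier S) E" by (rule \<sigma>.ring.img_is_subring[OF S.carrier_is_subring])
      show "\<zero>\<^bsub>E\<^esub> \<in> \<sigma>1 ` Q" using mem[of "\<zero>\<^bsub>S\<^esub>"] Q.zero_closed by simp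
      show "\<one>\<^bsub>E\<^esub> \<notin> \<sigma>1 ` Q" using mem[of "\<one>\<^bsub>S\<^esub>"] Q.one_imp_carrier Q.I_notcarr by auto
    next
      fix x y assume "x \<in> \<sigma>1 ` Q" "y \<in> \<sigma>1 ` Q"
      then obtain s t where "s \<in> Q" "t \<in> Q" "x = \<sigma>1 s" "y = \<sigma>1 t" by blast
      then show "x \<oplus>\<^bsub>E\<^esub> y \<in> \<sigma>1 ` Q" using mem[of "s \<oplus>\<^bsub>S\<^esub> t"] Q.a_closed Q.Icarr by simp
    next
      fix x y assume "x \<in> \<sigma>1 ` carrier S" "y \<in> \<sigma>1 ` Q"
      then obtain s t where "s \<in> carrier S" "t \<in> Q" "x = \<sigma>1 s" "y = \<sigma>1 t" by blast
      then show "x \<otimes>\<^bsub>E\<^esub> y \<in> \<sigma>1 ` Q" using mem[of "s \<otimes>\<^bsub>S\<^esub> t"] Q.I_l_closed Q.Icarr by simp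
    next
      fix x y assume "x \<in> \<sigma>1 ` carrier S" "y \<in> \<sigma>1 ` carrier S" and xy: "x \<otimes>\<^bsub>E\<^esub> y \<in> \<sigma>1 ` Q"
      then obtain s t where st: "s \<in> carrier S" "t \<in> carrier S" "x = \<sigma>1 s" "y = \<sigma>1 t" by blast
      then have "s \<otimes>\<^bsub>S\<^esub> t \<in> Q" using mem[of "s \<otimes>\<^bsub>S\<^esub> t"] xy by simp
      then show "x \<in> \<sigma>1 ` Q \<or> y \<in> \<sigma>1 ` Q" using Q.I_prime st by blast
    qed (use Q.a_subset in blast)
    then show ?case using mem by blast
  next
    case (insert \<sigma> F)
    then obtain A QQ where AQ: "prime_in E A QQ" "\<And>\<sigma>. \<sigma> \<in> insert \<sigma>1 F \<Longrightarrow> \<sigma> ` carrier S \<subseteq> A"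
      "\<And>s. s \<in> carrier S \<Longrightarrow> \<sigma>1 s \<in> QQ \<longleftrightarrow> s \<in> Q" by (metis insert_iff)
    have \<sigma>: "is_ext \<sigma>" "is_ext \<sigma>1" using insert.prems by auto
    have A: "subring A E" using prime_inD(1)[OF AQ(1)] .
    have \<eta>A: "\<eta> ` carrier R \<subseteq> A"
    proof
      fix x assume "x \<in> \<eta> ` carrier R"
      then obtain r where "r \<in> carrier R" "x = \<sigma>1 (\<iota> r)" using is_extD(3)[OF \<sigma>(2)] by auto
      then show "x \<in> A" using AQ(2)[of \<sigma>1] by auto
    qed
    note adj = adjoin_image[OF \<sigma>(1) A \<eta>A]
    let ?A = "lin_span E A (\<sigma> ` B)"
    have "finite (\<sigma> ` B)" "\<sigma> ` B \<subseteq> ?A" using B adj(3) by auto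
    then obtain Q' where Q': "prime_in E ?A Q'" "Q' \<inter> A = QQ"
      using E.lying_over[OF AQ(1) adj(1,2)] by metis
    have "\<sigma>1 s \<in> Q' \<longleftrightarrow> s \<in> Q" if "s \<in> carrier S" for s
      using AQ(2)[of \<sigma>1] AQ(3)[OF that] Q'(2) that by auto
    moreover have "\<tau> ` carrier S \<subseteq> ?A" if "\<tau> \<in> insert \<sigma>1 (insert \<sigma> F)" for \<tau>
      using that AQ(2)[of \<tau>] adj(2,3) by blast
    ultimately show ?case using Q'(1) by blast
  qed
  then show ?thesis using that by blast
qed

end

section \<open>Unramified primes separate homomorphisms\<close>

text \<open>Coefficient lists begin with the leading coefficient, so \<open>a\<close> in \<open>a # f\<close> belongs to the exponent \<open>length f\<close>.\<close>

primrec deriv_eval :: "('e, 'k) ring_scheme \<Rightarrow> 'e list \<Rightarrow> 'e \<Rightarrow> 'e" where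
  "deriv_eval E [] x = \<zero>\<^bsub>E\<^esub>"
| "deriv_eval E (a # f) x =
     add_pow E (length f) (a \<otimes>\<^bsub>E\<^esub> x [^]\<^bsub>E\<^esub> (length f - 1)) \<oplus>\<^bsub>E\<^esub> deriv_eval E f x"

context cring
begin

lemma deriv_eval_closed [simp]:
  "set f \<subseteq> carrier R \<Longrightarrow> x \<in> carrier R \<Longrightarrow> deriv_eval R f x \<in> carrier R"
  by (induction f) auto

lemma subring_add_pow:
  assumes "subring A R" "x \<in> A"
  shows "add_pow R (n::nat) x \<in> A"
  using subringE[OF assms(1)] assms(2) by (induction n) (auto simp: add.nat_pow_Suc)

lemma subring_pow:
  assumes "subring A R" "x \<in> A"
  shows "x [^] (n::nat) \<in> A"
  using subringE[OF assms(1)] assms(2) by (induction n) auto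

lemma pow_taylor:
  assumes A: "subring A R" and uv: "u \<in> A" "v \<in> A"
  shows "\<exists>h\<in>A. u [^] (n::nat) \<ominus> v [^] n = (u \<ominus> v) \<otimes> (add_pow R n (v [^] (n - 1)) \<oplus> (u \<ominus> v) \<otimes> h)"
proof (induction n)
  case 0
  have "u \<in> carrier R" "v \<in> carrier R" using uv subringE(1)[OF A] by auto
  then show ?case using subringE(2)[OF A] by (intro bexI[of _ \<zero>]) (auto simp: a_minus_def r_neg)
next
  case (Suc n)
  note a = subringE[OF A]
  have c: "u \<in> carrier R" "v \<in> carrier R" using uv a(1) by auto
  obtain h where h: "h \<in> A" "u [^] n \<ominus> v [^] n = (u \<ominus> v) \<otimes> (add_pow R n (v [^] (n - 1)) \<oplus> (u \<ominus> v) \<otimes> h)"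
    using Suc by blast
  have hc: "h \<in> carrier R" using h a(1) by auto
  define w where "w = add_pow R n (v [^] (n - 1))"
  have w: "w \<in> A" "w \<in> carrier R"
    unfolding w_def using subring_add_pow[OF A subring_pow[OF A uv(2)]] c by auto
  have vw: "v \<otimes> w = add_pow R n (v [^] n)"
  proof (cases n)
    case 0 then show ?thesis using c by (simp add: w_def)
  next
    case (Suc k) then show ?thesis using c by (simp add: w_def add_pow_rdistr r_distr m_comm)
  qed
  have gen: "y \<otimes> u \<ominus> z \<otimes> v = (u \<ominus> v) \<otimes> (v \<otimes> w \<oplus> z \<oplus> (u \<ominus> v) \<otimes> (w \<oplus> u \<otimes> h))"
    if "y \<ominus> z = (u \<ominus> v) \<otimes> (w \<oplus> (u \<ominus> v) \<otimes> h)" "y \<in> carrier R" "z \<in> carrier R" for y z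
  proof -
    have "y \<otimes> u \<ominus> z \<otimes> v = (y \<ominus> z) \<otimes> u \<oplus> (u \<ominus> v) \<otimes> z" using that(2,3) c by algebra
    also have "\<dots> = (u \<ominus> v) \<otimes> (v \<otimes> w \<oplus> z \<oplus> (u \<ominus> v) \<otimes> (w \<oplus> u \<otimes> h))"
      unfolding that(1) using that(2,3) c w(2) hc by algebra
    finally show ?thesis .
  qed
  have "u [^] Suc n \<ominus> v [^] Suc n = (u \<ominus> v) \<otimes> (v \<otimes> w \<oplus> v [^] n \<oplus> (u \<ominus> v) \<otimes> (w \<oplus> u \<otimes> h))"
    using gen[of "u [^] n" "v [^] n"] h(2) c by (simp add: w_def)
  also have "v \<otimes> w \<oplus> v [^] n = add_pow R (Suc n) (v [^] n)"
    using vw c by (simp add: add.nat_pow_Suc)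
  finally show ?case using h(1) w(1) uv a(6,7) by (intro bexI[of _ "w \<oplus> u \<otimes> h"]) auto
qed

text \<open>
  First-order Taylor expansion.  The remainder stays in \<open>A\<close>, so it can be controlled modulo a prime of \<open>A\<close>.
\<close>

lemma eval_taylor:
  assumes A: "subring A R" and uv: "u \<in> A" "v \<in> A" and "set f \<subseteq> A"
  shows "\<exists>h\<in>A. eval f u \<ominus> eval f v = (u \<ominus> v) \<otimes> (deriv_eval R f v \<oplus> (u \<ominus> v) \<otimes> h)"
  using assms(4)
proof (induction f)
  case Nil
  have "u \<in> carrier R" "v \<in> carrier R" using uv subringE(1)[OF A] by auto
  then show ?case using subringE(2)[OF A] by (intro bexI[of _ \<zero>]) (auto simp: a_minus_def r_neg)
next
  case (Cons b f)
  note a = subringE[OF A]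
  have fc: "set f \<subseteq> carrier R" "b \<in> carrier R" using Cons.prems a(1) by auto
  have c: "u \<in> carrier R" "v \<in> carrier R" using uv a(1) by auto
  obtain h where h: "h \<in> A" "eval f u \<ominus> eval f v = (u \<ominus> v) \<otimes> (deriv_eval R f v \<oplus> (u \<ominus> v) \<otimes> h)"
    using Cons by auto
  let ?n = "length f"
  obtain k where k: "k \<in> A" "u [^] ?n \<ominus> v [^] ?n = (u \<ominus> v) \<otimes> (add_pow R ?n (v [^] (?n - 1)) \<oplus> (u \<ominus> v) \<otimes> k)"
    using pow_taylor[OF A uv] by blast
  have gen: "(b \<otimes> x \<oplus> y) \<ominus> (b \<otimes> x' \<oplus> y') = (u \<ominus> v) \<otimes> (b \<otimes> w \<oplus> z \<oplus> (u \<ominus> v) \<otimes> (b \<otimes> k \<oplus> h))"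
    if "x \<ominus> x' = (u \<ominus> v) \<otimes> (w \<oplus> (u \<ominus> v) \<otimes> k)" "y \<ominus> y' = (u \<ominus> v) \<otimes> (z \<oplus> (u \<ominus> v) \<otimes> h)"
      "x \<in> carrier R" "x' \<in> carrier R" "y \<in> carrier R" "y' \<in> carrier R" "w \<in> carrier R" "z \<in> carrier R"
    for x x' y y' w z
  proof -
    have "(b \<otimes> x \<oplus> y) \<ominus> (b \<otimes> x' \<oplus> y') = b \<otimes> (x \<ominus> x') \<oplus> (y \<ominus> y')" using that(3-6) fc by algebra
    also have "\<dots> = (u \<ominus> v) \<otimes> (b \<otimes> w \<oplus> z \<oplus> (u \<ominus> v) \<otimes> (b \<otimes> k \<oplus> h))"
    proof -
      have "h \<in> carrier R" "k \<in> carrier R" using h(1) k(1) a(1) by auto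
      then have "b \<otimes> (d \<otimes> (w \<oplus> d \<otimes> k)) \<oplus> d \<otimes> (z \<oplus> d \<otimes> h) = d \<otimes> (b \<otimes> w \<oplus> z \<oplus> d \<otimes> (b \<otimes> k \<oplus> h))"
        if "d \<in> carrier R" for d
        using that \<open>w \<in> carrier R\<close> \<open>z \<in> carrier R\<close> fc by (simp add: r_distr m_ac a_ac)
      then show ?thesis unfolding that(1,2) using c by simp
    qed
    finally show ?thesis .
  qed
  have "eval (b # f) u \<ominus> eval (b # f) v =
      (u \<ominus> v) \<otimes> (b \<otimes> add_pow R ?n (v [^] (?n - 1)) \<oplus> deriv_eval R f v \<oplus> (u \<ominus> v) \<otimes> (b \<otimes> k \<oplus> h))"
    using gen[OF k(2) h(2)] c fc by (simp add: eval_in_carrier)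
  also have "b \<otimes> add_pow R ?n (v [^] (?n - 1)) \<oplus> deriv_eval R f v = deriv_eval R (b # f) v"
    using c fc by (simp add: add_pow_rdistr)
  finally show ?case using h(1) k(1) Cons.prems a(6,7) by (intro bexI[of _ "b \<otimes> k \<oplus> h"]) auto
qed

end

lemma (in ring_hom_cring) hom_add_pow:
  "x \<in> carrier R \<Longrightarrow> h (add_pow R (n::nat) x) = add_pow S n (h x)"
  by (induction n) (auto simp: R.add.nat_pow_Suc S.add.nat_pow_Suc)

lemma (in ring_hom_cring) hom_deriv_eval:
  assumes "set f \<subseteq> carrier R" "x \<in> carrier R"
  shows "h (deriv_eval R f x) = deriv_eval S (map h f) (h x)"
  using assms by (induction f) (auto simp: hom_add_pow ring.hom_nat_pow)

text \<open>
  Unramifiedness without localizing: \<open>Q S\<^sub>Q\<close> is generated by \<open>Q \<inter> R\<close>, and every residue class is a simple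
  root of a polynomial over the residue field of \<open>R\<close>, with denominators cleared.
\<close>

definition unramified_at ::
  "('a, 'k) ring_scheme \<Rightarrow> ('b, 'l) ring_scheme \<Rightarrow> ('a \<Rightarrow> 'b) \<Rightarrow> 'b set \<Rightarrow> bool" where
  "unramified_at R S \<iota> Q \<longleftrightarrow>
     (\<forall>y\<in>Q. \<exists>u\<in>carrier S - Q. u \<otimes>\<^bsub>S\<^esub> y \<in> lin_span S (\<iota> ` carrier R \<inter> Q) (carrier S)) \<and>
     (\<forall>y\<in>carrier S. \<exists>f. set f \<subseteq> carrier R \<and> ring.eval S (map \<iota> f) y \<in> Q \<and>
        deriv_eval S (map \<iota> f) y \<notin> Q)"


context extension_homs
begin

text \<open>
  Two homomorphisms \<open>\<sigma>\<close>, \<open>\<tau>\<close> over \<open>R\<close> that agree modulo a prime over an unramified \<open>Q\<close> are equal.  Let \<open>M\<close> be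
  the \<open>A\<close>-module spanned by the differences \<open>\<delta> y = \<sigma> y - \<tau> y\<close>; it is finitely generated by \<open>\<delta> B\<close>.  First
  \<open>\<delta> y\<close> is in \<open>QQ M\<close> locally for \<open>y\<close> in \<open>(Q \<inter> R) S\<close>, then for \<open>y\<close> in \<open>Q\<close>, and then for every \<open>y\<close>, by expanding a
  polynomial for which \<open>y\<close> is a simple root modulo \<open>Q\<close>: the factor that multiplies \<open>\<delta> y\<close> is the
  derivative modulo \<open>QQ\<close>.  So \<open>M = QQ M\<close> locally and \<open>M = 0\<close>.
\<close>

lemma unramified_separates:
  assumes \<sigma>: "is_ext \<sigma>" and \<tau>: "is_ext \<tau>" and QQ: "prime_in E A QQ"
    and A: "\<sigma> ` carrier S \<subseteq> A" "\<tau> ` carrier S \<subseteq> A"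
    and Q: "\<And>s. s \<in> carrier S \<Longrightarrow> \<sigma> s \<in> QQ \<longleftrightarrow> s \<in> Q" "Q \<subseteq> carrier S"
    and unr: "unramified_at R S \<iota> Q"
    and cong: "\<And>s. s \<in> carrier S \<Longrightarrow> \<sigma> s \<ominus>\<^bsub>E\<^esub> \<tau> s \<in> QQ"
    and "s \<in> carrier S"
  shows "\<sigma> s = \<tau> s"
proof -
  interpret \<sigma>: ring_hom_cring S E \<sigma> using is_extD(1)[OF \<sigma>] .
  interpret \<tau>: ring_hom_cring S E \<tau> using is_extD(1)[OF \<tau>] .
  note q = prime_inD[OF QQ]
  note a = subringE[OF q(1)]
  define \<delta> where "\<delta> s = \<sigma> s \<ominus>\<^bsub>E\<^esub> \<tau> s" for s
  have \<delta>c: "\<And>s. s \<in> carrier S \<Longrightarrow> \<delta> s \<in> carrier E" by (simp add: \<delta>_def)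
  define G where "G = \<delta> ` B"
  have G: "finite G" "G \<subseteq> carrier E" using B \<delta>c by (auto simp: G_def)
  \<comment> \<open>The elements of \<open>E\<close> that some multiplier outside \<open>QQ\<close> moves into \<open>QQ M\<close>.\<close>
  define J where "J = {z \<in> carrier E. \<exists>u\<in>A - QQ. u \<otimes>\<^bsub>E\<^esub> z \<in> lin_span E QQ G}"
  have lc: "\<And>x. x \<in> lin_span E QQ G \<Longrightarrow> x \<in> carrier E" using E.lin_span_closed[OF q(9) G(2)] .
  have uu: "\<And>u v. u \<in> A - QQ \<Longrightarrow> v \<in> A - QQ \<Longrightarrow> u \<otimes>\<^bsub>E\<^esub> v \<in> A - QQ" using q(7) a(6) by blast
  have spA: "c \<otimes>\<^bsub>E\<^esub> z \<in> lin_span E QQ G" if "c \<in> A" "z \<in> lin_span E QQ G" for c z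
    by (rule E.lin_span_smult[OF q(9) G(2) _ _ that(2)]) (use that a(1) q(6) in auto)
  have Jadd: "x \<oplus>\<^bsub>E\<^esub> y \<in> J" if xy: "x \<in> J" "y \<in> J" for x y
  proof -
    obtain u v where uv: "u \<in> A - QQ" "v \<in> A - QQ" "u \<otimes>\<^bsub>E\<^esub> x \<in> lin_span E QQ G" "v \<otimes>\<^bsub>E\<^esub> y \<in> lin_span E QQ G"
      using xy unfolding J_def by blast
    have c: "u \<in> carrier E" "v \<in> carrier E" "x \<in> carrier E" "y \<in> carrier E"
      using uv xy a(1) by (auto simp: J_def)
    have "(u \<otimes>\<^bsub>E\<^esub> v) \<otimes>\<^bsub>E\<^esub> (x \<oplus>\<^bsub>E\<^esub> y) = v \<otimes>\<^bsub>E\<^esub> (u \<otimes>\<^bsub>E\<^esub> x) \<oplus>\<^bsub>E\<^esub> u \<otimes>\<^bsub>E\<^esub> (v \<otimes>\<^bsub>E\<^esub> y)"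
      using c by (simp add: E.r_distr E.m_ac)
    also have "\<dots> \<in> lin_span E QQ G"
      using uv spA by (intro E.lin_span_add[OF q(9) G(2)]) auto
    finally show ?thesis using uu[OF uv(1,2)] c by (auto simp: J_def)
  qed
  have Jmult: "c \<otimes>\<^bsub>E\<^esub> x \<in> J" if cx: "c \<in> A" "x \<in> J" for c x
  proof -
    obtain u where u: "u \<in> A - QQ" "u \<otimes>\<^bsub>E\<^esub> x \<in> lin_span E QQ G" using cx unfolding J_def by blast
    have c: "u \<in> carrier E" "c \<in> carrier E" "x \<in> carrier E" using u cx a(1) by (auto simp: J_def)
    have "u \<otimes>\<^bsub>E\<^esub> (c \<otimes>\<^bsub>E\<^esub> x) = c \<otimes>\<^bsub>E\<^esub> (u \<otimes>\<^bsub>E\<^esub> x)" using c by (simp add: E.m_ac)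
    then have "u \<otimes>\<^bsub>E\<^esub> (c \<otimes>\<^bsub>E\<^esub> x) \<in> lin_span E QQ G" using spA[OF cx(1) u(2)] by simp
    then show ?thesis using u(1) c unfolding J_def by blast
  qed
  have Jcancel: "x \<in> J" if ux: "u \<in> A - QQ" "x \<in> carrier E" "u \<otimes>\<^bsub>E\<^esub> x \<in> J" for u x
  proof -
    obtain v where v: "v \<in> A - QQ" "v \<otimes>\<^bsub>E\<^esub> (u \<otimes>\<^bsub>E\<^esub> x) \<in> lin_span E QQ G" using ux unfolding J_def by blast
    have c: "u \<in> carrier E" "v \<in> carrier E" using ux v a(1) by auto
    have "(v \<otimes>\<^bsub>E\<^esub> u) \<otimes>\<^bsub>E\<^esub> x \<in> lin_span E QQ G" using v(2) c ux(2) by (simp add: E.m_assoc)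
    then show ?thesis using uu[OF v(1) ux(1)] ux(2) unfolding J_def by blast
  qed
  have m1: "\<ominus>\<^bsub>E\<^esub> \<one>\<^bsub>E\<^esub> \<in> A" using a(3,5) by blast
  have Jminus: "x \<ominus>\<^bsub>E\<^esub> y \<in> J" if "x \<in> J" "y \<in> J" for x y
  proof -
    have "y \<in> carrier E" using that by (simp add: J_def)
    then show ?thesis
      using Jadd[OF that(1) Jmult[OF m1 that(2)]] by (simp add: a_minus_def E.l_minus)
  qed
  have \<delta>span: "\<delta> x \<in> lin_span E A G" if "x \<in> carrier S" for x
    using span[OF that]
  proof (induction)
    case lin_span_zero
    have "\<delta> \<zero>\<^bsub>S\<^esub> = \<zero>\<^bsub>E\<^esub>" unfolding \<delta>_def by (simp add: a_minus_def)
    then show ?case by (simp add: lin_span.lin_span_zero)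
  next
    case (lin_span_step c g x)
    obtain r where r: "r \<in> carrier R" "c = \<iota> r" using lin_span_step by blast
    have x: "x \<in> carrier S"
      by (rule S.lin_span_closed[OF _ B(2) lin_span_step(3)]) auto
    have g: "g \<in> carrier S" using lin_span_step B by blast
    have \<eta>r: "\<eta> r = \<sigma> (\<iota> r)" "\<eta> r = \<tau> (\<iota> r)" "\<eta> r \<in> A"
      using is_extD(3)[OF \<sigma> r(1)] is_extD(3)[OF \<tau> r(1)] \<iota>.hom_closed[OF r(1)] A(1)
      by (metis, metis, metis image_subset_iff)
    have id: "(e \<otimes>\<^bsub>E\<^esub> s \<oplus>\<^bsub>E\<^esub> t) \<ominus>\<^bsub>E\<^esub> (e \<otimes>\<^bsub>E\<^esub> s' \<oplus>\<^bsub>E\<^esub> t') = e \<otimes>\<^bsub>E\<^esub> (s \<ominus>\<^bsub>E\<^esub> s') \<oplus>\<^bsub>E\<^esub> (t \<ominus>\<^bsub>E\<^esub> t')"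
      if "e \<in> carrier E" "s \<in> carrier E" "t \<in> carrier E" "s' \<in> carrier E" "t' \<in> carrier E" for e s t s' t'
      using that by algebra
    have "\<delta> (c \<otimes>\<^bsub>S\<^esub> g \<oplus>\<^bsub>S\<^esub> x) = \<eta> r \<otimes>\<^bsub>E\<^esub> \<delta> g \<oplus>\<^bsub>E\<^esub> \<delta> x"
      unfolding \<delta>_def r(2)
      using id[of "\<eta> r" "\<sigma> g" "\<sigma> x" "\<tau> g" "\<tau> x"] \<eta>r g x r(1) a(1) by (auto simp: subset_iff)
    then show ?case using lin_span_step \<eta>r(3) by (auto simp: G_def intro: lin_span.lin_span_step)
  qed
  have q\<delta>: "c \<otimes>\<^bsub>E\<^esub> \<delta> x \<in> J" if cx: "c \<in> QQ" "x \<in> carrier S" for c x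
  proof -
    have cE: "c \<in> carrier E" using cx q(9) by blast
    have "c \<otimes>\<^bsub>E\<^esub> \<delta> x \<in> lin_span E QQ G"
    proof (rule E.lin_span_smult[OF a(1) G(2) cE _ \<delta>span[OF cx(2)]])
      fix b assume "b \<in> A"
      then show "c \<otimes>\<^bsub>E\<^esub> b \<in> QQ" using q(6)[of b c] cx(1) cE a(1) by (metis E.m_comm subsetD)
    qed
    moreover have "\<one>\<^bsub>E\<^esub> \<in> A - QQ" using a(3) q(4) by blast
    ultimately show ?thesis using lc[of "c \<otimes>\<^bsub>E\<^esub> \<delta> x"] unfolding J_def
      by (intro CollectI conjI bexI[of _ "\<one>\<^bsub>E\<^esub>"]) auto
  qed
  have \<tau>Q: "\<tau> x \<in> QQ \<longleftrightarrow> \<sigma> x \<in> QQ" if x: "x \<in> carrier S" for x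
  proof
    have c: "\<sigma> x \<in> carrier E" "\<tau> x \<in> carrier E" using x by auto
    { assume "\<tau> x \<in> QQ"
      then have "(\<sigma> x \<ominus>\<^bsub>E\<^esub> \<tau> x) \<oplus>\<^bsub>E\<^esub> \<tau> x \<in> QQ" using q(5) cong[OF x] by blast
      moreover have "(\<sigma> x \<ominus>\<^bsub>E\<^esub> \<tau> x) \<oplus>\<^bsub>E\<^esub> \<tau> x = \<sigma> x" using c by algebra
      ultimately show "\<sigma> x \<in> QQ" by simp }
    { assume "\<sigma> x \<in> QQ"
      then have "\<sigma> x \<ominus>\<^bsub>E\<^esub> (\<sigma> x \<ominus>\<^bsub>E\<^esub> \<tau> x) \<in> QQ" using E.prime_in_minus[OF QQ] cong[OF x] by blast
      moreover have "\<sigma> x \<ominus>\<^bsub>E\<^esub> (\<sigma> x \<ominus>\<^bsub>E\<^esub> \<tau> x) = \<tau> x" using c by algebra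
      ultimately show "\<tau> x \<in> QQ" by simp }
  qed
  have \<delta>PS: "\<delta> x \<in> J" if "x \<in> lin_span S (\<iota> ` carrier R \<inter> Q) (carrier S)" for x
    using that
  proof (induction)
    case lin_span_zero
    have "\<delta> \<zero>\<^bsub>S\<^esub> = \<zero>\<^bsub>E\<^esub>" unfolding \<delta>_def by (simp add: a_minus_def)
    moreover have "\<zero>\<^bsub>E\<^esub> \<otimes>\<^bsub>E\<^esub> \<delta> \<zero>\<^bsub>S\<^esub> \<in> J" using q\<delta>[OF q(3)] by blast
    ultimately show ?case by simp
  next
    case (lin_span_step c g x)
    obtain r where r: "r \<in> carrier R" "c = \<iota> r" using lin_span_step by blast
    have x: "x \<in> carrier S"
      by (rule S.lin_span_closed[OF _ _ lin_span_step(3)]) auto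
    have g: "g \<in> carrier S" using lin_span_step by blast
    have \<eta>r: "\<eta> r = \<sigma> (\<iota> r)" "\<eta> r = \<tau> (\<iota> r)" "\<eta> r \<in> QQ"
      using is_extD(3)[OF \<sigma>] is_extD(3)[OF \<tau>] r lin_span_step(1) Q(1)[of c] by auto
    have id: "(e \<otimes>\<^bsub>E\<^esub> s \<oplus>\<^bsub>E\<^esub> t) \<ominus>\<^bsub>E\<^esub> (e \<otimes>\<^bsub>E\<^esub> s' \<oplus>\<^bsub>E\<^esub> t') = e \<otimes>\<^bsub>E\<^esub> (s \<ominus>\<^bsub>E\<^esub> s') \<oplus>\<^bsub>E\<^esub> (t \<ominus>\<^bsub>E\<^esub> t')"
      if "e \<in> carrier E" "s \<in> carrier E" "t \<in> carrier E" "s' \<in> carrier E" "t' \<in> carrier E" for e s t s' t'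
      using that by algebra
    have "\<delta> (c \<otimes>\<^bsub>S\<^esub> g \<oplus>\<^bsub>S\<^esub> x) = \<eta> r \<otimes>\<^bsub>E\<^esub> \<delta> g \<oplus>\<^bsub>E\<^esub> \<delta> x"
      unfolding \<delta>_def r(2)
      using id[of "\<eta> r" "\<sigma> g" "\<sigma> x" "\<tau> g" "\<tau> x"] \<eta>r g x r(1) q(9) by (auto simp: subset_iff)
    then show ?case using Jadd[OF q\<delta>[OF \<eta>r(3) g] lin_span_step.IH] by simp
  qed
  have \<delta>Q: "\<delta> y \<in> J" if y: "y \<in> Q" for y
  proof -
    obtain u where u: "u \<in> carrier S - Q" "u \<otimes>\<^bsub>S\<^esub> y \<in> lin_span S (\<iota> ` carrier R \<inter> Q) (carrier S)"
      using unr y unfolding unramified_at_def by blast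
    have c: "u \<in> carrier S" "y \<in> carrier S" using u y Q(2) by auto
    \<comment> \<open>\<open>\<delta> (u y) = \<sigma> u \<delta> y + \<tau> y \<delta> u\<close>, where \<open>\<tau> y\<close> is in \<open>QQ\<close>.\<close>
    have id: "s \<otimes>\<^bsub>E\<^esub> t \<ominus>\<^bsub>E\<^esub> s' \<otimes>\<^bsub>E\<^esub> t' \<ominus>\<^bsub>E\<^esub> t' \<otimes>\<^bsub>E\<^esub> (s \<ominus>\<^bsub>E\<^esub> s') = s \<otimes>\<^bsub>E\<^esub> (t \<ominus>\<^bsub>E\<^esub> t')"
      if "s \<in> carrier E" "t \<in> carrier E" "s' \<in> carrier E" "t' \<in> carrier E" for s t s' t'
      using that by algebra
    have "\<tau> y \<in> QQ" using \<tau>Q[OF c(2)] Q(1)[OF c(2)] y by simp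
    from Jminus[OF \<delta>PS[OF u(2)] q\<delta>[OF this c(1)]]
    have "\<sigma> u \<otimes>\<^bsub>E\<^esub> \<delta> y \<in> J"
      unfolding \<delta>_def using id[of "\<sigma> u" "\<sigma> y" "\<tau> u" "\<tau> y"] c by simp
    moreover have "\<sigma> u \<in> A - QQ" using u A(1) Q(1)[OF c(1)] by auto
    ultimately show ?thesis using Jcancel \<delta>c[OF c(2)] by blast
  qed
  have \<delta>J: "\<delta> y \<in> J" if y: "y \<in> carrier S" for y
  proof -
    obtain f where f: "set f \<subseteq> carrier R" "S.eval (map \<iota> f) y \<in> Q" "deriv_eval S (map \<iota> f) y \<notin> Q"
      using unr y unfolding unramified_at_def by blast
    have fS: "set (map \<iota> f) \<subseteq> carrier S" using f(1) by auto
    have \<eta>f: "map \<sigma> (map \<iota> f) = map \<eta> f" "map \<tau> (map \<iota> f) = map \<eta> f"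
      using f(1) is_extD(3)[OF \<sigma>] is_extD(3)[OF \<tau>] by (auto simp: subset_iff)
    have "set (map \<sigma> (map \<iota> f)) \<subseteq> A" using fS A(1) by auto
    then have \<eta>fA: "set (map \<eta> f) \<subseteq> A" unfolding \<eta>f .
    have uv: "\<sigma> y \<in> A" "\<tau> y \<in> A" using y A by auto
    obtain h where h: "h \<in> A" "E.eval (map \<eta> f) (\<sigma> y) \<ominus>\<^bsub>E\<^esub> E.eval (map \<eta> f) (\<tau> y) =
        (\<sigma> y \<ominus>\<^bsub>E\<^esub> \<tau> y) \<otimes>\<^bsub>E\<^esub> (deriv_eval E (map \<eta> f) (\<tau> y) \<oplus>\<^bsub>E\<^esub> (\<sigma> y \<ominus>\<^bsub>E\<^esub> \<tau> y) \<otimes>\<^bsub>E\<^esub> h)"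
      using E.eval_taylor[OF q(1) uv \<eta>fA] by blast
    have ev: "\<sigma> (S.eval (map \<iota> f) y) = E.eval (map \<eta> f) (\<sigma> y)" "\<tau> (S.eval (map \<iota> f) y) = E.eval (map \<eta> f) (\<tau> y)"
      using \<sigma>.ring.eval_hom'[OF y fS] \<tau>.ring.eval_hom'[OF y fS] unfolding \<eta>f by auto
    let ?d = "deriv_eval S (map \<iota> f) y"
    have d: "?d \<in> carrier S" "deriv_eval E (map \<eta> f) (\<tau> y) = \<tau> ?d"
      using S.deriv_eval_closed[OF fS y] \<tau>.hom_deriv_eval[OF fS y] unfolding \<eta>f by auto
    have dQ: "\<tau> ?d \<in> A - QQ" using \<tau>Q[OF d(1)] Q(1)[OF d(1)] f(3) A(2) d(1) by auto
    \<comment> \<open>\<open>t\<close> is the cofactor of \<open>\<delta> y\<close> in the Taylor expansion; it is outside \<open>QQ\<close> like the derivative.\<close>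
    define t where "t = \<tau> ?d \<oplus>\<^bsub>E\<^esub> \<delta> y \<otimes>\<^bsub>E\<^esub> h"
    have hq: "\<delta> y \<otimes>\<^bsub>E\<^esub> h \<in> QQ"
      using q(6)[OF h(1) cong[OF y]] \<delta>c[OF y] h(1) a(1) unfolding \<delta>_def[symmetric]
      by (metis E.m_comm subsetD)
    have t: "t \<in> A - QQ"
    proof
      show "t \<in> A" unfolding t_def using dQ hq q(2) a(7) by blast
      show "t \<notin> QQ"
      proof
        assume "t \<in> QQ"
        then have "t \<ominus>\<^bsub>E\<^esub> \<delta> y \<otimes>\<^bsub>E\<^esub> h \<in> QQ" using E.prime_in_minus[OF QQ _ hq] by blast
        moreover have "(x \<oplus>\<^bsub>E\<^esub> z) \<ominus>\<^bsub>E\<^esub> z = x" if "x \<in> carrier E" "z \<in> carrier E" for x z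
          using that by algebra
        ultimately show False using dQ hq q(9) a(1) d(1) unfolding t_def by (auto simp: subset_iff)
      qed
    qed
    have "S.eval (map \<iota> f) y \<in> Q" by (rule f(2))
    from \<delta>Q[OF this] have "\<delta> y \<otimes>\<^bsub>E\<^esub> t \<in> J"
      using h(2) ev d(2) unfolding t_def \<delta>_def by simp
    then have "t \<otimes>\<^bsub>E\<^esub> \<delta> y \<in> J" using t a(1) \<delta>c[OF y] by (auto simp: E.m_comm subset_iff)
    then show ?thesis using Jcancel[OF t \<delta>c[OF y]] by blast
  qed
  have G0: "\<forall>g\<in>G. g = \<zero>\<^bsub>E\<^esub>"
    by (rule E.nakayama_at_prime[OF QQ G]) (use \<delta>J B in \<open>auto simp: G_def J_def\<close>)
  have "x = \<zero>\<^bsub>E\<^esub>" if "x \<in> lin_span E A G" for x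
    using that
  proof induction
    case (lin_span_step b g x)
    then have "b \<in> carrier E" "g = \<zero>\<^bsub>E\<^esub>" using a(1) G0 by auto
    then show ?case using lin_span_step by simp
  qed simp
  then have "\<delta> s = \<zero>\<^bsub>E\<^esub>" using \<delta>span \<open>s \<in> carrier S\<close> by blast
  then show ?thesis using \<open>s \<in> carrier S\<close> by (simp add: \<delta>_def)
qed

end

section \<open>Localizations of a domain\<close>

text \<open>
  Over a domain the witness \<open>u\<close> in the definition of equality of fractions can be cancelled, so
  fractions are compared by cross-multiplication.
\<close>

locale domain_localization = domain R for R (structure) +
  fixes W
  assumes W: "W \<subseteq> carrier R" "\<one> \<in> W" "\<zero> \<notin> W" "\<And>s t. s \<in> W \<Longrightarrow> t \<in> W \<Longrightarrow> s \<otimes> t \<in> W"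
begin

lemma W_carrier [simp]: "s \<in> W \<Longrightarrow> s \<in> carrier R" using W(1) by blast
lemma W_nonzero: "s \<in> W \<Longrightarrow> s \<noteq> \<zero>" using W(3) by blast
lemma W_mult [simp]: "s \<in> W \<Longrightarrow> t \<in> W \<Longrightarrow> s \<otimes> t \<in> W" using W(4) .
lemma W_one [simp]: "\<one> \<in> W" using W(2) .

lemma fraction_mem_iff:
  assumes "a \<in> carrier R" "s \<in> W"
  shows "(b, t) \<in> fraction R W a s \<longleftrightarrow> b \<in> carrier R \<and> t \<in> W \<and> a \<otimes> t = b \<otimes> s"
proof -
  have "a \<otimes> t = b \<otimes> s" if "b \<in> carrier R" "t \<in> W" "u \<in> W" "u \<otimes> (a \<otimes> t) = u \<otimes> (b \<otimes> s)" for u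
    using that assms m_lcancel[of u "a \<otimes> t" "b \<otimes> s"] W_nonzero by auto
  moreover have "\<one> \<in> W" by simp
  ultimately show ?thesis unfolding fraction_def by (auto simp: assms)
qed

lemma fraction_self: "a \<in> carrier R \<Longrightarrow> s \<in> W \<Longrightarrow> (a, s) \<in> fraction R W a s"
  by (simp add: fraction_mem_iff)

lemma cross_trans:
  assumes "a \<in> carrier R" "b \<in> carrier R" "c \<in> carrier R" "s \<in> W" "t \<in> W" "u \<in> W"
    and "a \<otimes> t = b \<otimes> s" "b \<otimes> u = c \<otimes> t"
  shows "a \<otimes> u = c \<otimes> s"
proof -
  have "t \<otimes> (a \<otimes> u) = (a \<otimes> t) \<otimes> u" using assms(1-6) by (simp add: m_ac)
  also have "\<dots> = s \<otimes> (b \<otimes> u)" unfolding assms(7) using assms(1-6) by (simp add: m_ac)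
  also have "\<dots> = t \<otimes> (c \<otimes> s)" unfolding assms(8) using assms(1-6) by (simp add: m_ac)
  finally show ?thesis using m_lcancel[of t "a \<otimes> u" "c \<otimes> s"] W_nonzero assms by auto
qed

lemma fraction_eq_iff:
  assumes "a \<in> carrier R" "s \<in> W" "b \<in> carrier R" "t \<in> W"
  shows "fraction R W a s = fraction R W b t \<longleftrightarrow> a \<otimes> t = b \<otimes> s"
proof
  assume "fraction R W a s = fraction R W b t"
  then have "(b, t) \<in> fraction R W a s" using fraction_self assms by simp
  then show "a \<otimes> t = b \<otimes> s" using fraction_mem_iff assms by simp
next
  assume eq: "a \<otimes> t = b \<otimes> s"
  have "a \<otimes> u = c \<otimes> s \<longleftrightarrow> b \<otimes> u = c \<otimes> t" if "c \<in> carrier R" "u \<in> W" for c u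
  proof
    show "b \<otimes> u = c \<otimes> t" if "a \<otimes> u = c \<otimes> s"
      by (rule cross_trans[OF assms(3,1) _ assms(4,2) _ eq[symmetric] that]) fact+
    show "a \<otimes> u = c \<otimes> s" if "b \<otimes> u = c \<otimes> t"
      by (rule cross_trans[OF assms(1,3) _ assms(2,4) _ eq that]) fact+
  qed
  then have "(c, u) \<in> fraction R W a s \<longleftrightarrow> (c, u) \<in> fraction R W b t" for c u
    unfolding fraction_mem_iff[OF assms(1,2)] fraction_mem_iff[OF assms(3,4)] by blast
  then show "fraction R W a s = fraction R W b t" by auto
qed

abbreviation "Loc \<equiv> localization R W"

lemma Loc_carrier: "carrier Loc = {fraction R W a s | a s. a \<in> carrier R \<and> s \<in> W}"
  by (simp add: localization_def)

lemma fraction_closed [simp]: "a \<in> carrier R \<Longrightarrow> s \<in> W \<Longrightarrow> fraction R W a s \<in> carrier Loc"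
  unfolding Loc_carrier by blast

lemma Loc_cases:
  assumes "x \<in> carrier Loc"
  obtains a s where "a \<in> carrier R" "s \<in> W" "x = fraction R W a s"
  using assms unfolding Loc_carrier by blast

lemma fraction_mult [simp]:
  assumes "a \<in> carrier R" "s \<in> W" "b \<in> carrier R" "t \<in> W"
  shows "fraction R W a s \<otimes>\<^bsub>Loc\<^esub> fraction R W b t = fraction R W (a \<otimes> b) (s \<otimes> t)"
proof -
  have eq: "fraction R W (a' \<otimes> b') (s' \<otimes> t') = fraction R W (a \<otimes> b) (s \<otimes> t)"
    if "(a', s') \<in> fraction R W a s" "(b', t') \<in> fraction R W b t" for a' s' b' t'
  proof -
    have h: "a' \<in> carrier R" "s' \<in> W" "a \<otimes> s' = a' \<otimes> s" "b' \<in> carrier R" "t' \<in> W" "b \<otimes> t' = b' \<otimes> t"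
      using that assms by (auto simp: fraction_mem_iff)
    have "(a' \<otimes> b') \<otimes> (s \<otimes> t) = (a' \<otimes> s) \<otimes> (b' \<otimes> t)" using h(1,2,4,5) assms by (simp add: m_ac)
    also have "\<dots> = (a \<otimes> b) \<otimes> (s' \<otimes> t')" unfolding h(3,6)[symmetric] using h(1,2,4,5) assms by (simp add: m_ac)
    finally show ?thesis using h assms by (simp add: fraction_eq_iff)
  qed
  let ?g = "\<lambda>(a', s'). \<lambda>(b', t'). fraction R W (a' \<otimes> b') (s' \<otimes> t')"
  have "(\<Union>p\<in>fraction R W a s. \<Union>q\<in>fraction R W b t. ?g p q) = ?g (a, s) (b, t)"
  proof (intro equalityI UN_least)
    fix p q assume "p \<in> fraction R W a s" "q \<in> fraction R W b t"
    then show "?g p q \<subseteq> ?g (a, s) (b, t)"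
      using eq[of "fst p" "snd p" "fst q" "snd q"] by (simp add: case_prod_unfold)
  next
    show "?g (a, s) (b, t) \<subseteq> (\<Union>p\<in>fraction R W a s. \<Union>q\<in>fraction R W b t. ?g p q)"
      by (rule order_trans[OF UN_upper[OF fraction_self[OF assms(3,4)], of "?g (a, s)"]
            UN_upper[OF fraction_self[OF assms(1,2)], of "\<lambda>p. \<Union>q\<in>fraction R W b t. ?g p q"]])
  qed
  then show ?thesis by (simp add: localization_def case_prod_unfold)
qed

lemma fraction_add [simp]:
  assumes "a \<in> carrier R" "s \<in> W" "b \<in> carrier R" "t \<in> W"
  shows "fraction R W a s \<oplus>\<^bsub>Loc\<^esub> fraction R W b t = fraction R W (a \<otimes> t \<oplus> b \<otimes> s) (s \<otimes> t)"
proof -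
  have eq: "fraction R W (a' \<otimes> t' \<oplus> b' \<otimes> s') (s' \<otimes> t') = fraction R W (a \<otimes> t \<oplus> b \<otimes> s) (s \<otimes> t)"
    if "(a', s') \<in> fraction R W a s" "(b', t') \<in> fraction R W b t" for a' s' b' t'
  proof -
    have h: "a' \<in> carrier R" "s' \<in> W" "a \<otimes> s' = a' \<otimes> s" "b' \<in> carrier R" "t' \<in> W" "b \<otimes> t' = b' \<otimes> t"
      using that assms by (auto simp: fraction_mem_iff)
    have "(a' \<otimes> t' \<oplus> b' \<otimes> s') \<otimes> (s \<otimes> t) = (a' \<otimes> s) \<otimes> (t \<otimes> t') \<oplus> (b' \<otimes> t) \<otimes> (s \<otimes> s')"
      using h(1,2,4,5) assms by (simp add: l_distr r_distr m_ac)
    also have "\<dots> = (a \<otimes> t \<oplus> b \<otimes> s) \<otimes> (s' \<otimes> t')"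
      unfolding h(3,6)[symmetric] using h(1,2,4,5) assms by (simp add: l_distr r_distr m_ac)
    finally show ?thesis using h assms by (simp add: fraction_eq_iff)
  qed
  let ?g = "\<lambda>(a', s'). \<lambda>(b', t'). fraction R W (a' \<otimes> t' \<oplus> b' \<otimes> s') (s' \<otimes> t')"
  have "(\<Union>p\<in>fraction R W a s. \<Union>q\<in>fraction R W b t. ?g p q) = ?g (a, s) (b, t)"
  proof (intro equalityI UN_least)
    fix p q assume "p \<in> fraction R W a s" "q \<in> fraction R W b t"
    then show "?g p q \<subseteq> ?g (a, s) (b, t)"
      using eq[of "fst p" "snd p" "fst q" "snd q"] by (simp add: case_prod_unfold)
  next
    show "?g (a, s) (b, t) \<subseteq> (\<Union>p\<in>fraction R W a s. \<Union>q\<in>fraction R W b t. ?g p q)"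
      by (rule order_trans[OF UN_upper[OF fraction_self[OF assms(3,4)], of "?g (a, s)"]
            UN_upper[OF fraction_self[OF assms(1,2)], of "\<lambda>p. \<Union>q\<in>fraction R W b t. ?g p q"]])
  qed
  then show ?thesis by (simp add: localization_def case_prod_unfold)
qed

lemma Loc_zero: "\<zero>\<^bsub>Loc\<^esub> = fraction R W \<zero> \<one>" by (simp add: localization_def)
lemma Loc_one: "\<one>\<^bsub>Loc\<^esub> = fraction R W \<one> \<one>" by (simp add: localization_def)

lemma Loc_cring: "cring Loc"
proof (rule cringI)
  show "abelian_group Loc"
  proof (rule abelian_groupI)
    fix x y z assume "x \<in> carrier Loc" "y \<in> carrier Loc" "z \<in> carrier Loc"
    then show "x \<oplus>\<^bsub>Loc\<^esub> y \<oplus>\<^bsub>Loc\<^esub> z = x \<oplus>\<^bsub>Loc\<^esub> (y \<oplus>\<^bsub>Loc\<^esub> z)"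
      by (elim Loc_cases) (simp add: fraction_eq_iff l_distr r_distr m_ac a_ac)
  next
    fix x y assume "x \<in> carrier Loc" "y \<in> carrier Loc"
    then show "x \<oplus>\<^bsub>Loc\<^esub> y \<in> carrier Loc" "x \<oplus>\<^bsub>Loc\<^esub> y = y \<oplus>\<^bsub>Loc\<^esub> x"
      by (elim Loc_cases; simp add: fraction_eq_iff m_ac a_ac)+
  next
    fix x assume "x \<in> carrier Loc"
    then obtain a s where as: "a \<in> carrier R" "s \<in> W" "x = fraction R W a s" by (rule Loc_cases)
    then show "\<zero>\<^bsub>Loc\<^esub> \<oplus>\<^bsub>Loc\<^esub> x = x" by (simp add: Loc_zero)
    show "\<exists>y\<in>carrier Loc. y \<oplus>\<^bsub>Loc\<^esub> x = \<zero>\<^bsub>Loc\<^esub>"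
      using as by (intro bexI[of _ "fraction R W (\<ominus> a) s"]) (simp_all add: Loc_zero fraction_eq_iff l_minus l_neg)
  qed (simp add: Loc_zero)
  show "comm_monoid Loc"
  proof (rule comm_monoidI)
    fix x y z assume "x \<in> carrier Loc" "y \<in> carrier Loc" "z \<in> carrier Loc"
    then show "x \<otimes>\<^bsub>Loc\<^esub> y \<otimes>\<^bsub>Loc\<^esub> z = x \<otimes>\<^bsub>Loc\<^esub> (y \<otimes>\<^bsub>Loc\<^esub> z)"
      by (elim Loc_cases) (simp add: fraction_eq_iff m_ac)
  next
    fix x y assume "x \<in> carrier Loc" "y \<in> carrier Loc"
    then show "x \<otimes>\<^bsub>Loc\<^esub> y \<in> carrier Loc" "x \<otimes>\<^bsub>Loc\<^esub> y = y \<otimes>\<^bsub>Loc\<^esub> x"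
      by (elim Loc_cases; simp add: fraction_eq_iff m_ac)+
  next
    fix x assume "x \<in> carrier Loc"
    then show "\<one>\<^bsub>Loc\<^esub> \<otimes>\<^bsub>Loc\<^esub> x = x" by (elim Loc_cases) (simp add: Loc_one)
  qed (simp add: Loc_one)
  fix x y z assume "x \<in> carrier Loc" "y \<in> carrier Loc" "z \<in> carrier Loc"
  then show "(x \<oplus>\<^bsub>Loc\<^esub> y) \<otimes>\<^bsub>Loc\<^esub> z = x \<otimes>\<^bsub>Loc\<^esub> z \<oplus>\<^bsub>Loc\<^esub> y \<otimes>\<^bsub>Loc\<^esub> z"
    by (elim Loc_cases) (simp add: fraction_eq_iff l_distr r_distr m_ac a_ac)
qed

sublocale Loc: cring Loc by (rule Loc_cring)

definition toLoc :: "'a \<Rightarrow> ('a \<times> 'a) set" where "toLoc a = fraction R W a \<one>"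

lemma toLoc_hom: "ring_hom_cring R Loc toLoc"
  by unfold_locales (auto simp: ring_hom_def toLoc_def Loc_one fraction_eq_iff)

sublocale toLoc: ring_hom_cring R Loc toLoc by (rule toLoc_hom)

lemma toLoc_inj: "inj_on toLoc (carrier R)"
  by (rule inj_onI) (simp add: toLoc_def fraction_eq_iff)

lemma toLoc_unit:
  assumes "s \<in> W"
  shows "toLoc s \<in> Units Loc" "inv\<^bsub>Loc\<^esub> toLoc s = fraction R W \<one> s"
proof -
  have 1: "fraction R W \<one> s \<otimes>\<^bsub>Loc\<^esub> toLoc s = \<one>\<^bsub>Loc\<^esub>" "toLoc s \<otimes>\<^bsub>Loc\<^esub> fraction R W \<one> s = \<one>\<^bsub>Loc\<^esub>"
    using assms by (simp_all add: toLoc_def Loc_one fraction_eq_iff)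
  then show "toLoc s \<in> Units Loc"
    using assms unfolding Units_def by (auto intro!: bexI[of _ "fraction R W \<one> s"])
  show "inv\<^bsub>Loc\<^esub> toLoc s = fraction R W \<one> s"
    using 1 assms by (intro Loc.comm_inv_char) auto
qed

lemma fraction_zero_iff: "a \<in> carrier R \<Longrightarrow> s \<in> W \<Longrightarrow> fraction R W a s = \<zero>\<^bsub>Loc\<^esub> \<longleftrightarrow> a = \<zero>"
  by (simp add: Loc_zero fraction_eq_iff)

lemma fraction_conv: "a \<in> carrier R \<Longrightarrow> s \<in> W \<Longrightarrow> fraction R W a s = toLoc a \<otimes>\<^bsub>Loc\<^esub> inv\<^bsub>Loc\<^esub> toLoc s"
  by (simp add: toLoc_unit) (simp add: toLoc_def)

end

lemma (in domain) fraction_field_localization: "domain_localization R (carrier R - {\<zero>})"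
  by unfold_locales (auto dest: integral)

lemma (in domain) fraction_field_is_field: "field (fraction_field R)"
proof -
  interpret F: domain_localization R "carrier R - {\<zero>}" by (rule fraction_field_localization)
  have FF: "fraction_field R = F.Loc" by (simp add: fraction_field_def)
  have zero_neq_one: "\<zero>\<^bsub>F.Loc\<^esub> \<noteq> \<one>\<^bsub>F.Loc\<^esub>" by (simp add: F.Loc_zero F.Loc_one F.fraction_eq_iff)
  have "x \<in> Units F.Loc" if x: "x \<in> carrier F.Loc" "x \<noteq> \<zero>\<^bsub>F.Loc\<^esub>" for x
  proof -
    obtain a s where as: "a \<in> carrier R" "s \<in> carrier R - {\<zero>}" "x = fraction R (carrier R - {\<zero>}) a s"
      using x(1) by (rule F.Loc_cases)
    then have a: "a \<in> carrier R - {\<zero>}" using x(2) F.fraction_zero_iff by auto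
    let ?y = "fraction R (carrier R - {\<zero>}) s a"
    have "x \<otimes>\<^bsub>F.Loc\<^esub> ?y = fraction R (carrier R - {\<zero>}) (a \<otimes> s) (s \<otimes> a)"
      unfolding as(3) using as(1,2) a by (intro F.fraction_mult) auto
    also have "\<dots> = \<one>\<^bsub>F.Loc\<^esub>"
      unfolding F.Loc_one using F.fraction_eq_iff[OF _ F.W_mult[OF as(2) a], of "a \<otimes> s" \<one> \<one>] as a
      by (simp add: m_comm)
    finally have "x \<otimes>\<^bsub>F.Loc\<^esub> ?y = \<one>\<^bsub>F.Loc\<^esub>" "?y \<in> carrier F.Loc"
      using as a by auto
    then show ?thesis using x(1) F.Loc.m_comm[of x ?y] unfolding Units_def by auto
  qed
  moreover have "x \<in> carrier F.Loc - {\<zero>\<^bsub>F.Loc\<^esub>}" if x: "x \<in> Units F.Loc" for x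
  proof -
    have "x \<noteq> \<zero>\<^bsub>F.Loc\<^esub>"
    proof
      assume "x = \<zero>\<^bsub>F.Loc\<^esub>"
      then have "\<zero>\<^bsub>F.Loc\<^esub> \<otimes>\<^bsub>F.Loc\<^esub> inv\<^bsub>F.Loc\<^esub> x = \<one>\<^bsub>F.Loc\<^esub>" using F.Loc.Units_r_inv[OF x] by simp
      then show False using zero_neq_one F.Loc.Units_inv_closed[OF x] by simp
    qed
    then show ?thesis using F.Loc.Units_closed[OF x] by simp
  qed
  ultimately have "Units F.Loc = carrier F.Loc - {\<zero>\<^bsub>F.Loc\<^esub>}" by blast
  then show ?thesis unfolding FF by (rule F.Loc.cring_fieldI)
qed

section \<open>Integrality\<close>

context field
begin

lemma eval_reverse:
  assumes "x \<in> carrier R" "y \<in> carrier R" "x \<otimes> y = \<one>" "set p \<subseteq> carrier R"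
  shows "x [^] length p \<otimes> (y \<otimes> eval p y) = eval (rev p) x"
  using assms(4)
proof (induction p)
  case Nil then show ?case using assms by simp
next
  case (Cons a p)
  have c: "a \<in> carrier R" "set p \<subseteq> carrier R" "eval p y \<in> carrier R" "eval (rev p) x \<in> carrier R"
    using Cons.prems assms by (auto intro!: eval_in_carrier)
  have xy: "x [^] n \<otimes> y [^] n = \<one>" for n :: nat
    using assms(1-3) by (metis nat_pow_distrib nat_pow_one)
  let ?n = "length p"
  have "x [^] length (a # p) \<otimes> (y \<otimes> eval (a # p) y)
      = (x [^] ?n \<otimes> x) \<otimes> (y \<otimes> (a \<otimes> y [^] ?n \<oplus> eval p y))" by simp
  also have "\<dots> = (x \<otimes> y) \<otimes> (x [^] ?n \<otimes> y [^] ?n) \<otimes> a \<oplus> x \<otimes> (x [^] ?n \<otimes> (y \<otimes> eval p y))"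
    using c assms(1,2) by (simp add: r_distr m_ac)
  also have "\<dots> = a \<oplus> x \<otimes> eval (rev p) x"
    using Cons.IH[OF c(2)] xy assms(3) c by simp
  also have "\<dots> = eval (rev p @ [a]) x"
    using eval_append_aux[of "rev p" a x] c assms(1) by (simp add: a_comm m_comm)
  finally show ?case by simp
qed

lemma eval_map_uminus:
  assumes "x \<in> carrier R" "set p \<subseteq> carrier R"
  shows "eval (map (a_inv R) p) x = \<ominus> eval p x"
  using assms by (induction p) (auto simp: eval_in_carrier l_minus minus_add a_comm)

text \<open>
  If \<open>x M \<subseteq> M\<close> for a nonzero finite \<open>A\<close>-module \<open>M\<close>, then \<open>x\<close> is integral.  Instead of a characteristic
  polynomial, work in \<open>D = A[y]\<close> with \<open>y = x\<^sup>-\<^sup>1\<close>.  There \<open>M \<subseteq> y M\<close>, so if \<open>1 + y D\<close> did not contain \<open>0\<close>,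
  Nakayama's lemma would give \<open>M = 0\<close>.  Hence \<open>1 = y z\<close> with \<open>z\<close> in \<open>D\<close>, and reversing the polynomial that
  expresses \<open>z\<close> in \<open>y\<close> gives a monic equation for \<open>x\<close>.
\<close>

lemma finite_imp_integral:
  assumes A: "subring A R" and x: "x \<in> carrier R" and G: "finite G" "G \<subseteq> carrier R" "\<exists>g\<in>G. g \<noteq> \<zero>"
    and span: "\<And>g. g \<in> G \<Longrightarrow> x \<otimes> g \<in> lin_span R A G"
  shows "integral_over R A x"
proof (cases "x = \<zero>")
  case True
  note a = subringE[OF A]
  show ?thesis
    unfolding integral_over_def using True a(2,3)
    by (intro exI[of _ "[\<one>, \<zero>]"]) (auto simp: polynomial_def)
next
  case False
  note a = subringE[OF A]
  define y where "y = inv x"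
  have y: "y \<in> carrier R" "x \<otimes> y = \<one>" "y \<otimes> x = \<one>"
    using x False field_Units by (auto simp: y_def)
  define D where "D = simple_extension A y"
  have D: "subring D R" unfolding D_def by (rule simple_extension_is_subring[OF A y(1)])
  note d = subringE[OF D]
  have yD: "y \<in> D" unfolding D_def by (rule simple_extension_mem[OF A y(1)])
  have AD: "A \<subseteq> D" unfolding D_def by (rule simple_extension_incl[OF a(1) y(1)])
  define I where "I = (\<lambda>z. y \<otimes> z) ` D"
  define U where "U = {u \<in> D. \<one> \<ominus> u \<in> I}"
  have Ic: "I \<subseteq> D" using yD d(6) by (auto simp: I_def)
  have dc: "\<And>z. z \<in> D \<Longrightarrow> z \<in> carrier R" using d(1) by blast
  have ic: "\<And>z. z \<in> I \<Longrightarrow> z \<in> carrier R" using dc Ic by blast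
  have Iadd: "z \<oplus> w \<in> I" if "z \<in> I" "w \<in> I" for z w
  proof -
    obtain z' w' where "z' \<in> D" "w' \<in> D" "z = y \<otimes> z'" "w = y \<otimes> w'" using \<open>z \<in> I\<close> \<open>w \<in> I\<close> I_def by auto
    then have "z \<oplus> w = y \<otimes> (z' \<oplus> w')" "z' \<oplus> w' \<in> D" using y(1) dc d(7) by (auto simp: r_distr)
    then show ?thesis by (auto simp: I_def)
  qed
  have Imult: "c \<otimes> z \<in> I" if "c \<in> D" "z \<in> I" for c z
  proof -
    obtain z' where "z' \<in> D" "z = y \<otimes> z'" using \<open>z \<in> I\<close> I_def by auto
    then have "c \<otimes> z = y \<otimes> (c \<otimes> z')" "c \<otimes> z' \<in> D" using y(1) dc d(6) \<open>c \<in> D\<close> by (auto simp: m_lcomm)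
    then show ?thesis by (auto simp: I_def)
  qed
  have "\<zero> \<in> U"
  proof (rule ccontr)
    assume U0: "\<zero> \<notin> U"
    have "\<forall>g\<in>G. g = \<zero>"
    proof (rule nakayama[OF G(1,2), of I U])
      show "I \<subseteq> carrier R" "U \<subseteq> carrier R" using ic dc U_def by auto
      show "\<zero> \<notin> U" by (rule U0)
      show "\<zero> \<in> I" using d(2) y(1) by (auto simp: I_def intro!: image_eqI[of _ _ \<zero>])
    next
      fix z w assume "z \<in> I" "w \<in> I"
      then show "z \<oplus> w \<in> I" "z \<otimes> w \<in> I" using Iadd Imult Ic by blast+
    next
      fix u v assume uv: "u \<in> U" "v \<in> U"
      then have c: "u \<in> carrier R" "v \<in> carrier R" using dc by (auto simp: U_def)
      have "\<one> \<ominus> u \<otimes> v = (\<one> \<ominus> u) \<oplus> u \<otimes> (\<one> \<ominus> v)" using c by algebra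
      then show "u \<otimes> v \<in> U" using uv Iadd Imult d(6) by (auto simp: U_def)
    next
      fix u z assume "u \<in> U" "z \<in> I"
      then show "u \<otimes> z \<in> I" using Imult by (auto simp: U_def)
    next
      fix u z assume uz: "u \<in> U" "z \<in> I"
      then have c: "u \<in> carrier R" "z \<in> carrier R" using dc ic by (auto simp: U_def)
      have "\<one> \<ominus> (u \<ominus> z) = (\<one> \<ominus> u) \<oplus> z" using c by algebra
      then have "\<one> \<ominus> (u \<ominus> z) \<in> I" using uz Iadd by (auto simp: U_def)
      moreover have "u \<ominus> z \<in> D" using uz d(5,7) Ic by (auto simp: U_def a_minus_def)
      ultimately show "u \<ominus> z \<in> U" by (simp add: U_def)
    next
      fix g assume g: "g \<in> G"
      then have gc: "g \<in> carrier R" using G by blast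
      have "y \<otimes> (x \<otimes> g) \<in> lin_span R I G"
        by (rule lin_span_smult[OF a(1) G(2) y(1) _ span[OF g]]) (use AD in \<open>auto simp: I_def\<close>)
      moreover have "y \<otimes> (x \<otimes> g) = \<one> \<otimes> g" using y x gc by (simp flip: m_assoc)
      moreover have "\<one> \<in> U"
      proof -
        have "\<one> \<ominus> \<one> = y \<otimes> \<zero>" using y(1) by (simp add: a_minus_def r_neg)
        then show ?thesis using d(2,3) by (auto simp: U_def I_def)
      qed
      ultimately show "\<exists>u\<in>U. u \<otimes> g \<in> lin_span R I G" by auto
    qed
    then show False using G(3) by blast
  qed
  then have "\<one> \<in> I" by (simp add: U_def a_minus_def)
  then obtain z where z: "z \<in> D" "\<one> = y \<otimes> z" by (auto simp: I_def)
  then obtain p where p: "p \<in> carrier (A[X])" "z = eval p y"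
    unfolding D_def simple_extension_as_eval_img[OF a(1) y(1)] by blast
  have pA: "set p \<subseteq> A" using p(1) by (auto simp: univ_poly_def polynomial_def)
  have pc: "set p \<subseteq> carrier R" using pA a(1) by blast
  have rc: "set (rev p) \<subseteq> carrier R" using pc by simp
  have "x [^] length p = eval (rev p) x"
    using eval_reverse[OF x y(1,2) pc] x unfolding z(2)[unfolded p(2), symmetric] by simp
  then have "eval (\<one> # map (a_inv R) (rev p)) x = \<zero>"
    using eval_map_uminus[OF x rc] eval_in_carrier[OF rc x] x by (simp add: r_neg)
  then show ?thesis
    unfolding integral_over_def using pA a(3,5)
    by (intro exI[of _ "\<one> # map (a_inv R) (rev p)"]) (auto simp: polynomial_def)
qed

end

text \<open>
  The fraction \<open>c/b\<close> maps the finite module spanned by \<open>G\<close> to itself, so it is integral.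
\<close>

lemma normal_domain_divides:
  assumes normal: "normal_domain S" and A: "subring A S" and b: "b \<in> carrier S" "b \<noteq> \<zero>\<^bsub>S\<^esub>" and c: "c \<in> carrier S"
    and G: "finite G" "G \<subseteq> carrier S" "\<exists>g\<in>G. g \<noteq> \<zero>\<^bsub>S\<^esub>"
    and span: "\<And>g. g \<in> G \<Longrightarrow> \<exists>z\<in>lin_span S A G. g \<otimes>\<^bsub>S\<^esub> c = b \<otimes>\<^bsub>S\<^esub> z"
  shows "\<exists>t\<in>carrier S. c = b \<otimes>\<^bsub>S\<^esub> t"
proof -
  interpret S: domain S using normal by (simp add: normal_domain_def)
  interpret F: domain_localization S "carrier S - {\<zero>\<^bsub>S\<^esub>}" by (rule S.fraction_field_localization)
  have FF: "fraction_field S = F.Loc" by (simp add: fraction_field_def)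
  interpret L: field F.Loc using S.fraction_field_is_field unfolding FF .
  have j: "to_fraction_field S = F.toLoc" by (auto simp: to_fraction_field_def F.toLoc_def)
  let ?j = F.toLoc
  note a = subringE[OF A]
  have b0: "?j b \<noteq> \<zero>\<^bsub>F.Loc\<^esub>" using F.fraction_zero_iff[of b "\<one>\<^bsub>S\<^esub>"] b by (simp add: F.toLoc_def)
  have bu: "?j b \<in> Units F.Loc" using b F.toLoc_unit by blast
  define x where "x = ?j c \<otimes>\<^bsub>F.Loc\<^esub> inv\<^bsub>F.Loc\<^esub> (?j b)"
  have xc: "x \<in> carrier F.Loc" using bu c by (simp add: x_def)
  have bx: "?j b \<otimes>\<^bsub>F.Loc\<^esub> x = ?j c"
    unfolding x_def using bu c b F.Loc.m_lcomm[of "?j b" "?j c" "inv\<^bsub>F.Loc\<^esub> (?j b)"] by simp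
  have lin: "?j z \<in> lin_span F.Loc (?j ` carrier S) (?j ` G)" if "z \<in> lin_span S A G" for z
    using that
  proof induction
    case lin_span_zero then show ?case by (simp add: lin_span.lin_span_zero)
  next
    case (lin_span_step r g z)
    then have "r \<in> carrier S" "g \<in> carrier S" "z \<in> carrier S"
      using a(1) G S.lin_span_closed[OF a(1) G(2)] by auto
    then show ?case using lin_span_step by (auto intro: lin_span.lin_span_step)
  qed
  have "integral_over F.Loc (?j ` carrier S) x"
  proof (rule L.finite_imp_integral)
    show "subring (?j ` carrier S) F.Loc" by (rule F.toLoc.ring.img_is_subring[OF S.carrier_is_subring])
    show "x \<in> carrier F.Loc" by (rule xc)
    show "finite (?j ` G)" "?j ` G \<subseteq> carrier F.Loc" using G by auto
    show "\<exists>g\<in>?j ` G. g \<noteq> \<zero>\<^bsub>F.Loc\<^esub>"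
    proof -
      obtain g where "g \<in> G" "g \<noteq> \<zero>\<^bsub>S\<^esub>" using G(3) by blast
      then show ?thesis using F.fraction_zero_iff[of g "\<one>\<^bsub>S\<^esub>"] G(2) by (auto simp: F.toLoc_def)
    qed
    fix h assume "h \<in> ?j ` G"
    then obtain g where g: "g \<in> G" "h = ?j g" by blast
    obtain z where z: "z \<in> lin_span S A G" "g \<otimes>\<^bsub>S\<^esub> c = b \<otimes>\<^bsub>S\<^esub> z" using span g by blast
    have gc: "g \<in> carrier S" "z \<in> carrier S" using g G z S.lin_span_closed[OF a(1) G(2)] by auto
    have "?j b \<otimes>\<^bsub>F.Loc\<^esub> (x \<otimes>\<^bsub>F.Loc\<^esub> ?j g) = ?j (g \<otimes>\<^bsub>S\<^esub> c)"
      using bx b c gc xc by (simp flip: F.Loc.m_assoc) (simp add: F.Loc.m_comm)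
    also have "\<dots> = ?j b \<otimes>\<^bsub>F.Loc\<^esub> ?j z" unfolding z(2) using b gc by simp
    finally have "x \<otimes>\<^bsub>F.Loc\<^esub> ?j g = ?j z"
      using L.m_lcancel[OF b0, of "x \<otimes>\<^bsub>F.Loc\<^esub> ?j g" "?j z"] xc b gc by simp
    then show "x \<otimes>\<^bsub>F.Loc\<^esub> h \<in> lin_span F.Loc (?j ` carrier S) (?j ` G)"
      using lin[OF z(1)] g by simp
  qed
  then have "x \<in> ?j ` carrier S"
    using normal xc unfolding normal_domain_def FF j by blast
  then obtain t where t: "t \<in> carrier S" "x = ?j t" by blast
  then have "?j (b \<otimes>\<^bsub>S\<^esub> t) = ?j c" using bx b by simp
  then have "b \<otimes>\<^bsub>S\<^esub> t = c" by (rule inj_onD[OF F.toLoc_inj]) (use t b c in auto)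
  then have "c = b \<otimes>\<^bsub>S\<^esub> t" by simp
  then show ?thesis using t by blast
qed

section \<open>Noetherian extensions\<close>

context cring
begin

lemma ideal_criterion:
  assumes "I \<subseteq> carrier R" "\<zero> \<in> I" "\<And>x y. x \<in> I \<Longrightarrow> y \<in> I \<Longrightarrow> x \<oplus> y \<in> I"
    "\<And>a x. a \<in> carrier R \<Longrightarrow> x \<in> I \<Longrightarrow> a \<otimes> x \<in> I"
  shows "ideal I R"
proof (rule idealI[OF ring_axioms])
  show "subgroup I (add_monoid R)"
  proof (rule add.subgroupI)
    fix x assume x: "x \<in> I"
    then have "(\<ominus> \<one>) \<otimes> x \<in> I" using assms(4) by simp
    then show "\<ominus> x \<in> I" using x assms(1) by (auto simp: l_minus subset_iff)
  qed (use assms in auto)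
  fix a x assume "a \<in> I" "x \<in> carrier R"
  then have "x \<otimes> a \<in> I" "x \<otimes> a = a \<otimes> x" using assms(1,4) by (auto intro: m_comm)
  then show "x \<otimes> a \<in> I" "a \<otimes> x \<in> I" by simp_all
qed

lemma lin_span_ideal:
  assumes "K \<subseteq> carrier R"
  shows "ideal (lin_span R (carrier R) K) R"
proof (rule ideal_criterion)
  show "lin_span R (carrier R) K \<subseteq> carrier R" using lin_span_closed[OF _ assms] by blast
  show "\<zero> \<in> lin_span R (carrier R) K" by (rule lin_span_zero)
  show "x \<oplus> y \<in> lin_span R (carrier R) K"
    if "x \<in> lin_span R (carrier R) K" "y \<in> lin_span R (carrier R) K" for x y
    using lin_span_add[OF _ assms that] by simp
  show "a \<otimes> x \<in> lin_span R (carrier R) K"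
    if "a \<in> carrier R" "x \<in> lin_span R (carrier R) K" for a x
    by (rule lin_span_smult[OF _ assms _ _ that(2)]) (use that in auto)
qed

lemma genideal_lin_span:
  assumes "K \<subseteq> carrier R" "x \<in> Idl K"
  shows "x \<in> lin_span R (carrier R) K"
proof -
  have "K \<subseteq> lin_span R (carrier R) K" using lin_span_base[OF _ assms(1)] by auto
  then show ?thesis using genideal_minimal[OF lin_span_ideal[OF assms(1)]] assms(2) by blast
qed

lemma primeideal_prime_in:
  assumes "primeideal Q R"
  shows "prime_in R (carrier R) Q"
proof -
  interpret Q: primeideal Q R by (rule assms)
  show ?thesis unfolding prime_in_def
    using carrier_is_subring Q.a_subset Q.one_imp_carrier Q.I_notcarr Q.zero_closed Q.a_closed
      Q.I_l_closed Q.I_prime by (intro conjI) auto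
qed

lemma noetherian_maximal_ideal:
  assumes "noetherian_ring R" "\<I> \<noteq> {}" "\<And>I. I \<in> \<I> \<Longrightarrow> ideal I R"
  obtains M where "M \<in> \<I>" "\<And>I. I \<in> \<I> \<Longrightarrow> M \<subseteq> I \<Longrightarrow> I = M"
proof -
  have "\<Union>\<C> \<in> \<I>" if "\<C> \<noteq> {}" "subset.chain \<I> \<C>" for \<C>
  proof -
    have "subset.chain {I. ideal I R} \<C>" using that(2) assms(3) by (auto simp: subset_chain_def)
    then have "\<Union>\<C> \<in> \<C>" using noetherian_ring.ideal_chain_is_trivial[OF assms(1) that(1)] by blast
    then show ?thesis using that(2) by (auto simp: subset_chain_def)
  qed
  then show ?thesis using subset_Zorn_nonempty[OF assms(2)] that by blast
qed

end

context finite_domain_extension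
begin

abbreviation "A \<equiv> \<iota> ` carrier R"

lemma A_subring: "subring A S" by (rule \<iota>.ring.img_is_subring[OF R.carrier_is_subring])
lemma A_carrier: "A \<subseteq> carrier S" by auto

text \<open>
  Submodules of finite modules over a noetherian ring: by induction on the generators, with the ideal
  of leading coefficients at the generator \<open>h\<close>.
\<close>

lemma submodule_finitely_generated:
  assumes noeth: "noetherian_ring R" and "finite G" "G \<subseteq> carrier S" "N \<subseteq> lin_span S A G"
    and "\<zero>\<^bsub>S\<^esub> \<in> N" "\<And>x y. x \<in> N \<Longrightarrow> y \<in> N \<Longrightarrow> x \<oplus>\<^bsub>S\<^esub> y \<in> N"
    "\<And>r x. r \<in> carrier R \<Longrightarrow> x \<in> N \<Longrightarrow> \<iota> r \<otimes>\<^bsub>S\<^esub> x \<in> N"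
  shows "\<exists>C. finite C \<and> C \<subseteq> N \<and> N \<subseteq> lin_span S A C"
  using assms(2-)
proof (induction G arbitrary: N rule: finite_induct)
  case empty
  have "x = \<zero>\<^bsub>S\<^esub>" if "x \<in> lin_span S A {}" for x using that by cases auto
  then have "N \<subseteq> lin_span S A {}" using empty by (auto intro: lin_span.intros)
  then show ?case by blast
next
  case (insert h G)
  note N = insert.prems(2-5)
  have h: "h \<in> carrier S" and G: "G \<subseteq> carrier S" using insert.prems(1) by auto
  have spc: "\<And>z. z \<in> lin_span S A G \<Longrightarrow> z \<in> carrier S" using S.lin_span_closed[OF A_carrier G] .
  have sp_add: "\<And>x y. x \<in> lin_span S A G \<Longrightarrow> y \<in> lin_span S A G \<Longrightarrow> x \<oplus>\<^bsub>S\<^esub> y \<in> lin_span S A G"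
    using S.lin_span_add[OF A_carrier G] .
  have sp_mult: "\<iota> r \<otimes>\<^bsub>S\<^esub> x \<in> lin_span S A G" if "r \<in> carrier R" "x \<in> lin_span S A G" for r x
    by (rule S.lin_span_smult[OF A_carrier G _ _ that(2)]) (use that subringE(6)[OF A_subring] in auto)
  have Nc: "N \<subseteq> carrier S" using N(1) S.lin_span_closed[OF A_carrier insert.prems(1)] by blast
  define I where "I = {r \<in> carrier R. \<exists>z\<in>lin_span S A G. \<iota> r \<otimes>\<^bsub>S\<^esub> h \<oplus>\<^bsub>S\<^esub> z \<in> N}"
  have "ideal I R"
  proof (rule R.ideal_criterion)
    show "I \<subseteq> carrier R" by (auto simp: I_def)
    have "\<iota> \<zero>\<^bsub>R\<^esub> \<otimes>\<^bsub>S\<^esub> h \<oplus>\<^bsub>S\<^esub> \<zero>\<^bsub>S\<^esub> \<in> N" using h N(2) by simp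
    then show "\<zero>\<^bsub>R\<^esub> \<in> I" using lin_span_zero[of S A G] by (auto simp: I_def)
  next
    fix r s assume "r \<in> I" "s \<in> I"
    then obtain z w where zw: "r \<in> carrier R" "s \<in> carrier R" "z \<in> lin_span S A G" "w \<in> lin_span S A G"
      "\<iota> r \<otimes>\<^bsub>S\<^esub> h \<oplus>\<^bsub>S\<^esub> z \<in> N" "\<iota> s \<otimes>\<^bsub>S\<^esub> h \<oplus>\<^bsub>S\<^esub> w \<in> N" by (auto simp: I_def)
    have "\<iota> (r \<oplus>\<^bsub>R\<^esub> s) \<otimes>\<^bsub>S\<^esub> h \<oplus>\<^bsub>S\<^esub> (z \<oplus>\<^bsub>S\<^esub> w) = (\<iota> r \<otimes>\<^bsub>S\<^esub> h \<oplus>\<^bsub>S\<^esub> z) \<oplus>\<^bsub>S\<^esub> (\<iota> s \<otimes>\<^bsub>S\<^esub> h \<oplus>\<^bsub>S\<^esub> w)"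
      using zw(1,2) spc[OF zw(3)] spc[OF zw(4)] h by (simp add: S.l_distr S.a_ac)
    then show "r \<oplus>\<^bsub>R\<^esub> s \<in> I" using zw sp_add N(3) unfolding I_def by (metis (mono_tags, lifting) CollectI R.add.m_closed)
  next
    fix r s assume r: "r \<in> carrier R" and "s \<in> I"
    then obtain z where z: "s \<in> carrier R" "z \<in> lin_span S A G" "\<iota> s \<otimes>\<^bsub>S\<^esub> h \<oplus>\<^bsub>S\<^esub> z \<in> N" by (auto simp: I_def)
    have "\<iota> (r \<otimes>\<^bsub>R\<^esub> s) \<otimes>\<^bsub>S\<^esub> h \<oplus>\<^bsub>S\<^esub> \<iota> r \<otimes>\<^bsub>S\<^esub> z = \<iota> r \<otimes>\<^bsub>S\<^esub> (\<iota> s \<otimes>\<^bsub>S\<^esub> h \<oplus>\<^bsub>S\<^esub> z)"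
      using z(1) spc[OF z(2)] h r by (simp add: S.r_distr S.m_ac)
    then show "r \<otimes>\<^bsub>R\<^esub> s \<in> I" using z sp_mult r N(4) unfolding I_def by (metis (mono_tags, lifting) CollectI R.m_closed)
  qed
  then obtain K where K: "K \<subseteq> carrier R" "finite K" "I = Idl\<^bsub>R\<^esub> K"
    using noetherian_ring.finetely_gen[OF noeth] by blast
  have "K \<subseteq> I" using K(3) R.genideal_self[OF K(1)] by blast
  then have "\<forall>k\<in>K. \<exists>z\<in>lin_span S A G. \<iota> k \<otimes>\<^bsub>S\<^esub> h \<oplus>\<^bsub>S\<^esub> z \<in> N" by (auto simp: I_def)
  then obtain zf where zf: "\<And>k. k \<in> K \<Longrightarrow> zf k \<in> lin_span S A G \<and> \<iota> k \<otimes>\<^bsub>S\<^esub> h \<oplus>\<^bsub>S\<^esub> zf k \<in> N" by metis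
  define nf where "nf k = \<iota> k \<otimes>\<^bsub>S\<^esub> h \<oplus>\<^bsub>S\<^esub> zf k" for k
  have nfN: "nf ` K \<subseteq> N" using zf by (auto simp: nf_def)
  have "\<exists>C. finite C \<and> C \<subseteq> N \<inter> lin_span S A G \<and> N \<inter> lin_span S A G \<subseteq> lin_span S A C"
    by (rule insert.IH) (use G N sp_add sp_mult lin_span_zero[of S A G] in auto)
  then obtain C where C: "finite C" "C \<subseteq> N" "N \<inter> lin_span S A G \<subseteq> lin_span S A C" by blast
  let ?C = "nf ` K \<union> C"
  have Cc: "?C \<subseteq> carrier S" using nfN C(2) Nc by blast
  have lift: "\<exists>y z. y \<in> lin_span S A (nf ` K) \<and> y \<in> N \<and> z \<in> lin_span S A G \<and> y = \<iota> r \<otimes>\<^bsub>S\<^esub> h \<oplus>\<^bsub>S\<^esub> z"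
    if "r \<in> lin_span R (carrier R) K" for r
    using that
  proof induction
    case lin_span_zero
    have "\<zero>\<^bsub>S\<^esub> = \<iota> \<zero>\<^bsub>R\<^esub> \<otimes>\<^bsub>S\<^esub> h \<oplus>\<^bsub>S\<^esub> \<zero>\<^bsub>S\<^esub>" using h by simp
    then show ?case using N(2) lin_span.lin_span_zero by metis
  next
    case (lin_span_step a k r)
    then obtain y z where yz: "y \<in> lin_span S A (nf ` K)" "y \<in> N" "z \<in> lin_span S A G" "y = \<iota> r \<otimes>\<^bsub>S\<^esub> h \<oplus>\<^bsub>S\<^esub> z" by blast
    have k: "k \<in> carrier R" "r \<in> carrier R" "zf k \<in> lin_span S A G" "nf k \<in> N"
      using lin_span_step K(1) R.lin_span_closed[OF _ K(1)] zf by (auto simp: nf_def)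
    have "\<iota> a \<otimes>\<^bsub>S\<^esub> nf k \<oplus>\<^bsub>S\<^esub> y = \<iota> (a \<otimes>\<^bsub>R\<^esub> k \<oplus>\<^bsub>R\<^esub> r) \<otimes>\<^bsub>S\<^esub> h \<oplus>\<^bsub>S\<^esub> (\<iota> a \<otimes>\<^bsub>S\<^esub> zf k \<oplus>\<^bsub>S\<^esub> z)"
      unfolding nf_def yz(4) using lin_span_step(1) k(1,2) spc[OF k(3)] spc[OF yz(3)] h
      by (simp add: S.r_distr S.l_distr S.m_ac S.a_ac)
    moreover have "\<iota> a \<otimes>\<^bsub>S\<^esub> nf k \<oplus>\<^bsub>S\<^esub> y \<in> lin_span S A (nf ` K)"
      using lin_span_step yz by (intro lin_span.lin_span_step) auto
    moreover have "\<iota> a \<otimes>\<^bsub>S\<^esub> nf k \<oplus>\<^bsub>S\<^esub> y \<in> N" using N(3,4) lin_span_step(1) k(4) yz(2) by blast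
    moreover have "\<iota> a \<otimes>\<^bsub>S\<^esub> zf k \<oplus>\<^bsub>S\<^esub> z \<in> lin_span S A G" using sp_add sp_mult lin_span_step(1) k(3) yz(3) by blast
    ultimately show ?case by blast
  qed
  have "x \<in> lin_span S A ?C" if x: "x \<in> N" for x
  proof -
    have xs: "x \<in> lin_span S A (insert h G)" using N(1) x by blast
    obtain a z where az: "a \<in> A" "z \<in> lin_span S A G" "x = a \<otimes>\<^bsub>S\<^esub> h \<oplus>\<^bsub>S\<^esub> z"
      by (rule S.lin_span_insertE[OF A_carrier insert.prems(1) _ _ xs]) (use subringE(2,7)[OF A_subring] in auto)
    then obtain r where r: "r \<in> carrier R" "a = \<iota> r" by blast
    have "\<iota> r \<otimes>\<^bsub>S\<^esub> h \<oplus>\<^bsub>S\<^esub> z \<in> N" using az(3) x r(2) by simp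
    then have "r \<in> I" unfolding I_def using az(2) r(1) by blast
    then have "r \<in> lin_span R (carrier R) K" using R.genideal_lin_span[OF K(1)] K(3) by blast
    then obtain y w where yw: "y \<in> lin_span S A (nf ` K)" "y \<in> N" "w \<in> lin_span S A G" "y = \<iota> r \<otimes>\<^bsub>S\<^esub> h \<oplus>\<^bsub>S\<^esub> w"
      using lift by blast
    let ?m = "\<iota> (\<ominus>\<^bsub>R\<^esub> \<one>\<^bsub>R\<^esub>)"
    have c: "z \<in> carrier S" "w \<in> carrier S" "\<iota> r \<in> carrier S" using spc az yw r by auto
    have d1: "x \<oplus>\<^bsub>S\<^esub> ?m \<otimes>\<^bsub>S\<^esub> y = z \<oplus>\<^bsub>S\<^esub> ?m \<otimes>\<^bsub>S\<^esub> w"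
    proof -
      have "(u \<otimes>\<^bsub>S\<^esub> h \<oplus>\<^bsub>S\<^esub> z) \<oplus>\<^bsub>S\<^esub> (\<ominus>\<^bsub>S\<^esub> \<one>\<^bsub>S\<^esub>) \<otimes>\<^bsub>S\<^esub> (u \<otimes>\<^bsub>S\<^esub> h \<oplus>\<^bsub>S\<^esub> w) = z \<oplus>\<^bsub>S\<^esub> (\<ominus>\<^bsub>S\<^esub> \<one>\<^bsub>S\<^esub>) \<otimes>\<^bsub>S\<^esub> w" if "u \<in> carrier S" for u
        using that c(1,2) h by algebra
      then show ?thesis unfolding az(3) yw(4) r(2) using c(3) by simp
    qed
    have "x \<oplus>\<^bsub>S\<^esub> ?m \<otimes>\<^bsub>S\<^esub> y \<in> N" by (rule N(3)[OF x N(4)[OF _ yw(2)]]) simp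
    moreover have "z \<oplus>\<^bsub>S\<^esub> ?m \<otimes>\<^bsub>S\<^esub> w \<in> lin_span S A G" by (rule sp_add[OF az(2) sp_mult[OF _ yw(3)]]) simp
    ultimately have "x \<oplus>\<^bsub>S\<^esub> ?m \<otimes>\<^bsub>S\<^esub> y \<in> lin_span S A C" using C(3) d1 by auto
    then have 1: "x \<oplus>\<^bsub>S\<^esub> ?m \<otimes>\<^bsub>S\<^esub> y \<in> lin_span S A ?C" by (rule S.lin_span_mono[rotated 2]) auto
    have 2: "y \<in> lin_span S A ?C" by (rule S.lin_span_mono[OF _ _ yw(1)]) auto
    have xy: "x \<in> carrier S" "y \<in> carrier S" using Nc x yw by auto
    have "x = (x \<oplus>\<^bsub>S\<^esub> (\<ominus>\<^bsub>S\<^esub> \<one>\<^bsub>S\<^esub>) \<otimes>\<^bsub>S\<^esub> y) \<oplus>\<^bsub>S\<^esub> y" using xy by algebra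
    then show ?thesis using S.lin_span_add[OF A_carrier Cc 1 2] by simp
  qed
  then have "N \<subseteq> lin_span S A ?C" by blast
  moreover have "finite ?C" "?C \<subseteq> N" using K(2) C nfN by auto
  ultimately show ?case by blast
qed

lemma ideal_finitely_generated:
  assumes "noetherian_ring R" "ideal N S"
  obtains C where "finite C" "C \<subseteq> N" "N \<subseteq> lin_span S A C"
proof -
  interpret N: ideal N S by (rule assms(2))
  have "\<exists>C. finite C \<and> C \<subseteq> N \<and> N \<subseteq> lin_span S A C"
    by (rule submodule_finitely_generated[OF assms(1) B])
       (use span N.a_subset N.zero_closed N.a_closed N.I_l_closed in auto)
  then show ?thesis using that by blast
qed

lemma noetherian_extension:
  assumes "noetherian_ring R"
  shows "noetherian_ring S"
proof (rule S.noetherian_ringI)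
  fix N assume N: "ideal N S"
  interpret N: ideal N S by (rule N)
  obtain C where C: "finite C" "C \<subseteq> N" "N \<subseteq> lin_span S A C"
    using ideal_finitely_generated[OF assms N] by blast
  have Cc: "C \<subseteq> carrier S" using C(2) N.a_subset by blast
  interpret J: ideal "Idl\<^bsub>S\<^esub> C" S by (rule S.genideal_ideal[OF Cc])
  have CJ: "C \<subseteq> Idl\<^bsub>S\<^esub> C" by (rule S.genideal_self[OF Cc])
  have "N \<subseteq> Idl\<^bsub>S\<^esub> C"
  proof
    fix x assume "x \<in> N"
    then have "x \<in> lin_span S A C" using C(3) by blast
    then show "x \<in> Idl\<^bsub>S\<^esub> C"
    proof induction
      case (lin_span_step a g x)
      then have "a \<otimes>\<^bsub>S\<^esub> g \<in> Idl\<^bsub>S\<^esub> C" using CJ A_carrier by (intro J.I_l_closed) auto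
      then show ?case using lin_span_step by auto
    qed simp
  qed
  then have "N = Idl\<^bsub>S\<^esub> C" using S.genideal_minimal[OF N C(2)] by blast
  then show "\<exists>C\<subseteq>carrier S. finite C \<and> N = Idl\<^bsub>S\<^esub> C" using C(1) Cc by blast
qed

section \<open>Denominators of height at most one\<close>

text \<open>
  The conductors \<open>(b : s a)\<close> of those multiples of \<open>a/b\<close> that are not in \<open>S\<close> are proper ideals, and a maximal one
  is prime: if \<open>x y\<close> is in it and \<open>y\<close> is not, then \<open>(b : y s a)\<close> is also proper and contains both \<open>(b : s a)\<close>
  and \<open>x\<close>.
\<close>

lemma maximal_conductor_prime:
  assumes "noetherian_ring S" and a: "a \<in> carrier S" and b: "b \<in> carrier S"
    and nd: "\<not> (\<exists>l\<in>carrier S. a = b \<otimes>\<^bsub>S\<^esub> l)"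
  obtains s Q where "s \<in> carrier S" "primeideal Q S"
    "Q = {x \<in> carrier S. \<exists>t\<in>carrier S. x \<otimes>\<^bsub>S\<^esub> (s \<otimes>\<^bsub>S\<^esub> a) = b \<otimes>\<^bsub>S\<^esub> t}"
    "\<not> (\<exists>l\<in>carrier S. s \<otimes>\<^bsub>S\<^esub> a = b \<otimes>\<^bsub>S\<^esub> l)"
proof -
  define q where "q s = {x \<in> carrier S. \<exists>t\<in>carrier S. x \<otimes>\<^bsub>S\<^esub> (s \<otimes>\<^bsub>S\<^esub> a) = b \<otimes>\<^bsub>S\<^esub> t}" for s
  define bad where "bad s \<longleftrightarrow> s \<in> carrier S \<and> \<not> (\<exists>l\<in>carrier S. s \<otimes>\<^bsub>S\<^esub> a = b \<otimes>\<^bsub>S\<^esub> l)" for s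
  have qi: "ideal (q s) S" if s: "s \<in> carrier S" for s
  proof (rule S.ideal_criterion)
    show "q s \<subseteq> carrier S" by (auto simp: q_def)
    show "\<zero>\<^bsub>S\<^esub> \<in> q s" using s a b by (auto simp: q_def intro!: bexI[of _ "\<zero>\<^bsub>S\<^esub>"])
  next
    fix x y assume "x \<in> q s" "y \<in> q s"
    then obtain t u where h: "x \<in> carrier S" "y \<in> carrier S" "t \<in> carrier S" "u \<in> carrier S"
      "x \<otimes>\<^bsub>S\<^esub> (s \<otimes>\<^bsub>S\<^esub> a) = b \<otimes>\<^bsub>S\<^esub> t" "y \<otimes>\<^bsub>S\<^esub> (s \<otimes>\<^bsub>S\<^esub> a) = b \<otimes>\<^bsub>S\<^esub> u" by (auto simp: q_def)
    then have "(x \<oplus>\<^bsub>S\<^esub> y) \<otimes>\<^bsub>S\<^esub> (s \<otimes>\<^bsub>S\<^esub> a) = b \<otimes>\<^bsub>S\<^esub> (t \<oplus>\<^bsub>S\<^esub> u)"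
      using s a b by (simp add: S.l_distr S.r_distr)
    then show "x \<oplus>\<^bsub>S\<^esub> y \<in> q s" using h by (auto simp: q_def)
  next
    fix x y assume x: "x \<in> carrier S" and "y \<in> q s"
    then obtain u where h: "y \<in> carrier S" "u \<in> carrier S" "y \<otimes>\<^bsub>S\<^esub> (s \<otimes>\<^bsub>S\<^esub> a) = b \<otimes>\<^bsub>S\<^esub> u" by (auto simp: q_def)
    have "(x \<otimes>\<^bsub>S\<^esub> y) \<otimes>\<^bsub>S\<^esub> (s \<otimes>\<^bsub>S\<^esub> a) = x \<otimes>\<^bsub>S\<^esub> (y \<otimes>\<^bsub>S\<^esub> (s \<otimes>\<^bsub>S\<^esub> a))"
      using x h(1) s a by (simp add: S.m_assoc)
    also have "\<dots> = b \<otimes>\<^bsub>S\<^esub> (x \<otimes>\<^bsub>S\<^esub> u)" unfolding h(3) using x h(2) b by (simp add: S.m_lcomm)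
    finally show "x \<otimes>\<^bsub>S\<^esub> y \<in> q s" using h x by (auto simp: q_def)
  qed
  have "bad \<one>\<^bsub>S\<^esub>" using nd a by (simp add: bad_def)
  then have "q ` {s. bad s} \<noteq> {}" by blast
  then obtain M where M: "M \<in> q ` {s. bad s}" "\<And>I. I \<in> q ` {s. bad s} \<Longrightarrow> M \<subseteq> I \<Longrightarrow> I = M"
    by (rule S.noetherian_maximal_ideal[OF assms(1)]) (use qi bad_def in blast)+
  then obtain s where s: "bad s" "M = q s" by blast
  have sc: "s \<in> carrier S" using s(1) by (simp add: bad_def)
  have "primeideal M S"
  proof (rule primeidealI)
    show "ideal M S" using qi sc s by simp
    show "cring S" by (rule S.is_cring)
    show "carrier S \<noteq> M"
    proof
      assume "carrier S = M"
      then have "\<one>\<^bsub>S\<^esub> \<in> q s" using s by auto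
      then show False using s(1) a sc by (auto simp: q_def bad_def)
    qed
  next
    fix x y assume xy: "x \<in> carrier S" "y \<in> carrier S" "x \<otimes>\<^bsub>S\<^esub> y \<in> M"
    show "x \<in> M \<or> y \<in> M"
    proof (rule ccontr)
      assume neg: "\<not> ?thesis"
      have ys: "y \<otimes>\<^bsub>S\<^esub> s \<in> carrier S" using xy sc by simp
      have "bad (y \<otimes>\<^bsub>S\<^esub> s)"
        using neg s(2) xy sc a by (auto simp: q_def bad_def S.m_assoc)
      moreover have "q s \<subseteq> q (y \<otimes>\<^bsub>S\<^esub> s)"
      proof
        fix z assume "z \<in> q s"
        then obtain u where h: "z \<in> carrier S" "u \<in> carrier S" "z \<otimes>\<^bsub>S\<^esub> (s \<otimes>\<^bsub>S\<^esub> a) = b \<otimes>\<^bsub>S\<^esub> u" by (auto simp: q_def)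
        have "z \<otimes>\<^bsub>S\<^esub> ((y \<otimes>\<^bsub>S\<^esub> s) \<otimes>\<^bsub>S\<^esub> a) = y \<otimes>\<^bsub>S\<^esub> (z \<otimes>\<^bsub>S\<^esub> (s \<otimes>\<^bsub>S\<^esub> a))"
          using h(1) xy sc a by (simp add: S.m_ac)
        also have "\<dots> = b \<otimes>\<^bsub>S\<^esub> (y \<otimes>\<^bsub>S\<^esub> u)" unfolding h(3) using xy h(2) b by (simp add: S.m_lcomm)
        finally show "z \<in> q (y \<otimes>\<^bsub>S\<^esub> s)" using h xy by (auto simp: q_def)
      qed
      ultimately have "q (y \<otimes>\<^bsub>S\<^esub> s) = q s" using M(2) s(2) by blast
      moreover have "x \<in> q (y \<otimes>\<^bsub>S\<^esub> s)"
      proof -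
        obtain u where "u \<in> carrier S" "(x \<otimes>\<^bsub>S\<^esub> y) \<otimes>\<^bsub>S\<^esub> (s \<otimes>\<^bsub>S\<^esub> a) = b \<otimes>\<^bsub>S\<^esub> u" using xy(3) s(2) by (auto simp: q_def)
        then show ?thesis using xy sc a by (auto simp: q_def S.m_assoc)
      qed
      ultimately show False using neg s(2) by simp
    qed
  qed
  then show ?thesis using that[OF sc, of M] s unfolding q_def bad_def by blast
qed

text \<open>
  The case of Krull's principal ideal theorem in which \<open>Q\<close> itself is locally generated by \<open>q\<close>.  A prime
  \<open>P1\<close> strictly inside \<open>Q\<close> does not contain \<open>q\<close>, so \<open>P1 = q P1\<close> locally and \<open>P1 = 0\<close> by Nakayama's lemma; thus
  nothing fits below \<open>P1\<close>.
\<close>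

lemma locally_principal_height_le_1:
  assumes noeth: "noetherian_ring R" and Q: "primeideal Q S" and q: "q \<in> Q" and t: "t \<in> carrier S" "t \<notin> Q"
    and div: "\<And>x. x \<in> Q \<Longrightarrow> \<exists>y\<in>carrier S. t \<otimes>\<^bsub>S\<^esub> x = q \<otimes>\<^bsub>S\<^esub> y"
  shows "height S Q \<le> 1"
  unfolding height_def
proof (rule SUP_least)
  fix n assume "n \<in> {n. \<exists>P. (\<forall>i\<le>n. primeideal (P i) S) \<and> (\<forall>i<n. P i \<subset> P (Suc i)) \<and> P n = Q}"
  then obtain P where P: "\<And>i. i \<le> n \<Longrightarrow> primeideal (P i) S" "\<And>i. i < n \<Longrightarrow> P i \<subset> P (Suc i)" "P n = Q" by blast
  show "enat n \<le> 1"
  proof (rule ccontr)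
    assume "\<not> enat n \<le> 1"
    then have "\<not> n \<le> 1" by (simp add: one_enat_def)
    then obtain k where k: "n = Suc (Suc k)" by (metis One_nat_def Suc_le_mono le0 not0_implies_Suc)
    define P1 where "P1 = P (Suc k)"
    have P1: "primeideal P1 S" "P k \<subset> P1" "P1 \<subset> Q" "primeideal (P k) S"
      using P(1)[of "Suc k"] P(1)[of k] P(2)[of k] P(2)[of "Suc k"] P(3) k by (auto simp: P1_def)
    interpret Q: primeideal Q S by (rule Q)
    interpret P1: primeideal P1 S by (rule P1(1))
    interpret P0: primeideal "P k" S by (rule P1(4))
    have qc: "q \<in> carrier S" using q Q.Icarr by blast
    have tP1: "t \<notin> P1" using t P1(3) by blast
    have qP1: "q \<notin> P1"
    proof
      assume qP: "q \<in> P1"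
      have "x \<in> P1" if x: "x \<in> Q" for x
      proof -
        obtain y where "y \<in> carrier S" "t \<otimes>\<^bsub>S\<^esub> x = q \<otimes>\<^bsub>S\<^esub> y" using div x by blast
        then have "t \<otimes>\<^bsub>S\<^esub> x \<in> P1" using qP P1.I_r_closed by simp
        then show ?thesis using P1.I_prime[OF t(1)] x Q.Icarr tP1 by blast
      qed
      then show False using P1(3) by blast
    qed
    obtain C where C: "finite C" "C \<subseteq> P1" "P1 \<subseteq> lin_span S A C"
      using ideal_finitely_generated[OF noeth P1.is_ideal] by blast
    have Cc: "C \<subseteq> carrier S" using C(2) P1.a_subset by blast
    have "\<forall>g\<in>C. g = \<zero>\<^bsub>S\<^esub>"
    proof (rule S.nakayama_at_prime[OF S.primeideal_prime_in[OF Q] C(1) Cc])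
      fix g assume g: "g \<in> C"
      then have gP: "g \<in> P1" using C(2) by blast
      then have gQ: "g \<in> Q" using P1(3) by blast
      then obtain y where y: "y \<in> carrier S" "t \<otimes>\<^bsub>S\<^esub> g = q \<otimes>\<^bsub>S\<^esub> y" using div by blast
      have "t \<otimes>\<^bsub>S\<^esub> g \<in> P1" using gP t(1) P1.I_l_closed by blast
      then have "y \<in> P1" using P1.I_prime[OF qc y(1)] qP1 y(2) by simp
      then have "y \<in> lin_span S A C" using C(3) by blast
      then have "q \<otimes>\<^bsub>S\<^esub> y \<in> lin_span S Q C"
        by (rule S.lin_span_smult[OF A_carrier Cc qc, rotated]) (use q Q.I_r_closed in auto)
      then show "\<exists>u\<in>carrier S - Q. u \<otimes>\<^bsub>S\<^esub> g \<in> lin_span S Q C"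
        using y(2) t by (intro bexI[of _ t]) simp_all
    qed
    then have "x = \<zero>\<^bsub>S\<^esub>" if "x \<in> lin_span S A C" for x
    proof -
      assume C0: "\<forall>g\<in>C. g = \<zero>\<^bsub>S\<^esub>"
      show ?thesis using that
      proof induction
        case (lin_span_step a g x)
        then have "a \<in> carrier S" "g = \<zero>\<^bsub>S\<^esub>" using A_carrier C0 by auto
        then show ?case using lin_span_step by simp
      qed simp
    qed
    then have "P1 \<subseteq> {\<zero>\<^bsub>S\<^esub>}" using C(3) by blast
    then have "P1 \<subseteq> P k" using P0.zero_closed by blast
    then show False using P1(2) by blast
  qed
qed

end

section \<open>Trace functionals have no denominators in codimension one\<close>

text \<open>
  A functional \<open>\<Sum>\<^sub>\<sigma> \<sigma> (l y)\<close> with values in \<open>R\<close> and \<open>l = a/b\<close> has \<open>l\<close> in \<open>S\<close>; this is the triviality of the codifferent of an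
  extension that is unramified in codimension one.  A pole of \<open>l\<close> would be visible at a prime of height one, where the extension is
  unramified and the conjugates are independent modulo a prime over it.
\<close>

lemma (in extension_homs) functional_numerator_divisible:
  assumes noeth: "noetherian_ring R" and normal: "normal_domain S"
    and unr: "\<And>Q. primeideal Q S \<Longrightarrow> height S Q \<le> 1 \<Longrightarrow> unramified_at R S \<iota> Q"
    and H: "finite H" "H \<noteq> {}" "\<And>\<sigma>. \<sigma> \<in> H \<Longrightarrow> is_ext \<sigma>"
      "\<And>\<sigma> \<tau>. \<sigma> \<in> H \<Longrightarrow> \<tau> \<in> H \<Longrightarrow> (\<And>s. s \<in> carrier S \<Longrightarrow> \<sigma> s = \<tau> s) \<Longrightarrow> \<sigma> = \<tau>"
    and \<phi>: "\<And>y. y \<in> carrier S \<Longrightarrow> \<phi> y \<in> carrier R"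
    and ab: "a \<in> carrier S" "b \<in> carrier S" "b \<noteq> \<zero>\<^bsub>S\<^esub>"
    and c: "\<And>\<sigma>. \<sigma> \<in> H \<Longrightarrow> c \<sigma> \<in> carrier E \<and> c \<sigma> \<otimes>\<^bsub>E\<^esub> \<sigma> b = \<sigma> a"
    and rep: "\<And>y. y \<in> carrier S \<Longrightarrow> (\<Oplus>\<^bsub>E\<^esub>\<sigma>\<in>H. c \<sigma> \<otimes>\<^bsub>E\<^esub> \<sigma> y) = \<eta> (\<phi> y)"
  shows "\<exists>l\<in>carrier S. a = b \<otimes>\<^bsub>S\<^esub> l"
proof (rule ccontr)
  assume nab: "\<not> ?thesis"
  obtain s Q where s: "s \<in> carrier S" and Qp: "primeideal Q S"
    and Qdef: "Q = {x \<in> carrier S. \<exists>t\<in>carrier S. x \<otimes>\<^bsub>S\<^esub> (s \<otimes>\<^bsub>S\<^esub> a) = b \<otimes>\<^bsub>S\<^esub> t}"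
    and nd: "\<not> (\<exists>l\<in>carrier S. s \<otimes>\<^bsub>S\<^esub> a = b \<otimes>\<^bsub>S\<^esub> l)"
    by (rule maximal_conductor_prime[OF noetherian_extension[OF noeth] ab(1,2) nab])
  interpret Q: primeideal Q S by (rule Qp)
  \<comment> \<open>So \<open>Q\<close> consists of the \<open>x\<close> with \<open>x (d/b)\<close> in \<open>S\<close>.\<close>
  define d where "d = s \<otimes>\<^bsub>S\<^esub> a"
  have d: "d \<in> carrier S" using s ab by (simp add: d_def)
  have Qc: "Q \<subseteq> carrier S" by (rule Q.a_subset)
  have Qd: "\<exists>t\<in>carrier S. x \<otimes>\<^bsub>S\<^esub> d = b \<otimes>\<^bsub>S\<^esub> t" if "x \<in> Q" for x
    using that unfolding Qdef d_def by blast
  have "b \<in> Q" unfolding Qdef using ab s by blast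
  \<comment> \<open>If \<open>d/b\<close> mapped \<open>Q\<close> into \<open>Q\<close>, it would be integral and hence in \<open>S\<close>.  So some \<open>q\<close> in \<open>Q\<close> is mapped
    to a local unit \<open>t\<close>, and then \<open>q\<close> generates \<open>Q\<close> locally.\<close>
  have "\<exists>q\<in>Q. \<exists>t\<in>carrier S - Q. q \<otimes>\<^bsub>S\<^esub> d = b \<otimes>\<^bsub>S\<^esub> t"
  proof (rule ccontr)
    assume neg: "\<not> ?thesis"
    obtain C where C: "finite C" "C \<subseteq> Q" "Q \<subseteq> lin_span S A C"
      using ideal_finitely_generated[OF noeth Q.is_ideal] by blast
    have "\<exists>g\<in>C. g \<noteq> \<zero>\<^bsub>S\<^esub>"
    proof (rule ccontr)
      assume C0: "\<not> ?thesis"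
      have "x = \<zero>\<^bsub>S\<^esub>" if "x \<in> lin_span S A C" for x
        using that
      proof induction
        case (lin_span_step a g x)
        then have "a \<in> carrier S" "g = \<zero>\<^bsub>S\<^esub>" using A_carrier C0 by auto
        then show ?case using lin_span_step by simp
      qed simp
      then show False using \<open>b \<in> Q\<close> C(3) ab(3) by blast
    qed
    moreover have "\<exists>z\<in>lin_span S A C. g \<otimes>\<^bsub>S\<^esub> d = b \<otimes>\<^bsub>S\<^esub> z" if "g \<in> C" for g
    proof -
      have "g \<in> Q" using that C(2) by blast
      then obtain z where "z \<in> carrier S" "g \<otimes>\<^bsub>S\<^esub> d = b \<otimes>\<^bsub>S\<^esub> z" using Qd by blast
      moreover from this have "z \<in> Q" using neg \<open>g \<in> Q\<close> by blast
      ultimately show ?thesis using C(3) by blast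
    qed
    ultimately have "\<exists>t\<in>carrier S. d = b \<otimes>\<^bsub>S\<^esub> t"
      using C Qc by (intro normal_domain_divides[OF normal A_subring ab(2,3) d C(1)]) auto
    then show False using nd unfolding d_def[symmetric] by blast
  qed
  then obtain q t where qt: "q \<in> Q" "t \<in> carrier S" "t \<notin> Q" "q \<otimes>\<^bsub>S\<^esub> d = b \<otimes>\<^bsub>S\<^esub> t" by blast
  have qc: "q \<in> carrier S" using qt(1) Qc by blast
  have cancel: "x = y" if "b \<otimes>\<^bsub>S\<^esub> x = b \<otimes>\<^bsub>S\<^esub> y" "x \<in> carrier S" "y \<in> carrier S" for x y
    using S.m_lcancel[OF ab(3,2) that(2,3)] that(1) by blast
  have "height S Q \<le> 1"
  proof (rule locally_principal_height_le_1[OF noeth Qp qt(1-3)])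
    fix x assume x: "x \<in> Q"
    then obtain y where y: "y \<in> carrier S" "x \<otimes>\<^bsub>S\<^esub> d = b \<otimes>\<^bsub>S\<^esub> y" using Qd by blast
    have xc: "x \<in> carrier S" using x Qc by blast
    have "b \<otimes>\<^bsub>S\<^esub> (t \<otimes>\<^bsub>S\<^esub> x) = (b \<otimes>\<^bsub>S\<^esub> t) \<otimes>\<^bsub>S\<^esub> x" using ab qt xc by (simp add: S.m_assoc)
    also have "\<dots> = q \<otimes>\<^bsub>S\<^esub> (x \<otimes>\<^bsub>S\<^esub> d)" unfolding qt(4)[symmetric] using qc d xc by (simp add: S.m_ac)
    also have "\<dots> = b \<otimes>\<^bsub>S\<^esub> (q \<otimes>\<^bsub>S\<^esub> y)" unfolding y(2) using ab qc y(1) by (simp add: S.m_ac)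
    finally have "t \<otimes>\<^bsub>S\<^esub> x = q \<otimes>\<^bsub>S\<^esub> y" using cancel qt qc xc y by simp
    then show "\<exists>y\<in>carrier S. t \<otimes>\<^bsub>S\<^esub> x = q \<otimes>\<^bsub>S\<^esub> y" using y by blast
  qed
  then have unrQ: "unramified_at R S \<iota> Q" using unr Qp by blast
  obtain u where u: "u \<in> carrier S" "u \<notin> Q" "u \<otimes>\<^bsub>S\<^esub> q \<in> lin_span S (A \<inter> Q) (carrier S)"
    using unrQ qt(1) unfolding unramified_at_def by blast
  \<comment> \<open>As \<open>Q\<close> is generated locally by \<open>R \<inter> Q\<close>, the element \<open>q\<close> can be replaced by one from \<open>R\<close>.\<close>
  have "\<exists>\<pi>\<in>A \<inter> Q. \<exists>w\<in>carrier S - Q. \<pi> \<otimes>\<^bsub>S\<^esub> d = b \<otimes>\<^bsub>S\<^esub> w"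
  proof (rule ccontr)
    assume neg: "\<not> ?thesis"
    have "\<exists>z'\<in>Q. z \<otimes>\<^bsub>S\<^esub> d = b \<otimes>\<^bsub>S\<^esub> z'" if "z \<in> lin_span S (A \<inter> Q) (carrier S)" for z
      using that
    proof induction
      case lin_span_zero
      show ?case using d ab Q.zero_closed by (intro bexI[of _ "\<zero>\<^bsub>S\<^esub>"]) auto
    next
      case (lin_span_step \<pi> g z)
      then obtain z' where z': "z' \<in> Q" "z \<otimes>\<^bsub>S\<^esub> d = b \<otimes>\<^bsub>S\<^esub> z'" by blast
      have "\<pi> \<in> A \<inter> Q" by (rule lin_span_step(1))
      moreover from this obtain w where w: "w \<in> carrier S" "\<pi> \<otimes>\<^bsub>S\<^esub> d = b \<otimes>\<^bsub>S\<^esub> w"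
        using Qd[of \<pi>] by blast
      ultimately have wQ: "w \<in> Q" using neg by blast
      have cc: "\<pi> \<in> carrier S" "g \<in> carrier S" "z \<in> carrier S" "z' \<in> carrier S" "w \<in> carrier S"
        using \<open>\<pi> \<in> A \<inter> Q\<close> lin_span_step(2) Qc z'(1) w(1) S.lin_span_closed[OF _ _ lin_span_step(3)] by auto
      have "(\<pi> \<otimes>\<^bsub>S\<^esub> g \<oplus>\<^bsub>S\<^esub> z) \<otimes>\<^bsub>S\<^esub> d = g \<otimes>\<^bsub>S\<^esub> (\<pi> \<otimes>\<^bsub>S\<^esub> d) \<oplus>\<^bsub>S\<^esub> z \<otimes>\<^bsub>S\<^esub> d"
        using cc d by (simp add: S.l_distr S.r_distr S.m_ac)
      also have "\<dots> = b \<otimes>\<^bsub>S\<^esub> (g \<otimes>\<^bsub>S\<^esub> w \<oplus>\<^bsub>S\<^esub> z')"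
        unfolding z'(2) w(2) using cc ab by (simp add: S.r_distr S.m_ac)
      finally show ?case using Q.a_closed[OF Q.I_l_closed[OF wQ cc(2)] z'(1)] by blast
    qed
    then obtain z' where z': "z' \<in> Q" "(u \<otimes>\<^bsub>S\<^esub> q) \<otimes>\<^bsub>S\<^esub> d = b \<otimes>\<^bsub>S\<^esub> z'" using u(3) by blast
    have "b \<otimes>\<^bsub>S\<^esub> (u \<otimes>\<^bsub>S\<^esub> t) = u \<otimes>\<^bsub>S\<^esub> (q \<otimes>\<^bsub>S\<^esub> d)" unfolding qt(4) using ab u qt by (simp add: S.m_ac)
    also have "\<dots> = b \<otimes>\<^bsub>S\<^esub> z'" unfolding z'(2)[symmetric] using u qc d by (simp add: S.m_assoc)
    finally have "u \<otimes>\<^bsub>S\<^esub> t = z'" using cancel u qt z' Qc by auto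
    then show False using Q.I_prime[OF u(1) qt(2)] z'(1) u(2) qt(3) by simp
  qed
  then obtain p w where p: "p \<in> carrier R" "\<iota> p \<in> Q" and w: "w \<in> carrier S" "w \<notin> Q" "\<iota> p \<otimes>\<^bsub>S\<^esub> d = b \<otimes>\<^bsub>S\<^esub> w" by blast
  obtain \<sigma>1 where \<sigma>1: "\<sigma>1 \<in> H" using H(2) by blast
  define F where "F = H - {\<sigma>1}"
  have F: "finite F" "\<sigma>1 \<notin> F" "insert \<sigma>1 F = H" using H(1) \<sigma>1 by (auto simp: F_def)
  have homs: "ring_hom_cring S E \<sigma>" if "\<sigma> \<in> H" for \<sigma> using is_extD(1) H(3) that by blast
  obtain T QQ where T: "prime_in E T QQ" "\<And>\<sigma>. \<sigma> \<in> H \<Longrightarrow> \<sigma> ` carrier S \<subseteq> T"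
    "\<And>s. s \<in> carrier S \<Longrightarrow> \<sigma>1 s \<in> QQ \<longleftrightarrow> s \<in> Q"
    by (rule lying_over_images[OF F(1) _ Qp, of \<sigma>1]) (use F(3) H(3) in auto)
  note TP = prime_inD[OF T(1)]
  have \<sigma>T: "\<sigma> y \<in> T" if "\<sigma> \<in> H" "y \<in> carrier S" for \<sigma> y using T(2) that by blast
  have \<sigma>E: "\<sigma> y \<in> carrier E" if "\<sigma> \<in> H" "y \<in> carrier S" for \<sigma> y using \<sigma>T that TP(8) by blast
  have \<eta>1: "\<eta> r = \<sigma>1 (\<iota> r)" if "r \<in> carrier R" for r using is_extD(3)[OF H(3)[OF \<sigma>1] that] by simp
  have \<eta>E: "\<eta> r \<in> carrier E" if "r \<in> carrier R" for r using \<eta>1[OF that] \<sigma>E[OF \<sigma>1] that by simp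
  have \<sigma>w: "\<sigma> w = \<eta> p \<otimes>\<^bsub>E\<^esub> (c \<sigma> \<otimes>\<^bsub>E\<^esub> \<sigma> s)" if \<sigma>: "\<sigma> \<in> H" for \<sigma>
  proof -
    interpret \<sigma>: ring_hom_cring S E \<sigma> by (rule homs[OF \<sigma>])
    have b0: "\<sigma> b \<noteq> \<zero>\<^bsub>E\<^esub>"
      using is_extD(2)[OF H(3)[OF \<sigma>]] ab \<sigma>.hom_zero by (metis S.zero_closed inj_onD)
    have \<eta>p: "\<sigma> (\<iota> p) = \<eta> p" using is_extD(3)[OF H(3)[OF \<sigma>] p(1)] .
    have cc: "c \<sigma> \<in> carrier E" "c \<sigma> \<otimes>\<^bsub>E\<^esub> \<sigma> b = \<sigma> a" using c[OF \<sigma>] by auto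
    have "\<sigma> b \<otimes>\<^bsub>E\<^esub> \<sigma> w = \<sigma> (\<iota> p \<otimes>\<^bsub>S\<^esub> d)" unfolding w(3) using ab w by simp
    also have "\<dots> = \<eta> p \<otimes>\<^bsub>E\<^esub> (\<sigma> s \<otimes>\<^bsub>E\<^esub> \<sigma> a)" unfolding d_def using p s ab \<eta>p by simp
    also have "\<dots> = \<sigma> b \<otimes>\<^bsub>E\<^esub> (\<eta> p \<otimes>\<^bsub>E\<^esub> (c \<sigma> \<otimes>\<^bsub>E\<^esub> \<sigma> s))"
      unfolding cc(2)[symmetric] using cc(1) \<eta>E[OF p(1)] s ab by (simp add: E.m_ac)
    finally show ?thesis
      using E.m_lcancel[OF b0] ab w s cc(1) \<eta>E[OF p(1)] by simp
  qed
  \<comment> \<open>The sum is \<open>p \<phi> (s y)\<close>, a multiple of \<open>p\<close>.\<close>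
  have sum: "(\<Oplus>\<^bsub>E\<^esub>\<sigma>\<in>insert \<sigma>1 F. \<sigma> w \<otimes>\<^bsub>E\<^esub> \<sigma> y) \<in> QQ" if y: "y \<in> carrier S" for y
  proof -
    have "(\<Oplus>\<^bsub>E\<^esub>\<sigma>\<in>H. \<sigma> w \<otimes>\<^bsub>E\<^esub> \<sigma> y) = (\<Oplus>\<^bsub>E\<^esub>\<sigma>\<in>H. \<eta> p \<otimes>\<^bsub>E\<^esub> (c \<sigma> \<otimes>\<^bsub>E\<^esub> \<sigma> (s \<otimes>\<^bsub>S\<^esub> y)))"
    proof (rule E.finsum_cong'[OF refl])
      show "(\<lambda>\<sigma>. \<eta> p \<otimes>\<^bsub>E\<^esub> (c \<sigma> \<otimes>\<^bsub>E\<^esub> \<sigma> (s \<otimes>\<^bsub>S\<^esub> y))) \<in> H \<rightarrow> carrier E"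
        using c \<eta>E[OF p(1)] \<sigma>E s y by auto
      fix \<sigma> assume \<sigma>: "\<sigma> \<in> H"
      have "\<sigma> (s \<otimes>\<^bsub>S\<^esub> y) = \<sigma> s \<otimes>\<^bsub>E\<^esub> \<sigma> y" using ring_hom_mult[OF ring_hom_cring.homh[OF homs[OF \<sigma>]] s y] .
      then show "\<sigma> w \<otimes>\<^bsub>E\<^esub> \<sigma> y = \<eta> p \<otimes>\<^bsub>E\<^esub> (c \<sigma> \<otimes>\<^bsub>E\<^esub> \<sigma> (s \<otimes>\<^bsub>S\<^esub> y))"
        unfolding \<sigma>w[OF \<sigma>] using c[OF \<sigma>] \<eta>E[OF p(1)] \<sigma>E[OF \<sigma> s] \<sigma>E[OF \<sigma> y] by (simp add: E.m_assoc)
    qed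
    also have "\<dots> = \<eta> p \<otimes>\<^bsub>E\<^esub> (\<Oplus>\<^bsub>E\<^esub>\<sigma>\<in>H. c \<sigma> \<otimes>\<^bsub>E\<^esub> \<sigma> (s \<otimes>\<^bsub>S\<^esub> y))"
      using c \<eta>E[OF p(1)] \<sigma>E s y H(1) by (intro E.finsum_rdistr[symmetric]) auto
    also have "\<dots> = \<eta> p \<otimes>\<^bsub>E\<^esub> \<eta> (\<phi> (s \<otimes>\<^bsub>S\<^esub> y))" using rep s y by simp
    also have "\<dots> \<in> QQ"
    proof -
      have 1: "\<eta> p \<in> QQ" using T(3)[of "\<iota> p"] p \<eta>1[OF p(1)] by simp
      have r: "\<phi> (s \<otimes>\<^bsub>S\<^esub> y) \<in> carrier R" using \<phi> s y by simp
      have 2: "\<eta> (\<phi> (s \<otimes>\<^bsub>S\<^esub> y)) \<in> T" using \<eta>1[OF r] \<sigma>T[OF \<sigma>1] r by simp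
      show ?thesis using TP(6)[OF 2 1] \<eta>E[OF r] \<eta>E[OF p(1)] by (simp add: E.m_comm)
    qed
    finally show ?thesis using F(3) by simp
  qed
  have "\<sigma>1 w \<otimes>\<^bsub>E\<^esub> \<sigma>1 \<one>\<^bsub>S\<^esub> \<in> QQ"
  proof (rule E.independence_mod_prime[OF T(1) F(1,2), of "\<lambda>\<sigma>. \<sigma> w" "carrier S" "\<lambda>\<sigma>. \<sigma>" "(\<otimes>\<^bsub>S\<^esub>)"])
    fix \<sigma> assume "\<sigma> \<in> insert \<sigma>1 F"
    then have \<sigma>: "\<sigma> \<in> H" using F by simp
    show "\<sigma> w \<in> T" using \<sigma>T \<sigma> w by blast
    fix y assume y: "y \<in> carrier S"
    show "\<sigma> y \<in> T" using \<sigma>T \<sigma> y by blast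
    fix x assume x: "x \<in> carrier S"
    show "x \<otimes>\<^bsub>S\<^esub> y \<in> carrier S \<and> \<sigma> (x \<otimes>\<^bsub>S\<^esub> y) = \<sigma> x \<otimes>\<^bsub>E\<^esub> \<sigma> y"
      using x y ring_hom_mult[OF ring_hom_cring.homh[OF homs[OF \<sigma>]]] by blast
  next
    fix \<sigma> assume "\<sigma> \<in> F"
    then have \<sigma>: "\<sigma> \<in> H" "\<sigma> \<noteq> \<sigma>1" using F by auto
    show "\<exists>y\<in>carrier S. \<sigma> y \<ominus>\<^bsub>E\<^esub> \<sigma>1 y \<notin> QQ"
    proof (rule ccontr)
      assume neg: "\<not> ?thesis"
      have cong: "\<sigma>1 y \<ominus>\<^bsub>E\<^esub> \<sigma> y \<in> QQ" if y: "y \<in> carrier S" for y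
      proof -
        have "\<zero>\<^bsub>E\<^esub> \<ominus>\<^bsub>E\<^esub> (\<sigma> y \<ominus>\<^bsub>E\<^esub> \<sigma>1 y) \<in> QQ" using E.prime_in_minus[OF T(1) TP(3)] neg y by blast
        moreover have "\<zero>\<^bsub>E\<^esub> \<ominus>\<^bsub>E\<^esub> (v \<ominus>\<^bsub>E\<^esub> v') = v' \<ominus>\<^bsub>E\<^esub> v" if "v \<in> carrier E" "v' \<in> carrier E" for v v'
          using that by algebra
        ultimately show ?thesis using \<sigma>E \<sigma>(1) \<sigma>1 y by simp
      qed
      have "\<sigma>1 y = \<sigma> y" if "y \<in> carrier S" for y
        by (rule unramified_separates[OF H(3)[OF \<sigma>1] H(3)[OF \<sigma>(1)] T(1) T(2)[OF \<sigma>1] T(2)[OF \<sigma>(1)] T(3) Qc unrQ cong that])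
      then have "\<sigma>1 = \<sigma>" using H(4)[OF \<sigma>1 \<sigma>(1)] by blast
      then show False using \<sigma>(2) by simp
    qed
  qed (use sum in auto)
  then have "\<sigma>1 w \<in> QQ"
    using ring_hom_one[OF ring_hom_cring.homh[OF homs[OF \<sigma>1]]] \<sigma>E[OF \<sigma>1 w(1)] by simp
  then show False using T(3) w by blast
qed

section \<open>Functionals as combinations of homomorphisms\<close>

lemma (in ring) finsum_swap:
  assumes "finite I" "finite J" "\<And>i j. i \<in> I \<Longrightarrow> j \<in> J \<Longrightarrow> f i j \<in> carrier R"
  shows "(\<Oplus>i\<in>I. \<Oplus>j\<in>J. f i j) = (\<Oplus>j\<in>J. \<Oplus>i\<in>I. f i j)"
  using assms(1,3)
proof (induction I rule: finite_induct)
  case empty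
  then show ?case by simp
next
  case (insert x I)
  have "(\<Oplus>i\<in>insert x I. \<Oplus>j\<in>J. f i j) = (\<Oplus>j\<in>J. f x j) \<oplus> (\<Oplus>i\<in>I. \<Oplus>j\<in>J. f i j)"
    using insert by (intro finsum_insert) (auto intro!: finsum_closed)
  also have "\<dots> = (\<Oplus>j\<in>J. f x j \<oplus> (\<Oplus>i\<in>I. f i j))"
    using insert by (subst finsum_addf) (auto intro!: finsum_closed)
  also have "\<dots> = (\<Oplus>j\<in>J. \<Oplus>i\<in>insert x I. f i j)"
    using insert by (intro finsum_cong') (auto intro!: finsum_insert[symmetric] finsum_closed)
  finally show ?case .
qed

lemma (in domain) common_multiple:
  assumes "finite J" "\<And>e. e \<in> J \<Longrightarrow> b e \<in> carrier R - {\<zero>}"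
  shows "\<exists>\<beta>\<in>carrier R - {\<zero>}. \<forall>e\<in>J. \<exists>m\<in>carrier R. \<beta> = m \<otimes> b e"
  using assms
proof (induction J rule: finite_induct)
  case empty
  then show ?case by (intro bexI[of _ \<one>]) auto
next
  case (insert x J)
  then obtain \<beta> where \<beta>: "\<beta> \<in> carrier R - {\<zero>}" "\<forall>e\<in>J. \<exists>m\<in>carrier R. \<beta> = m \<otimes> b e" by auto
  have bx: "b x \<in> carrier R - {\<zero>}" using insert by auto
  have be: "\<And>e. e \<in> J \<Longrightarrow> b e \<in> carrier R" using insert by auto
  have "\<beta> \<otimes> b x \<in> carrier R - {\<zero>}" using \<beta> bx integral by auto
  moreover have "\<exists>m\<in>carrier R. \<beta> \<otimes> b x = m \<otimes> b e" if "e \<in> insert x J" for e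
  proof (cases "e = x")
    case True then show ?thesis using \<beta> by blast
  next
    case False
    then have e: "e \<in> J" using that by simp
    obtain m where m: "m \<in> carrier R" "\<beta> = m \<otimes> b e" using \<beta>(2) e by blast
    have "\<beta> \<otimes> b x = (b x \<otimes> m) \<otimes> b e" unfolding m(2) using bx be[OF e] m(1) by (simp add: m_ac)
    moreover have "b x \<otimes> m \<in> carrier R" using bx m(1) by simp
    ultimately show ?thesis by blast
  qed
  ultimately show ?case by blast
qed

context finite_domain_extension
begin

text \<open>
  The last nonzero coefficient of an equation for \<open>z\<close> is a multiple of \<open>z\<close>.
\<close>

lemma root_nonzero_multiple:
  assumes "set f \<subseteq> carrier R" "z \<in> carrier S" "z \<noteq> \<zero>\<^bsub>S\<^esub>" "S.eval (map \<iota> f) z = \<zero>\<^bsub>S\<^esub>" "\<exists>r\<in>set f. r \<noteq> \<zero>\<^bsub>R\<^esub>"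
  shows "\<exists>s\<in>carrier S. \<exists>r\<in>carrier R - {\<zero>\<^bsub>R\<^esub>}. z \<otimes>\<^bsub>S\<^esub> s = \<iota> r"
  using assms(1,4,5)
proof (induction f rule: rev_induct)
  case Nil
  then show ?case by simp
next
  case (snoc c f)
  have fc: "set (map \<iota> f) \<subseteq> carrier S" "c \<in> carrier R" using snoc.prems by auto
  let ?e = "S.eval (map \<iota> f) z"
  have ec: "?e \<in> carrier S" using S.eval_in_carrier[OF fc(1) assms(2)] .
  have eq: "?e \<otimes>\<^bsub>S\<^esub> z \<oplus>\<^bsub>S\<^esub> \<iota> c = \<zero>\<^bsub>S\<^esub>"
    using S.eval_append_aux[OF fc(1) \<iota>.hom_closed[OF fc(2)] assms(2)] snoc.prems(2) by simp
  show ?case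
  proof (cases "c = \<zero>\<^bsub>R\<^esub>")
    case True
    then have "?e \<otimes>\<^bsub>S\<^esub> z = \<zero>\<^bsub>S\<^esub>" using eq ec assms(2) by simp
    then have "?e = \<zero>\<^bsub>S\<^esub>" using S.integral[of ?e z] ec assms(2,3) by auto
    moreover have "\<exists>r\<in>set f. r \<noteq> \<zero>\<^bsub>R\<^esub>" using snoc.prems(3) True by auto
    ultimately show ?thesis using snoc by auto
  next
    case False
    have "z \<otimes>\<^bsub>S\<^esub> (\<ominus>\<^bsub>S\<^esub> ?e) = \<iota> c"
    proof -
      have "z \<otimes>\<^bsub>S\<^esub> (\<ominus>\<^bsub>S\<^esub> u) = v" if "u \<otimes>\<^bsub>S\<^esub> z \<oplus>\<^bsub>S\<^esub> v = \<zero>\<^bsub>S\<^esub>" "u \<in> carrier S" "v \<in> carrier S" for u v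
      proof -
        have "z \<otimes>\<^bsub>S\<^esub> (\<ominus>\<^bsub>S\<^esub> u) = v \<ominus>\<^bsub>S\<^esub> (u \<otimes>\<^bsub>S\<^esub> z \<oplus>\<^bsub>S\<^esub> v)" using that(2,3) assms(2) by algebra
        then show ?thesis using that by (simp add: a_minus_def)
      qed
      then show ?thesis using eq ec fc by simp
    qed
    then show ?thesis using False fc(2) ec by (intro bexI[of _ "\<ominus>\<^bsub>S\<^esub> ?e"] bexI[of _ c]) auto
  qed
qed

text \<open>
  Separability of the extension of fraction fields, stated with coefficients in \<open>R\<close>.
\<close>

definition separable_ext :: bool where
  "separable_ext \<longleftrightarrow> (\<forall>z\<in>carrier S. \<exists>f. set f \<subseteq> carrier R \<and> S.eval (map \<iota> f) z = \<zero>\<^bsub>S\<^esub> \<and>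
     deriv_eval S (map \<iota> f) z \<noteq> \<zero>\<^bsub>S\<^esub>)"

lemma (in cring) deriv_eval_zeros:
  "set f \<subseteq> {\<zero>} \<Longrightarrow> x \<in> carrier R \<Longrightarrow> deriv_eval R f x = \<zero>"
  by (induction f) auto

lemma nonzero_multiple:
  assumes "separable_ext" "z \<in> carrier S" "z \<noteq> \<zero>\<^bsub>S\<^esub>"
  shows "\<exists>s\<in>carrier S. \<exists>r\<in>carrier R - {\<zero>\<^bsub>R\<^esub>}. z \<otimes>\<^bsub>S\<^esub> s = \<iota> r"
proof -
  obtain f where f: "set f \<subseteq> carrier R" "S.eval (map \<iota> f) z = \<zero>\<^bsub>S\<^esub>" "deriv_eval S (map \<iota> f) z \<noteq> \<zero>\<^bsub>S\<^esub>"
    using assms unfolding separable_ext_def by blast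
  have "\<exists>r\<in>set f. r \<noteq> \<zero>\<^bsub>R\<^esub>"
  proof (rule ccontr)
    assume "\<not> ?thesis"
    then have "set (map \<iota> f) \<subseteq> {\<zero>\<^bsub>S\<^esub>}" by auto
    then show False using S.deriv_eval_zeros assms(2) f(3) by blast
  qed
  then show ?thesis using root_nonzero_multiple[OF f(1) assms(2,3) f(2)] by blast
qed

text \<open>
  A basis of the fraction field of \<open>S\<close> over that of \<open>R\<close>, consisting of elements of \<open>S\<close>.
\<close>

definition generic_basis :: "'b set \<Rightarrow> 'a \<Rightarrow> bool" where
  "generic_basis J d \<longleftrightarrow> lin_indep S A J \<and> d \<in> carrier R \<and> d \<noteq> \<zero>\<^bsub>R\<^esub> \<and>
     (\<forall>s\<in>carrier S. \<iota> d \<otimes>\<^bsub>S\<^esub> s \<in> lin_span S A J)"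

lemma generic_basis_exists: "\<exists>J d. generic_basis J d"
proof -
  have empty: "lin_indep S A {}" by (simp add: lin_indep_def)
  obtain J d where "{} \<subseteq> J" "lin_indep S A J" "d \<in> A" "d \<noteq> \<zero>\<^bsub>S\<^esub>"
    "\<And>t. t \<in> lin_span S A B \<Longrightarrow> d \<otimes>\<^bsub>S\<^esub> t \<in> lin_span S A J"
    by (rule S.extend_to_maximal_lin_indep[OF A_subring _ S.one_not_zero empty B])
       (use S.integral A_carrier in blast)+
  moreover from this obtain d' where "d' \<in> carrier R" "d = \<iota> d'" by blast
  ultimately have "generic_basis J d'" using span \<iota>_zero_iff by (auto simp: generic_basis_def)
  then show ?thesis by blast
qed

lemma generic_basisD:
  assumes "generic_basis J d"
  shows "lin_indep S A J" "finite J" "J \<subseteq> carrier S" "d \<in> carrier R" "d \<noteq> \<zero>\<^bsub>R\<^esub>"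
    "\<And>s. s \<in> carrier S \<Longrightarrow> \<iota> d \<otimes>\<^bsub>S\<^esub> s \<in> lin_span S A J" "J \<noteq> {}"
proof -
  show *: "lin_indep S A J" "finite J" "J \<subseteq> carrier S" "d \<in> carrier R" "d \<noteq> \<zero>\<^bsub>R\<^esub>"
    "\<And>s. s \<in> carrier S \<Longrightarrow> \<iota> d \<otimes>\<^bsub>S\<^esub> s \<in> lin_span S A J"
    using assms by (auto simp: generic_basis_def lin_indep_def)
  show "J \<noteq> {}"
  proof
    assume J: "J = {}"
    have "x = \<zero>\<^bsub>S\<^esub>" if "x \<in> lin_span S A {}" for x using that by cases auto
    then have "\<iota> d = \<zero>\<^bsub>S\<^esub>" using *(6)[of "\<one>\<^bsub>S\<^esub>"] *(4) J by simp
    then show False using *(4,5) \<iota>_zero_iff by blast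
  qed
qed

end

locale field_homs = extension_homs R S \<iota> B E \<eta> + EF: field E
  for R :: "('a, 'k) ring_scheme" and S :: "('b, 'l) ring_scheme" and \<iota> B
    and E :: "('e, 'n) ring_scheme" and \<eta> +
  fixes H
  assumes H: "finite H" "\<And>\<sigma>. \<sigma> \<in> H \<Longrightarrow> is_ext \<sigma>"
    and H_distinct: "\<And>\<sigma> \<tau>. \<sigma> \<in> H \<Longrightarrow> \<tau> \<in> H \<Longrightarrow> (\<And>s. s \<in> carrier S \<Longrightarrow> \<sigma> s = \<tau> s) \<Longrightarrow> \<sigma> = \<tau>"
begin

lemma H_hom: "\<sigma> \<in> H \<Longrightarrow> ring_hom_cring S E \<sigma>" using is_extD(1) H(2) by blast

lemma H_closed [simp]: "\<sigma> \<in> H \<Longrightarrow> s \<in> carrier S \<Longrightarrow> \<sigma> s \<in> carrier E"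
  using ring_hom_closed[OF ring_hom_cring.homh[OF H_hom]] .

lemma H_nonzero: "\<sigma> \<in> H \<Longrightarrow> s \<in> carrier S \<Longrightarrow> s \<noteq> \<zero>\<^bsub>S\<^esub> \<Longrightarrow> \<sigma> s \<noteq> \<zero>\<^bsub>E\<^esub>"
  using is_extD(2)[OF H(2)] ring_hom_cring.hom_zero[OF H_hom] by (metis S.zero_closed inj_onD)

lemma independence:
  assumes g: "\<And>\<sigma>. \<sigma> \<in> H \<Longrightarrow> g \<sigma> \<in> carrier E"
    and rel: "\<And>y. y \<in> carrier S \<Longrightarrow> (\<Oplus>\<^bsub>E\<^esub>\<sigma>\<in>H. g \<sigma> \<otimes>\<^bsub>E\<^esub> \<sigma> y) = \<zero>\<^bsub>E\<^esub>" and k: "k \<in> H"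
  shows "g k = \<zero>\<^bsub>E\<^esub>"
proof -
  have P: "prime_in E (carrier E) {\<zero>\<^bsub>E\<^esub>}"
    unfolding prime_in_def using E.carrier_is_subring E.integral by auto
  have eq: "insert k (H - {k}) = H" using k by blast
  have "g k \<otimes>\<^bsub>E\<^esub> k \<one>\<^bsub>S\<^esub> \<in> {\<zero>\<^bsub>E\<^esub>}"
  proof (rule E.independence_mod_prime[OF P _ _, of "H - {k}" k g "carrier S" "\<lambda>\<sigma>. \<sigma>" "(\<otimes>\<^bsub>S\<^esub>)"], unfold eq)
    show "finite (H - {k})" using H(1) by simp
    show "x \<otimes>\<^bsub>S\<^esub> y \<in> carrier S \<and> \<sigma> (x \<otimes>\<^bsub>S\<^esub> y) = \<sigma> x \<otimes>\<^bsub>E\<^esub> \<sigma> y"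
      if "\<sigma> \<in> H" "x \<in> carrier S" "y \<in> carrier S" for \<sigma> x y
      using that ring_hom_mult[OF ring_hom_cring.homh[OF H_hom]] by blast
    show "\<exists>y\<in>carrier S. \<sigma> y \<ominus>\<^bsub>E\<^esub> k y \<notin> {\<zero>\<^bsub>E\<^esub>}" if \<sigma>: "\<sigma> \<in> H - {k}" for \<sigma>
    proof (rule ccontr)
      assume "\<not> ?thesis"
      then have "\<sigma> y = k y" if "y \<in> carrier S" for y
        using that \<sigma> k H_closed E.r_right_minus_eq by auto
      then show False using H_distinct \<sigma> k by blast
    qed
  qed (use g rel k in auto)
  then show ?thesis using ring_hom_one[OF ring_hom_cring.homh[OF H_hom[OF k]]] g[OF k] by simp
qed

definition semilinear :: "('b \<Rightarrow> 'e) \<Rightarrow> bool" where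
  "semilinear f \<longleftrightarrow> f \<in> carrier S \<rightarrow> carrier E \<and>
     (\<forall>x\<in>carrier S. \<forall>y\<in>carrier S. f (x \<oplus>\<^bsub>S\<^esub> y) = f x \<oplus>\<^bsub>E\<^esub> f y) \<and>
     (\<forall>r\<in>carrier R. \<forall>x\<in>carrier S. f (\<iota> r \<otimes>\<^bsub>S\<^esub> x) = \<eta> r \<otimes>\<^bsub>E\<^esub> f x)"

lemma semilinear_hom: "\<sigma> \<in> H \<Longrightarrow> semilinear \<sigma>"
  using is_extD(3)[OF H(2)] ring_hom_add[OF ring_hom_cring.homh[OF H_hom]]
    ring_hom_mult[OF ring_hom_cring.homh[OF H_hom]]
  by (auto simp: semilinear_def)

lemma \<eta>_closed:
  assumes "H \<noteq> {}" "r \<in> carrier R"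
  shows "\<eta> r \<in> carrier E" "\<eta> r = \<zero>\<^bsub>E\<^esub> \<Longrightarrow> r = \<zero>\<^bsub>R\<^esub>"
proof -
  obtain \<sigma> where \<sigma>: "\<sigma> \<in> H" using assms(1) by blast
  have eq: "\<eta> r = \<sigma> (\<iota> r)" using is_extD(3)[OF H(2)[OF \<sigma>] assms(2)] by simp
  show "\<eta> r \<in> carrier E" unfolding eq using \<sigma> assms(2) by simp
  show "r = \<zero>\<^bsub>R\<^esub>" if "\<eta> r = \<zero>\<^bsub>E\<^esub>"
    using that H_nonzero[OF \<sigma>, of "\<iota> r"] \<iota>_zero_iff[OF assms(2)] assms(2) unfolding eq by auto
qed

lemma semilinear_zero:
  assumes H0: "H \<noteq> {}" and J: "generic_basis J d" and f: "semilinear f" and "\<And>x. x \<in> J \<Longrightarrow> f x = \<zero>\<^bsub>E\<^esub>"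
    and y: "y \<in> carrier S"
  shows "f y = \<zero>\<^bsub>E\<^esub>"
proof -
  note j = generic_basisD[OF J]
  have fc: "\<And>x. x \<in> carrier S \<Longrightarrow> f x \<in> carrier E" using f by (auto simp: semilinear_def)
  have f0: "f \<zero>\<^bsub>S\<^esub> = \<zero>\<^bsub>E\<^esub>"
  proof -
    have "f (\<iota> \<zero>\<^bsub>R\<^esub> \<otimes>\<^bsub>S\<^esub> \<zero>\<^bsub>S\<^esub>) = \<eta> \<zero>\<^bsub>R\<^esub> \<otimes>\<^bsub>E\<^esub> f \<zero>\<^bsub>S\<^esub>"
      using f R.zero_closed S.zero_closed unfolding semilinear_def by blast
    moreover have "\<eta> \<zero>\<^bsub>R\<^esub> = \<zero>\<^bsub>E\<^esub>"
    proof -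
      obtain \<sigma> where \<sigma>: "\<sigma> \<in> H" using H0 by blast
      show ?thesis using is_extD(3)[OF H(2)[OF \<sigma>], of "\<zero>\<^bsub>R\<^esub>"] ring_hom_cring.hom_zero[OF H_hom[OF \<sigma>]] by simp
    qed
    ultimately show ?thesis using fc[of "\<zero>\<^bsub>S\<^esub>"] by simp
  qed
  have "f x = \<zero>\<^bsub>E\<^esub>" if "x \<in> lin_span S A J" for x
    using that
  proof induction
    case (lin_span_step a g x)
    obtain r where r: "r \<in> carrier R" "a = \<iota> r" using lin_span_step by blast
    have c: "g \<in> carrier S" "x \<in> carrier S"
      using lin_span_step j(3) S.lin_span_closed[OF A_carrier j(3)] by auto
    have "f (a \<otimes>\<^bsub>S\<^esub> g \<oplus>\<^bsub>S\<^esub> x) = \<eta> r \<otimes>\<^bsub>E\<^esub> f g \<oplus>\<^bsub>E\<^esub> f x"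
      using f r c unfolding semilinear_def by auto
    then show ?case using assms(4) lin_span_step \<eta>_closed[OF H0 r(1)] by simp
  qed (rule f0)
  from this[OF j(6)[OF y]] have "\<eta> d \<otimes>\<^bsub>E\<^esub> f y = \<zero>\<^bsub>E\<^esub>" using f j(4) y by (auto simp: semilinear_def)
  then show ?thesis using \<eta>_closed[OF H0 j(4)] fc[OF y] j(5) E.integral by blast
qed

lemma semilinear_finsum:
  assumes H0: "H \<noteq> {}" and V: "finite V" and gc: "\<And>o'. o' \<in> V \<Longrightarrow> g o' \<in> carrier E"
    and v: "\<And>o'. o' \<in> V \<Longrightarrow> semilinear (v o')"
  shows "semilinear (\<lambda>y. \<Oplus>\<^bsub>E\<^esub>o'\<in>V. g o' \<otimes>\<^bsub>E\<^esub> v o' y)"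
proof -
  have vc: "v o' y \<in> carrier E" if "o' \<in> V" "y \<in> carrier S" for o' y
    using v[OF that(1)] that(2) by (auto simp: semilinear_def)
  show ?thesis
    unfolding semilinear_def
  proof (intro conjI ballI)
    show "(\<lambda>y. \<Oplus>\<^bsub>E\<^esub>o'\<in>V. g o' \<otimes>\<^bsub>E\<^esub> v o' y) \<in> carrier S \<rightarrow> carrier E"
      using gc vc by (auto intro!: E.finsum_closed)
  next
    fix x y assume xy: "x \<in> carrier S" "y \<in> carrier S"
    have "(\<Oplus>\<^bsub>E\<^esub>o'\<in>V. g o' \<otimes>\<^bsub>E\<^esub> v o' (x \<oplus>\<^bsub>S\<^esub> y)) = (\<Oplus>\<^bsub>E\<^esub>o'\<in>V. g o' \<otimes>\<^bsub>E\<^esub> v o' x \<oplus>\<^bsub>E\<^esub> g o' \<otimes>\<^bsub>E\<^esub> v o' y)"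
    proof (rule E.finsum_cong'[OF refl])
      fix o' assume o: "o' \<in> V"
      have "v o' (x \<oplus>\<^bsub>S\<^esub> y) = v o' x \<oplus>\<^bsub>E\<^esub> v o' y" using v[OF o] xy by (auto simp: semilinear_def)
      then show "g o' \<otimes>\<^bsub>E\<^esub> v o' (x \<oplus>\<^bsub>S\<^esub> y) = g o' \<otimes>\<^bsub>E\<^esub> v o' x \<oplus>\<^bsub>E\<^esub> g o' \<otimes>\<^bsub>E\<^esub> v o' y"
        using gc[OF o] vc[OF o] xy by (simp add: E.r_distr)
    qed (use gc vc xy in auto)
    also have "\<dots> = (\<Oplus>\<^bsub>E\<^esub>o'\<in>V. g o' \<otimes>\<^bsub>E\<^esub> v o' x) \<oplus>\<^bsub>E\<^esub> (\<Oplus>\<^bsub>E\<^esub>o'\<in>V. g o' \<otimes>\<^bsub>E\<^esub> v o' y)"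
      using gc vc xy by (intro E.finsum_addf) auto
    finally show "(\<Oplus>\<^bsub>E\<^esub>o'\<in>V. g o' \<otimes>\<^bsub>E\<^esub> v o' (x \<oplus>\<^bsub>S\<^esub> y)) = (\<Oplus>\<^bsub>E\<^esub>o'\<in>V. g o' \<otimes>\<^bsub>E\<^esub> v o' x) \<oplus>\<^bsub>E\<^esub> (\<Oplus>\<^bsub>E\<^esub>o'\<in>V. g o' \<otimes>\<^bsub>E\<^esub> v o' y)" .
  next
    fix r x assume rx: "r \<in> carrier R" "x \<in> carrier S"
    note \<eta>r = \<eta>_closed(1)[OF H0 rx(1)]
    have "(\<Oplus>\<^bsub>E\<^esub>o'\<in>V. g o' \<otimes>\<^bsub>E\<^esub> v o' (\<iota> r \<otimes>\<^bsub>S\<^esub> x)) = (\<Oplus>\<^bsub>E\<^esub>o'\<in>V. \<eta> r \<otimes>\<^bsub>E\<^esub> (g o' \<otimes>\<^bsub>E\<^esub> v o' x))"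
    proof (rule E.finsum_cong'[OF refl])
      fix o' assume o: "o' \<in> V"
      have "v o' (\<iota> r \<otimes>\<^bsub>S\<^esub> x) = \<eta> r \<otimes>\<^bsub>E\<^esub> v o' x" using v[OF o] rx by (auto simp: semilinear_def)
      then show "g o' \<otimes>\<^bsub>E\<^esub> v o' (\<iota> r \<otimes>\<^bsub>S\<^esub> x) = \<eta> r \<otimes>\<^bsub>E\<^esub> (g o' \<otimes>\<^bsub>E\<^esub> v o' x)"
        using gc[OF o] vc[OF o] rx \<eta>r by (simp add: E.m_lcomm)
    qed (use gc vc rx \<eta>r in auto)
    also have "\<dots> = \<eta> r \<otimes>\<^bsub>E\<^esub> (\<Oplus>\<^bsub>E\<^esub>o'\<in>V. g o' \<otimes>\<^bsub>E\<^esub> v o' x)"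
      using gc vc rx \<eta>r V by (intro E.finsum_rdistr[symmetric]) auto
    finally show "(\<Oplus>\<^bsub>E\<^esub>o'\<in>V. g o' \<otimes>\<^bsub>E\<^esub> v o' (\<iota> r \<otimes>\<^bsub>S\<^esub> x)) = \<eta> r \<otimes>\<^bsub>E\<^esub> (\<Oplus>\<^bsub>E\<^esub>o'\<in>V. g o' \<otimes>\<^bsub>E\<^esub> v o' x)" .
  qed
qed

lemma semilinear_agree:
  assumes H0: "H \<noteq> {}" and J: "generic_basis J d" and f: "semilinear f" and g: "semilinear g"
    and eq: "\<And>x. x \<in> J \<Longrightarrow> f x = g x" and y: "y \<in> carrier S"
  shows "f y = g y"
proof -
  note j = generic_basisD[OF J]
  have fc: "\<And>x. x \<in> carrier S \<Longrightarrow> f x \<in> carrier E" "\<And>x. x \<in> carrier S \<Longrightarrow> g x \<in> carrier E"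
    using f g by (auto simp: semilinear_def)
  have "semilinear (\<lambda>y. f y \<ominus>\<^bsub>E\<^esub> g y)"
    unfolding semilinear_def
  proof (intro conjI ballI)
    show "(\<lambda>y. f y \<ominus>\<^bsub>E\<^esub> g y) \<in> carrier S \<rightarrow> carrier E" using fc by auto
  next
    fix x y assume xy: "x \<in> carrier S" "y \<in> carrier S"
    have "(p \<oplus>\<^bsub>E\<^esub> q) \<ominus>\<^bsub>E\<^esub> (p' \<oplus>\<^bsub>E\<^esub> q') = (p \<ominus>\<^bsub>E\<^esub> p') \<oplus>\<^bsub>E\<^esub> (q \<ominus>\<^bsub>E\<^esub> q')"
      if "p \<in> carrier E" "q \<in> carrier E" "p' \<in> carrier E" "q' \<in> carrier E" for p q p' q'
      using that by algebra
    moreover have "f (x \<oplus>\<^bsub>S\<^esub> y) = f x \<oplus>\<^bsub>E\<^esub> f y" "g (x \<oplus>\<^bsub>S\<^esub> y) = g x \<oplus>\<^bsub>E\<^esub> g y"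
      using f g xy by (auto simp: semilinear_def)
    ultimately show "f (x \<oplus>\<^bsub>S\<^esub> y) \<ominus>\<^bsub>E\<^esub> g (x \<oplus>\<^bsub>S\<^esub> y) = (f x \<ominus>\<^bsub>E\<^esub> g x) \<oplus>\<^bsub>E\<^esub> (f y \<ominus>\<^bsub>E\<^esub> g y)"
      using fc xy by simp
  next
    fix r x assume rx: "r \<in> carrier R" "x \<in> carrier S"
    have "p \<otimes>\<^bsub>E\<^esub> q \<ominus>\<^bsub>E\<^esub> p \<otimes>\<^bsub>E\<^esub> q' = p \<otimes>\<^bsub>E\<^esub> (q \<ominus>\<^bsub>E\<^esub> q')"
      if "p \<in> carrier E" "q \<in> carrier E" "q' \<in> carrier E" for p q q'
      using that by algebra
    moreover have "f (\<iota> r \<otimes>\<^bsub>S\<^esub> x) = \<eta> r \<otimes>\<^bsub>E\<^esub> f x" "g (\<iota> r \<otimes>\<^bsub>S\<^esub> x) = \<eta> r \<otimes>\<^bsub>E\<^esub> g x"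
      using f g rx by (auto simp: semilinear_def)
    ultimately show "f (\<iota> r \<otimes>\<^bsub>S\<^esub> x) \<ominus>\<^bsub>E\<^esub> g (\<iota> r \<otimes>\<^bsub>S\<^esub> x) = \<eta> r \<otimes>\<^bsub>E\<^esub> (f x \<ominus>\<^bsub>E\<^esub> g x)"
      using fc rx \<eta>_closed(1)[OF H0 rx(1)] by simp
  qed
  then have "f y \<ominus>\<^bsub>E\<^esub> g y = \<zero>\<^bsub>E\<^esub>"
    by (rule semilinear_zero[OF H0 J _ _ y]) (use eq j(3) fc in \<open>auto simp: a_minus_def E.r_neg\<close>)
  then show ?thesis using fc y by simp
qed

text \<open>
  The functional and the homomorphisms in \<open>H\<close> are more vectors than there are coordinates with respect to
  \<open>J\<close>, hence dependent; by Dedekind's theorem the functional occurs with a nonzero coefficient.  The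
  inequality \<open>card J \<le> card H\<close> says that there are enough embeddings for the degree.
\<close>

lemma functional_combination:
  assumes H0: "H \<noteq> {}" and J: "generic_basis J d" and card: "card J \<le> card H" and f: "semilinear f"
  obtains c where "\<And>\<sigma>. \<sigma> \<in> H \<Longrightarrow> c \<sigma> \<in> carrier E"
    "\<And>y. y \<in> carrier S \<Longrightarrow> f y = (\<Oplus>\<^bsub>E\<^esub>\<sigma>\<in>H. c \<sigma> \<otimes>\<^bsub>E\<^esub> \<sigma> y)"
proof -
  note j = generic_basisD[OF J]
  have fc: "\<And>x. x \<in> carrier S \<Longrightarrow> f x \<in> carrier E" using f by (auto simp: semilinear_def)
  \<comment> \<open>\<open>None\<close> stands for the functional, \<open>Some \<sigma>\<close> for a homomorphism.\<close>
  define V where "V = insert None (Some ` H)"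
  define v where "v o' = (case o' of None \<Rightarrow> f | Some \<sigma> \<Rightarrow> \<sigma>)" for o'
  have V: "finite V" "card V = Suc (card H)" using H(1) by (auto simp: V_def card_image card_insert_if)
  have v: "semilinear (v o')" if "o' \<in> V" for o' using that f semilinear_hom by (auto simp: V_def v_def)
  have vc: "v o' y \<in> carrier E" if "o' \<in> V" "y \<in> carrier S" for o' y using v[OF that(1)] that(2) by (auto simp: semilinear_def)
  obtain g where g: "g \<in> V \<rightarrow> carrier E" "\<exists>o'\<in>V. g o' \<noteq> \<zero>\<^bsub>E\<^esub>"
    "\<And>x. x \<in> J \<Longrightarrow> (\<Oplus>\<^bsub>E\<^esub>o'\<in>V. g o' \<otimes>\<^bsub>E\<^esub> v o' x) = \<zero>\<^bsub>E\<^esub>"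
    by (rule E.linear_dependence[OF E.carrier_is_subring j(2) V(1), of v])
       (use V(2) card vc j(3) in auto)
  have gc: "\<And>o'. o' \<in> V \<Longrightarrow> g o' \<in> carrier E" using g(1) by blast
  have "semilinear (\<lambda>y. \<Oplus>\<^bsub>E\<^esub>o'\<in>V. g o' \<otimes>\<^bsub>E\<^esub> v o' y)"
    by (rule semilinear_finsum[OF H0 V(1) gc v])
  from semilinear_zero[OF H0 J this g(3)]
  have rel: "(\<Oplus>\<^bsub>E\<^esub>o'\<in>V. g o' \<otimes>\<^bsub>E\<^esub> v o' y) = \<zero>\<^bsub>E\<^esub>" if "y \<in> carrier S" for y using that by blast
  have split: "g None \<otimes>\<^bsub>E\<^esub> f y \<oplus>\<^bsub>E\<^esub> (\<Oplus>\<^bsub>E\<^esub>\<sigma>\<in>H. g (Some \<sigma>) \<otimes>\<^bsub>E\<^esub> \<sigma> y) = \<zero>\<^bsub>E\<^esub>" if y: "y \<in> carrier S" for y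
  proof -
    have "(\<Oplus>\<^bsub>E\<^esub>o'\<in>V. g o' \<otimes>\<^bsub>E\<^esub> v o' y) = g None \<otimes>\<^bsub>E\<^esub> v None y \<oplus>\<^bsub>E\<^esub> (\<Oplus>\<^bsub>E\<^esub>o'\<in>Some ` H. g o' \<otimes>\<^bsub>E\<^esub> v o' y)"
      unfolding V_def using gc vc y H(1) by (intro E.finsum_insert) (auto simp: V_def)
    also have "(\<Oplus>\<^bsub>E\<^esub>o'\<in>Some ` H. g o' \<otimes>\<^bsub>E\<^esub> v o' y) = (\<Oplus>\<^bsub>E\<^esub>\<sigma>\<in>H. g (Some \<sigma>) \<otimes>\<^bsub>E\<^esub> v (Some \<sigma>) y)"
      using gc vc y by (intro E.finsum_reindex) (auto simp: V_def)
    finally show ?thesis using rel[OF y] by (simp add: v_def)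
  qed
  have sc: "(\<Oplus>\<^bsub>E\<^esub>\<sigma>\<in>H. g (Some \<sigma>) \<otimes>\<^bsub>E\<^esub> \<sigma> y) \<in> carrier E" if "y \<in> carrier S" for y
    using gc that by (auto intro!: E.finsum_closed simp: V_def)
  have g0: "g None \<noteq> \<zero>\<^bsub>E\<^esub>"
  proof
    assume "g None = \<zero>\<^bsub>E\<^esub>"
    then have "(\<Oplus>\<^bsub>E\<^esub>\<sigma>\<in>H. g (Some \<sigma>) \<otimes>\<^bsub>E\<^esub> \<sigma> y) = \<zero>\<^bsub>E\<^esub>" if "y \<in> carrier S" for y
      using split[OF that] fc[OF that] sc[OF that] by simp
    then have "g (Some \<sigma>) = \<zero>\<^bsub>E\<^esub>" if "\<sigma> \<in> H" for \<sigma>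
      by (intro independence[OF _ _ that, of "\<lambda>\<sigma>. g (Some \<sigma>)"]) (use gc in \<open>auto simp: V_def\<close>)
    then show False using g(2) \<open>g None = \<zero>\<^bsub>E\<^esub>\<close> by (auto simp: V_def)
  qed
  have gN: "g None \<in> carrier E" using gc by (auto simp: V_def)
  define i where "i = \<ominus>\<^bsub>E\<^esub> (inv\<^bsub>E\<^esub> g None)"
  have gU: "g None \<in> Units E" using gN g0 EF.field_Units by auto
  have ic: "i \<in> carrier E" using gU by (simp add: i_def)
  have "f y = (\<Oplus>\<^bsub>E\<^esub>\<sigma>\<in>H. (i \<otimes>\<^bsub>E\<^esub> g (Some \<sigma>)) \<otimes>\<^bsub>E\<^esub> \<sigma> y)" if y: "y \<in> carrier S" for y
  proof -
    let ?s = "\<Oplus>\<^bsub>E\<^esub>\<sigma>\<in>H. g (Some \<sigma>) \<otimes>\<^bsub>E\<^esub> \<sigma> y"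
    have "u = i \<otimes>\<^bsub>E\<^esub> w" if "g None \<otimes>\<^bsub>E\<^esub> u \<oplus>\<^bsub>E\<^esub> w = \<zero>\<^bsub>E\<^esub>" "u \<in> carrier E" "w \<in> carrier E" for u w
    proof -
      have w: "w = \<ominus>\<^bsub>E\<^esub> (g None \<otimes>\<^bsub>E\<^esub> u)"
        using that gN by (metis E.a_comm E.m_closed E.minus_equality)
      have "i \<otimes>\<^bsub>E\<^esub> w = inv\<^bsub>E\<^esub> g None \<otimes>\<^bsub>E\<^esub> (g None \<otimes>\<^bsub>E\<^esub> u)"
        unfolding w i_def using that gN gU by (simp add: E.l_minus E.r_minus)
      also have "\<dots> = u" using that gN gU by (simp flip: E.m_assoc)
      finally show ?thesis by simp
    qed
    then have "f y = i \<otimes>\<^bsub>E\<^esub> ?s" using split[OF y] fc[OF y] sc[OF y] by blast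
    also have "\<dots> = (\<Oplus>\<^bsub>E\<^esub>\<sigma>\<in>H. i \<otimes>\<^bsub>E\<^esub> (g (Some \<sigma>) \<otimes>\<^bsub>E\<^esub> \<sigma> y))"
      using gc ic y H(1) by (intro E.finsum_rdistr) (auto simp: V_def)
    also have "\<dots> = (\<Oplus>\<^bsub>E\<^esub>\<sigma>\<in>H. (i \<otimes>\<^bsub>E\<^esub> g (Some \<sigma>)) \<otimes>\<^bsub>E\<^esub> \<sigma> y)"
      using gc ic y by (intro E.finsum_cong') (auto simp: V_def E.m_assoc)
    finally show ?thesis .
  qed
  then show ?thesis using that[of "\<lambda>\<sigma>. i \<otimes>\<^bsub>E\<^esub> g (Some \<sigma>)"] ic gc by (auto simp: V_def)
qed

lemma \<eta>_hom:
  assumes "H \<noteq> {}" "r \<in> carrier R" "t \<in> carrier R"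
  shows "\<eta> (r \<oplus>\<^bsub>R\<^esub> t) = \<eta> r \<oplus>\<^bsub>E\<^esub> \<eta> t" "\<eta> (r \<otimes>\<^bsub>R\<^esub> t) = \<eta> r \<otimes>\<^bsub>E\<^esub> \<eta> t" "\<eta> \<zero>\<^bsub>R\<^esub> = \<zero>\<^bsub>E\<^esub>" "\<eta> \<one>\<^bsub>R\<^esub> = \<one>\<^bsub>E\<^esub>"
proof -
  obtain \<sigma> where \<sigma>: "\<sigma> \<in> H" using assms(1) by blast
  interpret \<sigma>: ring_hom_cring S E \<sigma> by (rule H_hom[OF \<sigma>])
  have eq: "\<And>r. r \<in> carrier R \<Longrightarrow> \<eta> r = \<sigma> (\<iota> r)" using is_extD(3)[OF H(2)[OF \<sigma>]] by simp
  show "\<eta> (r \<oplus>\<^bsub>R\<^esub> t) = \<eta> r \<oplus>\<^bsub>E\<^esub> \<eta> t" "\<eta> (r \<otimes>\<^bsub>R\<^esub> t) = \<eta> r \<otimes>\<^bsub>E\<^esub> \<eta> t" "\<eta> \<zero>\<^bsub>R\<^esub> = \<zero>\<^bsub>E\<^esub>" "\<eta> \<one>\<^bsub>R\<^esub> = \<one>\<^bsub>E\<^esub>"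
    using eq assms(2,3) by simp_all
qed

end

locale split_field_homs = field_homs R S \<iota> B E \<eta> H
  for R :: "('a, 'k) ring_scheme" and S :: "('b, 'l) ring_scheme" and \<iota> B
    and E :: "('e, 'n) ring_scheme" and \<eta> H +
  fixes \<phi>
  assumes H0: "H \<noteq> {}"
    and \<phi>_closed [simp]: "\<And>y. y \<in> carrier S \<Longrightarrow> \<phi> y \<in> carrier R"
    and \<phi>_add: "\<And>x y. x \<in> carrier S \<Longrightarrow> y \<in> carrier S \<Longrightarrow> \<phi> (x \<oplus>\<^bsub>S\<^esub> y) = \<phi> x \<oplus>\<^bsub>R\<^esub> \<phi> y"
    and \<phi>_smult: "\<And>r x. r \<in> carrier R \<Longrightarrow> x \<in> carrier S \<Longrightarrow> \<phi> (\<iota> r \<otimes>\<^bsub>S\<^esub> x) = r \<otimes>\<^bsub>R\<^esub> \<phi> x"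
    and \<phi>_one: "\<phi> \<one>\<^bsub>S\<^esub> = \<one>\<^bsub>R\<^esub>"
begin

lemma \<phi>_zero: "\<phi> \<zero>\<^bsub>S\<^esub> = \<zero>\<^bsub>R\<^esub>"
  using \<phi>_smult[of "\<zero>\<^bsub>R\<^esub>" "\<zero>\<^bsub>S\<^esub>"] by simp

lemma \<phi>_semilinear: "z \<in> carrier S \<Longrightarrow> semilinear (\<lambda>y. \<eta> (\<phi> (z \<otimes>\<^bsub>S\<^esub> y)))"
  unfolding semilinear_def
proof (intro conjI ballI)
  fix r x assume z: "z \<in> carrier S" and r: "r \<in> carrier R" and x: "x \<in> carrier S"
  have "z \<otimes>\<^bsub>S\<^esub> (\<iota> r \<otimes>\<^bsub>S\<^esub> x) = \<iota> r \<otimes>\<^bsub>S\<^esub> (z \<otimes>\<^bsub>S\<^esub> x)" using z r x S.m_lcomm by simp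
  then show "\<eta> (\<phi> (z \<otimes>\<^bsub>S\<^esub> (\<iota> r \<otimes>\<^bsub>S\<^esub> x))) = \<eta> r \<otimes>\<^bsub>E\<^esub> \<eta> (\<phi> (z \<otimes>\<^bsub>S\<^esub> x))"
    using \<phi>_smult[OF r, of "z \<otimes>\<^bsub>S\<^esub> x"] \<eta>_hom(2)[OF H0 r] z x by simp
qed (use \<eta>_closed(1)[OF H0] \<eta>_hom(1)[OF H0] \<phi>_add in \<open>auto simp: S.r_distr\<close>)

lemma \<phi>_combination:
  assumes "finite T" "T \<subseteq> carrier S" "\<And>k. k \<in> T \<Longrightarrow> c k \<in> carrier R" "x \<in> carrier S"
  shows "\<phi> ((\<Oplus>\<^bsub>S\<^esub>k\<in>T. \<iota> (c k) \<otimes>\<^bsub>S\<^esub> k) \<otimes>\<^bsub>S\<^esub> x) = (\<Oplus>\<^bsub>R\<^esub>k\<in>T. c k \<otimes>\<^bsub>R\<^esub> \<phi> (k \<otimes>\<^bsub>S\<^esub> x))"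
  using assms(1-3)
proof (induction T rule: finite_induct)
  case empty
  then show ?case using assms(4) by (simp add: \<phi>_zero)
next
  case (insert k T)
  have k: "k \<in> carrier S" "c k \<in> carrier R" and T: "T \<subseteq> carrier S" using insert.prems by auto
  have cl: "(\<Oplus>\<^bsub>S\<^esub>k\<in>T. \<iota> (c k) \<otimes>\<^bsub>S\<^esub> k) \<in> carrier S"
    using insert.prems T by (intro S.finsum_closed) auto
  have "(\<Oplus>\<^bsub>S\<^esub>k\<in>insert k T. \<iota> (c k) \<otimes>\<^bsub>S\<^esub> k) = \<iota> (c k) \<otimes>\<^bsub>S\<^esub> k \<oplus>\<^bsub>S\<^esub> (\<Oplus>\<^bsub>S\<^esub>k\<in>T. \<iota> (c k) \<otimes>\<^bsub>S\<^esub> k)"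
    using insert.hyps insert.prems T k by (intro S.finsum_insert) auto
  then have "\<phi> ((\<Oplus>\<^bsub>S\<^esub>k\<in>insert k T. \<iota> (c k) \<otimes>\<^bsub>S\<^esub> k) \<otimes>\<^bsub>S\<^esub> x) =
      \<phi> (\<iota> (c k) \<otimes>\<^bsub>S\<^esub> (k \<otimes>\<^bsub>S\<^esub> x) \<oplus>\<^bsub>S\<^esub> (\<Oplus>\<^bsub>S\<^esub>k\<in>T. \<iota> (c k) \<otimes>\<^bsub>S\<^esub> k) \<otimes>\<^bsub>S\<^esub> x)"
    using cl k assms(4) by (simp add: S.l_distr S.m_assoc)
  also have "\<dots> = c k \<otimes>\<^bsub>R\<^esub> \<phi> (k \<otimes>\<^bsub>S\<^esub> x) \<oplus>\<^bsub>R\<^esub> (\<Oplus>\<^bsub>R\<^esub>k\<in>T. c k \<otimes>\<^bsub>R\<^esub> \<phi> (k \<otimes>\<^bsub>S\<^esub> x))"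
    using cl k assms(4) insert.IH insert.prems T by (simp add: \<phi>_add \<phi>_smult)
  also have "\<dots> = (\<Oplus>\<^bsub>R\<^esub>k\<in>insert k T. c k \<otimes>\<^bsub>R\<^esub> \<phi> (k \<otimes>\<^bsub>S\<^esub> x))"
    using insert.hyps insert.prems T k assms(4) by (intro R.finsum_insert[symmetric]) auto
  finally show ?case .
qed

text \<open>
  The form \<open>(x, y) \<mapsto> \<phi> (x y)\<close> is nondegenerate: if \<open>\<phi> (z S) = 0\<close> for some \<open>z \<noteq> 0\<close>, then a nonzero multiple
  \<open>\<iota> r\<close> of \<open>z\<close> would give \<open>r = \<phi> (\<iota> r) = 0\<close>.  So the system of equations for a dual vector is solvable up
  to a nonzero factor \<open>b\<close>.
\<close>

lemma dual_element:
  assumes J: "generic_basis J d" and sep: separable_ext and e: "e \<in> J"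
  shows "\<exists>b\<in>carrier R - {\<zero>\<^bsub>R\<^esub>}. \<exists>l\<in>carrier S. \<forall>x\<in>J. \<phi> (l \<otimes>\<^bsub>S\<^esub> x) = (if x = e then b else \<zero>\<^bsub>R\<^esub>)"
proof -
  note j = generic_basisD[OF J]
  \<comment> \<open>\<open>None\<close> stands for the wanted right-hand side.\<close>
  define V where "V = insert None (Some ` J)"
  define v where "v o' x = (case o' of None \<Rightarrow> if x = e then \<one>\<^bsub>R\<^esub> else \<zero>\<^bsub>R\<^esub> | Some k \<Rightarrow> \<phi> (k \<otimes>\<^bsub>S\<^esub> x))" for o' x
  have V: "finite V" "card V = Suc (card J)" using j(2) by (auto simp: V_def card_image card_insert_if)
  have vc: "v o' x \<in> carrier R" if "o' \<in> V" "x \<in> carrier S" for o' x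
    using that j(3) by (auto simp: V_def v_def)
  obtain g where g: "g \<in> V \<rightarrow> carrier R" "\<exists>o'\<in>V. g o' \<noteq> \<zero>\<^bsub>R\<^esub>"
    "\<And>x. x \<in> J \<Longrightarrow> (\<Oplus>\<^bsub>R\<^esub>o'\<in>V. g o' \<otimes>\<^bsub>R\<^esub> v o' x) = \<zero>\<^bsub>R\<^esub>"
    by (rule R.linear_dependence[OF R.carrier_is_subring j(2) V(1), of v])
       (use V(2) vc j(3) in auto)
  have gc: "\<And>o'. o' \<in> V \<Longrightarrow> g o' \<in> carrier R" using g(1) by blast
  have gS: "\<And>k. k \<in> J \<Longrightarrow> g (Some k) \<in> carrier R" and gN: "g None \<in> carrier R"
    using gc by (auto simp: V_def)
  define z where "z = (\<Oplus>\<^bsub>S\<^esub>k\<in>J. \<iota> (g (Some k)) \<otimes>\<^bsub>S\<^esub> k)"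
  have z: "z \<in> carrier S" unfolding z_def using gS j(3) by (intro S.finsum_closed) auto
  have \<phi>z: "\<phi> (z \<otimes>\<^bsub>S\<^esub> x) = (\<Oplus>\<^bsub>R\<^esub>k\<in>J. g (Some k) \<otimes>\<^bsub>R\<^esub> \<phi> (k \<otimes>\<^bsub>S\<^esub> x))" if "x \<in> carrier S" for x
    unfolding z_def by (rule \<phi>_combination[OF j(2,3) gS that])
  have rel: "(if x = e then g None else \<zero>\<^bsub>R\<^esub>) \<oplus>\<^bsub>R\<^esub> \<phi> (z \<otimes>\<^bsub>S\<^esub> x) = \<zero>\<^bsub>R\<^esub>" if x: "x \<in> J" for x
  proof -
    have xc: "x \<in> carrier S" using x j(3) by blast
    have "(\<Oplus>\<^bsub>R\<^esub>o'\<in>V. g o' \<otimes>\<^bsub>R\<^esub> v o' x) = g None \<otimes>\<^bsub>R\<^esub> v None x \<oplus>\<^bsub>R\<^esub> (\<Oplus>\<^bsub>R\<^esub>o'\<in>Some ` J. g o' \<otimes>\<^bsub>R\<^esub> v o' x)"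
      unfolding V_def using gc vc xc j(2) by (intro R.finsum_insert) (auto simp: V_def)
    also have "(\<Oplus>\<^bsub>R\<^esub>o'\<in>Some ` J. g o' \<otimes>\<^bsub>R\<^esub> v o' x) = (\<Oplus>\<^bsub>R\<^esub>k\<in>J. g (Some k) \<otimes>\<^bsub>R\<^esub> v (Some k) x)"
      using gc vc xc by (intro R.finsum_reindex) (auto simp: V_def)
    finally show ?thesis using g(3)[OF x] \<phi>z[OF xc] gN by (auto simp: v_def split: if_splits)
  qed
  have "g None \<noteq> \<zero>\<^bsub>R\<^esub>"
  proof
    assume gN0: "g None = \<zero>\<^bsub>R\<^esub>"
    have "\<phi> (z \<otimes>\<^bsub>S\<^esub> x) = \<zero>\<^bsub>R\<^esub>" if x: "x \<in> J" for x
      using rel[OF x] gN0 z j(3) x by (auto split: if_splits)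
    then have "\<eta> (\<phi> (z \<otimes>\<^bsub>S\<^esub> y)) = \<zero>\<^bsub>E\<^esub>" if "y \<in> carrier S" for y
      using semilinear_zero[OF H0 J \<phi>_semilinear[OF z] _ that] \<eta>_hom(3)[OF H0] by auto
    then have \<phi>0: "\<phi> (z \<otimes>\<^bsub>S\<^esub> y) = \<zero>\<^bsub>R\<^esub>" if "y \<in> carrier S" for y
      using \<eta>_closed(2)[OF H0] that z by simp
    obtain k where k: "k \<in> J" "g (Some k) \<noteq> \<zero>\<^bsub>R\<^esub>" using g(2) gN0 by (auto simp: V_def)
    have "z \<noteq> \<zero>\<^bsub>S\<^esub>"
    proof
      assume z0: "z = \<zero>\<^bsub>S\<^esub>"
      have gA: "(\<lambda>k. \<iota> (g (Some k))) \<in> J \<rightarrow> A" using gS by auto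
      have "\<iota> (g (Some k)) = \<zero>\<^bsub>S\<^esub>" by (rule lin_indepD[OF j(1) gA z0[unfolded z_def] k(1)])
      then show False using k gS \<iota>_zero_iff by blast
    qed
    then obtain s r where sr: "s \<in> carrier S" "r \<in> carrier R - {\<zero>\<^bsub>R\<^esub>}" "z \<otimes>\<^bsub>S\<^esub> s = \<iota> r"
      using nonzero_multiple[OF sep z] by blast
    have "\<phi> (\<iota> r) = r" using \<phi>_smult[of r "\<one>\<^bsub>S\<^esub>"] \<phi>_one sr(2) by simp
    then show False using \<phi>0[OF sr(1)] sr by simp
  qed
  moreover have "\<phi> ((\<iota> (\<ominus>\<^bsub>R\<^esub> \<one>\<^bsub>R\<^esub>) \<otimes>\<^bsub>S\<^esub> z) \<otimes>\<^bsub>S\<^esub> x) = (if x = e then g None else \<zero>\<^bsub>R\<^esub>)" if x: "x \<in> J" for x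
  proof -
    have xc: "x \<in> carrier S" using x j(3) by blast
    have "(\<iota> (\<ominus>\<^bsub>R\<^esub> \<one>\<^bsub>R\<^esub>) \<otimes>\<^bsub>S\<^esub> z) \<otimes>\<^bsub>S\<^esub> x = \<iota> (\<ominus>\<^bsub>R\<^esub> \<one>\<^bsub>R\<^esub>) \<otimes>\<^bsub>S\<^esub> (z \<otimes>\<^bsub>S\<^esub> x)"
      by (rule S.m_assoc) (use z xc in auto)
    then have "\<phi> ((\<iota> (\<ominus>\<^bsub>R\<^esub> \<one>\<^bsub>R\<^esub>) \<otimes>\<^bsub>S\<^esub> z) \<otimes>\<^bsub>S\<^esub> x) = (\<ominus>\<^bsub>R\<^esub> \<one>\<^bsub>R\<^esub>) \<otimes>\<^bsub>R\<^esub> \<phi> (z \<otimes>\<^bsub>S\<^esub> x)"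
      using \<phi>_smult[of "\<ominus>\<^bsub>R\<^esub> \<one>\<^bsub>R\<^esub>" "z \<otimes>\<^bsub>S\<^esub> x"] z xc by simp
    moreover have "(\<ominus>\<^bsub>R\<^esub> \<one>\<^bsub>R\<^esub>) \<otimes>\<^bsub>R\<^esub> u = w" if "w \<oplus>\<^bsub>R\<^esub> u = \<zero>\<^bsub>R\<^esub>" "w \<in> carrier R" "u \<in> carrier R" for u w
      using that by (metis R.l_minus R.l_one R.minus_equality R.one_closed)
    ultimately show ?thesis using rel[OF x] gN z xc by auto
  qed
  moreover have "\<iota> (\<ominus>\<^bsub>R\<^esub> \<one>\<^bsub>R\<^esub>) \<otimes>\<^bsub>S\<^esub> z \<in> carrier S" using z by auto
  ultimately show ?thesis using gN by blast
qed

lemma dual_basis: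
  assumes J: "generic_basis J d" and sep: separable_ext
  obtains \<beta> l where "\<beta> \<in> carrier R" "\<beta> \<noteq> \<zero>\<^bsub>R\<^esub>" "\<And>e. e \<in> J \<Longrightarrow> l e \<in> carrier S"
    "\<And>e x. e \<in> J \<Longrightarrow> x \<in> J \<Longrightarrow> \<phi> (l e \<otimes>\<^bsub>S\<^esub> x) = (if x = e then \<beta> else \<zero>\<^bsub>R\<^esub>)"
proof -
  note j = generic_basisD[OF J]
  obtain b l where bl: "\<And>e. e \<in> J \<Longrightarrow> b e \<in> carrier R - {\<zero>\<^bsub>R\<^esub>}" "\<And>e. e \<in> J \<Longrightarrow> l e \<in> carrier S"
    "\<And>e x. e \<in> J \<Longrightarrow> x \<in> J \<Longrightarrow> \<phi> (l e \<otimes>\<^bsub>S\<^esub> x) = (if x = e then b e else \<zero>\<^bsub>R\<^esub>)"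
  proof -
    have "\<forall>e\<in>J. \<exists>b l. b \<in> carrier R - {\<zero>\<^bsub>R\<^esub>} \<and> l \<in> carrier S \<and>
        (\<forall>x\<in>J. \<phi> (l \<otimes>\<^bsub>S\<^esub> x) = (if x = e then b else \<zero>\<^bsub>R\<^esub>))"
      using dual_element[OF J sep] by blast
    then obtain b where "\<forall>e\<in>J. \<exists>l. b e \<in> carrier R - {\<zero>\<^bsub>R\<^esub>} \<and> l \<in> carrier S \<and>
        (\<forall>x\<in>J. \<phi> (l \<otimes>\<^bsub>S\<^esub> x) = (if x = e then b e else \<zero>\<^bsub>R\<^esub>))" by (rule bchoice[THEN exE])
    then obtain l where "\<forall>e\<in>J. b e \<in> carrier R - {\<zero>\<^bsub>R\<^esub>} \<and> l e \<in> carrier S \<and>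
        (\<forall>x\<in>J. \<phi> (l e \<otimes>\<^bsub>S\<^esub> x) = (if x = e then b e else \<zero>\<^bsub>R\<^esub>))" by (rule bchoice[THEN exE])
    then show thesis by (intro that[of b l]) blast+
  qed
  obtain \<beta> where \<beta>: "\<beta> \<in> carrier R - {\<zero>\<^bsub>R\<^esub>}" "\<forall>e\<in>J. \<exists>m\<in>carrier R. \<beta> = m \<otimes>\<^bsub>R\<^esub> b e"
    by (rule R.common_multiple[OF j(2), of b, THEN bexE]) (use bl(1) in auto)
  then have "\<forall>e\<in>J. \<exists>m. m \<in> carrier R \<and> \<beta> = m \<otimes>\<^bsub>R\<^esub> b e" by blast
  then obtain m where "\<forall>e\<in>J. m e \<in> carrier R \<and> \<beta> = m e \<otimes>\<^bsub>R\<^esub> b e" by (rule bchoice[THEN exE])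
  then have m: "\<And>e. e \<in> J \<Longrightarrow> m e \<in> carrier R" "\<And>e. e \<in> J \<Longrightarrow> \<beta> = m e \<otimes>\<^bsub>R\<^esub> b e" by blast+
  have "\<phi> ((\<iota> (m e) \<otimes>\<^bsub>S\<^esub> l e) \<otimes>\<^bsub>S\<^esub> x) = (if x = e then \<beta> else \<zero>\<^bsub>R\<^esub>)" if ex: "e \<in> J" "x \<in> J" for e x
  proof -
    have xc: "x \<in> carrier S" using ex j(3) by blast
    have "\<phi> ((\<iota> (m e) \<otimes>\<^bsub>S\<^esub> l e) \<otimes>\<^bsub>S\<^esub> x) = m e \<otimes>\<^bsub>R\<^esub> \<phi> (l e \<otimes>\<^bsub>S\<^esub> x)"
      using m(1)[OF ex(1)] bl(2)[OF ex(1)] xc by (simp add: S.m_assoc \<phi>_smult)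
    then show ?thesis using bl(3)[OF ex] m(1)[OF ex(1)] m(2)[OF ex(1)] by auto
  qed
  moreover have "\<iota> (m e) \<otimes>\<^bsub>S\<^esub> l e \<in> carrier S" if "e \<in> J" for e using m(1) bl(2) that by simp
  ultimately show ?thesis using that[of \<beta> "\<lambda>e. \<iota> (m e) \<otimes>\<^bsub>S\<^esub> l e"] \<beta>(1) by blast
qed

text \<open>
  The coefficients of \<open>\<phi>\<close> at the embeddings are conjugate: \<open>c\<^sub>\<sigma> = \<sigma> (a/b)\<close>.  Let \<open>l\<^sub>e\<close> be dual to the basis
  elements \<open>e\<close> up to the factor \<open>\<beta>\<close>.  For an embedding \<open>k\<close>, expanding \<open>y\<close> in the basis gives
  \<open>\<beta> k y = \<Sum>\<^sub>e k e \<phi> (l\<^sub>e y) = \<Sum>\<^sub>\<sigma> (c\<^sub>\<sigma> \<Sum>\<^sub>e k e \<sigma> l\<^sub>e) \<sigma> y\<close>, and Dedekind's theorem compares the coefficients at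
  \<open>\<sigma> = k\<close>: \<open>\<beta> = c\<^sub>k k (\<Sum>\<^sub>e e l\<^sub>e)\<close>.  So \<open>a = \<beta>\<close> and \<open>b = \<Sum>\<^sub>e e l\<^sub>e\<close>.
\<close>

lemma splitting_numerator:
  assumes J: "generic_basis J d" and sep: separable_ext and card: "card J \<le> card H"
  obtains a b c where "a \<in> carrier S" "b \<in> carrier S" "b \<noteq> \<zero>\<^bsub>S\<^esub>"
    "\<And>\<sigma>. \<sigma> \<in> H \<Longrightarrow> c \<sigma> \<in> carrier E \<and> c \<sigma> \<otimes>\<^bsub>E\<^esub> \<sigma> b = \<sigma> a"
    "\<And>y. y \<in> carrier S \<Longrightarrow> (\<Oplus>\<^bsub>E\<^esub>\<sigma>\<in>H. c \<sigma> \<otimes>\<^bsub>E\<^esub> \<sigma> y) = \<eta> (\<phi> y)"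
proof -
  note j = generic_basisD[OF J]
  have "semilinear (\<lambda>y. \<eta> (\<phi> (\<one>\<^bsub>S\<^esub> \<otimes>\<^bsub>S\<^esub> y)))" by (rule \<phi>_semilinear) simp
  then obtain c where c: "\<And>\<sigma>. \<sigma> \<in> H \<Longrightarrow> c \<sigma> \<in> carrier E"
    and rep: "\<And>y. y \<in> carrier S \<Longrightarrow> \<eta> (\<phi> (\<one>\<^bsub>S\<^esub> \<otimes>\<^bsub>S\<^esub> y)) = (\<Oplus>\<^bsub>E\<^esub>\<sigma>\<in>H. c \<sigma> \<otimes>\<^bsub>E\<^esub> \<sigma> y)"
    by (rule functional_combination[OF H0 J card]) blast
  have rep: "\<eta> (\<phi> y) = (\<Oplus>\<^bsub>E\<^esub>\<sigma>\<in>H. c \<sigma> \<otimes>\<^bsub>E\<^esub> \<sigma> y)" if "y \<in> carrier S" for y using rep[OF that] that by simp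
  obtain \<beta> l where \<beta>: "\<beta> \<in> carrier R" "\<beta> \<noteq> \<zero>\<^bsub>R\<^esub>" and l: "\<And>e. e \<in> J \<Longrightarrow> l e \<in> carrier S"
    and dual: "\<And>e x. e \<in> J \<Longrightarrow> x \<in> J \<Longrightarrow> \<phi> (l e \<otimes>\<^bsub>S\<^esub> x) = (if x = e then \<beta> else \<zero>\<^bsub>R\<^esub>)"
    by (rule dual_basis[OF J sep]) blast
  note \<eta>\<beta> = \<eta>_closed(1)[OF H0 \<beta>(1)]
  have Jc: "\<And>e. e \<in> J \<Longrightarrow> e \<in> carrier S" using j(3) by blast
  define b where "b = (\<Oplus>\<^bsub>S\<^esub>e\<in>J. e \<otimes>\<^bsub>S\<^esub> l e)"
  have b: "b \<in> carrier S" unfolding b_def using Jc l by (intro S.finsum_closed) auto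
  have cb: "c k \<otimes>\<^bsub>E\<^esub> k b = \<eta> \<beta>" if k: "k \<in> H" for k
  proof -
    interpret k: ring_hom_cring S E k by (rule H_hom[OF k])
    have exp: "\<eta> \<beta> \<otimes>\<^bsub>E\<^esub> k y = (\<Oplus>\<^bsub>E\<^esub>e\<in>J. k e \<otimes>\<^bsub>E\<^esub> \<eta> (\<phi> (l e \<otimes>\<^bsub>S\<^esub> y)))" if y: "y \<in> carrier S" for y
    proof (rule semilinear_agree[OF H0 J _ _ _ y])
      show "semilinear (\<lambda>y. \<eta> \<beta> \<otimes>\<^bsub>E\<^esub> k y)"
        unfolding semilinear_def using \<eta>\<beta> \<eta>_closed(1)[OF H0] is_extD(3)[OF H(2)[OF k]]
        by (auto simp: E.r_distr E.m_lcomm)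
      show "semilinear (\<lambda>y. \<Oplus>\<^bsub>E\<^esub>e\<in>J. k e \<otimes>\<^bsub>E\<^esub> \<eta> (\<phi> (l e \<otimes>\<^bsub>S\<^esub> y)))"
        by (rule semilinear_finsum[OF H0 j(2), of k]) (use Jc l \<phi>_semilinear in auto)
    next
      fix x assume x: "x \<in> J"
      have "(\<Oplus>\<^bsub>E\<^esub>e\<in>J. k e \<otimes>\<^bsub>E\<^esub> \<eta> (\<phi> (l e \<otimes>\<^bsub>S\<^esub> x))) = (\<Oplus>\<^bsub>E\<^esub>e\<in>J. if x = e then k e \<otimes>\<^bsub>E\<^esub> \<eta> \<beta> else \<zero>\<^bsub>E\<^esub>)"
        using dual[OF _ x] \<eta>_hom(3)[OF H0 \<beta>(1) \<beta>(1)] \<eta>\<beta> Jc by (intro E.finsum_cong') auto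
      also have "\<dots> = k x \<otimes>\<^bsub>E\<^esub> \<eta> \<beta>"
        using E.finsum_singleton[OF x j(2), of "\<lambda>e. k e \<otimes>\<^bsub>E\<^esub> \<eta> \<beta>"] \<eta>\<beta> Jc by auto
      finally show "\<eta> \<beta> \<otimes>\<^bsub>E\<^esub> k x = (\<Oplus>\<^bsub>E\<^esub>e\<in>J. k e \<otimes>\<^bsub>E\<^esub> \<eta> (\<phi> (l e \<otimes>\<^bsub>S\<^esub> x)))"
        using \<eta>\<beta> Jc[OF x] by (simp add: E.m_comm)
    qed
    define g where "g \<sigma> = c \<sigma> \<otimes>\<^bsub>E\<^esub> (\<Oplus>\<^bsub>E\<^esub>e\<in>J. k e \<otimes>\<^bsub>E\<^esub> \<sigma> (l e))" for \<sigma>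
    have sc: "(\<Oplus>\<^bsub>E\<^esub>e\<in>J. k e \<otimes>\<^bsub>E\<^esub> \<sigma> (l e)) \<in> carrier E" if "\<sigma> \<in> H" for \<sigma>
      using Jc l that by (intro E.finsum_closed) auto
    have gc: "g \<sigma> \<in> carrier E" if "\<sigma> \<in> H" for \<sigma> unfolding g_def using c sc that by auto
    have sum1: "\<eta> \<beta> \<otimes>\<^bsub>E\<^esub> k y = (\<Oplus>\<^bsub>E\<^esub>\<sigma>\<in>H. g \<sigma> \<otimes>\<^bsub>E\<^esub> \<sigma> y)" if y: "y \<in> carrier S" for y
    proof -
      have "(\<Oplus>\<^bsub>E\<^esub>e\<in>J. k e \<otimes>\<^bsub>E\<^esub> \<eta> (\<phi> (l e \<otimes>\<^bsub>S\<^esub> y))) = (\<Oplus>\<^bsub>E\<^esub>e\<in>J. \<Oplus>\<^bsub>E\<^esub>\<sigma>\<in>H. k e \<otimes>\<^bsub>E\<^esub> (c \<sigma> \<otimes>\<^bsub>E\<^esub> \<sigma> (l e \<otimes>\<^bsub>S\<^esub> y)))"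
      proof (rule E.finsum_cong'[OF refl])
        show "(\<lambda>e. \<Oplus>\<^bsub>E\<^esub>\<sigma>\<in>H. k e \<otimes>\<^bsub>E\<^esub> (c \<sigma> \<otimes>\<^bsub>E\<^esub> \<sigma> (l e \<otimes>\<^bsub>S\<^esub> y))) \<in> J \<rightarrow> carrier E"
          using c Jc l y by (auto intro!: E.finsum_closed)
        fix e assume e: "e \<in> J"
        have "l e \<otimes>\<^bsub>S\<^esub> y \<in> carrier S" using l e y by simp
        then show "k e \<otimes>\<^bsub>E\<^esub> \<eta> (\<phi> (l e \<otimes>\<^bsub>S\<^esub> y)) = (\<Oplus>\<^bsub>E\<^esub>\<sigma>\<in>H. k e \<otimes>\<^bsub>E\<^esub> (c \<sigma> \<otimes>\<^bsub>E\<^esub> \<sigma> (l e \<otimes>\<^bsub>S\<^esub> y)))"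
          unfolding rep[OF \<open>l e \<otimes>\<^bsub>S\<^esub> y \<in> carrier S\<close>] using c Jc[OF e] H(1) by (intro E.finsum_rdistr) auto
      qed
      also have "\<dots> = (\<Oplus>\<^bsub>E\<^esub>\<sigma>\<in>H. \<Oplus>\<^bsub>E\<^esub>e\<in>J. k e \<otimes>\<^bsub>E\<^esub> (c \<sigma> \<otimes>\<^bsub>E\<^esub> \<sigma> (l e \<otimes>\<^bsub>S\<^esub> y)))"
        using c Jc l y by (intro E.finsum_swap[OF j(2) H(1)]) auto
      also have "\<dots> = (\<Oplus>\<^bsub>E\<^esub>\<sigma>\<in>H. g \<sigma> \<otimes>\<^bsub>E\<^esub> \<sigma> y)"
      proof (rule E.finsum_cong'[OF refl])
        show "(\<lambda>\<sigma>. g \<sigma> \<otimes>\<^bsub>E\<^esub> \<sigma> y) \<in> H \<rightarrow> carrier E" using gc y by auto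
        fix \<sigma> assume \<sigma>: "\<sigma> \<in> H"
        interpret \<sigma>: ring_hom_cring S E \<sigma> by (rule H_hom[OF \<sigma>])
        have "g \<sigma> \<otimes>\<^bsub>E\<^esub> \<sigma> y = (c \<sigma> \<otimes>\<^bsub>E\<^esub> \<sigma> y) \<otimes>\<^bsub>E\<^esub> (\<Oplus>\<^bsub>E\<^esub>e\<in>J. k e \<otimes>\<^bsub>E\<^esub> \<sigma> (l e))"
          unfolding g_def using c[OF \<sigma>] sc[OF \<sigma>] y by (simp add: E.m_ac)
        also have "\<dots> = (\<Oplus>\<^bsub>E\<^esub>e\<in>J. (c \<sigma> \<otimes>\<^bsub>E\<^esub> \<sigma> y) \<otimes>\<^bsub>E\<^esub> (k e \<otimes>\<^bsub>E\<^esub> \<sigma> (l e)))"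
          using c[OF \<sigma>] y Jc l j(2) by (intro E.finsum_rdistr) auto
        also have "\<dots> = (\<Oplus>\<^bsub>E\<^esub>e\<in>J. k e \<otimes>\<^bsub>E\<^esub> (c \<sigma> \<otimes>\<^bsub>E\<^esub> \<sigma> (l e \<otimes>\<^bsub>S\<^esub> y)))"
          using c[OF \<sigma>] y Jc l by (intro E.finsum_cong') (auto simp: E.m_ac)
        finally show "(\<Oplus>\<^bsub>E\<^esub>e\<in>J. k e \<otimes>\<^bsub>E\<^esub> (c \<sigma> \<otimes>\<^bsub>E\<^esub> \<sigma> (l e \<otimes>\<^bsub>S\<^esub> y))) = g \<sigma> \<otimes>\<^bsub>E\<^esub> \<sigma> y" by simp
      qed
      finally show ?thesis using exp[OF y] by simp
    qed
    define g' where "g' \<sigma> = (if k = \<sigma> then \<eta> \<beta> else \<zero>\<^bsub>E\<^esub>)" for \<sigma>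
    have g'c: "g' \<sigma> \<in> carrier E" for \<sigma> using \<eta>\<beta> by (simp add: g'_def)
    have sum2: "\<eta> \<beta> \<otimes>\<^bsub>E\<^esub> k y = (\<Oplus>\<^bsub>E\<^esub>\<sigma>\<in>H. g' \<sigma> \<otimes>\<^bsub>E\<^esub> \<sigma> y)" if y: "y \<in> carrier S" for y
    proof -
      have "(\<Oplus>\<^bsub>E\<^esub>\<sigma>\<in>H. g' \<sigma> \<otimes>\<^bsub>E\<^esub> \<sigma> y) = (\<Oplus>\<^bsub>E\<^esub>\<sigma>\<in>H. if k = \<sigma> then \<eta> \<beta> \<otimes>\<^bsub>E\<^esub> \<sigma> y else \<zero>\<^bsub>E\<^esub>)"
        using \<eta>\<beta> y by (intro E.finsum_cong') (auto simp: g'_def)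
      also have "\<dots> = \<eta> \<beta> \<otimes>\<^bsub>E\<^esub> k y"
        using E.finsum_singleton[OF k H(1), of "\<lambda>\<sigma>. \<eta> \<beta> \<otimes>\<^bsub>E\<^esub> \<sigma> y"] \<eta>\<beta> y by auto
      finally show ?thesis by simp
    qed
    have "g k \<ominus>\<^bsub>E\<^esub> g' k = \<zero>\<^bsub>E\<^esub>"
    proof (rule independence[OF _ _ k])
      fix y assume y: "y \<in> carrier S"
      have "(\<Oplus>\<^bsub>E\<^esub>\<sigma>\<in>H. (g \<sigma> \<ominus>\<^bsub>E\<^esub> g' \<sigma>) \<otimes>\<^bsub>E\<^esub> \<sigma> y) \<oplus>\<^bsub>E\<^esub> (\<Oplus>\<^bsub>E\<^esub>\<sigma>\<in>H. g' \<sigma> \<otimes>\<^bsub>E\<^esub> \<sigma> y) =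
          (\<Oplus>\<^bsub>E\<^esub>\<sigma>\<in>H. (g \<sigma> \<ominus>\<^bsub>E\<^esub> g' \<sigma>) \<otimes>\<^bsub>E\<^esub> \<sigma> y \<oplus>\<^bsub>E\<^esub> g' \<sigma> \<otimes>\<^bsub>E\<^esub> \<sigma> y)"
        using gc g'c y by (intro E.finsum_addf[symmetric]) auto
      also have "\<dots> = (\<Oplus>\<^bsub>E\<^esub>\<sigma>\<in>H. g \<sigma> \<otimes>\<^bsub>E\<^esub> \<sigma> y)"
      proof (rule E.finsum_cong'[OF refl])
        fix \<sigma> assume "\<sigma> \<in> H"
        moreover have "(u \<ominus>\<^bsub>E\<^esub> v) \<otimes>\<^bsub>E\<^esub> w \<oplus>\<^bsub>E\<^esub> v \<otimes>\<^bsub>E\<^esub> w = u \<otimes>\<^bsub>E\<^esub> w" if "u \<in> carrier E" "v \<in> carrier E" "w \<in> carrier E" for u v w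
          using that by algebra
        ultimately show "(g \<sigma> \<ominus>\<^bsub>E\<^esub> g' \<sigma>) \<otimes>\<^bsub>E\<^esub> \<sigma> y \<oplus>\<^bsub>E\<^esub> g' \<sigma> \<otimes>\<^bsub>E\<^esub> \<sigma> y = g \<sigma> \<otimes>\<^bsub>E\<^esub> \<sigma> y" using gc g'c y by simp
      qed (use gc y in auto)
      also have "\<dots> = (\<Oplus>\<^bsub>E\<^esub>\<sigma>\<in>H. g' \<sigma> \<otimes>\<^bsub>E\<^esub> \<sigma> y)" using sum1[OF y] sum2[OF y] by simp
      finally have *: "(\<Oplus>\<^bsub>E\<^esub>\<sigma>\<in>H. (g \<sigma> \<ominus>\<^bsub>E\<^esub> g' \<sigma>) \<otimes>\<^bsub>E\<^esub> \<sigma> y) \<oplus>\<^bsub>E\<^esub> (\<Oplus>\<^bsub>E\<^esub>\<sigma>\<in>H. g' \<sigma> \<otimes>\<^bsub>E\<^esub> \<sigma> y) = (\<Oplus>\<^bsub>E\<^esub>\<sigma>\<in>H. g' \<sigma> \<otimes>\<^bsub>E\<^esub> \<sigma> y)" .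
      have "(\<Oplus>\<^bsub>E\<^esub>\<sigma>\<in>H. (g \<sigma> \<ominus>\<^bsub>E\<^esub> g' \<sigma>) \<otimes>\<^bsub>E\<^esub> \<sigma> y) \<in> carrier E" "(\<Oplus>\<^bsub>E\<^esub>\<sigma>\<in>H. g' \<sigma> \<otimes>\<^bsub>E\<^esub> \<sigma> y) \<in> carrier E"
        using gc g'c y by (auto intro!: E.finsum_closed)
      then show "(\<Oplus>\<^bsub>E\<^esub>\<sigma>\<in>H. (g \<sigma> \<ominus>\<^bsub>E\<^esub> g' \<sigma>) \<otimes>\<^bsub>E\<^esub> \<sigma> y) = \<zero>\<^bsub>E\<^esub>"
      proof -
        have "u = \<zero>\<^bsub>E\<^esub>" if "u \<oplus>\<^bsub>E\<^esub> v = v" "u \<in> carrier E" "v \<in> carrier E" for u v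
        proof -
          have "u = (u \<oplus>\<^bsub>E\<^esub> v) \<ominus>\<^bsub>E\<^esub> v" using that(2,3) by algebra
          then show ?thesis unfolding that(1) using that(3) by (simp add: a_minus_def E.r_neg)
        qed
        from this[OF *] show ?thesis
          using \<open>(\<Oplus>\<^bsub>E\<^esub>\<sigma>\<in>H. (g \<sigma> \<ominus>\<^bsub>E\<^esub> g' \<sigma>) \<otimes>\<^bsub>E\<^esub> \<sigma> y) \<in> carrier E\<close> \<open>(\<Oplus>\<^bsub>E\<^esub>\<sigma>\<in>H. g' \<sigma> \<otimes>\<^bsub>E\<^esub> \<sigma> y) \<in> carrier E\<close> by blast
      qed
    qed (use gc g'c in auto)
    then have "g k = \<eta> \<beta>" using gc[OF k] g'c[of k] by (simp add: g'_def)
    moreover have "k b = (\<Oplus>\<^bsub>E\<^esub>e\<in>J. k e \<otimes>\<^bsub>E\<^esub> k (l e))"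
      unfolding b_def using Jc l
      by (subst k.hom_finsum) (auto intro!: E.finsum_cong')
    ultimately show ?thesis by (simp add: g_def)
  qed
  have "b \<noteq> \<zero>\<^bsub>S\<^esub>"
  proof
    assume b0: "b = \<zero>\<^bsub>S\<^esub>"
    obtain k where k: "k \<in> H" using H0 by blast
    have "\<eta> \<beta> = \<zero>\<^bsub>E\<^esub>" using cb[OF k] c[OF k] ring_hom_cring.hom_zero[OF H_hom[OF k]] b0 by simp
    then show False using \<eta>_closed(2)[OF H0 \<beta>(1)] \<beta>(2) by blast
  qed
  moreover have "c \<sigma> \<in> carrier E \<and> c \<sigma> \<otimes>\<^bsub>E\<^esub> \<sigma> b = \<sigma> (\<iota> \<beta>)" if "\<sigma> \<in> H" for \<sigma>
    using c[OF that] cb[OF that] is_extD(3)[OF H(2)[OF that] \<beta>(1)] by simp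
  ultimately show ?thesis using that[of "\<iota> \<beta>" b c] \<beta>(1) b rep by simp
qed

end

section \<open>Embeddings of a separable extension into an algebraically closed field\<close>

lemma (in cring) deriv_eval_normalize:
  "set f \<subseteq> carrier R \<Longrightarrow> x \<in> carrier R \<Longrightarrow> deriv_eval R (normalize f) x = deriv_eval R f x"
  by (induction f) auto

lemma deriv_eval_consistent: "deriv_eval (E\<lparr>carrier := F\<rparr>) f x = deriv_eval E f x"
  by (induction f) (simp_all add: add_pow_def nat_pow_def)

context domain
begin

lemma linear_poly_closed: "\<beta> \<in> carrier R \<Longrightarrow> [\<one>, \<ominus> \<beta>] \<in> carrier (poly_ring R)"
  by (simp add: univ_poly_def polynomial_def)

lemma root_factor:
  assumes p: "p \<in> carrier (poly_ring R)" and \<beta>: "\<beta> \<in> carrier R" and root: "eval p \<beta> = \<zero>"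
  shows "\<exists>k\<in>carrier (poly_ring R). p = [\<one>, \<ominus> \<beta>] \<otimes>\<^bsub>poly_ring R\<^esub> k \<and> eval k \<beta> = deriv_eval R p \<beta>"
proof -
  interpret UP: domain "poly_ring R" by (rule univ_poly_is_domain[OF carrier_is_subring])
  interpret c: ring_hom_cring R "poly_ring R" poly_of_const
    using canonical_embedding_is_hom[OF carrier_is_subring] by unfold_locales simp
  interpret ev: ring_hom_cring "poly_ring R" R "\<lambda>p. eval p \<beta>"
    by (rule eval_cring_hom[OF carrier_is_subring \<beta>])
  let ?X = "X :: 'a list" and ?c = "poly_of_const :: 'a \<Rightarrow> 'a list" and ?l = "[\<one>, \<ominus> \<beta>]"
  have X: "?X \<in> carrier (poly_ring R)" using var_closed[OF carrier_is_subring] by blast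
  have l: "?l \<in> carrier (poly_ring R)" by (rule linear_poly_closed[OF \<beta>])
  have pc: "set p \<subseteq> carrier R" using p by (auto simp: univ_poly_def polynomial_def)
  have cp: "set (map ?c p) \<subseteq> carrier (poly_ring R)" using pc by auto
  have lin: "?X \<ominus>\<^bsub>poly_ring R\<^esub> ?c \<beta> = ?l"
  proof -
    have "?l = UP.eval (map ?c ?l) ?X" by (rule eval_rewrite[OF carrier_is_subring l])
    also have "\<dots> = ?X \<ominus>\<^bsub>poly_ring R\<^esub> ?c \<beta>" using X \<beta> by (simp add: a_minus_def)
    finally show ?thesis by simp
  qed
  obtain h where h: "h \<in> carrier (poly_ring R)"
    "UP.eval (map ?c p) ?X \<ominus>\<^bsub>poly_ring R\<^esub> UP.eval (map ?c p) (?c \<beta>) =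
      (?X \<ominus>\<^bsub>poly_ring R\<^esub> ?c \<beta>) \<otimes>\<^bsub>poly_ring R\<^esub> (deriv_eval (poly_ring R) (map ?c p) (?c \<beta>)
        \<oplus>\<^bsub>poly_ring R\<^esub> (?X \<ominus>\<^bsub>poly_ring R\<^esub> ?c \<beta>) \<otimes>\<^bsub>poly_ring R\<^esub> h)"
    using UP.eval_taylor[OF UP.carrier_is_subring X c.hom_closed[OF \<beta>] cp] by blast
  have 1: "UP.eval (map ?c p) ?X = p" using eval_rewrite[OF carrier_is_subring p] by simp
  have 2: "UP.eval (map ?c p) (?c \<beta>) = \<zero>\<^bsub>poly_ring R\<^esub>"
    using c.ring.eval_hom'[OF \<beta> pc] root by simp
  have 3: "deriv_eval (poly_ring R) (map ?c p) (?c \<beta>) = ?c (deriv_eval R p \<beta>)"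
    using c.hom_deriv_eval[OF pc \<beta>] by simp
  have dc: "deriv_eval R p \<beta> \<in> carrier R" by (rule deriv_eval_closed[OF pc \<beta>])
  define k where "k = ?c (deriv_eval R p \<beta>) \<oplus>\<^bsub>poly_ring R\<^esub> ?l \<otimes>\<^bsub>poly_ring R\<^esub> h"
  have k: "k \<in> carrier (poly_ring R)" unfolding k_def using l h(1) dc by simp
  have "p = ?l \<otimes>\<^bsub>poly_ring R\<^esub> k" using h(2) p unfolding 1 2 3 lin k_def by (simp add: a_minus_def)
  moreover have "eval k \<beta> = deriv_eval R p \<beta>"
  proof -
    have "eval ?l \<beta> = \<zero>" using \<beta> by (simp add: r_neg)
    moreover have "eval (?c (deriv_eval R p \<beta>)) \<beta> = deriv_eval R p \<beta>"
      unfolding poly_of_const_def using eval_normalize[of "[deriv_eval R p \<beta>]" \<beta>] dc \<beta> by simp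
    ultimately show ?thesis unfolding k_def using ev.hom_add ev.hom_mult l h(1) dc by simp
  qed
  ultimately show ?thesis using k by blast
qed

lemma deriv_eval_mult_root:
  assumes q: "q \<in> carrier (poly_ring R)" and g: "g \<in> carrier (poly_ring R)" and \<beta>: "\<beta> \<in> carrier R"
    and root: "eval q \<beta> = \<zero>"
  shows "deriv_eval R (q \<otimes>\<^bsub>poly_ring R\<^esub> g) \<beta> = deriv_eval R q \<beta> \<otimes> eval g \<beta>"
proof -
  interpret UP: domain "poly_ring R" by (rule univ_poly_is_domain[OF carrier_is_subring])
  interpret ev: ring_hom_cring "poly_ring R" R "\<lambda>p. eval p \<beta>"
    by (rule eval_cring_hom[OF carrier_is_subring \<beta>])
  note l = linear_poly_closed[OF \<beta>]
  obtain k where k: "k \<in> carrier (poly_ring R)" "q = [\<one>, \<ominus> \<beta>] \<otimes>\<^bsub>poly_ring R\<^esub> k" "eval k \<beta> = deriv_eval R q \<beta>"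
    using root_factor[OF q \<beta> root] by blast
  have "eval (q \<otimes>\<^bsub>poly_ring R\<^esub> g) \<beta> = \<zero>"
    using ev.hom_mult[OF q g] ev.hom_closed[OF g] root by simp
  then obtain k' where k': "k' \<in> carrier (poly_ring R)" "q \<otimes>\<^bsub>poly_ring R\<^esub> g = [\<one>, \<ominus> \<beta>] \<otimes>\<^bsub>poly_ring R\<^esub> k'"
    "eval k' \<beta> = deriv_eval R (q \<otimes>\<^bsub>poly_ring R\<^esub> g) \<beta>"
    using root_factor[OF UP.m_closed[OF q g] \<beta>] by blast
  have "[\<one>, \<ominus> \<beta>] \<otimes>\<^bsub>poly_ring R\<^esub> k' = [\<one>, \<ominus> \<beta>] \<otimes>\<^bsub>poly_ring R\<^esub> (k \<otimes>\<^bsub>poly_ring R\<^esub> g)"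
    using k'(2) k(1,2) l g by (simp add: UP.m_assoc)
  moreover have "[\<one>, \<ominus> \<beta>] \<noteq> \<zero>\<^bsub>poly_ring R\<^esub>" by (simp add: univ_poly_zero)
  ultimately have "k' = k \<otimes>\<^bsub>poly_ring R\<^esub> g"
    using UP.m_lcancel[OF _ l k'(1)] k(1) g by simp
  then show ?thesis using k'(3) k(3) ev.hom_mult[OF k(1) g] by simp
qed

text \<open>
  A double root would be a common root with the derivative.
\<close>

lemma simple_roots_card:
  assumes p: "p \<in> carrier (poly_ring R)"
    and simple: "\<And>\<beta>. \<beta> \<in> carrier R \<Longrightarrow> eval p \<beta> = \<zero> \<Longrightarrow> deriv_eval R p \<beta> \<noteq> \<zero>"
  shows "card (set_mset (roots p)) = size (roots p)"
proof -
  interpret UP: domain "poly_ring R" by (rule univ_poly_is_domain[OF carrier_is_subring])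
  have "count (roots p) \<beta> = 1" if \<beta>: "\<beta> \<in># roots p" for \<beta>
  proof -
    have b: "\<beta> \<in> carrier R" "eval p \<beta> = \<zero>"
      using roots_mem_iff_is_root[OF p] \<beta> by (auto simp: is_root_def)
    interpret ev: ring_hom_cring "poly_ring R" R "\<lambda>p. eval p \<beta>"
      by (rule eval_cring_hom[OF carrier_is_subring b(1)])
    note l = linear_poly_closed[OF b(1)]
    have l0: "eval [\<one>, \<ominus> \<beta>] \<beta> = \<zero>" using b by (simp add: r_neg)
    have "\<not> 2 \<le> alg_mult p \<beta>"
    proof
      assume "2 \<le> alg_mult p \<beta>"
      then have "([\<one>, \<ominus> \<beta>] [^]\<^bsub>poly_ring R\<^esub> (2::nat)) pdivides p"
        using le_alg_mult_imp_pdivides[OF b(1) p] by blast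
      then obtain h where h: "h \<in> carrier (poly_ring R)"
        "p = ([\<one>, \<ominus> \<beta>] [^]\<^bsub>poly_ring R\<^esub> (2::nat)) \<otimes>\<^bsub>poly_ring R\<^esub> h"
        unfolding pdivides_def factor_def by blast
      then have ph: "p = [\<one>, \<ominus> \<beta>] \<otimes>\<^bsub>poly_ring R\<^esub> ([\<one>, \<ominus> \<beta>] \<otimes>\<^bsub>poly_ring R\<^esub> h)"
        using l by (simp add: numeral_2_eq_2 UP.m_assoc)
      have lh: "[\<one>, \<ominus> \<beta>] \<otimes>\<^bsub>poly_ring R\<^esub> h \<in> carrier (poly_ring R)" using l h by simp
      have "eval ([\<one>, \<ominus> \<beta>] \<otimes>\<^bsub>poly_ring R\<^esub> h) \<beta> = \<zero>"
        using ev.hom_mult[OF l h(1)] l0 ev.hom_closed[OF h(1)] by simp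
      then have "deriv_eval R p \<beta> = \<zero>"
        using deriv_eval_mult_root[OF l lh b(1) l0] ph b(1) by simp
      then show False using simple b by blast
    qed
    moreover have "alg_mult p \<beta> = count (roots p) \<beta>" using alg_mult_eq_count_roots[OF p] by simp
    moreover have "count (roots p) \<beta> > 0" using \<beta> by simp
    ultimately show ?thesis by linarith
  qed
  then have "sum (count (roots p)) (set_mset (roots p)) = sum (\<lambda>_. 1) (set_mset (roots p))"
    by (intro sum.cong) auto
  then show ?thesis by (simp add: size_multiset_overloaded_eq)
qed

end

lemma ring_hom_factor:
  assumes "ring P" "ring F" "ring E" and u: "u \<in> ring_hom P F" "u ` carrier P = carrier F" and v: "v \<in> ring_hom P E"
    and ker: "\<And>x. x \<in> carrier P \<Longrightarrow> u x = \<zero>\<^bsub>F\<^esub> \<Longrightarrow> v x = \<zero>\<^bsub>E\<^esub>"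
  obtains \<tau> where "\<tau> \<in> ring_hom F E" "\<And>x. x \<in> carrier P \<Longrightarrow> \<tau> (u x) = v x"
proof -
  interpret u: ring_hom_ring P F u by (rule ring_hom_ringI2[OF assms(1,2) u(1)])
  interpret v: ring_hom_ring P E v by (rule ring_hom_ringI2[OF assms(1,3) v])
  define \<tau> where "\<tau> z = v (inv_into (carrier P) u z)" for z
  have \<tau>: "\<tau> (u x) = v x" if x: "x \<in> carrier P" for x
  proof -
    define y where "y = inv_into (carrier P) u (u x)"
    have y: "y \<in> carrier P" "u y = u x" using x by (auto simp: y_def inv_into_into f_inv_into_f)
    have "u (y \<ominus>\<^bsub>P\<^esub> x) = \<zero>\<^bsub>F\<^esub>" using x y by (simp add: a_minus_def u.S.r_neg)
    then have "v (y \<ominus>\<^bsub>P\<^esub> x) = \<zero>\<^bsub>E\<^esub>" using ker x y by simp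
    then have "v y \<ominus>\<^bsub>E\<^esub> v x = \<zero>\<^bsub>E\<^esub>" using x y by (simp add: a_minus_def)
    then have "v y = v x" using x y by simp
    then show ?thesis by (simp add: \<tau>_def y_def)
  qed
  have "\<tau> \<in> ring_hom F E"
  proof (rule ring_hom_memI)
    fix x assume "x \<in> carrier F"
    then obtain a where "a \<in> carrier P" "x = u a" using u(2) by blast
    then show "\<tau> x \<in> carrier E" using \<tau> by simp
    fix y assume "y \<in> carrier F"
    then obtain b where "b \<in> carrier P" "y = u b" using u(2) by blast
    then show "\<tau> (x \<otimes>\<^bsub>F\<^esub> y) = \<tau> x \<otimes>\<^bsub>E\<^esub> \<tau> y" "\<tau> (x \<oplus>\<^bsub>F\<^esub> y) = \<tau> x \<oplus>\<^bsub>E\<^esub> \<tau> y"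
      using \<tau>[of a] \<tau>[of b] \<tau>[of "a \<otimes>\<^bsub>P\<^esub> b"] \<tau>[of "a \<oplus>\<^bsub>P\<^esub> b"] \<open>a \<in> carrier P\<close> \<open>x = u a\<close> by auto
  next
    show "\<tau> \<one>\<^bsub>F\<^esub> = \<one>\<^bsub>E\<^esub>" using \<tau>[of "\<one>\<^bsub>P\<^esub>"] by simp
  qed
  then show ?thesis using that \<tau> by blast
qed

text \<open>
  \<open>F(y)\<close> is the quotient of \<open>F[X]\<close> by the minimal polynomial of \<open>y\<close>, and evaluation at \<open>\<beta>\<close> factors through it.
\<close>

lemma (in field) extend_hom_simple:
  assumes F: "subfield F R" and y: "y \<in> carrier R" "(algebraic over F) y" and E: "field E"
    and \<rho>: "\<rho> \<in> ring_hom (R\<lparr>carrier := F\<rparr>) E"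
    and \<beta>: "\<beta> \<in> carrier E" "ring.eval E (map \<rho> (Irr F y)) \<beta> = \<zero>\<^bsub>E\<^esub>"
  obtains \<tau> where "\<tau> \<in> ring_hom (R\<lparr>carrier := simple_extension F y\<rparr>) E" "\<tau> y = \<beta>" "\<And>x. x \<in> F \<Longrightarrow> \<tau> x = \<rho> x"
proof -
  interpret E: field E by (rule E)
  have Fs: "subring F R" using subfieldE(1)[OF F] .
  interpret RF: field "R\<lparr>carrier := F\<rparr>" using subfield_iff(2)[OF F] .
  interpret \<rho>: ring_hom_cring "R\<lparr>carrier := F\<rparr>" E \<rho> using \<rho> by unfold_locales
  interpret UP: domain "F[X]" by (rule univ_poly_is_domain[OF Fs])
  interpret u: ring_hom_cring "F[X]" R "\<lambda>p. eval p y" by (rule eval_cring_hom[OF Fs y(1)])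
  let ?F' = "simple_extension F y"
  have F': "subfield ?F' R" using simple_extension_is_subfield[OF F y(1)] y(2) by simp
  have polyF: "set p \<subseteq> F" if "p \<in> carrier (F[X])" for p using that by (auto simp: univ_poly_def polynomial_def)
  have polyE: "set (map \<rho> p) \<subseteq> carrier E" if "p \<in> carrier (F[X])" for p using polyF[OF that] \<rho>.hom_closed by auto
  define v where "v p = E.eval (map \<rho> p) \<beta>" for p
  have v: "v \<in> ring_hom (F[X]) E"
  proof (rule ring_hom_memI)
    fix p assume p: "p \<in> carrier (F[X])"
    show "v p \<in> carrier E" unfolding v_def using E.eval_in_carrier[OF polyE[OF p] \<beta>(1)] .
    fix q assume q: "q \<in> carrier (F[X])"
    have pq: "set p \<subseteq> carrier (R\<lparr>carrier := F\<rparr>)" "set q \<subseteq> carrier (R\<lparr>carrier := F\<rparr>)" using polyF p q by auto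
    have "E.normalize (map \<rho> (poly_mult p q)) = E.poly_mult (map \<rho> p) (map \<rho> q)"
      using \<rho>.ring.poly_mult_hom'[OF pq] poly_mult_consistent[OF Fs] by simp
    then have "E.eval (E.normalize (map \<rho> (poly_mult p q))) \<beta> = v p \<otimes>\<^bsub>E\<^esub> v q"
      using E.eval_poly_mult[OF polyE[OF p] polyE[OF q] \<beta>(1)] by (simp add: v_def)
    moreover have "p \<otimes>\<^bsub>F[X]\<^esub> q = poly_mult p q" by (simp add: univ_poly_mult)
    moreover have "E.eval (E.normalize (map \<rho> (p \<otimes>\<^bsub>F[X]\<^esub> q))) \<beta> = v (p \<otimes>\<^bsub>F[X]\<^esub> q)"
      unfolding v_def by (rule E.eval_normalize[OF polyE[OF UP.m_closed[OF p q]] \<beta>(1)])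
    ultimately show "v (p \<otimes>\<^bsub>F[X]\<^esub> q) = v p \<otimes>\<^bsub>E\<^esub> v q" by simp
    have "E.normalize (map \<rho> (poly_add p q)) = E.poly_add (map \<rho> p) (map \<rho> q)"
      using \<rho>.ring.poly_add_hom'[OF pq] poly_add_consistent[OF Fs] by simp
    then have "E.eval (E.normalize (map \<rho> (poly_add p q))) \<beta> = v p \<oplus>\<^bsub>E\<^esub> v q"
      using E.eval_poly_add[OF polyE[OF p] polyE[OF q] \<beta>(1)] by (simp add: v_def del: E.poly_add.simps)
    moreover have "p \<oplus>\<^bsub>F[X]\<^esub> q = poly_add p q" by (simp add: univ_poly_add)
    moreover have "E.eval (E.normalize (map \<rho> (p \<oplus>\<^bsub>F[X]\<^esub> q))) \<beta> = v (p \<oplus>\<^bsub>F[X]\<^esub> q)"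
      unfolding v_def by (rule E.eval_normalize[OF polyE[OF UP.a_closed[OF p q]] \<beta>(1)])
    ultimately show "v (p \<oplus>\<^bsub>F[X]\<^esub> q) = v p \<oplus>\<^bsub>E\<^esub> v q" by simp
  next
    show "v \<one>\<^bsub>F[X]\<^esub> = \<one>\<^bsub>E\<^esub>" using \<beta>(1) \<rho>.hom_one by (simp add: v_def univ_poly_one)
  qed
  interpret v: ring_hom_cring "F[X]" E v using v by unfold_locales
  note I = IrrE[OF F y]
  have img: "(\<lambda>p. eval p y) ` carrier (F[X]) = ?F'"
    using simple_extension_as_eval_img[OF subfieldE(3)[OF F] y(1)] by simp
  have uF: "(\<lambda>p. eval p y) \<in> ring_hom (F[X]) (R\<lparr>carrier := ?F'\<rparr>)"
    using u.homh img unfolding ring_hom_def by auto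
  have F'r: "ring (R\<lparr>carrier := ?F'\<rparr>)" using subring_is_ring[OF subfieldE(1)[OF F']] .
  obtain \<tau> where \<tau>: "\<tau> \<in> ring_hom (R\<lparr>carrier := ?F'\<rparr>) E" "\<And>p. p \<in> carrier (F[X]) \<Longrightarrow> \<tau> (eval p y) = v p"
  proof (rule ring_hom_factor[OF UP.ring_axioms F'r E.ring_axioms uF _ v])
    show "(\<lambda>p. eval p y) ` carrier (F[X]) = carrier (R\<lparr>carrier := ?F'\<rparr>)" using img by simp
    fix p assume p: "p \<in> carrier (F[X])" and "eval p y = \<zero>\<^bsub>R\<lparr>carrier := ?F'\<rparr>\<^esub>"
    then have "p \<in> a_kernel (F[X]) R (\<lambda>p. eval p y)" unfolding a_kernel_def' by simp
    then have "p \<in> PIdl\<^bsub>F[X]\<^esub> (Irr F y)" using Irr_generates_ker[OF F y] by simp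
    then obtain g where g: "g \<in> carrier (F[X])" "p = g \<otimes>\<^bsub>F[X]\<^esub> Irr F y" unfolding cgenideal_def by blast
    have "v (Irr F y) = \<zero>\<^bsub>E\<^esub>" using \<beta>(2) by (simp add: v_def)
    then show "v p = \<zero>\<^bsub>E\<^esub>" unfolding g(2) using v.hom_mult[OF g(1) I(1)] v.hom_closed[OF g(1)] by simp
  qed blast
  have "\<tau> y = \<beta>"
  proof -
    have X: "X \<in> carrier (F[X])" using var_closed(1)[OF Fs] .
    have "v X = \<beta>" using \<beta>(1) \<rho>.hom_one \<rho>.hom_zero by (simp add: v_def var_def)
    then show ?thesis using \<tau>(2)[OF X] eval_var[OF y(1)] by simp
  qed
  moreover have "\<tau> x = \<rho> x" if x: "x \<in> F" for x
  proof -
    have xc: "x \<in> carrier R" using x subfieldE(3)[OF F] by blast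
    have c: "normalize [x] \<in> carrier (F[X])"
      using normalize_gives_polynomial[of "[x]" F] x by (simp add: univ_poly_carrier)
    have "eval (normalize [x]) y = x" using eval_normalize[of "[x]" y] xc y(1) by simp
    moreover have "v (normalize [x]) = \<rho> x" using \<beta>(1) \<rho>.hom_closed[of x] x \<rho>.hom_zero by (auto simp: v_def)
    ultimately show ?thesis using \<tau>(2)[OF c] by simp
  qed
  ultimately show ?thesis using that \<tau>(1) by blast
qed

text \<open>
  A separable extension has as many embeddings as its degree.  Adjoin one generator at a time: each
  embedding of \<open>F\<close> extends to \<open>F(y)\<close> once for each root of the transported minimal polynomial of \<open>y\<close>, and
  these roots are simple.  The homomorphisms are made extensional so that distinct elements of \<open>H\<close>
  differ on the subfield.
\<close>

lemma (in field) embeddings_exist: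
  assumes K: "subfield K R" and "algebraically_closed E" and \<eta>: "\<eta> \<in> ring_hom (R\<lparr>carrier := K\<rparr>) E"
    and "set ys \<subseteq> carrier R"
    and "\<And>y. y \<in> set ys \<Longrightarrow> \<exists>f. set f \<subseteq> K \<and> eval f y = \<zero> \<and> deriv_eval R f y \<noteq> \<zero>"
  shows "subfield (finite_extension K ys) R \<and>
    (\<exists>H. finite H \<and> dimension (card H) K (finite_extension K ys) \<and>
      (\<forall>\<rho>\<in>H. \<rho> \<in> ring_hom (R\<lparr>carrier := finite_extension K ys\<rparr>) E \<and>
         \<rho> \<in> extensional (finite_extension K ys) \<and> (\<forall>x\<in>K. \<rho> x = \<eta> x)))"
  using assms(4,5)
proof (induction ys)
  case Nil
  have "restrict \<eta> K \<in> ring_hom (R\<lparr>carrier := K\<rparr>) E"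
    using \<eta> subfieldE(1)[OF K] subringE[of K R] by (auto simp: ring_hom_def)
  moreover have "dimension (card {restrict \<eta> K}) K K" using dimension_one[OF K] by simp
  moreover have "restrict \<eta> K \<in> extensional K" "\<forall>x\<in>K. restrict \<eta> K x = \<eta> x" by simp_all
  ultimately have "\<exists>H. finite H \<and> dimension (card H) K K \<and> (\<forall>\<rho>\<in>H. \<rho> \<in> ring_hom (R\<lparr>carrier := K\<rparr>) E \<and>
      \<rho> \<in> extensional K \<and> (\<forall>x\<in>K. \<rho> x = \<eta> x))"
    by (intro exI[of _ "{restrict \<eta> K}"]) blast
  then show ?case using K by simp
next
  case (Cons y ys)
  interpret E: algebraically_closed E by (rule assms(2))
  let ?F = "finite_extension K ys"
  let ?F' = "simple_extension ?F y"
  obtain H where F: "subfield ?F R" and H: "finite H" "dimension (card H) K ?F"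
    "\<And>\<rho>. \<rho> \<in> H \<Longrightarrow> \<rho> \<in> ring_hom (R\<lparr>carrier := ?F\<rparr>) E" "\<And>\<rho>. \<rho> \<in> H \<Longrightarrow> \<rho> \<in> extensional ?F"
    "\<And>\<rho> x. \<rho> \<in> H \<Longrightarrow> x \<in> K \<Longrightarrow> \<rho> x = \<eta> x"
    using Cons by auto
  have y: "y \<in> carrier R" using Cons.prems by simp
  have Fs: "subring ?F R" and Fc: "?F \<subseteq> carrier R" using subfieldE(1,3)[OF F] by auto
  have KF: "K \<subseteq> ?F" using finite_extension_incl[OF subfieldE(3)[OF K]] Cons.prems(1) by simp
  obtain f where f: "set f \<subseteq> K" "eval f y = \<zero>" "deriv_eval R f y \<noteq> \<zero>" using Cons.prems(2)[of y] by auto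
  have fc: "set f \<subseteq> carrier R" using f(1) KF Fc by blast
  define g where "g = normalize f"
  have g: "g \<in> carrier (?F[X])" "eval g y = \<zero>" "deriv_eval R g y \<noteq> \<zero>"
    using normalize_gives_polynomial[of f ?F] f KF eval_normalize[OF fc y] deriv_eval_normalize[OF fc y]
    by (auto simp: g_def univ_poly_carrier)
  have g0: "g \<noteq> []" using g(3) by auto
  have alg: "(algebraic over ?F) y" using algebraicI[OF g(1) g0 g(2)] .
  let ?I = "Irr ?F y"
  note I = IrrE[OF F y alg]
  have F': "subfield ?F' R" using simple_extension_is_subfield[OF F y] alg by simp
  have yF': "y \<in> ?F'" by (rule simple_extension_mem[OF Fs y])
  have FF': "?F \<subseteq> ?F'" by (rule simple_extension_incl[OF Fc y])
  define d where "d = degree ?I"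
  have subc: "carrier (?F[X]) \<subseteq> carrier (poly_ring R)"
    using Fc by (auto simp: univ_poly_def polynomial_def)
  have Ic: "set ?I \<subseteq> ?F" using I(1) by (auto simp: univ_poly_def polynomial_def)
  \<comment> \<open>The minimal polynomial divides \<open>g\<close>, so it inherits the simple root \<open>y\<close>.\<close>
  have dI: "deriv_eval R ?I y \<noteq> \<zero>"
  proof
    assume 0: "deriv_eval R ?I y = \<zero>"
    interpret UP: domain "?F[X]" by (rule univ_poly_is_domain[OF Fs])
    have "g \<in> a_kernel (?F[X]) R (\<lambda>p. eval p y)" unfolding a_kernel_def' using g by simp
    then have "g \<in> PIdl\<^bsub>?F[X]\<^esub> ?I" using Irr_generates_ker[OF F y alg] by simp
    then obtain h where h: "h \<in> carrier (?F[X])" "g = h \<otimes>\<^bsub>?F[X]\<^esub> ?I" unfolding cgenideal_def by blast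
    then have "g = ?I \<otimes>\<^bsub>?F[X]\<^esub> h" using UP.m_comm I(1) by simp
    then have gI: "g = ?I \<otimes>\<^bsub>poly_ring R\<^esub> h" by (simp add: univ_poly_mult)
    have hc: "set h \<subseteq> carrier R" using h(1) Fc by (auto simp: univ_poly_def polynomial_def)
    have "deriv_eval R g y = deriv_eval R ?I y \<otimes> eval h y"
      unfolding gI by (rule deriv_eval_mult_root) (use I h subc y in auto)
    then show False using g(3) 0 eval_in_carrier[OF hc y] by simp
  qed
  define Rt where "Rt \<rho> = set_mset (E.roots (map \<rho> ?I))" for \<rho>
  have ex: "\<exists>\<tau>. \<tau> \<in> ring_hom (R\<lparr>carrier := ?F'\<rparr>) E \<and> \<tau> y = \<beta> \<and> (\<forall>x\<in>?F. \<tau> x = \<rho> x)"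
    if "\<rho> \<in> H" "\<beta> \<in> carrier E" "E.eval (map \<rho> ?I) \<beta> = \<zero>\<^bsub>E\<^esub>" for \<rho> \<beta>
    by (rule extend_hom_simple[OF F y alg E.field_axioms H(3)[OF that(1)] that(2,3)]) (intro exI conjI ballI; assumption?; simp)
  have poly: "map \<rho> ?I \<in> carrier (poly_ring E)" if \<rho>: "\<rho> \<in> H" for \<rho>
    using polynomial_hom[OF H(3)[OF \<rho>] subfield_iff(2)[OF F] E.field_axioms] I(1) univ_poly_consistent[OF Fs] by simp
  have root: "\<beta> \<in> carrier E \<and> E.eval (map \<rho> ?I) \<beta> = \<zero>\<^bsub>E\<^esub>" if "\<rho> \<in> H" "\<beta> \<in> Rt \<rho>" for \<rho> \<beta>
    using E.roots_mem_iff_is_root[OF poly[OF that(1)]] that(2) by (auto simp: Rt_def E.is_root_def)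
  have cardR: "card (Rt \<rho>) = d" if \<rho>: "\<rho> \<in> H" for \<rho>
  proof -
    have "card (set_mset (E.roots (map \<rho> ?I))) = size (E.roots (map \<rho> ?I))"
    proof (rule E.simple_roots_card[OF poly[OF \<rho>]])
      fix \<beta> assume \<beta>: "\<beta> \<in> carrier E" "E.eval (map \<rho> ?I) \<beta> = \<zero>\<^bsub>E\<^esub>"
      obtain \<tau> where \<tau>: "\<tau> \<in> ring_hom (R\<lparr>carrier := ?F'\<rparr>) E" "\<tau> y = \<beta>" "\<And>x. x \<in> ?F \<Longrightarrow> \<tau> x = \<rho> x"
        using ex[OF \<rho> \<beta>] by blast
      interpret RF: field "R\<lparr>carrier := ?F'\<rparr>" using subfield_iff(2)[OF F'] .
      interpret \<tau>: ring_hom_cring "R\<lparr>carrier := ?F'\<rparr>" E \<tau> using \<tau>(1) by unfold_locales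
      have I': "set ?I \<subseteq> carrier (R\<lparr>carrier := ?F'\<rparr>)" using Ic FF' by auto
      have "\<tau> (deriv_eval (R\<lparr>carrier := ?F'\<rparr>) ?I y) = deriv_eval E (map \<tau> ?I) (\<tau> y)"
        by (rule \<tau>.hom_deriv_eval[OF I']) (use yF' in simp)
      moreover have "map \<tau> ?I = map \<rho> ?I" using \<tau>(3) Ic by (auto simp: subset_iff)
      ultimately have eq: "deriv_eval E (map \<rho> ?I) \<beta> = \<tau> (deriv_eval R ?I y)"
        by (simp only: \<tau>(2) deriv_eval_consistent)
      have dF': "deriv_eval R ?I y \<in> ?F'"
        using RF.deriv_eval_closed[OF I', of y] yF' by (simp add: deriv_eval_consistent)
      have inj: "inj_on \<tau> ?F'"
        using non_trivial_field_hom_is_inj[OF \<tau>(1) RF.field_axioms E.field_axioms] by simp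
      \<comment> \<open>\<open>\<beta>\<close> is the image of \<open>y\<close> under an injective extension \<open>\<tau>\<close> of \<open>\<rho>\<close>.\<close>
      show "deriv_eval E (map \<rho> ?I) \<beta> \<noteq> \<zero>\<^bsub>E\<^esub>"
      proof
        assume "deriv_eval E (map \<rho> ?I) \<beta> = \<zero>\<^bsub>E\<^esub>"
        then have "\<tau> (deriv_eval R ?I y) = \<tau> \<zero>" using eq \<tau>.hom_zero by simp
        then have "deriv_eval R ?I y = \<zero>"
          by (rule inj_onD[OF inj]) (use dF' subringE(2)[OF subfieldE(1)[OF F']] in auto)
        then show False using dI by blast
      qed
    qed
    also have "\<dots> = d" using E.roots_over_carrier[OF poly[OF \<rho>]] by (simp add: E.splitted_def d_def)
    finally show ?thesis by (simp add: Rt_def)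
  qed
  define ext where "ext \<rho> \<beta> = (SOME \<tau>. \<tau> \<in> ring_hom (R\<lparr>carrier := ?F'\<rparr>) E \<and> \<tau> y = \<beta> \<and> (\<forall>x\<in>?F. \<tau> x = \<rho> x))" for \<rho> \<beta>
  have ext: "ext \<rho> \<beta> \<in> ring_hom (R\<lparr>carrier := ?F'\<rparr>) E \<and> ext \<rho> \<beta> y = \<beta> \<and> (\<forall>x\<in>?F. ext \<rho> \<beta> x = \<rho> x)"
    if "\<rho> \<in> H" "\<beta> \<in> Rt \<rho>" for \<rho> \<beta>
    unfolding ext_def
    by (rule someI_ex[OF ex[OF that(1) root[OF that, THEN conjunct1] root[OF that, THEN conjunct2]]])
  define G where "G = (\<lambda>(\<rho>, \<beta>). restrict (ext \<rho> \<beta>) ?F')"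
  have inj: "inj_on G (SIGMA \<rho>:H. Rt \<rho>)"
  proof (rule inj_onI)
    fix p q assume p: "p \<in> (SIGMA \<rho>:H. Rt \<rho>)" and q: "q \<in> (SIGMA \<rho>:H. Rt \<rho>)" and eq: "G p = G q"
    obtain \<rho> \<beta> \<rho>' \<beta>' where pq: "p = (\<rho>, \<beta>)" "q = (\<rho>', \<beta>')" "\<rho> \<in> H" "\<beta> \<in> Rt \<rho>" "\<rho>' \<in> H" "\<beta>' \<in> Rt \<rho>'"
      using p q by auto
    have val: "ext \<rho> \<beta> x = ext \<rho>' \<beta>' x" if "x \<in> ?F'" for x
      using fun_cong[OF eq, of x] that by (simp add: G_def pq)
    have "\<beta> = \<beta>'" using val[OF yF'] ext[OF pq(3,4)] ext[OF pq(5,6)] by simp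
    moreover have "\<rho> = \<rho>'"
    proof (rule extensionalityI[OF H(4)[OF pq(3)] H(4)[OF pq(5)]])
      fix x assume x: "x \<in> ?F"
      then have "ext \<rho> \<beta> x = ext \<rho>' \<beta>' x" using val FF' by blast
      then show "\<rho> x = \<rho>' x" using ext[OF pq(3,4)] ext[OF pq(5,6)] x by simp
    qed
    ultimately show "p = q" using pq by simp
  qed
  let ?H = "G ` (SIGMA \<rho>:H. Rt \<rho>)"
  have fin: "finite (SIGMA \<rho>:H. Rt \<rho>)" using H(1) by (auto simp: Rt_def)
  have "card ?H = card (SIGMA \<rho>:H. Rt \<rho>)" by (rule card_image[OF inj])
  also have "\<dots> = (\<Sum>\<rho>\<in>H. card (Rt \<rho>))" using H(1) by (intro card_SigmaI) (auto simp: Rt_def)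
  also have "\<dots> = card H * d" using cardR by simp
  finally have cardH: "card ?H = card H * d" .
  have "dimension d ?F ?F'" unfolding d_def by (rule dimension_simple_extension[OF F y alg])
  then have dim: "dimension (card ?H) K ?F'"
    unfolding cardH by (rule telescopic_base[OF K F H(2)])
  have mem: "\<tau> \<in> ring_hom (R\<lparr>carrier := ?F'\<rparr>) E \<and> \<tau> \<in> extensional ?F' \<and> (\<forall>x\<in>K. \<tau> x = \<eta> x)" if \<tau>: "\<tau> \<in> ?H" for \<tau>
  proof -
    obtain \<rho> \<beta> where sb: "\<rho> \<in> H" "\<beta> \<in> Rt \<rho>" "\<tau> = restrict (ext \<rho> \<beta>) ?F'" using \<tau> unfolding G_def by (elim imageE SigmaE) simp
    have "\<tau> \<in> ring_hom (R\<lparr>carrier := ?F'\<rparr>) E"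
      using ext[OF sb(1,2)] subringE[OF subfieldE(1)[OF F']] unfolding sb(3) by (auto simp: ring_hom_def)
    moreover have "\<tau> x = \<eta> x" if "x \<in> K" for x
      using ext[OF sb(1,2)] H(5)[OF sb(1) that] that KF FF' unfolding sb(3) by auto
    ultimately show ?thesis unfolding sb(3) by auto
  qed
  show ?case
    using F' fin dim mem by (intro conjI exI[of _ ?H]) auto
qed

section \<open>Embeddings of the fraction field extension\<close>

context finite_domain_extension
begin

lemma localization_map_fraction:
  assumes "domain_localization R W" "domain_localization S W'" "\<iota> ` W \<subseteq> W'" "a \<in> carrier R" "s \<in> W"
  shows "localization_map S W' \<iota> (fraction R W a s) = fraction S W' (\<iota> a) (\<iota> s)"
proof -
  interpret LR: domain_localization R W by fact
  interpret LS: domain_localization S W' by fact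
  have eq: "fraction S W' (\<iota> b) (\<iota> t) = fraction S W' (\<iota> a) (\<iota> s)" if "(b, t) \<in> fraction R W a s" for b t
  proof -
    have h: "b \<in> carrier R" "t \<in> W" "a \<otimes>\<^bsub>R\<^esub> t = b \<otimes>\<^bsub>R\<^esub> s"
      using that LR.fraction_mem_iff[OF assms(4,5)] by auto
    have "\<iota> b \<otimes>\<^bsub>S\<^esub> \<iota> s = \<iota> a \<otimes>\<^bsub>S\<^esub> \<iota> t" using h assms(4,5) by (simp flip: \<iota>.hom_mult)
    moreover have "\<iota> t \<in> W'" "\<iota> s \<in> W'" using assms(3,5) h by auto
    ultimately show ?thesis using h(1) assms(4) by (simp add: LS.fraction_eq_iff)
  qed
  show ?thesis
    unfolding localization_map_def
  proof (intro equalityI UN_least)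
    fix p assume "p \<in> fraction R W a s"
    then show "(case p of (b, t) \<Rightarrow> fraction S W' (\<iota> b) (\<iota> t)) \<subseteq> fraction S W' (\<iota> a) (\<iota> s)"
      using eq[of "fst p" "snd p"] by (simp add: case_prod_unfold)
  next
    show "fraction S W' (\<iota> a) (\<iota> s) \<subseteq> (\<Union>(b, t)\<in>fraction R W a s. fraction S W' (\<iota> b) (\<iota> t))"
      using UN_upper[OF LR.fraction_self[OF assms(4,5)], of "\<lambda>(b, t). fraction S W' (\<iota> b) (\<iota> t)"] by simp
  qed
qed

lemma localization_map_hom:
  assumes "domain_localization R W" "domain_localization S W'" "\<iota> ` W \<subseteq> W'"
  shows "localization_map S W' \<iota> \<in> ring_hom (localization R W) (localization S W')"
proof -
  interpret LR: domain_localization R W by fact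
  interpret LS: domain_localization S W' by fact
  note f = localization_map_fraction[OF assms]
  have W': "\<And>s. s \<in> W \<Longrightarrow> \<iota> s \<in> W'" using assms(3) by blast
  show ?thesis
  proof (rule ring_hom_memI)
    fix x assume "x \<in> carrier LR.Loc"
    then obtain a s where x: "a \<in> carrier R" "s \<in> W" "x = fraction R W a s" by (rule LR.Loc_cases)
    then show "localization_map S W' \<iota> x \<in> carrier LS.Loc" using f W' by simp
    fix y assume "y \<in> carrier LR.Loc"
    then obtain b t where y: "b \<in> carrier R" "t \<in> W" "y = fraction R W b t" by (rule LR.Loc_cases)
    show "localization_map S W' \<iota> (x \<otimes>\<^bsub>LR.Loc\<^esub> y) = localization_map S W' \<iota> x \<otimes>\<^bsub>LS.Loc\<^esub> localization_map S W' \<iota> y"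
      "localization_map S W' \<iota> (x \<oplus>\<^bsub>LR.Loc\<^esub> y) = localization_map S W' \<iota> x \<oplus>\<^bsub>LS.Loc\<^esub> localization_map S W' \<iota> y"
      unfolding x(3) y(3) using x(1,2) y(1,2) W' by (simp_all add: f)
  next
    show "localization_map S W' \<iota> \<one>\<^bsub>LR.Loc\<^esub> = \<one>\<^bsub>LS.Loc\<^esub>"
      unfolding LR.Loc_one LS.Loc_one using f[of "\<one>\<^bsub>R\<^esub>" "\<one>\<^bsub>R\<^esub>"] by simp
  qed
qed

lemma (in ring) combine_map_finsum:
  assumes "distinct us" "length Ks = length us" "set Ks \<subseteq> carrier R" "j ` set us \<subseteq> carrier R"
  shows "\<exists>c. (\<forall>i<length us. c (us ! i) = Ks ! i) \<and> combine Ks (map j us) = (\<Oplus>x\<in>set us. c x \<otimes> j x)"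
  using assms
proof (induction us arbitrary: Ks)
  case Nil
  then show ?case by simp
next
  case (Cons u us)
  then obtain k Ks' where Ks: "Ks = k # Ks'" "length Ks' = length us" by (cases Ks) auto
  obtain c where c: "\<forall>i<length us. c (us ! i) = Ks' ! i" "combine Ks' (map j us) = (\<Oplus>x\<in>set us. c x \<otimes> j x)"
    using Cons.IH[of Ks'] Cons.prems Ks by auto
  define c' where "c' = c(u := k)"
  have cK: "c x \<in> carrier R" if x: "x \<in> set us" for x
  proof -
    obtain i where "i < length us" "x = us ! i" using x by (metis in_set_conv_nth)
    then show ?thesis using c(1) Ks Cons.prems(3) by (auto simp: subset_iff)
  qed
  have un: "u \<notin> set us" using Cons.prems by simp
  have k: "k \<in> carrier R" "j u \<in> carrier R" using Cons.prems Ks by auto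
  have "(\<Oplus>x\<in>set us. c' x \<otimes> j x) = (\<Oplus>x\<in>set us. c x \<otimes> j x)"
    using un cK Cons.prems(4) by (intro finsum_cong') (auto simp: c'_def)
  moreover have "(\<Oplus>x\<in>insert u (set us). c' x \<otimes> j x) = c' u \<otimes> j u \<oplus> (\<Oplus>x\<in>set us. c' x \<otimes> j x)"
    using un cK k Cons.prems(4) by (intro finsum_insert) (auto simp: c'_def)
  ultimately have "combine Ks (map j (u # us)) = (\<Oplus>x\<in>set (u # us). c' x \<otimes> j x)"
    using c(2) Ks by (simp add: c'_def)
  moreover have "\<forall>i<length (u # us). c' ((u # us) ! i) = Ks ! i"
  proof (intro allI impI)
    fix i assume i: "i < length (u # us)"
    show "c' ((u # us) ! i) = Ks ! i"
    proof (cases i)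
      case (Suc n)
      then have "us ! n \<noteq> u" "c (us ! n) = Ks' ! n" using i un c(1) by auto
      then show ?thesis using Suc Ks by (simp add: c'_def)
    qed (use Ks in \<open>simp add: c'_def\<close>)
  qed
  ultimately show ?case by blast
qed

text \<open>
  Embed the fraction field of \<open>S\<close> into its own algebraic closure and restrict to \<open>S\<close>.  The generators \<open>B\<close> of \<open>S\<close>
  also generate the field, so \<open>embeddings_exist\<close> counts its embeddings; and \<open>J\<close> stays independent over
  the fraction field of \<open>R\<close>, which bounds its size by the degree.
\<close>

theorem embeddings_of_separable_extension:
  assumes sep: separable_ext and J: "generic_basis J d"
  obtains E :: "((('b \<times> 'b) set list \<times> nat) multiset \<Rightarrow> ('b \<times> 'b) set) ring" and \<eta> H
  where "field_homs R S \<iota> B E \<eta> H" "H \<noteq> {}" "card J \<le> card H"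
    "card H = field_degree (fraction_field R) (fraction_field S) (fraction_field_map S \<iota>)"
proof -
  note J' = generic_basisD[OF J]
  let ?WR = "carrier R - {\<zero>\<^bsub>R\<^esub>}" and ?WS = "carrier S - {\<zero>\<^bsub>S\<^esub>}"
  interpret FR: domain_localization R ?WR by (rule R.fraction_field_localization)
  interpret FS: domain_localization S ?WS by (rule S.fraction_field_localization)
  have FF: "fraction_field R = FR.Loc" "fraction_field S = FS.Loc" by (simp_all add: fraction_field_def)
  interpret K: field FR.Loc using R.fraction_field_is_field unfolding FF .
  interpret L: field FS.Loc using S.fraction_field_is_field unfolding FF .
  define g where "g = fraction_field_map S \<iota>"
  have WW: "\<iota> ` ?WR \<subseteq> ?WS" using \<iota>_zero_iff by auto
  have g_frac: "g (fraction R ?WR a s) = fraction S ?WS (\<iota> a) (\<iota> s)" if "a \<in> carrier R" "s \<in> ?WR" for a s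
    unfolding g_def fraction_field_map_def
    by (rule localization_map_fraction[OF FR.domain_localization_axioms FS.domain_localization_axioms WW that])
  have g: "g \<in> ring_hom FR.Loc FS.Loc" unfolding g_def fraction_field_map_def
    by (rule localization_map_hom[OF FR.domain_localization_axioms FS.domain_localization_axioms WW])
  define K where "K = g ` carrier FR.Loc"
  have K: "subfield K FS.Loc" unfolding K_def
    by (rule ring_hom_ring.img_is_subfield(2)[OF ring_hom_ringI2[OF cring.axioms(1)[OF FR.Loc_cring] cring.axioms(1)[OF FS.Loc_cring] g] K.carrier_is_subfield])
       (use L.one_not_zero in simp)
  let ?j = FS.toLoc
  have K_elem: "\<exists>a\<in>carrier R. \<exists>s\<in>?WR. k = fraction S ?WS (\<iota> a) (\<iota> s)" if kK: "k \<in> K" for k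
  proof -
    obtain x where x: "x \<in> carrier FR.Loc" "k = g x" using kK by (auto simp: K_def)
    from x(1) obtain a s where "a \<in> carrier R" "s \<in> ?WR" "x = fraction R ?WR a s" by (rule FR.Loc_cases)
    then show ?thesis using g_frac x(2) by blast
  qed
  have jK: "?j (\<iota> r) \<in> K" if "r \<in> carrier R" for r
  proof -
    have "?j (\<iota> r) = g (fraction R ?WR r \<one>\<^bsub>R\<^esub>)" using g_frac[OF that] by (simp add: FS.toLoc_def)
    then show ?thesis unfolding K_def using that by simp
  qed
  obtain ys where ys: "set ys = ?j ` B" using finite_list[of "?j ` B"] B(1) by auto
  let ?E = "L.alg_closure"
  interpret E: algebraic_closure ?E "FS.Loc.indexed_const ` carrier FS.Loc" by (rule L.alg_closureE(1))
  \<comment> \<open>The type annotation fixes the type of variables in the construction of the closure.\<close>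
  define ic :: "('b \<times> 'b) set \<Rightarrow> (('b \<times> 'b) set list \<times> nat) multiset \<Rightarrow> ('b \<times> 'b) set"
    where "ic = FS.Loc.indexed_const"
  have emb: "ic \<in> ring_hom FS.Loc ?E" unfolding ic_def by (rule L.alg_closureE(2))
  have embK: "ic \<in> ring_hom (FS.Loc\<lparr>carrier := K\<rparr>) ?E"
    using emb subfieldE(3)[OF K] by (auto simp: ring_hom_def subset_iff)
  define \<eta> where "\<eta> r = ic (?j (\<iota> r))" for r
  have sepB: "\<exists>f. set f \<subseteq> K \<and> FS.Loc.eval f y = \<zero>\<^bsub>FS.Loc\<^esub> \<and> deriv_eval FS.Loc f y \<noteq> \<zero>\<^bsub>FS.Loc\<^esub>" if yy: "y \<in> set ys" for y
  proof -
    obtain b where b: "b \<in> carrier S" "y = ?j b" using yy ys B by auto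
    obtain f where f: "set f \<subseteq> carrier R" "S.eval (map \<iota> f) b = \<zero>\<^bsub>S\<^esub>" "deriv_eval S (map \<iota> f) b \<noteq> \<zero>\<^bsub>S\<^esub>"
      using sep b(1) unfolding separable_ext_def by blast
    have fS: "set (map \<iota> f) \<subseteq> carrier S" using f(1) by auto
    have "FS.Loc.eval (map ?j (map \<iota> f)) y = \<zero>\<^bsub>FS.Loc\<^esub>"
      using FS.toLoc.ring.eval_hom'[OF b(1) fS] f(2) b(2) by simp
    moreover have "deriv_eval FS.Loc (map ?j (map \<iota> f)) y \<noteq> \<zero>\<^bsub>FS.Loc\<^esub>"
    proof
      assume "deriv_eval FS.Loc (map ?j (map \<iota> f)) y = \<zero>\<^bsub>FS.Loc\<^esub>"
      then have "?j (deriv_eval S (map \<iota> f) b) = ?j \<zero>\<^bsub>S\<^esub>"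
        using FS.toLoc.hom_deriv_eval[OF fS b(1)] b(2) by simp
      then have "deriv_eval S (map \<iota> f) b = \<zero>\<^bsub>S\<^esub>"
        by (rule inj_onD[OF FS.toLoc_inj]) (use S.deriv_eval_closed[OF fS b(1)] in simp_all)
      then show False using f(3) by blast
    qed
    moreover have "set (map ?j (map \<iota> f)) \<subseteq> K" using f(1) jK by auto
    ultimately show ?thesis by blast
  qed
  have ysc: "set ys \<subseteq> carrier FS.Loc" using ys B by auto
  define F where "F = FS.Loc.finite_extension K ys"
  have "subfield F FS.Loc \<and> (\<exists>H. finite H \<and> FS.Loc.dimension (card H) K F \<and>
      (\<forall>\<sigma>\<in>H. \<sigma> \<in> ring_hom (FS.Loc\<lparr>carrier := F\<rparr>) ?E \<and> \<sigma> \<in> extensional F \<and> (\<forall>x\<in>K. \<sigma> x = ic x)))"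
    unfolding F_def by (rule L.embeddings_exist[OF K E.algebraically_closed_axioms embK ysc sepB])
  then obtain H where F: "subfield F FS.Loc" and H: "finite H" "FS.Loc.dimension (card H) K F"
    "\<And>\<sigma>. \<sigma> \<in> H \<Longrightarrow> \<sigma> \<in> ring_hom (FS.Loc\<lparr>carrier := F\<rparr>) ?E" "\<And>\<sigma>. \<sigma> \<in> H \<Longrightarrow> \<sigma> \<in> extensional F"
    "\<And>\<sigma> x. \<sigma> \<in> H \<Longrightarrow> x \<in> K \<Longrightarrow> \<sigma> x = ic x" by blast
  note f = subringE[OF subfieldE(1)[OF F]]
  have KF: "K \<subseteq> F" unfolding F_def by (rule FS.Loc.finite_extension_incl[OF subfieldE(3)[OF K] ysc])
  have jF: "?j s \<in> F" if "s \<in> carrier S" for s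
    using span[OF that]
  proof induction
    case lin_span_zero
    then show ?case using f(2) by simp
  next
    case (lin_span_step a b x)
    have "x \<in> carrier S" using S.lin_span_closed[OF A_carrier B(2)] lin_span_step by blast
    moreover have "?j b \<in> F"
      using L.finite_extension_mem[OF subfieldE(1)[OF K] ysc] ys lin_span_step unfolding F_def by blast
    moreover have "?j a \<in> F" using lin_span_step jK KF by blast
    moreover have "a \<in> carrier S" "b \<in> carrier S" using lin_span_step(1,2) B(2) by auto
    ultimately have "?j a \<otimes>\<^bsub>FS.Loc\<^esub> ?j b \<oplus>\<^bsub>FS.Loc\<^esub> ?j x \<in> F" and
      "?j (a \<otimes>\<^bsub>S\<^esub> b \<oplus>\<^bsub>S\<^esub> x) = ?j a \<otimes>\<^bsub>FS.Loc\<^esub> ?j b \<oplus>\<^bsub>FS.Loc\<^esub> ?j x"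
      using f(7)[OF f(6)] lin_span_step(4) by simp_all
    then show ?case by simp
  qed
  have FL: "F = carrier FS.Loc"
  proof
    show "F \<subseteq> carrier FS.Loc" by (rule f(1))
    show "carrier FS.Loc \<subseteq> F"
    proof
      fix z assume "z \<in> carrier FS.Loc"
      then obtain a s where as: "a \<in> carrier S" "s \<in> ?WS" "z = fraction S ?WS a s" by (rule FS.Loc_cases)
      have s0: "?j s \<noteq> \<zero>\<^bsub>FS.Loc\<^esub>" using FS.fraction_zero_iff[of s "\<one>\<^bsub>S\<^esub>"] as(2) by (simp add: FS.toLoc_def)
      have "inv\<^bsub>FS.Loc\<^esub> ?j s \<in> F" using FS.Loc.subfield_m_inv(1)[OF F] jF[of s] as(2) s0 by blast
      then show "z \<in> F" using FS.fraction_conv[OF as(1,2)] as(3) jF[OF as(1)] f(6) by simp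
    qed
  qed
  have Hh: "\<sigma> \<in> ring_hom FS.Loc ?E" if "\<sigma> \<in> H" for \<sigma> using H(3)[OF that] unfolding FL by simp
  have Hc: "ring_hom_cring FS.Loc ?E \<sigma>" if "\<sigma> \<in> H" for \<sigma>
    using Hh[OF that] by (simp add: ring_hom_cring_def ring_hom_cring_axioms_def FS.Loc_cring E.is_cring)
  have determined: "\<sigma> = \<tau>" if st: "\<sigma> \<in> H" "\<tau> \<in> H" "\<And>s. s \<in> carrier S \<Longrightarrow> \<sigma> (?j s) = \<tau> (?j s)" for \<sigma> \<tau>
  proof (rule extensionalityI[OF H(4)[OF st(1)] H(4)[OF st(2)]])
    interpret \<sigma>: ring_hom_cring FS.Loc ?E \<sigma> by (rule Hc[OF st(1)])
    interpret \<tau>: ring_hom_cring FS.Loc ?E \<tau> by (rule Hc[OF st(2)])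
    fix z assume "z \<in> F"
    then have "z \<in> carrier FS.Loc" using FL by simp
    then obtain a s where as: "a \<in> carrier S" "s \<in> ?WS" "z = fraction S ?WS a s" by (rule FS.Loc_cases)
    have zc: "z \<in> carrier FS.Loc" using as by simp
    have su: "?j s \<in> Units FS.Loc" using FS.toLoc_unit as(2) by blast
    have sc: "?j s \<in> carrier FS.Loc" using as by simp
    have zs: "z \<otimes>\<^bsub>FS.Loc\<^esub> ?j s = ?j a"
      using FS.fraction_conv[OF as(1,2)] as(1,3) su FS.Loc.m_assoc[of "?j a" "inv\<^bsub>FS.Loc\<^esub> ?j s" "?j s"] sc by simp
    have "\<sigma> z \<otimes>\<^bsub>?E\<^esub> \<sigma> (?j s) = \<sigma> (?j a)" using \<sigma>.hom_mult[OF zc sc] zs by simp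
    moreover have "\<tau> z \<otimes>\<^bsub>?E\<^esub> \<sigma> (?j s) = \<sigma> (?j a)"
      using \<tau>.hom_mult[OF zc sc] zs st(3)[of s] st(3)[OF as(1)] as(2) by simp
    moreover have "\<sigma> (?j s) \<noteq> \<zero>\<^bsub>?E\<^esub>"
    proof
      assume 0: "\<sigma> (?j s) = \<zero>\<^bsub>?E\<^esub>"
      have "\<sigma> (?j s) \<otimes>\<^bsub>?E\<^esub> \<sigma> (inv\<^bsub>FS.Loc\<^esub> ?j s) = \<one>\<^bsub>?E\<^esub>"
        using \<sigma>.hom_mult[OF sc FS.Loc.Units_inv_closed[OF su]] FS.Loc.Units_r_inv[OF su] \<sigma>.hom_one by simp
      then show False using 0 \<sigma>.hom_closed[OF FS.Loc.Units_inv_closed[OF su]] E.one_not_zero by simp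
    qed
    ultimately show "\<sigma> z = \<tau> z"
      using E.m_rcancel[of "\<sigma> (?j s)" "\<sigma> z" "\<tau> z"] \<sigma>.hom_closed[OF zc] \<tau>.hom_closed[OF zc] \<sigma>.hom_closed[OF sc] by simp
  qed
  define HS where "HS = (\<lambda>\<sigma>. \<sigma> \<circ> ?j) ` H"
  have "inj_on (\<lambda>\<sigma>. \<sigma> \<circ> ?j) H"
  proof (rule inj_onI)
    fix \<sigma> \<tau> assume st: "\<sigma> \<in> H" "\<tau> \<in> H" "\<sigma> \<circ> ?j = \<tau> \<circ> ?j"
    show "\<sigma> = \<tau>" by (rule determined[OF st(1,2)]) (use fun_cong[OF st(3)] in simp)
  qed
  then have cardHS: "card HS = card H" unfolding HS_def by (rule card_image)
  have "extension_homs R S \<iota> B ?E" by unfold_locales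
  then interpret X: extension_homs R S \<iota> B ?E \<eta> .
  have ext: "X.is_ext (\<sigma> \<circ> ?j)" if \<sigma>: "\<sigma> \<in> H" for \<sigma>
    unfolding X.is_ext_def
  proof (intro conjI ballI)
    show "\<sigma> \<circ> ?j \<in> ring_hom S ?E" by (rule ring_hom_trans[OF FS.toLoc.homh Hh[OF \<sigma>]])
    have "inj_on \<sigma> (carrier FS.Loc)"
      using non_trivial_field_hom_is_inj[OF Hh[OF \<sigma>] L.field_axioms E.field_axioms] .
    then show "inj_on (\<sigma> \<circ> ?j) (carrier S)"
      using FS.toLoc_inj by (intro comp_inj_on) (auto intro: inj_on_subset)
    show "(\<sigma> \<circ> ?j) (\<iota> r) = \<eta> r" if "r \<in> carrier R" for r
      using H(5)[OF \<sigma> jK[OF that]] by (simp add: \<eta>_def)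
  qed
  have fh: "field_homs R S \<iota> B ?E \<eta> HS"
  proof (unfold_locales)
    show "finite HS" using H(1) by (simp add: HS_def)
    show "X.is_ext \<sigma>" if "\<sigma> \<in> HS" for \<sigma> using that ext by (auto simp: HS_def)
    fix \<sigma> \<tau> assume st: "\<sigma> \<in> HS" "\<tau> \<in> HS" and eq: "\<And>s. s \<in> carrier S \<Longrightarrow> \<sigma> s = \<tau> s"
    obtain \<sigma>' \<tau>' where st': "\<sigma>' \<in> H" "\<tau>' \<in> H" "\<sigma> = \<sigma>' \<circ> ?j" "\<tau> = \<tau>' \<circ> ?j" using st by (auto simp: HS_def)
    have "\<sigma>' = \<tau>'" by (rule determined[OF st'(1,2)]) (use eq st'(3,4) in simp)
    then show "\<sigma> = \<tau>" using st' by simp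
  qed
  have dim: "FS.Loc.dimension (card H) K (carrier FS.Loc)" using H(2) FL by simp
  have deg: "card HS = field_degree (fraction_field R) (fraction_field S) (fraction_field_map S \<iota>)"
    unfolding field_degree_def FF g_def[symmetric] K_def[symmetric]
    using FS.Loc.dimI[OF K dim] cardHS by (simp add: over_def)
  have "card J \<le> card H"
  proof -
    obtain us where us: "set us = J" "distinct us" using finite_distinct_list[OF J'(2)] by blast
    have usc: "set (map ?j us) \<subseteq> carrier FS.Loc" using us J'(3) by auto
    have "FS.Loc.independent K (map ?j us)"
    proof (rule ccontr)
      note [simp del] = FR.W_carrier FS.W_carrier
      assume "\<not> FS.Loc.independent K (map ?j us)"
      then obtain Ks where Ks: "length Ks = length (map ?j us)" "FS.Loc.combine Ks (map ?j us) = \<zero>\<^bsub>FS.Loc\<^esub>"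
        "set Ks \<subseteq> K" "set Ks \<noteq> {\<zero>\<^bsub>FS.Loc\<^esub>}"
        using FS.Loc.dependent_imp_non_trivial_combine[OF K usc] by blast
      have Ksc: "set Ks \<subseteq> carrier FS.Loc" using Ks(3) subfieldE(3)[OF K] by blast
      obtain c where c: "\<forall>i<length us. c (us ! i) = Ks ! i"
        "FS.Loc.combine Ks (map ?j us) = (\<Oplus>\<^bsub>FS.Loc\<^esub>x\<in>set us. c x \<otimes>\<^bsub>FS.Loc\<^esub> ?j x)"
        using FS.Loc.combine_map_finsum[OF us(2), of Ks ?j] Ks(1) Ksc usc by auto
      have cK: "c x \<in> K" if x: "x \<in> J" for x
      proof -
        obtain i where "i < length us" "x = us ! i" using x us(1) by (metis in_set_conv_nth)
        then show ?thesis using c(1) Ks(1,3) by (auto simp: subset_iff)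
      qed
      have "\<forall>x\<in>J. \<exists>p. fst p \<in> carrier R \<and> snd p \<in> ?WR \<and> c x = fraction S ?WS (\<iota> (fst p)) (\<iota> (snd p))"
        using K_elem[OF cK] by fastforce
      then obtain P where P: "\<forall>x\<in>J. fst (P x) \<in> carrier R \<and> snd (P x) \<in> ?WR \<and>
          c x = fraction S ?WS (\<iota> (fst (P x))) (\<iota> (snd (P x)))" by (rule bchoice[THEN exE])
      define num where "num x = fst (P x)" for x
      define den where "den x = snd (P x)" for x
      have nd: "num x \<in> carrier R" "den x \<in> ?WR" "c x = fraction S ?WS (\<iota> (num x)) (\<iota> (den x))" if "x \<in> J" for x
        using P that by (auto simp: num_def den_def)
      \<comment> \<open>Clear the denominators of a relation over the fraction field of \<open>R\<close>.\<close>
      obtain \<beta> where \<beta>: "\<beta> \<in> ?WR" "\<forall>x\<in>J. \<exists>m\<in>carrier R. \<beta> = m \<otimes>\<^bsub>R\<^esub> den x"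
        by (rule R.common_multiple[OF J'(2), of den, THEN bexE]) (use nd in auto)
      then have "\<forall>x\<in>J. \<exists>m. m \<in> carrier R \<and> \<beta> = m \<otimes>\<^bsub>R\<^esub> den x" by blast
      then obtain m where m: "\<forall>x\<in>J. m x \<in> carrier R \<and> \<beta> = m x \<otimes>\<^bsub>R\<^esub> den x" by (rule bchoice[THEN exE])
      have mc: "m x \<in> carrier R" if "x \<in> J" for x using m that by blast
      have \<beta>S: "\<iota> \<beta> \<in> carrier S" using \<beta>(1) by simp
      have shuffle: "(a \<otimes>\<^bsub>S\<^esub> b) \<otimes>\<^bsub>S\<^esub> (k \<otimes>\<^bsub>S\<^esub> e) = (k \<otimes>\<^bsub>S\<^esub> a) \<otimes>\<^bsub>S\<^esub> e \<otimes>\<^bsub>S\<^esub> b"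
        if "a \<in> carrier S" "b \<in> carrier S" "k \<in> carrier S" "e \<in> carrier S" for a b k e
        using that by (simp add: S.m_ac)
      have summand: "?j (\<iota> \<beta>) \<otimes>\<^bsub>FS.Loc\<^esub> (c x \<otimes>\<^bsub>FS.Loc\<^esub> ?j x) = ?j (\<iota> (num x \<otimes>\<^bsub>R\<^esub> m x) \<otimes>\<^bsub>S\<^esub> x)" if x: "x \<in> J" for x
      proof -
        have h: "num x \<in> carrier R" "den x \<in> ?WR" "m x \<in> carrier R" "x \<in> carrier S" "\<iota> (den x) \<in> ?WS"
          "\<beta> = m x \<otimes>\<^bsub>R\<^esub> den x"
          using nd(1,2)[OF x] WW J'(3) x bspec[OF m x] by (blast, blast, blast, blast, blast, blast)
        have "?j (\<iota> \<beta>) \<otimes>\<^bsub>FS.Loc\<^esub> (c x \<otimes>\<^bsub>FS.Loc\<^esub> ?j x) =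
          fraction S ?WS (\<iota> \<beta> \<otimes>\<^bsub>S\<^esub> (\<iota> (num x) \<otimes>\<^bsub>S\<^esub> x)) (\<one>\<^bsub>S\<^esub> \<otimes>\<^bsub>S\<^esub> (\<iota> (den x) \<otimes>\<^bsub>S\<^esub> \<one>\<^bsub>S\<^esub>))"
          unfolding FS.toLoc_def nd(3)[OF x]
          using h(1,4,5) \<beta>S FS.W_one by (subst FS.fraction_mult, simp_all only: FS.W_mult \<iota>.hom_closed S.m_closed FS.fraction_mult)
        also have "\<dots> = fraction S ?WS (\<iota> (num x \<otimes>\<^bsub>R\<^esub> m x) \<otimes>\<^bsub>S\<^esub> x) \<one>\<^bsub>S\<^esub>"
        proof (subst FS.fraction_eq_iff)
          show "\<one>\<^bsub>S\<^esub> \<otimes>\<^bsub>S\<^esub> (\<iota> (den x) \<otimes>\<^bsub>S\<^esub> \<one>\<^bsub>S\<^esub>) \<in> ?WS" using h(5) by simp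
          have dc: "\<iota> (den x) \<in> carrier S" using h(5) by blast
          show "\<iota> \<beta> \<otimes>\<^bsub>S\<^esub> (\<iota> (num x) \<otimes>\<^bsub>S\<^esub> x) \<otimes>\<^bsub>S\<^esub> \<one>\<^bsub>S\<^esub> = \<iota> (num x \<otimes>\<^bsub>R\<^esub> m x) \<otimes>\<^bsub>S\<^esub> x \<otimes>\<^bsub>S\<^esub> (\<one>\<^bsub>S\<^esub> \<otimes>\<^bsub>S\<^esub> (\<iota> (den x) \<otimes>\<^bsub>S\<^esub> \<one>\<^bsub>S\<^esub>))"
            using shuffle[of "\<iota> (m x)" "\<iota> (den x)" "\<iota> (num x)" x] h(1,3,4) dc DiffD1[OF h(2)]
            unfolding h(6) by simp
        qed (use h \<beta>S in simp_all)
        finally show ?thesis by (simp add: FS.toLoc_def)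
      qed
      have cc: "c x \<otimes>\<^bsub>FS.Loc\<^esub> ?j x \<in> carrier FS.Loc" if "x \<in> J" for x
        using cK[OF that] subfieldE(3)[OF K] J'(3) that by auto
      have nmA: "(\<lambda>x. \<iota> (num x \<otimes>\<^bsub>R\<^esub> m x)) \<in> J \<rightarrow> A" using nd(1) mc by auto
      have "?j (\<Oplus>\<^bsub>S\<^esub>x\<in>J. \<iota> (num x \<otimes>\<^bsub>R\<^esub> m x) \<otimes>\<^bsub>S\<^esub> x) = (\<Oplus>\<^bsub>FS.Loc\<^esub>x\<in>J. ?j (\<iota> (num x \<otimes>\<^bsub>R\<^esub> m x) \<otimes>\<^bsub>S\<^esub> x))"
        by (subst FS.toLoc.hom_finsum) (use nd(1) mc J'(3) in \<open>auto simp: comp_def\<close>)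
      also have "\<dots> = (\<Oplus>\<^bsub>FS.Loc\<^esub>x\<in>J. ?j (\<iota> \<beta>) \<otimes>\<^bsub>FS.Loc\<^esub> (c x \<otimes>\<^bsub>FS.Loc\<^esub> ?j x))"
        by (rule FS.Loc.finsum_cong'[OF refl]) (use summand cc \<beta>S in auto)
      also have "\<dots> = ?j (\<iota> \<beta>) \<otimes>\<^bsub>FS.Loc\<^esub> (\<Oplus>\<^bsub>FS.Loc\<^esub>x\<in>J. c x \<otimes>\<^bsub>FS.Loc\<^esub> ?j x)"
        by (rule FS.Loc.finsum_rdistr[symmetric]) (use J'(2) cc \<beta>S in auto)
      also have "\<dots> = \<zero>\<^bsub>FS.Loc\<^esub>" using trans[OF c(2)[symmetric] Ks(2)] us(1) \<beta>S by simp
      finally have "?j (\<Oplus>\<^bsub>S\<^esub>x\<in>J. \<iota> (num x \<otimes>\<^bsub>R\<^esub> m x) \<otimes>\<^bsub>S\<^esub> x) = ?j \<zero>\<^bsub>S\<^esub>" by simp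
      then have "(\<Oplus>\<^bsub>S\<^esub>x\<in>J. \<iota> (num x \<otimes>\<^bsub>R\<^esub> m x) \<otimes>\<^bsub>S\<^esub> x) = \<zero>\<^bsub>S\<^esub>"
        by (rule inj_onD[OF FS.toLoc_inj]) (use nd(1) mc J'(3) in \<open>auto intro!: S.finsum_closed\<close>)
      from lin_indepD[OF J'(1) nmA this] have z: "\<iota> (num x \<otimes>\<^bsub>R\<^esub> m x) = \<zero>\<^bsub>S\<^esub>" if "x \<in> J" for x using that .
      have c0: "c x = \<zero>\<^bsub>FS.Loc\<^esub>" if x: "x \<in> J" for x
      proof -
        have h: "num x \<in> carrier R" "m x \<in> carrier R" "\<beta> = m x \<otimes>\<^bsub>R\<^esub> den x" "den x \<in> ?WR" using nd(1,2)[OF x] bspec[OF m x] by auto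
        have "m x \<noteq> \<zero>\<^bsub>R\<^esub>" using h(3,4) \<beta>(1) by auto
        moreover have "num x \<otimes>\<^bsub>R\<^esub> m x = \<zero>\<^bsub>R\<^esub>" using iffD1[OF \<iota>_zero_iff[OF R.m_closed[OF h(1,2)]] z[OF x]] .
        ultimately have "num x = \<zero>\<^bsub>R\<^esub>" using R.integral h(1,2) by blast
        then show ?thesis using nd(3)[OF x] FS.fraction_zero_iff[of "\<zero>\<^bsub>S\<^esub>"] subsetD[OF WW imageI[OF h(4)]] by simp
      qed
      have "k = \<zero>\<^bsub>FS.Loc\<^esub>" if k: "k \<in> set Ks" for k
      proof -
        obtain i where i: "i < length us" "k = Ks ! i" using k Ks(1) in_set_conv_nth[of k Ks] by auto
        then have "us ! i \<in> J" using us(1) nth_mem by blast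
        then show ?thesis using c0 c(1) i by auto
      qed
      moreover have "Ks \<noteq> []" using Ks(1) us(1) J'(7) by auto
      ultimately have "set Ks = {\<zero>\<^bsub>FS.Loc\<^esub>}" by (cases Ks) auto
      then show False using Ks(4) by blast
    qed
    then have "length (map ?j us) \<le> card H"
      by (rule FS.Loc.independent_length_le_dimension[OF K dim _ usc])
    then show ?thesis using us distinct_card[OF us(2)] by simp
  qed
  moreover have "HS \<noteq> {}"
  proof
    assume "HS = {}"
    then have "card H = 0" using cardHS by simp
    then show False using \<open>card J \<le> card H\<close> J'(2,7) by (simp add: card_gt_0_iff)
  qed
  ultimately show ?thesis using that[OF fh _ _ deg] cardHS by simp
qed

end

section \<open>Traces and the residue field\<close>

lemma proper_ideal_in_max:
  assumes noeth: "noetherian_ring R" and loc: "local_ring R m" and I: "ideal I R" "\<one>\<^bsub>R\<^esub> \<notin> I"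
  shows "I \<subseteq> m"
proof -
  interpret R: cring R using loc by (simp add: local_ring_def)
  let ?F = "{J. ideal J R \<and> \<one>\<^bsub>R\<^esub> \<notin> J \<and> I \<subseteq> J}"
  obtain M where M: "M \<in> ?F" "\<And>J. J \<in> ?F \<Longrightarrow> M \<subseteq> J \<Longrightarrow> J = M"
    by (rule R.noetherian_maximal_ideal[OF noeth, of ?F]) (use I in auto)
  have "maximalideal M R"
  proof (rule maximalidealI)
    show "ideal M R" using M(1) by blast
    show "carrier R \<noteq> M" using M(1) by auto
    fix J assume J: "ideal J R" "M \<subseteq> J" "J \<subseteq> carrier R"
    show "J = M \<or> J = carrier R"
    proof (cases "\<one>\<^bsub>R\<^esub> \<in> J")
      case True
      then show ?thesis using ideal.one_imp_carrier[OF J(1)] by blast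
    next
      case False
      then have "J \<in> ?F" using J M(1) by blast
      then show ?thesis using M(2) J(2) by blast
    qed
  qed
  then have "M = m" using loc unfolding local_ring_def by blast
  then show ?thesis using M(1) by blast
qed

lemma local_maximal_ideal:
  assumes "local_ring R m"
  shows "ideal m R" "\<one>\<^bsub>R\<^esub> \<notin> m" "primeideal m R"
proof -
  have m: "maximalideal m R" using assms by (simp add: local_ring_def)
  then interpret m: maximalideal m R .
  show i: "ideal m R" by (rule m.is_ideal)
  show "\<one>\<^bsub>R\<^esub> \<notin> m" using ideal.one_imp_carrier[OF i] m.I_notcarr by auto
  show "primeideal m R" using cring.maximalideal_prime[OF _ m] assms by (auto simp: local_ring_def)
qed

context finite_domain_extension
begin

text \<open>
  Multiplication by \<open>x\<close> preserves the finite module \<open>S\<close>, so \<open>x\<close> is integral; the equation found in the fraction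
  field has coefficients from \<open>R\<close> and pulls back to \<open>S\<close>.
\<close>

lemma integral_equation:
  assumes x: "x \<in> carrier S"
  shows "\<exists>f. set f \<subseteq> carrier R \<and> f \<noteq> [] \<and> hd f = \<one>\<^bsub>R\<^esub> \<and> S.eval (map \<iota> f) x = \<zero>\<^bsub>S\<^esub>"
proof -
  let ?W = "carrier S - {\<zero>\<^bsub>S\<^esub>}"
  interpret FS: domain_localization S ?W by (rule S.fraction_field_localization)
  interpret L: field FS.Loc using S.fraction_field_is_field by (simp add: fraction_field_def)
  let ?j = FS.toLoc
  let ?A = "?j ` A"
  have Asub: "subring ?A FS.Loc" by (rule FS.toLoc.ring.img_is_subring[OF A_subring])
  have jspan: "?j z \<in> lin_span FS.Loc ?A (?j ` B)" if "z \<in> lin_span S A B" for z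
    using that
  proof induction
    case lin_span_zero
    then show ?case using lin_span.lin_span_zero[of FS.Loc] by simp
  next
    case (lin_span_step a b z)
    have c: "a \<in> carrier S" "b \<in> carrier S" "z \<in> carrier S"
      using lin_span_step(1-3) B(2) S.lin_span_closed[OF A_carrier B(2)] by auto
    have "?j a \<otimes>\<^bsub>FS.Loc\<^esub> ?j b \<oplus>\<^bsub>FS.Loc\<^esub> ?j z \<in> lin_span FS.Loc ?A (?j ` B)"
      by (rule lin_span.lin_span_step[OF imageI[OF lin_span_step(1)] imageI[OF lin_span_step(2)] lin_span_step(4)])
    then show ?case using c by simp
  qed
  have "\<exists>b\<in>B. b \<noteq> \<zero>\<^bsub>S\<^esub>"
  proof (rule ccontr)
    assume n: "\<not> (\<exists>b\<in>B. b \<noteq> \<zero>\<^bsub>S\<^esub>)"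
    have "z = \<zero>\<^bsub>S\<^esub>" if "z \<in> lin_span S A B" for z
      using that
    proof induction
      case (lin_span_step a g z)
      then have "g = \<zero>\<^bsub>S\<^esub>" "a \<in> carrier S" using n A_carrier by blast+
      then show ?case using lin_span_step(4) by simp
    qed simp
    then show False using span[OF S.one_closed] S.one_not_zero by blast
  qed
  then obtain b where b: "b \<in> B" "b \<noteq> \<zero>\<^bsub>S\<^esub>" by blast
  have jb: "?j b \<noteq> \<zero>\<^bsub>FS.Loc\<^esub>"
    using b B(2) inj_onD[OF FS.toLoc_inj, of b "\<zero>\<^bsub>S\<^esub>"] FS.toLoc.hom_zero by auto
  have "integral_over FS.Loc ?A (?j x)"
  proof (rule L.finite_imp_integral[OF Asub])
    show "?j x \<in> carrier FS.Loc" using x by simp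
    show "finite (?j ` B)" "?j ` B \<subseteq> carrier FS.Loc" using B by auto
    show "\<exists>g\<in>?j ` B. g \<noteq> \<zero>\<^bsub>FS.Loc\<^esub>" using b(1) jb by blast
    fix g assume "g \<in> ?j ` B"
    then obtain b' where b': "b' \<in> B" "g = ?j b'" by blast
    then show "?j x \<otimes>\<^bsub>FS.Loc\<^esub> g \<in> lin_span FS.Loc ?A (?j ` B)"
      using jspan[OF span[of "x \<otimes>\<^bsub>S\<^esub> b'"]] x B(2) by auto
  qed
  then obtain q where q: "polynomial\<^bsub>FS.Loc\<^esub> ?A q" "q \<noteq> []" "hd q = \<one>\<^bsub>FS.Loc\<^esub>" "FS.Loc.eval q (?j x) = \<zero>\<^bsub>FS.Loc\<^esub>"
    unfolding integral_over_def by blast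
  have qA: "set q \<subseteq> ?A" using q(1,2) unfolding polynomial_def by blast
  let ?g = "\<lambda>r. ?j (\<iota> r)"
  have ginj: "inj_on ?g (carrier R)"
    using comp_inj_on[OF \<iota>_inj, of ?j] FS.toLoc_inj inj_on_subset[OF FS.toLoc_inj A_carrier] by (simp add: comp_def)
  have qg: "set q \<subseteq> ?g ` carrier R" using qA by (simp add: image_image)
  define f where "f = map (inv_into (carrier R) ?g) q"
  have f: "set f \<subseteq> carrier R" unfolding f_def using qg by (auto intro!: inv_into_into)
  have gf: "map ?g f = q" 
  proof -
    have "?g (inv_into (carrier R) ?g t) = t" if "t \<in> set q" for t
      by (rule f_inv_into_f[of t ?g]) (use that qg in blast)
    then show ?thesis unfolding f_def by (simp add: map_idI)
  qed
  have fS: "set (map \<iota> f) \<subseteq> carrier S" using f by auto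
  have "?j (S.eval (map \<iota> f) x) = FS.Loc.eval (map ?j (map \<iota> f)) (?j x)"
    using FS.toLoc.ring.eval_hom'[OF x fS] .
  also have "\<dots> = ?j \<zero>\<^bsub>S\<^esub>" using q(4) gf by (simp add: comp_def)
  finally have "S.eval (map \<iota> f) x = \<zero>\<^bsub>S\<^esub>"
    by (rule inj_onD[OF FS.toLoc_inj]) (use S.eval_in_carrier[OF fS x] in simp_all)
  moreover have "f \<noteq> []" using q(2) by (simp add: f_def)
  moreover have "hd f = \<one>\<^bsub>R\<^esub>"
  proof (rule inj_onD[OF ginj])
    show "?g (hd f) = ?g \<one>\<^bsub>R\<^esub>" using gf q(2,3) by (metis \<iota>.hom_one FS.toLoc.hom_one hd_map list.map_disc_iff)
    show "hd f \<in> carrier R" using f \<open>f \<noteq> []\<close> by (cases f) auto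
  qed simp
  ultimately show ?thesis using f by blast
qed

text \<open>
  \<open>S\<close> is local and integral over \<open>R\<close>, so \<open>n\<close> is its only prime over \<open>m\<close>.  If \<open>x\<close> in \<open>n\<close> were not in \<open>q\<close>, then in an
  equation for \<open>x\<close> the coefficients would lie in \<open>m\<close> one after the other, starting with the constant one:
  each lies in \<open>n \<inter> R = m \<subseteq> q\<close>, and \<open>x\<close> can be cancelled modulo \<open>q\<close>.  The leading coefficient is \<open>1\<close>.
\<close>

lemma prime_over_max:
  assumes noeth: "noetherian_ring R" and R: "local_ring R m" and S: "local_ring S n" and mn: "\<iota> ` m \<subseteq> n"
    and q: "prime_in S (carrier S) q" "\<iota> ` m \<subseteq> q"
  shows "n \<subseteq> q"
proof
  fix x assume xn: "x \<in> n"
  note m = local_maximal_ideal[OF R] and n = local_maximal_ideal[OF S]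
  note q' = prime_inD[OF q(1)]
  interpret m: ideal m R by (rule m(1))
  interpret n: ideal n S by (rule n(1))
  have x: "x \<in> carrier S" using xn n.Icarr by blast
  have "ideal q S" by (rule S.ideal_criterion[OF q'(9,3)]) (use q'(5,6) in auto)
  then have qn: "q \<subseteq> n" by (rule proper_ideal_in_max[OF noetherian_extension[OF noeth] S _ q'(4)])
  have "ideal {r \<in> carrier R. \<iota> r \<in> n} R"
    by (rule R.ideal_criterion) (auto simp: n.I_l_closed n.a_closed)
  then have "{r \<in> carrier R. \<iota> r \<in> n} \<subseteq> m"
    by (rule proper_ideal_in_max[OF noeth R]) (use n(2) in simp)
  then have nm: "r \<in> m" if "r \<in> carrier R" "\<iota> r \<in> n" for r using that by blast
  show "x \<in> q"
  proof (rule ccontr)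
    assume xq: "x \<notin> q"
    have coeffs: "set f \<subseteq> m" if "set f \<subseteq> carrier R" "S.eval (map \<iota> f) x \<in> q" for f
      using that
    proof (induction f rule: rev_induct)
      case (snoc c f)
      have f: "set (map \<iota> f) \<subseteq> carrier S" "c \<in> carrier R" "set f \<subseteq> carrier R" using snoc.prems(1) by auto
      let ?e = "S.eval (map \<iota> f) x"
      have e: "?e \<in> carrier S" using S.eval_in_carrier[OF f(1) x] .
      have ic: "\<iota> c \<in> carrier S" using f(2) by simp
      have s: "?e \<otimes>\<^bsub>S\<^esub> x \<oplus>\<^bsub>S\<^esub> \<iota> c \<in> q"
        using snoc.prems(2) S.eval_append_aux[OF f(1) ic x] by simp
      have cancel: "(u \<oplus>\<^bsub>S\<^esub> v) \<ominus>\<^bsub>S\<^esub> u = v" "(u \<oplus>\<^bsub>S\<^esub> v) \<ominus>\<^bsub>S\<^esub> v = u" if "u \<in> carrier S" "v \<in> carrier S" for u v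
        using that by algebra+
      have "(?e \<otimes>\<^bsub>S\<^esub> x \<oplus>\<^bsub>S\<^esub> \<iota> c) \<ominus>\<^bsub>S\<^esub> ?e \<otimes>\<^bsub>S\<^esub> x \<in> n"
        unfolding a_minus_def by (rule n.a_closed[OF subsetD[OF qn s] n.a_inv_closed[OF n.I_l_closed[OF xn e]]])
      then have "\<iota> c \<in> n" using cancel(1)[of "?e \<otimes>\<^bsub>S\<^esub> x" "\<iota> c"] e ic x by simp
      then have c: "c \<in> m" using nm f(2) by blast
      then have "\<iota> c \<in> q" using q(2) by blast
      then have "(?e \<otimes>\<^bsub>S\<^esub> x \<oplus>\<^bsub>S\<^esub> \<iota> c) \<ominus>\<^bsub>S\<^esub> \<iota> c \<in> q" by (rule S.prime_in_minus[OF q(1) s])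
      then have "?e \<otimes>\<^bsub>S\<^esub> x \<in> q" using cancel(2)[of "?e \<otimes>\<^bsub>S\<^esub> x" "\<iota> c"] e ic x by simp
      then have "?e \<in> q" using q'(7)[OF e x] xq by blast
      then show ?case using snoc.IH[OF f(3)] c by simp
    qed simp
    obtain f where f: "set f \<subseteq> carrier R" "f \<noteq> []" "hd f = \<one>\<^bsub>R\<^esub>" "S.eval (map \<iota> f) x = \<zero>\<^bsub>S\<^esub>"
      using integral_equation[OF x] by blast
    have "set f \<subseteq> m" by (rule coeffs[OF f(1)]) (use f(4) q'(3) in simp)
    then have "\<one>\<^bsub>R\<^esub> \<in> m" using f(2,3) hd_in_set[OF f(2)] by auto
    then show False using m(2) by blast
  qed
qed

lemma residue_representative:
  assumes n: "ideal n S" and m: "ideal m R" and s: "s \<in> carrier S"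
    and bij: "bij_betw (quotient_map S n \<iota>) (carrier (R Quot m)) (carrier (S Quot n))"
  obtains r where "r \<in> carrier R" "s \<ominus>\<^bsub>S\<^esub> \<iota> r \<in> n"
proof -
  interpret n: ideal n S by (rule n)
  interpret m: ideal m R by (rule m)
  have "n +>\<^bsub>S\<^esub> s \<in> carrier (S Quot n)" using s by (auto simp: FactRing_def A_RCOSETS_def')
  then obtain Z where Z: "Z \<in> carrier (R Quot m)" "quotient_map S n \<iota> Z = n +>\<^bsub>S\<^esub> s"
    using bij_betw_imp_surj_on[OF bij] by (metis imageE)
  have "s \<in> n +>\<^bsub>S\<^esub> s" by (rule n.a_rcos_self[OF s])
  then obtain x where x: "x \<in> Z" "s \<in> n +>\<^bsub>S\<^esub> \<iota> x" using Z(2) unfolding quotient_map_def by blast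
  have xR: "x \<in> carrier R"
  proof -
    obtain a where a: "a \<in> carrier R" "Z = m +>\<^bsub>R\<^esub> a" using Z(1) by (auto simp: FactRing_def A_RCOSETS_def')
    then obtain h where "h \<in> m" "x = h \<oplus>\<^bsub>R\<^esub> a" using x(1) by (auto simp: a_r_coset_def')
    then show ?thesis using m.Icarr a(1) by simp
  qed
  obtain h where h: "h \<in> n" "s = h \<oplus>\<^bsub>S\<^esub> \<iota> x" using x(2) by (auto simp: a_r_coset_def')
  have "(h \<oplus>\<^bsub>S\<^esub> v) \<ominus>\<^bsub>S\<^esub> v = h" if "v \<in> carrier S" for v
    using that n.Icarr[OF h(1)] by algebra
  then have "s \<ominus>\<^bsub>S\<^esub> \<iota> x \<in> n" using h xR by simp
  then show ?thesis using that xR by blast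
qed

end

lemma (in ring) finsum_const:
  assumes "finite H" "x \<in> carrier R"
  shows "(\<Oplus>i\<in>H. x) = add_pow R (card H) x"
  using assms by (induction H rule: finite_induct) (auto simp: add.nat_pow_Suc a_comm)

lemma (in ring) char_add_pow:
  assumes "ring_characteristic R dvd k" "x \<in> carrier R"
  shows "add_pow R (k::nat) x = \<zero>"
proof -
  obtain j where j: "k = ring_characteristic R * j" using assms(1) by (rule dvdE)
  have p: "add_pow R (ring_characteristic R) \<one> = \<zero>"
    using add.pow_ord_eq_1[of \<one>] unfolding ring_characteristic_def add_pow_def by simp
  have "add_pow R k \<one> = add_pow R j (add_pow R (ring_characteristic R) \<one>)"
    unfolding j by (subst add.nat_pow_pow) auto
  then have "add_pow R k \<one> = \<zero>" unfolding p by simp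
  then show ?thesis using add_pow_ldistr[OF one_closed assms(2), of k] assms(2) by simp
qed

text \<open>
  \<open>\<phi> = Tr (l \<cdot>)\<close> with \<open>l\<close> in \<open>S\<close>, and \<open>l\<close> differs from an element of \<open>R\<close>, which has trace zero, by some \<open>x\<close> in \<open>n\<close>.
  So \<open>1 = \<phi> 1 = Tr x\<close>, while all conjugates of \<open>x\<close> lie in a common proper prime.
\<close>

lemma (in split_field_homs) residue_contradiction:
  assumes noeth: "noetherian_ring R" and normal: "normal_domain S"
    and unr: "\<And>Q. primeideal Q S \<Longrightarrow> height S Q \<le> 1 \<Longrightarrow> unramified_at R S \<iota> Q"
    and J: "generic_basis J d" and sep: separable_ext and card: "card J \<le> card H"
    and R: "local_ring R m" and S: "local_ring S n" and mn: "\<iota> ` m \<subseteq> n"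
    and bij: "bij_betw (quotient_map S n \<iota>) (carrier (R Quot m)) (carrier (S Quot n))"
    and p: "ring_characteristic R dvd card H"
  shows False
proof -
  have "\<exists>a b c. a \<in> carrier S \<and> b \<in> carrier S \<and> b \<noteq> \<zero>\<^bsub>S\<^esub> \<and>
      (\<forall>\<sigma>\<in>H. c \<sigma> \<in> carrier E \<and> c \<sigma> \<otimes>\<^bsub>E\<^esub> \<sigma> b = \<sigma> a) \<and>
      (\<forall>y\<in>carrier S. (\<Oplus>\<^bsub>E\<^esub>\<sigma>\<in>H. c \<sigma> \<otimes>\<^bsub>E\<^esub> \<sigma> y) = \<eta> (\<phi> y))"
    by (rule splitting_numerator[OF J sep card]) blast
  then obtain a b c where ab: "a \<in> carrier S" "b \<in> carrier S" "b \<noteq> \<zero>\<^bsub>S\<^esub>"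
    and c: "\<And>\<sigma>. \<sigma> \<in> H \<Longrightarrow> c \<sigma> \<in> carrier E \<and> c \<sigma> \<otimes>\<^bsub>E\<^esub> \<sigma> b = \<sigma> a"
    and rep: "\<And>y. y \<in> carrier S \<Longrightarrow> (\<Oplus>\<^bsub>E\<^esub>\<sigma>\<in>H. c \<sigma> \<otimes>\<^bsub>E\<^esub> \<sigma> y) = \<eta> (\<phi> y)"
    by blast
  obtain l where l: "l \<in> carrier S" "a = b \<otimes>\<^bsub>S\<^esub> l"
    by (rule functional_numerator_divisible[OF noeth normal unr H(1) H0 H(2) H_distinct \<phi>_closed ab c rep, THEN bexE])
  note hom = ring_hom_cring.homh[OF H_hom]
  have cl: "c \<sigma> = \<sigma> l" if \<sigma>: "\<sigma> \<in> H" for \<sigma>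
  proof -
    have "c \<sigma> \<otimes>\<^bsub>E\<^esub> \<sigma> b = \<sigma> l \<otimes>\<^bsub>E\<^esub> \<sigma> b"
      using c[OF \<sigma>] l ab \<sigma> ring_hom_mult[OF hom[OF \<sigma>] ab(2) l(1)] by (simp add: E.m_comm)
    then show ?thesis
      using E.m_rcancel[of "\<sigma> b" "c \<sigma>" "\<sigma> l"] c[OF \<sigma>] H_nonzero[OF \<sigma> ab(2,3)] \<sigma> l(1) ab(2) by simp
  qed
  note m = local_maximal_ideal[OF R] and n = local_maximal_ideal[OF S]
  interpret n: ideal n S by (rule n(1))
  interpret m: ideal m R by (rule m(1))
  obtain r where r: "r \<in> carrier R" "l \<ominus>\<^bsub>S\<^esub> \<iota> r \<in> n" by (rule residue_representative[OF n(1) m(1) l(1) bij])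
  define x where "x = l \<ominus>\<^bsub>S\<^esub> \<iota> r"
  have x: "x \<in> n" "x \<in> carrier S" using r l(1) by (auto simp: x_def)
  have lx: "l = x \<oplus>\<^bsub>S\<^esub> \<iota> r"
  proof -
    have "u = (u \<ominus>\<^bsub>S\<^esub> v) \<oplus>\<^bsub>S\<^esub> v" if "u \<in> carrier S" "v \<in> carrier S" for u v using that by algebra
    then show ?thesis using l(1) r(1) by (simp add: x_def)
  qed
  have \<eta>c: "\<eta> r \<in> carrier E" using \<eta>_closed(1)[OF H0 r(1)] .
  have trace: "(\<Oplus>\<^bsub>E\<^esub>\<sigma>\<in>H. \<sigma> x) = \<one>\<^bsub>E\<^esub>"
  proof -
    have "(\<Oplus>\<^bsub>E\<^esub>\<sigma>\<in>H. c \<sigma> \<otimes>\<^bsub>E\<^esub> \<sigma> \<one>\<^bsub>S\<^esub>) = (\<Oplus>\<^bsub>E\<^esub>\<sigma>\<in>H. \<sigma> x \<oplus>\<^bsub>E\<^esub> \<eta> r)"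
    proof (rule E.finsum_cong'[OF refl])
      show "(\<lambda>\<sigma>. \<sigma> x \<oplus>\<^bsub>E\<^esub> \<eta> r) \<in> H \<rightarrow> carrier E" using x(2) \<eta>c by auto
      fix \<sigma> assume \<sigma>: "\<sigma> \<in> H"
      have "\<sigma> l = \<sigma> x \<oplus>\<^bsub>E\<^esub> \<sigma> (\<iota> r)" unfolding lx by (rule ring_hom_add[OF hom[OF \<sigma>] x(2)]) (use r(1) in simp)
      then show "c \<sigma> \<otimes>\<^bsub>E\<^esub> \<sigma> \<one>\<^bsub>S\<^esub> = \<sigma> x \<oplus>\<^bsub>E\<^esub> \<eta> r"
        using cl[OF \<sigma>] ring_hom_one[OF hom[OF \<sigma>]] is_extD(3)[OF H(2)[OF \<sigma>] r(1)] x(2) \<eta>c \<sigma> by simp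
    qed
    also have "\<dots> = (\<Oplus>\<^bsub>E\<^esub>\<sigma>\<in>H. \<sigma> x) \<oplus>\<^bsub>E\<^esub> (\<Oplus>\<^bsub>E\<^esub>\<sigma>\<in>H. \<eta> r)"
      by (rule E.finsum_addf) (use x(2) \<eta>c in auto)
    also have "(\<Oplus>\<^bsub>E\<^esub>\<sigma>\<in>H. \<eta> r) = \<zero>\<^bsub>E\<^esub>"
    proof -
      obtain \<tau> where \<tau>: "\<tau> \<in> H" using H0 by blast
      interpret \<tau>: ring_hom_cring S E \<tau> by (rule H_hom[OF \<tau>])
      have "\<eta> r = \<tau> (\<iota> r)" using is_extD(3)[OF H(2)[OF \<tau>] r(1)] by simp
      then have "add_pow E (card H) (\<eta> r) = \<tau> (\<iota> (add_pow R (card H) r))"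
        using r(1) by (simp add: \<tau>.hom_add_pow \<iota>.hom_add_pow)
      also have "\<dots> = \<zero>\<^bsub>E\<^esub>" using R.char_add_pow[OF p r(1)] by simp
      finally show ?thesis using E.finsum_const[OF H(1) \<eta>c] by simp
    qed
    also have "(\<Oplus>\<^bsub>E\<^esub>\<sigma>\<in>H. \<sigma> x) \<oplus>\<^bsub>E\<^esub> \<zero>\<^bsub>E\<^esub> = (\<Oplus>\<^bsub>E\<^esub>\<sigma>\<in>H. \<sigma> x)"
      by (rule E.r_zero) (use x(2) in \<open>auto intro!: E.finsum_closed\<close>)
    finally show ?thesis using rep[OF S.one_closed] \<phi>_one \<eta>_hom(4)[OF H0] R.one_closed by simp
  qed
  obtain \<tau> where \<tau>: "\<tau> \<in> H" using H0 by blast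
  have ins: "insert \<tau> H = H" using \<tau> by blast
  obtain T QQ where QQ: "prime_in E T QQ" and T: "\<And>\<sigma>. \<sigma> \<in> insert \<tau> H \<Longrightarrow> \<sigma> ` carrier S \<subseteq> T"
    and \<tau>Q: "\<And>s. s \<in> carrier S \<Longrightarrow> \<tau> s \<in> QQ \<longleftrightarrow> s \<in> n"
    by (rule lying_over_images[OF H(1) _ n(3), of \<tau>]) (use H(2) ins in auto)
  note Q' = prime_inD[OF QQ]
  \<comment> \<open>The preimage of \<open>QQ\<close> under \<open>\<sigma>\<close> is a prime of \<open>S\<close> over \<open>m\<close>, hence contains \<open>n\<close>.\<close>
  have conj: "\<sigma> x \<in> QQ" if \<sigma>: "\<sigma> \<in> H" for \<sigma>
  proof -
    interpret \<sigma>: ring_hom_cring S E \<sigma> by (rule H_hom[OF \<sigma>])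
    have \<sigma>T: "\<sigma> s \<in> T" if "s \<in> carrier S" for s using T[of \<sigma>] \<sigma> that by blast
    let ?q = "{s \<in> carrier S. \<sigma> s \<in> QQ}"
    have "prime_in S (carrier S) ?q"
      unfolding prime_in_def
    proof (intro conjI ballI impI)
      show "subring (carrier S) S" by (rule S.carrier_is_subring)
      show "\<zero>\<^bsub>S\<^esub> \<in> ?q" using Q'(3) by simp
      show "\<one>\<^bsub>S\<^esub> \<notin> ?q" using Q'(4) by simp
      show "s \<oplus>\<^bsub>S\<^esub> t \<in> ?q" if "s \<in> ?q" "t \<in> ?q" for s t using that Q'(5) by simp
      show "s \<otimes>\<^bsub>S\<^esub> t \<in> ?q" if "s \<in> carrier S" "t \<in> ?q" for s t using that Q'(6)[OF \<sigma>T] by simp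
      show "s \<in> ?q \<or> t \<in> ?q" if "s \<in> carrier S" "t \<in> carrier S" "s \<otimes>\<^bsub>S\<^esub> t \<in> ?q" for s t
        using that Q'(7)[OF \<sigma>T \<sigma>T, of s t] by auto
    qed auto
    moreover have "\<iota> ` m \<subseteq> ?q"
    proof
      fix y assume "y \<in> \<iota> ` m"
      then obtain r' where r': "r' \<in> m" "y = \<iota> r'" by blast
      have rc: "r' \<in> carrier R" using r'(1) m.Icarr by blast
      have "\<iota> r' \<in> n" using mn r'(1) by blast
      then have "\<tau> (\<iota> r') \<in> QQ" using \<tau>Q rc by simp
      then have "\<sigma> (\<iota> r') \<in> QQ" using is_extD(3)[OF H(2)[OF \<sigma>] rc] is_extD(3)[OF H(2)[OF \<tau>] rc] by simp
      then show "y \<in> ?q" using rc r'(2) by simp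
    qed
    ultimately have "n \<subseteq> ?q" by (rule prime_over_max[OF noeth R S mn])
    then show ?thesis using x(1) by blast
  qed
  have "\<one>\<^bsub>E\<^esub> \<in> QQ" unfolding trace[symmetric] by (rule E.prime_in_finsum[OF QQ H(1) conj])
  then show False using Q'(4) by blast
qed

section \<open>Unramified primes from etale local homomorphisms\<close>

context domain
begin

lemma prime_localization:
  assumes "primeideal Q R"
  shows "domain_localization R (carrier R - Q)"
proof -
  interpret Q: primeideal Q R by fact
  show ?thesis
  proof (unfold_locales)
    show "\<one> \<in> carrier R - Q" using Q.I_notcarr Q.one_imp_carrier by blast
    show "\<zero> \<notin> carrier R - Q" using additive_subgroup.zero_closed[OF Q.additive_subgroup_axioms] by blast
    fix s t assume "s \<in> carrier R - Q" "t \<in> carrier R - Q"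
    then show "s \<otimes> t \<in> carrier R - Q" using Q.I_prime by blast
  qed auto
qed

text \<open>
  The fractions with numerator in \<open>Q\<close> form a maximal ideal, since all the others are units; and \<open>n\<close> is the
  only maximal ideal.
\<close>

lemma localization_max_ideal:
  assumes Q: "primeideal Q R" and loc: "local_ring (localization_at R Q) n"
    and as: "a \<in> carrier R" "s \<in> carrier R - Q"
  shows "fraction R (carrier R - Q) a s \<in> n \<longleftrightarrow> a \<in> Q"
proof -
  interpret Q: primeideal Q R by (rule Q)
  interpret LQ: domain_localization R "carrier R - Q" by (rule prime_localization[OF Q])
  note [simp del] = LQ.W_carrier
  let ?fr = "fraction R (carrier R - Q)"
  define N where "N = {?fr a s | a s. a \<in> Q \<and> s \<in> carrier R - Q}"
  have N_iff: "?fr a s \<in> N \<longleftrightarrow> a \<in> Q" if as: "a \<in> carrier R" "s \<in> carrier R - Q" for a s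
  proof
    assume "?fr a s \<in> N"
    then obtain b t where bt: "b \<in> Q" "t \<in> carrier R - Q" "?fr a s = ?fr b t" unfolding N_def by blast
    then have "a \<otimes> t = b \<otimes> s" using LQ.fraction_eq_iff[OF as Q.Icarr[OF bt(1)] bt(2)] by blast
    then have "a \<otimes> t \<in> Q" using Q.I_r_closed[OF bt(1)] as(2) by simp
    then show "a \<in> Q" using Q.I_prime[OF as(1), of t] bt(2) by blast
  qed (use that in \<open>auto simp: N_def\<close>)
  have N: "ideal N LQ.Loc"
  proof (rule LQ.Loc.ideal_criterion)
    show "N \<subseteq> carrier LQ.Loc"
    proof
      fix x assume "x \<in> N"
      then obtain a s where "a \<in> Q" "s \<in> carrier R - Q" "x = ?fr a s" unfolding N_def by blast
      then show "x \<in> carrier LQ.Loc" using LQ.fraction_closed Q.Icarr by blast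
    qed
    have "\<zero> \<in> Q" using additive_subgroup.zero_closed[OF Q.additive_subgroup_axioms] .
    then show "\<zero>\<^bsub>LQ.Loc\<^esub> \<in> N" unfolding LQ.Loc_zero using N_iff[OF zero_closed LQ.W_one] by blast
  next
    fix x y assume "x \<in> N" "y \<in> N"
    then obtain a s b t where h: "a \<in> Q" "s \<in> carrier R - Q" "x = ?fr a s" "b \<in> Q" "t \<in> carrier R - Q" "y = ?fr b t"
      unfolding N_def by blast
    have c: "a \<in> carrier R" "b \<in> carrier R" "s \<in> carrier R" "t \<in> carrier R" using h Q.Icarr by auto
    have "a \<otimes> t \<oplus> b \<otimes> s \<in> Q"
      by (rule Q.a_closed[OF Q.I_r_closed[OF h(1) c(4)] Q.I_r_closed[OF h(4) c(3)]])
    then show "x \<oplus>\<^bsub>LQ.Loc\<^esub> y \<in> N"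
      unfolding h(3,6) LQ.fraction_add[OF c(1) h(2) c(2) h(5)] using LQ.W_mult[OF h(2,5)] unfolding N_def by blast
  next
    fix x y assume "x \<in> carrier LQ.Loc" "y \<in> N"
    then obtain a s b t where h: "a \<in> carrier R" "s \<in> carrier R - Q" "x = ?fr a s" "b \<in> Q" "t \<in> carrier R - Q" "y = ?fr b t"
      unfolding N_def LQ.Loc_carrier by blast
    have "a \<otimes> b \<in> Q" by (rule Q.I_l_closed[OF h(4,1)])
    then show "x \<otimes>\<^bsub>LQ.Loc\<^esub> y \<in> N"
      unfolding h(3,6) LQ.fraction_mult[OF h(1,2) Q.Icarr[OF h(4)] h(5)] using LQ.W_mult[OF h(2,5)] unfolding N_def by blast
  qed
  have "maximalideal N LQ.Loc"
  proof (rule maximalidealI[OF N])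
    show "carrier LQ.Loc \<noteq> N"
      using N_iff[OF one_closed LQ.W_one] LQ.W_one LQ.fraction_closed[OF one_closed LQ.W_one] by blast
    fix U assume U: "ideal U LQ.Loc" "N \<subseteq> U" "U \<subseteq> carrier LQ.Loc"
    interpret U: ideal U LQ.Loc by (rule U(1))
    show "U = N \<or> U = carrier LQ.Loc"
    proof (cases "U \<subseteq> N")
      case False
      then obtain x where x: "x \<in> U" "x \<notin> N" by blast
      then have "x \<in> carrier LQ.Loc" using U(3) by blast
      then obtain a s where as: "a \<in> carrier R" "s \<in> carrier R - Q" "x = ?fr a s" by (rule LQ.Loc_cases)
      have a: "a \<in> carrier R - Q" using x(2) N_iff[OF as(1,2)] as(1,3) by blast
      have sc: "s \<in> carrier R" using as(2) by blast
      have "?fr s a \<otimes>\<^bsub>LQ.Loc\<^esub> x \<in> U" by (rule U.I_l_closed[OF x(1) LQ.fraction_closed[OF sc a]])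
      moreover have "?fr s a \<otimes>\<^bsub>LQ.Loc\<^esub> x = \<one>\<^bsub>LQ.Loc\<^esub>"
        unfolding as(3) LQ.fraction_mult[OF sc a as(1,2)] LQ.Loc_one
        using LQ.fraction_eq_iff[OF _ LQ.W_mult[OF a as(2)] one_closed LQ.W_one, of "s \<otimes> a"] as(1) sc by (simp add: m_comm)
      ultimately show ?thesis using U.one_imp_carrier by simp
    qed (use U(2) in blast)
  qed
  then have "N = n" using loc unfolding local_ring_def by blast
  then show ?thesis using N_iff[OF as] by simp
qed

end

context cring
begin

lemma lin_span_mult_carrier:
  assumes "x \<in> lin_span R K (carrier R)" "K \<subseteq> carrier R" "v \<in> carrier R"
  shows "v \<otimes> x \<in> lin_span R K (carrier R)"
  using assms(1)
proof induction
  case lin_span_zero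
  then show ?case using lin_span.lin_span_zero[of R] assms(3) by simp
next
  case (lin_span_step a g x)
  have c: "a \<in> carrier R" "x \<in> carrier R" "v \<otimes> g \<in> carrier R"
    using lin_span_step assms lin_span_closed[OF assms(2) subset_refl lin_span_step(3)] by auto
  have "v \<otimes> (a \<otimes> g \<oplus> x) = a \<otimes> (v \<otimes> g) \<oplus> v \<otimes> x"
    using c lin_span_step(2) assms(3) by (simp add: r_distr m_lcomm)
  then show ?case using lin_span.lin_span_step[OF lin_span_step(1) c(3) lin_span_step(4)] by simp
qed

lemma eval_smult_list:
  "v \<in> carrier R \<Longrightarrow> set f \<subseteq> carrier R \<Longrightarrow> x \<in> carrier R \<Longrightarrow> eval (map (\<lambda>k. v \<otimes> k) f) x = v \<otimes> eval f x"
  by (induction f) (auto simp: eval_in_carrier r_distr m_assoc)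

lemma deriv_eval_smult_list:
  "v \<in> carrier R \<Longrightarrow> set f \<subseteq> carrier R \<Longrightarrow> x \<in> carrier R \<Longrightarrow>
    deriv_eval R (map (\<lambda>k. v \<otimes> k) f) x = v \<otimes> deriv_eval R f x"
  by (induction f) (auto simp: r_distr m_assoc add_pow_rdistr)

lemma eval_poly_derivative:
  assumes "set q \<subseteq> carrier R" "x \<in> carrier R"
  shows "eval (poly_derivative R q) x = deriv_eval R q x"
proof -
  let ?D = "\<lambda>q. map (\<lambda>i. add_pow R (length q - 1 - i) (q ! i)) [0..<length q - 1]"
  have D: "set (?D q) \<subseteq> carrier R" if "set q \<subseteq> carrier R" for q
    using that by (auto intro!: add.nat_pow_closed)
  have "eval (?D q) x = deriv_eval R q x"
    using assms(1)
  proof (induction q)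
    case (Cons c q)
    show ?case
    proof (cases q)
      case (Cons d q')
      have "[0..<length (c # q) - 1] = 0 # map Suc [0..<length q - 1]"
        using Cons by (simp add: map_Suc_upt upt_conv_Cons del: upt_Suc)
      then have "?D (c # q) = add_pow R (length q) c # ?D q" by simp
      then show ?thesis
        using Cons.IH Cons.prems D[of q] assms(2) add_pow_ldistr[of c "x [^] (length q - 1)" "length q"] by simp
    qed (use Cons.prems assms(2) in simp)
  qed simp
  then show ?thesis unfolding poly_derivative_def using eval_normalize[OF D[OF assms(1)] assms(2)] by simp
qed

end

context field
begin

text \<open>
  Evaluate the Bezout identity of the polynomial and its derivative at the root.
\<close>

lemma separable_poly_deriv_eval:
  assumes K: "subfield K R" and q: "q \<in> carrier (univ_poly R K)" and x: "x \<in> carrier R" and 0: "eval q x = \<zero>"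
    and sep: "separable_poly R K q"
  shows "deriv_eval R q x \<noteq> \<zero>"
proof
  assume d0: "deriv_eval R q x = \<zero>"
  note Ks = subfieldE(1)[OF K]
  have Kc: "K \<subseteq> carrier R" by (rule subfieldE(3)[OF K])
  obtain a b where ab: "a \<in> carrier (univ_poly R K)" "b \<in> carrier (univ_poly R K)"
    "a \<otimes>\<^bsub>univ_poly R K\<^esub> q \<oplus>\<^bsub>univ_poly R K\<^esub> b \<otimes>\<^bsub>univ_poly R K\<^esub> poly_derivative R q = \<one>\<^bsub>univ_poly R K\<^esub>"
    using sep unfolding separable_poly_def by blast
  have qK: "set q \<subseteq> K" using q unfolding univ_poly_carrier[symmetric] polynomial_def by auto
  have "set (map (\<lambda>i. add_pow R (length q - 1 - i) (q ! i)) [0..<length q - 1]) \<subseteq> K"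
    by (auto intro!: subring_add_pow[OF Ks] subsetD[OF qK nth_mem])
  then have dq: "poly_derivative R q \<in> carrier (univ_poly R K)"
    unfolding poly_derivative_def univ_poly_carrier[symmetric] by (rule normalize_gives_polynomial)
  note h = eval_is_hom[OF Ks x]
  interpret UP: ring "univ_poly R K" by (rule univ_poly_is_ring[OF Ks])
  have ev0: "eval (poly_derivative R q) x = \<zero>"
    using eval_poly_derivative[OF subset_trans[OF qK Kc] x] d0 by simp
  have "eval (a \<otimes>\<^bsub>univ_poly R K\<^esub> q \<oplus>\<^bsub>univ_poly R K\<^esub> b \<otimes>\<^bsub>univ_poly R K\<^esub> poly_derivative R q) x =
    eval a x \<otimes> eval q x \<oplus> eval b x \<otimes> eval (poly_derivative R q) x"
    using ring_hom_add[OF h UP.m_closed[OF ab(1) q] UP.m_closed[OF ab(2) dq]]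
      ring_hom_mult[OF h ab(1) q] ring_hom_mult[OF h ab(2) dq] by simp
  also have "\<dots> = \<zero>" unfolding 0 ev0 using ring_hom_closed[OF h ab(1)] ring_hom_closed[OF h ab(2)] by simp
  finally show False unfolding ab(3) using ring_hom_one[OF h] one_not_zero by simp
qed

end

context finite_domain_extension
begin

lemma contracted_primeideal:
  assumes "primeideal Q S"
  shows "primeideal {r \<in> carrier R. \<iota> r \<in> Q} R"
proof -
  interpret Q: primeideal Q S by fact
  have z: "\<zero>\<^bsub>S\<^esub> \<in> Q" using additive_subgroup.zero_closed[OF Q.additive_subgroup_axioms] .
  show ?thesis
  proof (rule primeidealI[OF _ R.is_cring])
    show "ideal {r \<in> carrier R. \<iota> r \<in> Q} R"
      by (rule R.ideal_criterion) (use z in \<open>auto simp: Q.I_l_closed Q.a_closed\<close>)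
    have "\<one>\<^bsub>S\<^esub> \<notin> Q" using Q.I_notcarr Q.one_imp_carrier by blast
    then have "\<one>\<^bsub>R\<^esub> \<notin> {r \<in> carrier R. \<iota> r \<in> Q}" by simp
    then show "carrier R \<noteq> {r \<in> carrier R. \<iota> r \<in> Q}" using R.one_closed by blast
    fix a b assume "a \<in> carrier R" "b \<in> carrier R" "a \<otimes>\<^bsub>R\<^esub> b \<in> {r \<in> carrier R. \<iota> r \<in> Q}"
    then show "a \<in> {r \<in> carrier R. \<iota> r \<in> Q} \<or> b \<in> {r \<in> carrier R. \<iota> r \<in> Q}"
      using Q.I_prime[of "\<iota> a" "\<iota> b"] by auto
  qed
qed

text \<open>
  The generation of the maximal ideal and the separability of the residue field extension give the two
  halves of unramifiedness after clearing denominators.  For the second half, the minimal polynomial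
  of the class of \<open>y\<close> has a simple root there; its coefficients come from \<open>R\<^sub>P\<close>, and a common
  denominator \<open>u\<close> outside \<open>P\<close> turns it into a polynomial over \<open>R\<close>.
\<close>

lemma etale_imp_unramified:
  assumes Q: "primeideal Q S"
    and et: "etale_local_hom (localization_at R {r \<in> carrier R. \<iota> r \<in> Q}) (localization_at S Q)
      (localization_map S (carrier S - Q) \<iota>)"
  shows "unramified_at R S \<iota> Q"
proof -
  define P where "P = {r \<in> carrier R. \<iota> r \<in> Q}"
  define f where "f = localization_map S (carrier S - Q) \<iota>"
  have P: "primeideal P R" unfolding P_def by (rule contracted_primeideal[OF Q])
  interpret Q: primeideal Q S by (rule Q)
  interpret LR: domain_localization R "carrier R - P" by (rule R.prime_localization[OF P])
  interpret LS: domain_localization S "carrier S - Q" by (rule S.prime_localization[OF Q])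
  note [simp del] = LR.W_carrier LS.W_carrier
  let ?fR = "fraction R (carrier R - P)" and ?fS = "fraction S (carrier S - Q)"
  have WW: "\<iota> ` (carrier R - P) \<subseteq> carrier S - Q" unfolding P_def by auto
  have f_frac: "f (?fR a s) = ?fS (\<iota> a) (\<iota> s)" if "a \<in> carrier R" "s \<in> carrier R - P" for a s
    unfolding f_def by (rule localization_map_fraction[OF LR.domain_localization_axioms LS.domain_localization_axioms WW that])
  obtain m n where m: "local_ring LR.Loc m" and n: "local_ring LS.Loc n" and f: "f \<in> ring_hom LR.Loc LS.Loc"
    and fm: "f ` m \<subseteq> n" and gen: "genideal LS.Loc (f ` m) = n"
    and fsep: "finite_separable_extension (LR.Loc Quot m) (LS.Loc Quot n) (quotient_map LS.Loc n f)"
    using et unfolding etale_local_hom_def P_def[symmetric] f_def[symmetric] by blast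
  have m_iff: "?fR a s \<in> m \<longleftrightarrow> a \<in> P" if "a \<in> carrier R" "s \<in> carrier R - P" for a s
    by (rule R.localization_max_ideal[OF P m that])
  have n_iff: "?fS a s \<in> n \<longleftrightarrow> a \<in> Q" if "a \<in> carrier S" "s \<in> carrier S - Q" for a s
    by (rule S.localization_max_ideal[OF Q n that])
  note m' = local_maximal_ideal[OF m] and n' = local_maximal_ideal[OF n]
  interpret m: ideal m LR.Loc by (rule m'(1))
  interpret n: ideal n LS.Loc by (rule n'(1))
  have part1: "\<exists>u\<in>carrier S - Q. u \<otimes>\<^bsub>S\<^esub> y \<in> lin_span S (A \<inter> Q) (carrier S)" if y: "y \<in> Q" for y
  proof -
    let ?L = "lin_span S (A \<inter> Q) (carrier S)"
    have AQ: "A \<inter> Q \<subseteq> carrier S" using A_carrier by blast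
    have Lc: "x \<in> carrier S" if "x \<in> ?L" for x using S.lin_span_closed[OF AQ subset_refl that] .
    have yc: "y \<in> carrier S" by (rule Q.Icarr[OF y])
    have fmc: "f ` m \<subseteq> carrier LS.Loc" using fm n.a_subset by blast
    have "?fS y \<one>\<^bsub>S\<^esub> \<in> genideal LS.Loc (f ` m)" unfolding gen using n_iff[OF yc LS.W_one] y by blast
    then have "?fS y \<one>\<^bsub>S\<^esub> \<in> lin_span LS.Loc (carrier LS.Loc) (f ` m)" by (rule LS.Loc.genideal_lin_span[OF fmc])
    moreover have "\<exists>x\<in>?L. \<exists>u\<in>carrier S - Q. z = ?fS x u" if "z \<in> lin_span LS.Loc (carrier LS.Loc) (f ` m)" for z
      using that
    proof induction
      case lin_span_zero
      show ?case unfolding LS.Loc_zero using lin_span.lin_span_zero[of S] LS.W_one by blast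
    next
      case (lin_span_step c g z)
      obtain b t where bt: "b \<in> carrier S" "t \<in> carrier S - Q" "c = ?fS b t"
        by (rule LS.Loc_cases[OF lin_span_step(1)])
      obtain w where w: "w \<in> m" "g = f w" using lin_span_step(2) by blast
      obtain a s where as: "a \<in> carrier R" "s \<in> carrier R - P" "w = ?fR a s"
        by (rule LR.Loc_cases[OF m.Icarr[OF w(1)]])
      have aQ: "\<iota> a \<in> Q" "\<iota> a \<in> carrier S" using m_iff[OF as(1,2)] w(1) as(1,3) unfolding P_def by auto
      have isQ: "\<iota> s \<in> carrier S - Q" using WW as(2) by blast
      have g: "g = ?fS (\<iota> a) (\<iota> s)" unfolding w(2) as(3) by (rule f_frac[OF as(1,2)])
      obtain x u where xu: "x \<in> ?L" "u \<in> carrier S - Q" "z = ?fS x u" using lin_span_step(4) by blast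
      have v: "t \<otimes>\<^bsub>S\<^esub> \<iota> s \<in> carrier S - Q" by (rule LS.W_mult[OF bt(2) isQ])
      have vc: "t \<otimes>\<^bsub>S\<^esub> \<iota> s \<in> carrier S" "u \<in> carrier S" using v xu(2) by auto
      have "c \<otimes>\<^bsub>LS.Loc\<^esub> g \<oplus>\<^bsub>LS.Loc\<^esub> z = ?fS ((b \<otimes>\<^bsub>S\<^esub> \<iota> a) \<otimes>\<^bsub>S\<^esub> u \<oplus>\<^bsub>S\<^esub> x \<otimes>\<^bsub>S\<^esub> (t \<otimes>\<^bsub>S\<^esub> \<iota> s)) ((t \<otimes>\<^bsub>S\<^esub> \<iota> s) \<otimes>\<^bsub>S\<^esub> u)"
        unfolding bt(3) g xu(3) LS.fraction_mult[OF bt(1,2) aQ(2) isQ]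
        by (rule LS.fraction_add[OF S.m_closed[OF bt(1) aQ(2)] v Lc[OF xu(1)] xu(2)])
      moreover have "\<iota> a \<otimes>\<^bsub>S\<^esub> (b \<otimes>\<^bsub>S\<^esub> u) \<oplus>\<^bsub>S\<^esub> (t \<otimes>\<^bsub>S\<^esub> \<iota> s) \<otimes>\<^bsub>S\<^esub> x \<in> ?L"
        by (rule lin_span.lin_span_step[OF _ S.m_closed[OF bt(1) vc(2)] S.lin_span_mult_carrier[OF xu(1) AQ vc(1)]])
          (use aQ(1) as(1) in blast)
      moreover have "(b \<otimes>\<^bsub>S\<^esub> \<iota> a) \<otimes>\<^bsub>S\<^esub> u \<oplus>\<^bsub>S\<^esub> x \<otimes>\<^bsub>S\<^esub> (t \<otimes>\<^bsub>S\<^esub> \<iota> s) = \<iota> a \<otimes>\<^bsub>S\<^esub> (b \<otimes>\<^bsub>S\<^esub> u) \<oplus>\<^bsub>S\<^esub> (t \<otimes>\<^bsub>S\<^esub> \<iota> s) \<otimes>\<^bsub>S\<^esub> x"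
      proof -
        have "(b' \<otimes>\<^bsub>S\<^esub> a') \<otimes>\<^bsub>S\<^esub> u' \<oplus>\<^bsub>S\<^esub> x' \<otimes>\<^bsub>S\<^esub> v' = a' \<otimes>\<^bsub>S\<^esub> (b' \<otimes>\<^bsub>S\<^esub> u') \<oplus>\<^bsub>S\<^esub> v' \<otimes>\<^bsub>S\<^esub> x'"
          if "b' \<in> carrier S" "a' \<in> carrier S" "u' \<in> carrier S" "x' \<in> carrier S" "v' \<in> carrier S" for a' b' u' x' v'
          using that by (simp add: S.m_ac)
        then show ?thesis using bt(1) aQ(2) vc Lc[OF xu(1)] by blast
      qed
      moreover have "(t \<otimes>\<^bsub>S\<^esub> \<iota> s) \<otimes>\<^bsub>S\<^esub> u \<in> carrier S - Q" by (rule LS.W_mult[OF v xu(2)])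
      ultimately show ?case by metis
    qed
    ultimately obtain x u where xu: "x \<in> ?L" "u \<in> carrier S - Q" "?fS y \<one>\<^bsub>S\<^esub> = ?fS x u" by blast
    then have "y \<otimes>\<^bsub>S\<^esub> u = x \<otimes>\<^bsub>S\<^esub> \<one>\<^bsub>S\<^esub>" using LS.fraction_eq_iff[OF yc LS.W_one Lc[OF xu(1)] xu(2)] by blast
    then have "u \<otimes>\<^bsub>S\<^esub> y = x" using Lc[OF xu(1)] yc xu(2) by (simp add: S.m_comm)
    then show ?thesis using xu(1,2) by blast
  qed
  have part2: "\<exists>fs. set fs \<subseteq> carrier R \<and> S.eval (map \<iota> fs) y \<in> Q \<and> deriv_eval S (map \<iota> fs) y \<notin> Q" if y: "y \<in> carrier S" for y
  proof -
    define F where "F = LS.Loc Quot n"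
    define \<pi> where "\<pi> = a_r_coset LS.Loc n"
    have nmax: "maximalideal n LS.Loc" using n by (simp add: local_ring_def)
    interpret F: field F unfolding F_def by (rule maximalideal.quotient_is_field[OF nmax LS.Loc_cring])
    have \<pi>: "\<pi> \<in> ring_hom LS.Loc F" unfolding \<pi>_def F_def by (rule n.rcos_ring_hom)
    have \<pi>0: "\<pi> x = \<zero>\<^bsub>F\<^esub> \<longleftrightarrow> x \<in> n" if x: "x \<in> carrier LS.Loc" for x
    proof -
      have "\<zero>\<^bsub>F\<^esub> = n" by (simp add: F_def FactRing_def)
      then show ?thesis unfolding \<pi>_def using n.a_rcos_self[OF x] LS.Loc.a_rcos_zero[OF n'(1)] by auto
    qed
    have h: "\<pi> \<circ> f \<in> ring_hom LR.Loc F" by (rule ring_hom_trans[OF f \<pi>])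
    interpret h: ring_hom_cring LR.Loc F "\<pi> \<circ> f"
      using h by (simp add: ring_hom_cring_def ring_hom_cring_axioms_def LR.Loc_cring F.is_cring)
    have \<alpha>: "\<pi> \<circ> LS.toLoc \<in> ring_hom S F" by (rule ring_hom_trans[OF LS.toLoc.homh \<pi>])
    interpret \<alpha>: ring_hom_cring S F "\<pi> \<circ> LS.toLoc"
      using \<alpha> by (simp add: ring_hom_cring_def ring_hom_cring_axioms_def S.is_cring F.is_cring)
    let ?\<alpha> = "\<pi> \<circ> LS.toLoc"
    have \<alpha>0: "?\<alpha> z = \<zero>\<^bsub>F\<^esub> \<longleftrightarrow> z \<in> Q" if "z \<in> carrier S" for z
      using \<pi>0[OF LS.toLoc.hom_closed[OF that]] n_iff[OF that LS.W_one] by (simp add: LS.toLoc_def)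
    \<comment> \<open>The residue field of \<open>R\<^sub>P\<close>, as a subfield of that of \<open>S\<^sub>Q\<close>.\<close>
    define K where "K = quotient_map LS.Loc n f ` carrier (LR.Loc Quot m)"
    have q_coset: "quotient_map LS.Loc n f (m +>\<^bsub>LR.Loc\<^esub> x) = \<pi> (f x)" if x: "x \<in> carrier LR.Loc" for x
    proof -
      have eq: "n +>\<^bsub>LS.Loc\<^esub> f x' = n +>\<^bsub>LS.Loc\<^esub> f x" if x': "x' \<in> m +>\<^bsub>LR.Loc\<^esub> x" for x'
      proof -
        obtain k where k: "k \<in> m" "x' = k \<oplus>\<^bsub>LR.Loc\<^esub> x" using x' by (auto simp: a_r_coset_def')
        have fk: "f k \<in> n" using fm k(1) by blast
        have "f x' = f k \<oplus>\<^bsub>LS.Loc\<^esub> f x" unfolding k(2) by (rule ring_hom_add[OF f m.Icarr[OF k(1)] x])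
        then have "f x' \<in> n +>\<^bsub>LS.Loc\<^esub> f x" using fk by (auto simp: a_r_coset_def')
        then show ?thesis using LS.Loc.a_repr_independence[OF _ ring_hom_closed[OF f x] n.a_subgroup] by simp
      qed
      show ?thesis unfolding quotient_map_def \<pi>_def using eq m.a_rcos_self[OF x] by blast
    qed
    have KI: "K = (\<pi> \<circ> f) ` carrier LR.Loc"
    proof -
      have "carrier (LR.Loc Quot m) = (\<lambda>x. m +>\<^bsub>LR.Loc\<^esub> x) ` carrier LR.Loc"
        by (auto simp: FactRing_def A_RCOSETS_def')
      then show ?thesis unfolding K_def by (simp add: image_image q_coset)
    qed
    have Ksub: "subring K F" unfolding KI
      using h.ring.img_is_subring[OF ring.carrier_is_subring[OF cring.axioms(1)[OF LR.Loc_cring]]] .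
    have K: "subfield K F"
    proof (rule F.subfieldI'[OF Ksub])
      fix k assume k: "k \<in> K - {\<zero>\<^bsub>F\<^esub>}"
      then obtain x where x: "x \<in> carrier LR.Loc" "k = (\<pi> \<circ> f) x" unfolding KI by blast
      obtain a s where as: "a \<in> carrier R" "s \<in> carrier R - P" "x = ?fR a s" by (rule LR.Loc_cases[OF x(1)])
      have "a \<notin> P"
      proof
        assume "a \<in> P"
        then have "f x \<in> n" using m_iff[OF as(1,2)] as(3) fm by blast
        then show False using k x \<pi>0[OF ring_hom_closed[OF f x(1)]] by simp
      qed
      then have aW: "a \<in> carrier R - P" using as(1) by blast
      have sc: "s \<in> carrier R" using as(2) by blast
      have "x \<otimes>\<^bsub>LR.Loc\<^esub> ?fR s a = \<one>\<^bsub>LR.Loc\<^esub>"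
        unfolding as(3) LR.fraction_mult[OF as(1,2) sc aW] LR.Loc_one
        using LR.fraction_eq_iff[OF _ LR.W_mult[OF as(2) aW] R.one_closed LR.W_one, of "a \<otimes>\<^bsub>R\<^esub> s"] as(1) sc by (simp add: R.m_comm)
      then have "k \<otimes>\<^bsub>F\<^esub> (\<pi> \<circ> f) (?fR s a) = \<one>\<^bsub>F\<^esub>"
        using h.hom_mult[OF x(1) LR.fraction_closed[OF sc aW]] x(2) h.hom_one by simp
      then have "inv\<^bsub>F\<^esub> k = (\<pi> \<circ> f) (?fR s a)"
        using F.comm_inv_char[OF _ h.hom_closed[OF LR.fraction_closed[OF sc aW]]] x h.hom_closed[OF x(1)] by simp
      then show "inv\<^bsub>F\<^esub> k \<in> K" unfolding KI using LR.fraction_closed[OF sc aW] by blast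
    qed
    let ?y = "?\<alpha> y"
    have yF: "?y \<in> carrier F" by (rule \<alpha>.hom_closed[OF y])
    have alg: "\<not> F.transcendental K ?y" and sp: "separable_poly F K (F.Irr K ?y)"
      using fsep yF unfolding finite_separable_extension_def F_def[symmetric] K_def[symmetric] by blast+
    have alg': "(F.algebraic over K) ?y" using alg by (simp add: over_def)
    define q where "q = F.Irr K ?y"
    have q: "q \<in> carrier (univ_poly F K)" "F.eval q ?y = \<zero>\<^bsub>F\<^esub>"
      unfolding q_def using F.IrrE[OF K yF] alg' by (auto simp: over_def)
    have dq: "deriv_eval F q ?y \<noteq> \<zero>\<^bsub>F\<^esub>"
      by (rule F.separable_poly_deriv_eval[OF K q(1) yF q(2)]) (use sp in \<open>simp add: q_def\<close>)
    have qK: "set q \<subseteq> K" using q(1) unfolding univ_poly_carrier[symmetric] polynomial_def by auto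
    have KF: "K \<subseteq> carrier F" by (rule subfieldE(3)[OF K])
    have clear: "\<exists>fs u. set fs \<subseteq> carrier R \<and> u \<in> carrier R - P \<and>
        map (\<lambda>r. ?\<alpha> (\<iota> r)) fs = map (\<lambda>k. ?\<alpha> (\<iota> u) \<otimes>\<^bsub>F\<^esub> k) q" if "set q \<subseteq> K" for q
      using that
    proof (induction q)
      case Nil
      show ?case by (intro exI[of _ "[]"] exI[of _ "\<one>\<^bsub>R\<^esub>"]) (use LR.W_one in simp)
    next
      case (Cons k q)
      then obtain fs u where fs: "set fs \<subseteq> carrier R" "u \<in> carrier R - P"
        "map (\<lambda>r. ?\<alpha> (\<iota> r)) fs = map (\<lambda>k. ?\<alpha> (\<iota> u) \<otimes>\<^bsub>F\<^esub> k) q" by auto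
      have k: "k \<in> K" using Cons.prems by simp
      then obtain x where x: "x \<in> carrier LR.Loc" "k = (\<pi> \<circ> f) x" unfolding KI by blast
      obtain a s where as: "a \<in> carrier R" "s \<in> carrier R - P" "x = ?fR a s" by (rule LR.Loc_cases[OF x(1)])
      have sc: "s \<in> carrier R" "u \<in> carrier R" using as(2) fs(2) by auto
      have isQ: "\<iota> s \<in> carrier S - Q" using WW as(2) by blast
      have isc: "\<iota> s \<in> carrier S" "\<iota> u \<in> carrier S" "\<iota> a \<in> carrier S" using sc as(1) by simp_all
      have \<alpha>c: "?\<alpha> (\<iota> s) \<in> carrier F" "?\<alpha> (\<iota> u) \<in> carrier F" "?\<alpha> (\<iota> a) \<in> carrier F"
        using \<alpha>.hom_closed[OF isc(1)] \<alpha>.hom_closed[OF isc(2)] \<alpha>.hom_closed[OF isc(3)] by blast+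
      have kF: "k \<in> carrier F" using k KF by blast
      have fx: "f x = ?fS (\<iota> a) (\<iota> s)" unfolding as(3) by (rule f_frac[OF as(1,2)])
      have "LS.toLoc (\<iota> s) \<otimes>\<^bsub>LS.Loc\<^esub> f x = LS.toLoc (\<iota> a)"
        unfolding fx LS.toLoc_def LS.fraction_mult[OF isc(1) LS.W_one isc(3) isQ]
        using LS.fraction_eq_iff[OF _ LS.W_mult[OF LS.W_one isQ] isc(3) LS.W_one, of "\<iota> s \<otimes>\<^bsub>S\<^esub> \<iota> a"] isc by (simp add: S.m_comm)
      then have sk: "?\<alpha> (\<iota> s) \<otimes>\<^bsub>F\<^esub> k = ?\<alpha> (\<iota> a)"
        using ring_hom_mult[OF \<pi> LS.toLoc.hom_closed[OF isc(1)] ring_hom_closed[OF f x(1)]] x(2) by simp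
      have mult: "?\<alpha> (\<iota> (r \<otimes>\<^bsub>R\<^esub> t)) = ?\<alpha> (\<iota> r) \<otimes>\<^bsub>F\<^esub> ?\<alpha> (\<iota> t)" if "r \<in> carrier R" "t \<in> carrier R" for r t
        unfolding \<iota>.hom_mult[OF that] by (rule \<alpha>.hom_mult[OF \<iota>.hom_closed[OF that(1)] \<iota>.hom_closed[OF that(2)]])
      let ?fs = "(a \<otimes>\<^bsub>R\<^esub> u) # map (\<lambda>r. s \<otimes>\<^bsub>R\<^esub> r) fs"
      have "map (\<lambda>r. ?\<alpha> (\<iota> (s \<otimes>\<^bsub>R\<^esub> r))) fs = map (\<lambda>z. ?\<alpha> (\<iota> s) \<otimes>\<^bsub>F\<^esub> z) (map (\<lambda>r. ?\<alpha> (\<iota> r)) fs)"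
        using fs(1) mult[OF sc(1)] by auto
      also have "\<dots> = map (\<lambda>k. ?\<alpha> (\<iota> (s \<otimes>\<^bsub>R\<^esub> u)) \<otimes>\<^bsub>F\<^esub> k) q"
        unfolding fs(3) using Cons.prems KF \<alpha>c mult[OF sc] by (auto simp: F.m_assoc)
      finally have tl: "map (\<lambda>r. ?\<alpha> (\<iota> (s \<otimes>\<^bsub>R\<^esub> r))) fs = map (\<lambda>k. ?\<alpha> (\<iota> (s \<otimes>\<^bsub>R\<^esub> u)) \<otimes>\<^bsub>F\<^esub> k) q" .
      have hd: "?\<alpha> (\<iota> (a \<otimes>\<^bsub>R\<^esub> u)) = ?\<alpha> (\<iota> (s \<otimes>\<^bsub>R\<^esub> u)) \<otimes>\<^bsub>F\<^esub> k"
        unfolding mult[OF as(1) sc(2)] mult[OF sc] sk[symmetric] using \<alpha>c kF by (simp add: F.m_ac)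
      show ?case
      proof (intro exI conjI)
        show "set ?fs \<subseteq> carrier R" using fs(1) sc as(1) by auto
        show "s \<otimes>\<^bsub>R\<^esub> u \<in> carrier R - P" by (rule LR.W_mult[OF as(2) fs(2)])
        show "map (\<lambda>r. ?\<alpha> (\<iota> r)) ?fs = map (\<lambda>k. ?\<alpha> (\<iota> (s \<otimes>\<^bsub>R\<^esub> u)) \<otimes>\<^bsub>F\<^esub> k) (k # q)"
          unfolding list.map map_map hd using tl by (simp only: comp_def)
      qed
    qed
    obtain fs u where fs: "set fs \<subseteq> carrier R" "u \<in> carrier R - P"
        "map (\<lambda>r. ?\<alpha> (\<iota> r)) fs = map (\<lambda>k. ?\<alpha> (\<iota> u) \<otimes>\<^bsub>F\<^esub> k) q" using clear[OF qK] by blast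
    have fsS: "set (map \<iota> fs) \<subseteq> carrier S" using fs(1) by auto
    have mm: "map ?\<alpha> (map \<iota> fs) = map (\<lambda>k. ?\<alpha> (\<iota> u) \<otimes>\<^bsub>F\<^esub> k) q" using fs(3) by (simp only: map_map comp_def)
    have uS: "\<iota> u \<in> carrier S" "\<iota> u \<notin> Q" using WW fs(2) by blast+
    have v: "?\<alpha> (\<iota> u) \<in> carrier F" "?\<alpha> (\<iota> u) \<noteq> \<zero>\<^bsub>F\<^esub>" using \<alpha>.hom_closed[OF uS(1)] \<alpha>0[OF uS(1)] uS(2) by blast+
    have qF: "set q \<subseteq> carrier F" using qK KF by blast
    have "?\<alpha> (S.eval (map \<iota> fs) y) = \<zero>\<^bsub>F\<^esub>"
      using \<alpha>.ring.eval_hom'[OF y fsS] F.eval_smult_list[OF v(1) qF yF] q(2) v(1) unfolding mm by simp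
    then have e: "S.eval (map \<iota> fs) y \<in> Q" using \<alpha>0[OF S.eval_in_carrier[OF fsS y]] by blast
    have "?\<alpha> (deriv_eval S (map \<iota> fs) y) = ?\<alpha> (\<iota> u) \<otimes>\<^bsub>F\<^esub> deriv_eval F q ?y"
      using \<alpha>.hom_deriv_eval[OF fsS y] F.deriv_eval_smult_list[OF v(1) qF yF] unfolding mm by simp
    moreover have "?\<alpha> (\<iota> u) \<otimes>\<^bsub>F\<^esub> deriv_eval F q ?y \<noteq> \<zero>\<^bsub>F\<^esub>"
      using F.integral_iff[OF v(1) F.deriv_eval_closed[OF qF yF]] v(2) dq by blast
    ultimately have "deriv_eval S (map \<iota> fs) y \<notin> Q" using \<alpha>0[OF S.deriv_eval_closed[OF fsS y]] by simp
    then show ?thesis using e fs(1) by blast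
  qed
  show ?thesis unfolding unramified_at_def using part1 part2 by blast
qed

lemma separable_from_generic_point:
  assumes "unramified_at R S \<iota> {\<zero>\<^bsub>S\<^esub>}"
  shows separable_ext
  using assms unfolding unramified_at_def separable_ext_def by simp

lemma zero_ideal_height: "primeideal {\<zero>\<^bsub>S\<^esub>} S" "height S {\<zero>\<^bsub>S\<^esub>} \<le> 1"
proof -
  show "primeideal {\<zero>\<^bsub>S\<^esub>} S" by (rule S.zeroprimeideal)
  have chain: "n = 0" if P: "\<forall>i\<le>n. primeideal (P i) S" "\<forall>i<n. P i \<subset> P (Suc i)" "P n = {\<zero>\<^bsub>S\<^esub>}" for n and P :: "nat \<Rightarrow> 'b set"
  proof (rule ccontr)
    assume "n \<noteq> 0"
    then obtain k where k: "n = Suc k" by (cases n) auto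
    have "P k \<subset> {\<zero>\<^bsub>S\<^esub>}" using P(2,3) k by auto
    moreover have "\<zero>\<^bsub>S\<^esub> \<in> P k"
      using primeideal_def ideal_def additive_subgroup.zero_closed P(1) k by (metis le_SucI order_refl)
    ultimately show False by blast
  qed
  then show "height S {\<zero>\<^bsub>S\<^esub>} \<le> 1" 
    unfolding height_def
  proof (intro SUP_least)
    fix n assume "n \<in> {n. \<exists>P :: nat \<Rightarrow> 'b set. (\<forall>i\<le>n. primeideal (P i) S) \<and> (\<forall>i<n. P i \<subset> P (Suc i)) \<and> P n = {\<zero>\<^bsub>S\<^esub>}}"
    then have "n = 0" using chain by blast
    then show "enat n \<le> 1" by (simp add: zero_enat_def[symmetric])
  qed
qed

end

theorem corollary2p11:
  fixes R :: "('a, 'k) ring_scheme" and m :: "'a set" and p :: nat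
  assumes "local_ring R m" and "noetherian_ring R"
    and "Factorial_Ring.prime p" and "ring_characteristic R = p" and "F_finite p R"
  shows "(strongly_F_regular p R \<longrightarrow> splinter R) \<and>
    (splinter R \<longrightarrow>
      \<not> (\<exists>(S :: 'b ring) n \<iota>.
            module_finite_extension R S \<iota> \<and> local_ring S n \<and> \<iota> ` m \<subseteq> n \<and>
            normal_domain R \<and> normal_domain S \<and>
            bij_betw (quotient_map S n \<iota>) (carrier (R Quot m)) (carrier (S Quot n)) \<and>
            p dvd field_degree (fraction_field R) (fraction_field S) (fraction_field_map S \<iota>) \<and>
            etale_in_codim_1 R S \<iota>))"
proof (intro conjI impI notI)
  assume "strongly_F_regular p R"
  then show "splinter R" by (rule strongly_F_regular_imp_splinter[OF assms(3,4)])
next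
  assume spl: "splinter R"
  assume "\<exists>(S :: 'b ring) n \<iota>.
            module_finite_extension R S \<iota> \<and> local_ring S n \<and> \<iota> ` m \<subseteq> n \<and>
            normal_domain R \<and> normal_domain S \<and>
            bij_betw (quotient_map S n \<iota>) (carrier (R Quot m)) (carrier (S Quot n)) \<and>
            p dvd field_degree (fraction_field R) (fraction_field S) (fraction_field_map S \<iota>) \<and>
            etale_in_codim_1 R S \<iota>"
  then obtain S :: "'b ring" and n \<iota> where
    ext: "module_finite_extension R S \<iota>" and S: "local_ring S n" "\<iota> ` m \<subseteq> n"
    and norm: "normal_domain R" "normal_domain S"
    and bij: "bij_betw (quotient_map S n \<iota>) (carrier (R Quot m)) (carrier (S Quot n))"
    and deg: "p dvd field_degree (fraction_field R) (fraction_field S) (fraction_field_map S \<iota>)"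
    and et: "etale_in_codim_1 R S \<iota>" by blast
  have \<iota>: "\<iota> \<in> ring_hom R S" "inj_on \<iota> (carrier R)"
    using ext unfolding module_finite_extension_def by blast+
  have dom: "domain R" "domain S" using norm unfolding normal_domain_def by blast+
  obtain B where B: "finite B" "B \<subseteq> carrier S" "\<And>s. s \<in> carrier S \<Longrightarrow> s \<in> lin_span S (\<iota> ` carrier R) B"
    using module_finite_lin_span[OF ext] by metis
  interpret finite_domain_extension R S \<iota> B
    using dom \<iota> B by (simp add: finite_domain_extension_def finite_domain_extension_axioms_def)
  have unr: "unramified_at R S \<iota> Q" if "primeideal Q S" "height S Q \<le> 1" for Q
    by (rule etale_imp_unramified) (use that et in \<open>auto simp: etale_in_codim_1_def\<close>)
  \<comment> \<open>The zero ideal has height zero, so the extension is etale there.\<close>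
  have sep: separable_ext by (rule separable_from_generic_point[OF unr[OF zero_ideal_height]])
  obtain \<phi> where \<phi>: "\<phi> \<in> module_hom R (alg_module \<iota> S) (alg_module id R)" "\<forall>r\<in>carrier R. \<phi> (\<iota> r) = r"
    using splinter_splits[OF spl ext] unfolding extension_splits_def by blast
  obtain J d where J: "generic_basis J d" using generic_basis_exists by blast
  show False
  proof (rule embeddings_of_separable_extension[OF sep J])
    fix E :: "((('b \<times> 'b) set list \<times> nat) multiset \<Rightarrow> ('b \<times> 'b) set) ring" and \<eta> H
    assume fh: "field_homs R S \<iota> B E \<eta> H" and H0: "H \<noteq> {}" and card: "card J \<le> card H"
      and cardH: "card H = field_degree (fraction_field R) (fraction_field S) (fraction_field_map S \<iota>)"
    have \<phi>1: "\<phi> \<one>\<^bsub>S\<^esub> = \<one>\<^bsub>R\<^esub>" using \<phi>(2) \<iota>.hom_one R.one_closed by metis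
    interpret split_field_homs R S \<iota> B E \<eta> H \<phi>
      using fh H0 \<phi>(1) \<phi>1
      by (auto simp: split_field_homs_def split_field_homs_axioms_def module_hom_def alg_module_def)
    show False
      by (rule residue_contradiction[OF assms(2) norm(2) unr J sep card assms(1) S bij])
        (use deg cardH assms(4) in simp_all)
  qed
qed


end
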